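(* Let $d=1$, let $B\in C^1_b(\mathbb{R},\mathbb{R})$ and $A\in C^2_b(\mathbb{R},\mathbb{R})$, and assume there is $c>0$ such that $A(x)^2\ge c$ for all $x\in\mathbb{R}$. Let $\mu_0$ be a probability measure on $\mathbb{R}$, let $X$ be the solution of $dX_t=B(X_t)dt+A(X_t)dW_t$ with $X_0\sim\mu_0$ independent of the one-dimensional Brownian motion $W$, and let $M_t=\sup_{0\le s\le t}X_s$. Then the density $p_V(\cdot;t)$ of $(M_t,X_t)$, $t>0$, satisfies: (i) for every $T>0$, the map $(t,m)\mapsto\sup_{u>0}p_V(m,m-u;t)$ belongs to $L^1([0,T]\times\mathbb{R},dt\,dm)$; (ii) for all $t>0$, for Lebesgue-almost every $m\in\mathbb{R}$, the limit $p_V(m,m;t):=\lim_{u\to0^+}p_V(m,m-u;t)$ exists. Consequently, for every $F\in C^2_b(\mathbb{R}^2,\mathbb{R})$ and $t>0$, $$\mathbb{E}[F(M_t,X_t)]=\mathbb{E}[F(X_0,X_0)]+\int_0^t\mathbb{E}[\mathcal{L}(F)(M_s,X_s)]\,ds+\frac12\int_0^t\mathbb{E}\left[A^2(X_s)\,\partial_mF(X_s,X_s)\,\frac{p_V(X_s,X_s;s)}{p_X(X_s;s)}\right]ds .$$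
   Context: $C^i_b(\mathbb{R}^d,\mathbb{R}^n)$ is the set of $i$ times (continuously) differentiable bounded functions with bounded derivatives. Points of $\mathbb{R}^2$ are written $(m,x)$; $\partial_m$ is the derivative in the first variable. For $\Phi\in C^2(\mathbb{R}^{2},\mathbb{R})$, $\mathcal{L}(\Phi)(m,x)=B(x)\partial_{x}\Phi(m,x)+\frac12A(x)^2\partial^2_{xx}\Phi(m,x)$. It is known that for every $t>0$ the law of $(M_t,X_t)$ has a density $p_V(\cdot;t)$ with respect to Lebesgue measure on $\mathbb{R}^{2}$, supported in $\{(m,x): m\ge x\}$, and that $X_t$ has a positive density $p_X(\cdot;t)$. Statements (i) and (ii) are understood for a suitable version of the density $p_V$. *)

theory Defs
  imports "HOL-Probability.Probability"
begin

text \<open>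
  \<open>Cb i f\<close>: \<open>f\<close> is bounded, \<open>i\<close> times continuously differentiable, and all its partial
  derivatives up to order \<open>i\<close> are bounded. The recursion uses that \<open>f\<close> is \<open>C\<^sup>i\<^sup>+\<^sup>1\<close> iff it is
  differentiable and its first-order partial derivatives are \<open>C\<^sup>i\<close>; on \<open>real\<close> the only basis
  vector is \<open>1\<close> and the partial derivative is the usual derivative.
\<close>

primrec Cb :: "nat \<Rightarrow> ('a::euclidean_space \<Rightarrow> 'b::euclidean_space) \<Rightarrow> bool" where
  "Cb 0 f \<longleftrightarrow> continuous_on UNIV f \<and> bounded (range f)"
| "Cb (Suc i) f \<longleftrightarrow> bounded (range f) \<and> (\<forall>x. f differentiable (at x)) \<and>
     (\<forall>v\<in>Basis. Cb i (\<lambda>x. frechet_derivative f (at x) v))"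

definition partial_m :: "(real \<times> real \<Rightarrow> real) \<Rightarrow> real \<Rightarrow> real \<Rightarrow> real" where
  "partial_m \<Phi> m x = deriv (\<lambda>r. \<Phi> (r, x)) m"

definition partial_x :: "(real \<times> real \<Rightarrow> real) \<Rightarrow> real \<Rightarrow> real \<Rightarrow> real" where
  "partial_x \<Phi> m x = deriv (\<lambda>y. \<Phi> (m, y)) x"

definition partial_xx :: "(real \<times> real \<Rightarrow> real) \<Rightarrow> real \<Rightarrow> real \<Rightarrow> real" where
  "partial_xx \<Phi> m x = deriv (\<lambda>y. partial_x \<Phi> m y) x"

definition generator ::
  "(real \<Rightarrow> real) \<Rightarrow> (real \<Rightarrow> real) \<Rightarrow> (real \<times> real \<Rightarrow> real) \<Rightarrow> real \<Rightarrow> real \<Rightarrow> real" where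
  "generator B A \<Phi> m x = B x * partial_x \<Phi> m x + 1 / 2 * (A x)\<^sup>2 * partial_xx \<Phi> m x"

text \<open>
  Processes and filtrations are indexed by \<open>real\<close>; only times \<open>t \<ge> 0\<close> matter (a filtration on
  \<open>[0,\<infinity>)\<close> can be extended by its value at \<open>0\<close>). No completeness or right continuity of the
  filtration is required.
\<close>

definition filtration_on :: "'w measure \<Rightarrow> (real \<Rightarrow> 'w measure) \<Rightarrow> bool" where
  "filtration_on P \<F> \<longleftrightarrow> filtration (space P) \<F> \<and> (\<forall>t. sets (\<F> t) \<subseteq> sets P)"

definition brownian_motion ::
  "'w measure \<Rightarrow> (real \<Rightarrow> 'w measure) \<Rightarrow> (real \<Rightarrow> 'w \<Rightarrow> real) \<Rightarrow> bool" where
  "brownian_motion P \<F> W \<longleftrightarrow>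
     (\<forall>t\<ge>0. W t \<in> borel_measurable (\<F> t)) \<and>
     (AE \<omega> in P. W 0 \<omega> = 0) \<and>
     (AE \<omega> in P. continuous_on {0..} (\<lambda>t. W t \<omega>)) \<and>
     (\<forall>s t. 0 \<le> s \<and> s < t \<longrightarrow>
        distributed P lborel (\<lambda>\<omega>. W t \<omega> - W s \<omega>) (normal_density 0 (sqrt (t - s))) \<and>
        prob_space.indep_set P (sets (\<F> s))
          (sets (vimage_algebra (space P) (\<lambda>\<omega>. W t \<omega> - W s \<omega>) borel)))"

text \<open>
  The Ito integral, by \<open>L\<^sup>2\<close>-approximation. A simple integrand is
  \<open>\<Sum>i<n. \<xi>\<^sub>i 1\<^bsub>(\<tau>\<^sub>i, \<tau>\<^sub>i\<^sub>+\<^sub>1]\<^esub>\<close> with deterministic times \<open>0 \<le> \<tau>\<^sub>0 \<le> \<dots> \<le> \<tau>\<^sub>n\<close> and bounded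
  \<open>\<F>\<^bsub>\<tau>\<^sub>i\<^esub>\<close>-measurable \<open>\<xi>\<^sub>i\<close>.
\<close>

definition simple_integrand ::
  "(real \<Rightarrow> 'w measure) \<Rightarrow> nat \<Rightarrow> (nat \<Rightarrow> real) \<Rightarrow> (nat \<Rightarrow> 'w \<Rightarrow> real) \<Rightarrow> bool" where
  "simple_integrand \<F> n \<tau> \<xi> \<longleftrightarrow> 0 \<le> \<tau> 0 \<and>
     (\<forall>i<n. \<tau> i \<le> \<tau> (Suc i) \<and> \<xi> i \<in> borel_measurable (\<F> (\<tau> i)) \<and>
            (\<exists>C. \<forall>\<omega>\<in>space (\<F> (\<tau> i)). \<bar>\<xi> i \<omega>\<bar> \<le> C))"

definition simple_process ::
  "nat \<Rightarrow> (nat \<Rightarrow> real) \<Rightarrow> (nat \<Rightarrow> 'w \<Rightarrow> real) \<Rightarrow> real \<Rightarrow> 'w \<Rightarrow> real" where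
  "simple_process n \<tau> \<xi> s \<omega> = (\<Sum>i<n. \<xi> i \<omega> * indicator {\<tau> i<..\<tau> (Suc i)} s)"

definition simple_ito ::
  "(real \<Rightarrow> 'w \<Rightarrow> real) \<Rightarrow> nat \<Rightarrow> (nat \<Rightarrow> real) \<Rightarrow> (nat \<Rightarrow> 'w \<Rightarrow> real) \<Rightarrow> real \<Rightarrow> 'w \<Rightarrow> real" where
  "simple_ito W n \<tau> \<xi> t \<omega> = (\<Sum>i<n. \<xi> i \<omega> * (W (min (\<tau> (Suc i)) t) \<omega> - W (min (\<tau> i) t) \<omega>))"

text \<open>
  \<open>ito_integral P \<F> W H t I\<close>: the random variable \<open>I\<close> is (a version of) \<open>\<integral>\<^sub>0\<^sup>t H\<^sub>s dW\<^sub>s\<close>.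
  The measurability requirements ensure that the nonnegative integrals are the genuine ones.
\<close>

definition ito_integral ::
  "'w measure \<Rightarrow> (real \<Rightarrow> 'w measure) \<Rightarrow> (real \<Rightarrow> 'w \<Rightarrow> real) \<Rightarrow> (real \<Rightarrow> 'w \<Rightarrow> real) \<Rightarrow> real \<Rightarrow>
     ('w \<Rightarrow> real) \<Rightarrow> bool" where
  "ito_integral P \<F> W H t I \<longleftrightarrow>
     I \<in> borel_measurable P \<and>
     (\<lambda>(s, \<omega>). H s \<omega>) \<in> borel_measurable (restrict_space borel {0..t} \<Otimes>\<^sub>M P) \<and>
     (\<exists>n \<tau> \<xi>. (\<forall>k. simple_integrand \<F> (n k) (\<tau> k) (\<xi> k)) \<and>
        (\<lambda>k::nat. \<integral>\<^sup>+\<omega>. (\<integral>\<^sup>+s\<in>{0..t}.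
            ennreal ((simple_process (n k) (\<tau> k) (\<xi> k) s \<omega> - H s \<omega>)\<^sup>2) \<partial>lborel) \<partial>P)
          \<longlonglongrightarrow> 0 \<and>
        (\<lambda>k::nat. \<integral>\<^sup>+\<omega>. ennreal ((simple_ito W (n k) (\<tau> k) (\<xi> k) t \<omega> - I \<omega>)\<^sup>2) \<partial>P)
          \<longlonglongrightarrow> 0)"

text \<open>\<open>X\<close> is a continuous adapted solution of \<open>dX\<^sub>t = B(X\<^sub>t) dt + A(X\<^sub>t) dW\<^sub>t\<close>.\<close>

definition sde_solution ::
  "'w measure \<Rightarrow> (real \<Rightarrow> 'w measure) \<Rightarrow> (real \<Rightarrow> 'w \<Rightarrow> real) \<Rightarrow> (real \<Rightarrow> real) \<Rightarrow> (real \<Rightarrow> real) \<Rightarrow>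
     (real \<Rightarrow> 'w \<Rightarrow> real) \<Rightarrow> bool" where
  "sde_solution P \<F> W B A X \<longleftrightarrow>
     (\<forall>t\<ge>0. X t \<in> borel_measurable (\<F> t)) \<and>
     (\<forall>\<omega>\<in>space P. continuous_on {0..} (\<lambda>t. X t \<omega>)) \<and>
     (\<forall>t\<ge>0. \<exists>I. ito_integral P \<F> W (\<lambda>s \<omega>. A (X s \<omega>)) t I \<and>
        (AE \<omega> in P. X t \<omega> = X 0 \<omega> + (LBINT s:{0..t}. B (X s \<omega>)) + I \<omega>))"

text \<open>
  \<open>X\<^sub>0\<close> is independent of the whole process \<open>(W\<^sub>t)\<^bsub>t\<ge>0\<^esub>\<close>, viewed as a random element of the
  product space.
\<close>

definition indep_initial :: "'w measure \<Rightarrow> ('w \<Rightarrow> real) \<Rightarrow> (real \<Rightarrow> 'w \<Rightarrow> real) \<Rightarrow> bool" where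
  "indep_initial P X0 W \<longleftrightarrow> prob_space.indep_set P
     (sets (vimage_algebra (space P) X0 borel))
     (sets (vimage_algebra (space P) (\<lambda>\<omega>. \<lambda>t\<in>{0..}. W t \<omega>) (\<Pi>\<^sub>M t\<in>{0..}. borel)))"

definition running_sup :: "(real \<Rightarrow> 'w \<Rightarrow> real) \<Rightarrow> real \<Rightarrow> 'w \<Rightarrow> real" where
  "running_sup X t \<omega> = (SUP s\<in>{0..t}. X s \<omega>)"

text \<open>
  The value \<open>p\<^sub>V(m,m;t)\<close> always denotes the limit from inside the support, never the value of the
  chosen version of the density on the (Lebesgue-null) diagonal.
\<close>

definition diag_limit :: "(real \<Rightarrow> real \<Rightarrow> real \<Rightarrow> real) \<Rightarrow> real \<Rightarrow> real \<Rightarrow> real" where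
  "diag_limit pV m t = Lim (at_right 0) (\<lambda>u. pV m (m - u) t)"

end

theory Submission
  imports Defs
begin

text \<open>
Write \<open>a = |A|\<close>, \<open>\<phi>' = 1 / a\<close>, \<open>Y = \<phi>(X)\<close>, \<open>N = \<phi>(M)\<close>. For a suitable weight \<open>\<eta>\<close>, every solution \<open>u\<close> of the
heat equation gives a function \<open>f = e\<^sup>\<kappa>\<^sup>s \<eta>(\<phi>(x)) u(t - s, \<phi>(x))\<close> with \<open>(\<partial>\<^sub>s + L) f = (\<kappa> - V) f\<close> and \<open>V\<close> bounded. If \<open>u\<close>
vanishes at \<open>\<alpha>\<close>, the Ito formula stopped when \<open>N\<close> reaches \<open>\<alpha>\<close> is an integral equation comparing the weighted law of
\<open>(N, Y)\<close> with the law \<open>U\<close> of Brownian motion and its maximum. For \<open>\<kappa> = \<plusminus> sup |V|\<close> the perturbation has a sign: one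
choice gives the upper bound \<open>U\<close>, the other the positivity of the density of \<open>X\<close>. Hence the density is \<open>U\<close> minus an integral
of dominated densities against Gaussian kernels, which is continuous up to the diagonal; this is (i) and (ii).

For the identity, expand on a grid with \<open>M\<close> frozen on each interval. If \<open>\<partial>\<^sub>m F\<close> vanishes on the diagonal, the increments of
\<open>M\<close> contribute nothing in the limit, as \<open>M\<close> only grows when \<open>M\<close> is close to \<open>X\<close>. In general subtract
\<open>\<partial>\<^sub>m F(m, m) \<delta> arctan((m - x) / \<delta>)\<close>: its second derivative in \<open>x\<close> is an approximate identity at the diagonal of
mass 1, and as \<open>\<delta> \<rightarrow> 0\<close> it produces the boundary term by (i) and (ii).
\<close>

text \<open>Two obstacles shape the proof. First, comparison yields a density only up to null sets,
  while (ii) concerns the null diagonal. In the integral equation the unknown law enters integrated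
  over time and space, so any version bounded by U may be inserted there, and the kernels then
  supply continuity in the second variable. The singularities 1/sqrt(s) of U and 1/sqrt(t - s) of
  the kernel have an integrable product on (0, t). The equation is first derived with kernel time t
  + \<epsilon> - s, since the test function must stay bounded up to time t. Writing V - \<kappa> as
  a difference of nonnegative functions keeps every term in \<open>ennreal\<close>. The weight
  \<eta> is the exponential that removes the first-order term of the generator; its logarithm is
  Lipschitz, so Gaussian bounds absorb it at the price of doubled variances. Second, no moment of
  the initial law is assumed, so M need not be integrable. Only bounded test functions are used, and
  one of them, arctan(m - x), shows through Fatou's lemma that the increment of M has finite mean.
  This increment dominates the Riemann sums in the diagonal term.\<close>

abbreviation bm :: "'a measure => ('a => 'b::topological_space) set" where
  "bm M \<equiv> borel_measurable M"

syntax "_nn_int" :: "pttrn => 'a measure => ennreal => ennreal" ("NN _|_. _" [0, 110, 60] 60)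
translations "NN x|M. f" == "CONST nn_integral M (%x. f)"

section \<open>Brownian increments and the Ito integral\<close>

lemma prob_space_nn_integral_const_le:
	assumes "prob_space M" "\<And>x. x \<in> space M ==> f x <= c"
	shows "(NN x|M. f x) <= c"
proof -
	interpret prob_space M by fact
	have "(NN x|M. f x) <= (NN x|M. c)" by (rule nn_integral_mono) (use assms in auto)
	then show ?thesis by (simp add: emeasure_space_1)
qed

locale brownian = prob_space P for P :: "'w measure" +
	fixes F :: "real => 'w measure" and W :: "real => 'w => real"
	assumes filt: "filtration_on P F" and bm: "brownian_motion P F W"
begin

lemma space_F [simp]: "space (F t) = space P"
	using filt unfolding filtration_on_def filtration_def by auto

lemma sets_F_mono: "s <= t ==> sets (F s) \<subseteq> sets (F t)"
	using filt unfolding filtration_on_def filtration_def by auto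

lemma sets_F_P: "sets (F s) \<subseteq> sets P"
	using filt unfolding filtration_on_def by auto

lemma measurable_F_mono: "z \<in> bm (F s) ==> s <= t ==> z \<in> bm (F t)"
	using sets_F_mono[of s t] unfolding measurable_def by auto

lemma measurable_F_P: "z \<in> bm (F s) ==> z \<in> bm P"
	using sets_F_P[of s] unfolding measurable_def by auto

lemma W_meas_F: "0 <= t ==> t <= u ==> W t \<in> bm (F u)"
	using bm measurable_F_mono[of "W t" t u] unfolding brownian_motion_def by auto

lemma W_meas: "0 <= t ==> W t \<in> bm P"
	using W_meas_F[of t t] measurable_F_P by auto

lemma incr_distributed: "0 <= s ==> s < t ==>
		distributed P lborel (%w. W t w - W s w) (normal_density 0 (sqrt (t - s)))"
	using bm unfolding brownian_motion_def by auto

lemma incr_indep: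
	assumes "0 <= s" "s < t" and Z: "Z \<in> bm (F s)"
	shows "indep_var borel Z borel (%w. W t w - W s w)"
proof -
	have a: "random_variable borel Z" using Z by (rule measurable_F_P)
	have b: "random_variable borel (%w. W t w - W s w)" using W_meas[of s] W_meas[of t] assms by simp
	have ind: "indep_set (sets (F s)) (sets (vimage_algebra (space P) (%w. W t w - W s w) borel))"
		using bm assms unfolding brownian_motion_def by auto
	have 1: "sigma_sets (space P) {Z -` A \<inter> space P |A. A \<in> sets borel} \<subseteq> sets (F s)"
	proof -
		have "sigma_sets (space (F s)) {Z -` A \<inter> space (F s) |A. A \<in> sets borel} \<subseteq> sets (F s)"
			using measurable_sets[OF Z] by (intro sets.sigma_sets_subset) auto
		then show ?thesis by simp
	qed
	have 2: "sigma_sets (space P) {(%w. W t w - W s w) -` A \<inter> space P |A. A \<in> sets borel}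
			= sets (vimage_algebra (space P) (%w. W t w - W s w) borel)"
		by (simp add: sets_vimage_algebra)
	have c: "indep_set (sigma_sets (space P) {Z -` A \<inter> space P |A. A \<in> sets borel})
		 (sigma_sets (space P) {(%w. W t w - W s w) -` A \<inter> space P |A. A \<in> sets borel})"
		using ind 1 unfolding 2 indep_sets2_eq by blast
	show ?thesis unfolding indep_var_eq using a b c by blast
qed

lemma incr_moment:
	assumes "0 <= s" "s < t"
	shows "integrable P (%w. (W t w - W s w) ^ k)"
		and "(LINT w|P. (W t w - W s w) ^ k) = (LINT x|lborel. normal_density 0 (sqrt (t - s)) x * x ^ k)"
proof -
	have i: "integrable lborel (%x. normal_density 0 (sqrt (t - s)) x * x ^ k)"
		using integrable_normal_moment[of "sqrt (t - s)" 0 k] assms by simp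
	show "integrable P (%w. (W t w - W s w) ^ k)"
		using distributed_integrable[OF incr_distributed[OF assms], of "%x. x ^ k"] i by simp
	show "(LINT w|P. (W t w - W s w) ^ k) = (LINT x|lborel. normal_density 0 (sqrt (t - s)) x * x ^ k)"
		using distributed_integral[OF incr_distributed[OF assms], of "%x. x ^ k"] by simp
qed

lemma incr_mult:
	assumes "0 <= s" "s < t" and Z: "Z \<in> bm (F s)" "integrable P Z"
	shows "integrable P (%w. Z w * (W t w - W s w) ^ k)"
		and "(LINT w|P. Z w * (W t w - W s w) ^ k) =
			(LINT w|P. Z w) * (LINT x|lborel. normal_density 0 (sqrt (t - s)) x * x ^ k)"
proof -
	have ind: "indep_var borel Z borel (%w. (W t w - W s w) ^ k)"
		using indep_var_compose[OF incr_indep[OF assms(1-3)], of "%x. x" borel "%x. x ^ k" borel]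
		by (simp add: comp_def)
	show "integrable P (%w. Z w * (W t w - W s w) ^ k)"
		using indep_var_integrable[OF ind Z(2) incr_moment(1)[OF assms(1,2)]] by simp
	show "(LINT w|P. Z w * (W t w - W s w) ^ k) =
			(LINT w|P. Z w) * (LINT x|lborel. normal_density 0 (sqrt (t - s)) x * x ^ k)"
		using indep_var_lebesgue_integral[OF ind Z(2) incr_moment(1)[OF assms(1,2)]] incr_moment(2)[OF assms(1,2)]
		by simp
qed

lemma incr_mult_1:
	assumes "0 <= s" "s <= t" and Z: "Z \<in> bm (F s)" "integrable P Z"
	shows "integrable P (%w. Z w * (W t w - W s w))"
		and "(LINT w|P. Z w * (W t w - W s w)) = 0"
proof -
	have *: "s < t ==> (LINT x|lborel. normal_density 0 (sqrt (t - s)) x * x) = 0"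
		using integral_normal_moment_nz_1[of "sqrt (t - s)" 0] by simp
	show "integrable P (%w. Z w * (W t w - W s w))"
		using incr_mult(1)[OF assms(1) _ Z, of t 1] assms(2) by (cases "s = t") auto
	show "(LINT w|P. Z w * (W t w - W s w)) = 0"
		using incr_mult(2)[OF assms(1) _ Z, of t 1] assms(2) * by (cases "s = t") auto
qed

lemma incr_mult_2:
	assumes "0 <= s" "s <= t" and Z: "Z \<in> bm (F s)" "integrable P Z"
	shows "integrable P (%w. Z w * (W t w - W s w)^2)"
		and "(LINT w|P. Z w * (W t w - W s w)^2) = (t - s) * (LINT w|P. Z w)"
proof -
	have *: "s < t ==> (LINT x|lborel. normal_density 0 (sqrt (t - s)) x * x^2) = t - s"
		using integral_normal_moment_even[of "sqrt (t - s)" 0 1] by simp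
	show "integrable P (%w. Z w * (W t w - W s w)^2)"
		using incr_mult(1)[OF assms(1) _ Z, of t 2] assms(2) by (cases "s = t") auto
	show "(LINT w|P. Z w * (W t w - W s w)^2) = (t - s) * (LINT w|P. Z w)"
		using incr_mult(2)[OF assms(1) _ Z, of t 2] assms(2) * by (cases "s = t") auto
qed

lemma incr_4:
	assumes "0 <= s" "s <= t"
	shows "integrable P (%w. (W t w - W s w) ^ 4)"
		and "(LINT w|P. (W t w - W s w) ^ 4) = 3 * (t - s)^2"
proof -
	have "s < t ==> (LINT x|lborel. normal_density 0 (sqrt (t - s)) x * x ^ 4) = 3 * (t - s)^2"
		using integral_normal_moment_even[of "sqrt (t - s)" 0 2]
		by (simp add: fact_numeral field_simps power2_eq_square)
	then show "(LINT w|P. (W t w - W s w) ^ 4) = 3 * (t - s)^2"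
		using incr_moment(2)[OF assms(1), of t 4] assms(2) by (cases "s = t") auto
	show "integrable P (%w. (W t w - W s w) ^ 4)"
		using incr_moment(1)[OF assms(1), of t 4] assms(2) by (cases "s = t") auto
qed

section \<open>Elementary integrands and the polarised isometry\<close>

definition elem :: "real \<times> real \<times> ('w => real) => bool" where
	"elem e \<longleftrightarrow> (case e of (a, b, z) => 0 <= a \<and> a <= b \<and> z \<in> bm (F a) \<and>
		 (\<exists>C. \<forall>w\<in>space P. \<bar>z w\<bar> <= C))"

text \<open>With a <= c the product is expanded at c and at the earlier right end \<open>e\<close>.
  Every term except the square over (c, e] ends with an increment of W that has mean zero and is
  independent of the factor before it.\<close>

lemma elem_cross_ordered:
	assumes e1: "elem (a, b, z)" and e2: "elem (c, d, \<eta>)" and "a <= c"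
	shows "integrable P (%w. (z w * (W b w - W a w)) * (\<eta> w * (W d w - W c w)))"
		and "(LINT w|P. (z w * (W b w - W a w)) * (\<eta> w * (W d w - W c w)))
			= (LINT w|P. z w * \<eta> w) * max 0 (min b d - max a c)"
proof -
	from e1 e2 obtain C D where *: "0 <= a" "a <= b" "z \<in> bm (F a)" "\<And>w. w \<in> space P ==> \<bar>z w\<bar> <= C"
		 "0 <= c" "c <= d" "\<eta> \<in> bm (F c)" "\<And>w. w \<in> space P ==> \<bar>\<eta> w\<bar> <= D"
		unfolding elem_def by auto
	define Z where "Z = (%w. z w * \<eta> w)"
	have Zc: "Z \<in> bm (F c)"
		unfolding Z_def using *(7) measurable_F_mono[OF *(3) \<open>a <= c\<close>] by simp
	have Zb: "\<bar>Z w\<bar> <= C * D" if "w \<in> space P" for w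
		unfolding Z_def abs_mult using *(4,8)[OF that] by (intro mult_mono) auto
	have Zi: "integrable P Z"
		by (rule integrable_const_bound[where B="C*D"]) (use Zb measurable_F_P[OF Zc] in auto)
	have ZW: "(%w. Z w * (W v w - W u w)) \<in> bm (F r)" "integrable P (%w. Z w * (W v w - W u w))"
		if "0 <= u" "u <= v" "v <= r" "c <= r" for u v r
	proof -
		show "(%w. Z w * (W v w - W u w)) \<in> bm (F r)"
			using measurable_F_mono[OF Zc \<open>c <= r\<close>] W_meas_F[of v r] W_meas_F[of u r] that by simp
		have "integrable P (%w. W v w - W u w)"
			using incr_mult_1(1)[OF that(1,2) borel_measurable_const[of 1] integrable_const[of 1]] by (simp only: mult_1_left)
		then have "integrable P (%w. C * D * (W v w - W u w))" by (rule integrable_mult_right)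
		then show "integrable P (%w. Z w * (W v w - W u w))"
		proof (rule Bochner_Integration.integrable_bound)
			show "(%w. Z w * (W v w - W u w)) \<in> bm P"
				using measurable_F_P[OF Zc] W_meas[of v] W_meas[of u] that by simp
			show "AE x in P. norm (Z x * (W v x - W u x)) <= norm (C * D * (W v x - W u x))"
			proof (rule AE_I2)
				fix x assume "x \<in> space P"
				then have "\<bar>Z x\<bar> <= \<bar>C * D\<bar>" using Zb[of x] by linarith
				then show "norm (Z x * (W v x - W u x)) <= norm (C * D * (W v x - W u x))"
					unfolding real_norm_def abs_mult[of "Z x"] abs_mult[of "C * D"] by (rule mult_right_mono) simp
			qed
		qed
	qed
	have "integrable P (%w. (z w * (W b w - W a w)) * (\<eta> w * (W d w - W c w))) \<and>
		 (LINT w|P. (z w * (W b w - W a w)) * (\<eta> w * (W d w - W c w)))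
			= (LINT w|P. Z w) * max 0 (min b d - max a c)"
	proof (cases "b <= c")
		case True
		have "(%w. (z w * (W b w - W a w)) * (\<eta> w * (W d w - W c w))) =
			(%w. (Z w * (W b w - W a w)) * (W d w - W c w))" by (auto simp: Z_def)
		moreover have "max 0 (min b d - max a c) = 0" using True by auto
		ultimately show ?thesis
			using incr_mult_1[OF \<open>0 <= c\<close> \<open>c <= d\<close> ZW[OF \<open>0 <= a\<close> \<open>a <= b\<close> True order_refl]] by simp
	next
		case False
		\<comment> \<open>Since \<open>e = b\<close> or \<open>e = d\<close>, at most one of
		  \<open>?C\<close> and \<open>?D\<close> below differs from 0; keeping both avoids a case
		  split.\<close>
		define e where "e = min b d"
		have e: "c <= e" "e <= b" "e <= d" "e = b \<or> e = d" using False * by (auto simp: e_def)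
		let ?A = "%w. (Z w * (W c w - W a w)) * (W d w - W c w)"
		let ?B = "%w. Z w * (W e w - W c w)^2"
		let ?C = "%w. (Z w * (W e w - W c w)) * (W d w - W e w)"
		let ?D = "%w. (Z w * (W e w - W c w)) * (W b w - W e w)"
		have eq: "(%w. (z w * (W b w - W a w)) * (\<eta> w * (W d w - W c w))) = (%w. ?A w + ?B w + ?C w + ?D w)"
			using e(4) by (auto simp: Z_def fun_eq_iff algebra_simps power2_eq_square)
		have A: "integrable P ?A" "integral\<^sup>L P ?A = 0"
			using incr_mult_1[OF \<open>0 <= c\<close> \<open>c <= d\<close> ZW[OF \<open>0 <= a\<close> \<open>a <= c\<close> order_refl order_refl]] by auto
		have B: "integrable P ?B" "integral\<^sup>L P ?B = (e - c) * integral\<^sup>L P Z"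
			using incr_mult_2[OF \<open>0 <= c\<close> \<open>c <= e\<close> Zc Zi] by auto
		have "0 <= e" using e * by auto
		have C: "integrable P ?C" "integral\<^sup>L P ?C = 0"
			using incr_mult_1[OF \<open>0 <= e\<close> \<open>e <= d\<close> ZW[OF \<open>0 <= c\<close> \<open>c <= e\<close> order_refl \<open>c <= e\<close>]] by auto
		have D: "integrable P ?D" "integral\<^sup>L P ?D = 0"
			using incr_mult_1[OF \<open>0 <= e\<close> \<open>e <= b\<close> ZW[OF \<open>0 <= c\<close> \<open>c <= e\<close> order_refl \<open>c <= e\<close>]] by auto
		have "max 0 (min b d - max a c) = e - c" using e \<open>a <= c\<close> by (auto simp: e_def)
		then show ?thesis unfolding eq using A B C D by simp
	qed
	then show "integrable P (%w. (z w * (W b w - W a w)) * (\<eta> w * (W d w - W c w)))"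
		and "(LINT w|P. (z w * (W b w - W a w)) * (\<eta> w * (W d w - W c w)))
			= (LINT w|P. z w * \<eta> w) * max 0 (min b d - max a c)"
		by (auto simp: Z_def)
qed

definition elem_ito :: "real \<times> real \<times> ('w => real) => 'w => real" where
	"elem_ito e w = (case e of (a, b, z) => z w * (W b w - W a w))"

definition elem_step :: "real \<times> real \<times> ('w => real) => real => 'w => real" where
	"elem_step e s w = (case e of (a, b, z) => z w * indicator {a<..b} s)"

text \<open>A finite sum of elementary integrands is kept as a list whose intervals may overlap in
  any order. Adding two integrands is then concatenation, without a common refinement of their time
  grids.\<close>

definition fam_ito :: "(real \<times> real \<times> ('w => real)) list => 'w => real" where
	"fam_ito fs w = (\<Sum>e\<leftarrow>fs. elem_ito e w)"

definition fam_step :: "(real \<times> real \<times> ('w => real)) list => real => 'w => real" where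
	"fam_step fs s w = (\<Sum>e\<leftarrow>fs. elem_step e s w)"

lemma elem_meas: "elem e ==> elem_ito e \<in> bm P"
	"elem e ==> (%(s, w). elem_step e s w) \<in> bm (borel \<Otimes>\<^sub>M P)"
proof -
	assume "elem e"
	then obtain a b z where e: "e = (a, b, z)" "0 <= a" "a <= b" and [measurable]: "z \<in> bm P"
		unfolding elem_def using measurable_F_P by (cases e) auto
	note [measurable] = W_meas[of a] W_meas[of b]
	show "elem_ito e \<in> bm P" unfolding e elem_ito_def[abs_def] using e(2,3) by simp
	show "(%(s, w). elem_step e s w) \<in> bm (borel \<Otimes>\<^sub>M P)"
		unfolding e elem_step_def by simp
qed

lemma fam_meas: "list_all elem fs ==> fam_ito fs \<in> bm P"
	"list_all elem fs ==> (%(s, w). fam_step fs s w) \<in> bm (borel \<Otimes>\<^sub>M P)"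
proof -
	show "list_all elem fs ==> fam_ito fs \<in> bm P"
		by (induction fs) (auto simp: fam_ito_def[abs_def] intro!: borel_measurable_add elem_meas)
	show "list_all elem fs ==> (%(s, w). fam_step fs s w) \<in> bm (borel \<Otimes>\<^sub>M P)"
	proof (induction fs)
		case Nil then show ?case by (simp add: fam_step_def)
	next
		case (Cons e fs)
		then show ?case using elem_meas(2)[of e] by (auto simp: fam_step_def split_beta' intro!: borel_measurable_add)
	qed
qed

text \<open>The isometry in polarised form, bundled with the integrability it needs. As a relation
  it is symmetric and closed under addition in the first pair, so two inductions carry it from
  single intervals to lists.\<close>

definition iso :: "('w => real) => (real => 'w => real) => ('w => real) => (real => 'w => real) => bool" where
	"iso I f J g \<longleftrightarrow> integrable P (%w. I w * J w) \<and> (\<forall>w. integrable lborel (%s. f s w * g s w)) \<and>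
		 integrable P (%w. \<integral>s. f s w * g s w \<partial>lborel) \<and>
		 (LINT w|P. I w * J w) = (LINT w|P. (LINT s|lborel. f s w * g s w))"

lemma iso_add: "iso I f J g ==> iso I' f' J g ==> iso (%w. I w + I' w) (%s w. f s w + f' s w) J g"
	unfolding iso_def by (simp add: distrib_right)

lemma iso_sym: "iso I f J g ==> iso J g I f"
	unfolding iso_def by (simp add: mult.commute)

lemma iso_0: "iso (%_. 0) (%_ _. 0) J g"
	unfolding iso_def by simp

lemma elem_iso:
	assumes "elem e" "elem e'"
	shows "iso (elem_ito e) (elem_step e) (elem_ito e') (elem_step e')"
proof -
	have *: "iso (elem_ito (a, b, z)) (elem_step (a, b, z)) (elem_ito (c, d, \<eta>)) (elem_step (c, d, \<eta>))"
		if e: "elem (a, b, z)" "elem (c, d, \<eta>)" and "a <= c" for a b c d z \<eta>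
	proof -
		have eq: "(%s. elem_step (a, b, z) s w * elem_step (c, d, \<eta>) s w) =
			(%s. (z w * \<eta> w) * indicator {max a c<..min b d} s)" for w
			by (auto simp: elem_step_def fun_eq_iff indicator_def)
		have int: "(LINT s|lborel. (z w * \<eta> w) * indicator {max a c<..min b d} s)
			 = (z w * \<eta> w) * max 0 (min b d - max a c)" for w
			by (cases "max a c <= min b d") (auto simp: measure_def not_le)
		have i2: "integrable lborel (%s. (z w * \<eta> w) * indicator {max a c<..min b d} s)" for w
			by (cases "max a c <= min b d") auto
		from e obtain C D where *: "z \<in> bm P" "\<And>w. w \<in> space P ==> \<bar>z w\<bar> <= C"
			"\<eta> \<in> bm P" "\<And>w. w \<in> space P ==> \<bar>\<eta> w\<bar> <= D"
			unfolding elem_def prod.case using measurable_F_P by blast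
		have "integrable P (%w. z w * \<eta> w)"
		proof (rule integrable_const_bound[where B="C*D"])
			show "AE x in P. norm (z x * \<eta> x) <= C * D"
				using * by (intro AE_I2) (auto simp: abs_mult intro!: mult_mono intro: order_trans[OF abs_ge_zero])
		qed (use * in simp)
		then show ?thesis
			unfolding iso_def eq int using elem_cross_ordered[OF that] i2 by (auto simp: elem_ito_def)
	qed
	show ?thesis
		using *[of "fst e" "fst (snd e)" "snd (snd e)" "fst e'" "fst (snd e')" "snd (snd e')"]
			iso_sym[OF *[of "fst e'" "fst (snd e')" "snd (snd e')" "fst e" "fst (snd e)" "snd (snd e)"]] assms
		by (cases "fst e <= fst e'") auto
qed

lemma fam_iso1:
	assumes "list_all elem fs" "elem e"
	shows "iso (fam_ito fs) (fam_step fs) (elem_ito e) (elem_step e)"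
	using assms(1)
proof (induction fs)
	case Nil then show ?case using iso_0 by (simp add: fam_ito_def[abs_def] fam_step_def[abs_def])
next
	case (Cons a fs)
	then show ?case using iso_add[OF elem_iso[of a e]] assms(2)
		by (simp add: fam_ito_def[abs_def] fam_step_def[abs_def])
qed

lemma fam_iso:
	assumes "list_all elem fs" "list_all elem gs"
	shows "iso (fam_ito fs) (fam_step fs) (fam_ito gs) (fam_step gs)"
proof (rule iso_sym, use assms(2) in \<open>induction gs\<close>)
	case Nil then show ?case using iso_0 by (simp add: fam_ito_def[abs_def] fam_step_def[abs_def])
next
	case (Cons a gs)
	then show ?case using iso_add[OF iso_sym[OF fam_iso1[OF assms(1), of a]]]
		by (simp add: fam_ito_def[abs_def] fam_step_def[abs_def])
qed

lemma fam_isometry: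
	assumes "list_all elem fs"
	shows "(NN w|P. ennreal ((fam_ito fs w)^2)) = (NN w|P. (NN s|lborel. ennreal ((fam_step fs s w)^2)))"
		and "integrable P (%w. (fam_ito fs w)^2)"
proof -
	from fam_iso[OF assms assms] have *: "integrable P (%w. (fam_ito fs w)^2)" "integrable lborel (%s. (fam_step fs s w)^2)"
		"integrable P (%w. \<integral>s. (fam_step fs s w)^2 \<partial>lborel)"
		"(LINT w|P. (fam_ito fs w)^2) = (\<integral>w. \<integral>s. (fam_step fs s w)^2 \<partial>lborel \<partial>P)" for w
		unfolding iso_def by (auto simp: power2_eq_square)
	show "integrable P (%w. (fam_ito fs w)^2)" by fact
	have "(NN w|P. (NN s|lborel. ennreal ((fam_step fs s w)^2))) = (NN w|P. ennreal (LINT s|lborel. (fam_step fs s w)^2))"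
		by (intro nn_integral_cong nn_integral_eq_integral *) simp
	also have "... = ennreal (\<integral>w. \<integral>s. (fam_step fs s w)^2 \<partial>lborel \<partial>P)"
		by (rule nn_integral_eq_integral[OF *(3)]) simp
	also have "... = (NN w|P. ennreal ((fam_ito fs w)^2))"
		unfolding *(4)[symmetric] by (rule nn_integral_eq_integral[OF *(1), symmetric]) simp
	finally show "(NN w|P. ennreal ((fam_ito fs w)^2)) = (NN w|P. (NN s|lborel. ennreal ((fam_step fs s w)^2)))" ..
qed

text \<open>Each summand is \<open>Z * z\<close> times an increment of W starting at a time
  \<open>a\<close> not before \<open>s\<close>. The factor \<open>Z * z\<close> is known at time
  \<open>a\<close>, hence independent of the increment.\<close>

lemma fam_orth:
	assumes "list_all elem fs" and "\<And>a b z. (a, b, z) \<in> set fs ==> s <= a"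
		and Z: "Z \<in> bm (F s)" "\<And>w. w \<in> space P ==> \<bar>Z w\<bar> <= C"
	shows "integrable P (%w. Z w * fam_ito fs w) \<and> (LINT w|P. Z w * fam_ito fs w) = 0"
	using assms(1,2)
proof (induction fs)
	case Nil then show ?case by (simp add: fam_ito_def)
next
	case (Cons e fs)
	obtain a b z where e: "e = (a, b, z)" by (cases e)
	from Cons.prems e obtain D where *: "0 <= a" "a <= b" "z \<in> bm (F a)" "\<And>w. w \<in> space P ==> \<bar>z w\<bar> <= D"
		unfolding elem_def by (simp split: prod.splits) blast
	have "s <= a" using Cons.prems(2) e by auto
	have m: "(%w. Z w * z w) \<in> bm (F a)"
		using *(3) measurable_F_mono[OF Z(1) \<open>s <= a\<close>] by simp
	have "integrable P (%w. Z w * z w)"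
	proof (rule integrable_const_bound[where B="C*D"])
		show "AE x in P. norm (Z x * z x) <= C * D"
			using * Z by (intro AE_I2) (auto simp: abs_mult intro!: mult_mono intro: order_trans[OF abs_ge_zero])
	qed (use measurable_F_P[OF m] in simp)
	note 1 = incr_mult_1[OF *(1,2) m this]
	have "integrable P (%w. Z w * fam_ito fs w) \<and> (LINT w|P. Z w * fam_ito fs w) = 0"
		using Cons by auto
	moreover have "(%w. Z w * fam_ito (e # fs) w) = (%w. Z w * z w * (W b w - W a w) + Z w * fam_ito fs w)"
		by (auto simp: fam_ito_def e elem_ito_def algebra_simps)
	ultimately show ?case using 1 by simp
qed

end

lemma ennreal_sq_add2: "ennreal ((a + b)^2) <= 2 * ennreal (a^2) + 2 * ennreal (b^2)"
proof -
	have "(a + b)^2 <= 2 * a^2 + 2 * b^2"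
		using sum_squares_bound[of a b] by (simp add: power2_sum)
	then have "ennreal ((a + b)^2) <= ennreal (2 * a^2 + 2 * b^2)" by (rule ennreal_leI)
	also have "... = 2 * ennreal (a^2) + 2 * ennreal (b^2)"
		by (simp add: ennreal_mult flip: ennreal_numeral)
	finally show ?thesis .
qed

lemma ennreal_sq_diff2: "ennreal ((a - b)^2) <= 2 * ennreal ((a - c)^2) + 2 * ennreal ((b - c)^2)"
	using ennreal_sq_add2[of "a - c" "c - b"] by (simp add: power2_commute[of c b])

lemma ennreal_sq_add4:
	"ennreal ((a + b + c + d)^2) <= 4 * (ennreal (a^2) + ennreal (b^2) + ennreal (c^2) + ennreal (d^2))"
proof -
	have "(a + b + c + d)^2 <= 4 * (a^2 + b^2 + c^2 + d^2)"
		using sum_squares_bound[of a b] sum_squares_bound[of a c] sum_squares_bound[of a d]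
			sum_squares_bound[of b c] sum_squares_bound[of b d] sum_squares_bound[of c d]
		by (simp add: power2_eq_square algebra_simps)
	then have "ennreal ((a + b + c + d)^2) <= ennreal (4 * (a^2 + b^2 + c^2 + d^2))" by (rule ennreal_leI)
	also have "... = 4 * (ennreal (a^2) + ennreal (b^2) + ennreal (c^2) + ennreal (d^2))"
		by (simp add: ennreal_mult distrib_left flip: ennreal_numeral)
	finally show ?thesis .
qed

text \<open>Rounding the time down to a multiple of 1/(n + 1) leaves countably many times, and for
  each of them measurability in the second variable suffices. Continuity of the paths recovers the
  process as a pointwise limit.\<close>

lemma borel_measurable_pair_continuous:
	fixes g :: "real => 'w => real"
	assumes m: "\<And>s. g s \<in> bm M"
		and c: "\<And>w. w \<in> space M ==> continuous_on UNIV (%s. g s w)"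
	shows "(%(s, w). g s w) \<in> bm (borel \<Otimes>\<^sub>M M)"
proof (rule borel_measurable_LIMSEQ_metric[where f="%(n::nat) (s, w). g (real_of_int \<lfloor>(real n + 1) * s\<rfloor> / (real n + 1)) w"])
	let ?r = "%(n::nat) s. real_of_int \<lfloor>(real n + 1) * s\<rfloor> / (real n + 1)"
	fix n :: nat
	have "(%z. (%(i::int) z. g (real_of_int i / (real n + 1)) (snd z)) \<lfloor>(real n + 1) * fst z\<rfloor> z) \<in> bm (borel \<Otimes>\<^sub>M M)"
	proof (rule measurable_compose_countable[where f="%(i::int) z. g (real_of_int i / (real n + 1)) (snd z)" and g="%z. \<lfloor>(real n + 1) * fst z\<rfloor>"])
		show "(%z. g (real_of_int i / (real n + 1)) (snd z)) \<in> bm (borel \<Otimes>\<^sub>M M)" for i :: int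
			by (rule measurable_compose[OF measurable_snd m])
		show "(%z. \<lfloor>(real n + 1) * fst z\<rfloor>) \<in> borel \<Otimes>\<^sub>M M \<rightarrow>\<^sub>M count_space UNIV" by measurable
	qed
	then show "(%(s, w). g (?r n s) w) \<in> bm (borel \<Otimes>\<^sub>M M)" by (simp add: split_beta')
next
	let ?r = "%(n::nat) s. real_of_int \<lfloor>(real n + 1) * s\<rfloor> / (real n + 1)"
	fix z assume "z \<in> space ((borel :: real measure) \<Otimes>\<^sub>M M)"
	then obtain s w where z: "z = (s, w)" "w \<in> space M" by (auto simp: space_pair_measure)
	have bd: "\<bar>?r n s - s\<bar> <= 1 / (real n + 1)" for n
	proof -
		have "\<bar>real_of_int \<lfloor>(real n + 1) * s\<rfloor> - (real n + 1) * s\<bar> <= 1" by linarith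
		moreover have "?r n s - s = (real_of_int \<lfloor>(real n + 1) * s\<rfloor> - (real n + 1) * s) / (real n + 1)"
			by (simp add: field_simps)
		ultimately show ?thesis by (simp add: abs_divide divide_right_mono)
	qed
	have "(%n. ?r n s - s) \<longlonglongrightarrow> 0"
		by (rule Lim_null_comparison[OF always_eventually LIMSEQ_inverse_real_of_nat[unfolded inverse_eq_divide of_nat_Suc]]) (use bd in \<open>simp add: add.commute\<close>)
	then have "(%n. ?r n s) \<longlonglongrightarrow> s" by (simp add: LIM_zero_iff)
	then have "(%n. g (?r n s) w) \<longlonglongrightarrow> g s w"
		by (rule continuous_on_tendsto_compose[OF c[OF z(2)]]) auto
	then show "(%n. (%(s, w). g (?r n s) w) z) \<longlonglongrightarrow> (%(s, w). g s w) z" by (simp add: z)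
qed

section \<open>Increments of the Ito integral over a time step\<close>

context brownian
begin

text \<open>A simple integrand cut down to (s, t] by clamping its times. A piece that starts after t
  collapses to the time t, where its coefficient need not be measurable yet; the coefficient is
  therefore replaced by 0.\<close>

definition rfam :: "nat => (nat => real) => (nat => 'w => real) => real => real => (real \<times> real \<times> ('w => real)) list" where
	"rfam n r z s t = map (%i. (min (max (r i) s) t, min (max (r (Suc i)) s) t,
			%w. if r i <= t then z i w else 0)) [0..<n]"

lemma simple_nonneg: "simple_integrand F n r z ==> i <= n ==> 0 <= r i"
	by (induction i) (auto simp: simple_integrand_def intro: order_trans)

lemma rfam_elem:
	assumes "simple_integrand F n r z" "0 <= s" "s <= t"
	shows "list_all elem (rfam n r z s t)"
proof -
	have "elem (min (max (r i) s) t, min (max (r (Suc i)) s) t, %w. if r i <= t then z i w else 0)" if "i < n" for i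
	proof -
		from assms(1) that obtain C where *: "r i <= r (Suc i)" "z i \<in> bm (F (r i))" "\<And>w. w \<in> space P ==> \<bar>z i w\<bar> <= C"
			unfolding simple_integrand_def space_F by blast
		have "(%w. if r i <= t then z i w else 0) \<in> bm (F (min (max (r i) s) t))"
			using measurable_F_mono[OF *(2), of "min (max (r i) s) t"] by (cases "r i <= t") auto
		moreover have "\<exists>C. \<forall>w\<in>space P. \<bar>if r i <= t then z i w else 0\<bar> <= C"
			using *(3) by (intro exI[of _ "max 0 C"]) (auto intro: max.coboundedI2)
		ultimately show ?thesis using assms *(1) by (auto simp: elem_def)
	qed
	then show ?thesis unfolding rfam_def list_all_iff by auto
qed

lemma rfam_ge: "(a, b, \<xi>') \<in> set (rfam n r \<xi> s t) ==> s <= t ==> s <= a"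
	unfolding rfam_def by auto

lemma rfam_ito:
	assumes "simple_integrand F n r z" "0 <= s" "s <= t"
	shows "fam_ito (rfam n r z s t) w = simple_ito W n r z t w - simple_ito W n r z s w"
proof -
	have "fam_ito (rfam n r z s t) w = (\<Sum>i<n. (if r i <= t then z i w else 0) *
		 (W (min (max (r (Suc i)) s) t) w - W (min (max (r i) s) t) w))"
		unfolding fam_ito_def rfam_def by (simp add: comp_def elem_ito_def interv_sum_list_conv_sum_set_nat atLeast0LessThan)
	also have "... = (\<Sum>i<n. z i w * (W (min (r (Suc i)) t) w - W (min (r i) t) w) -
			 z i w * (W (min (r (Suc i)) s) w - W (min (r i) s) w))"
	proof (rule sum.cong[OF refl])
		fix i assume "i \<in> {..<n}"
		then have "r i <= r (Suc i)" using assms unfolding simple_integrand_def by auto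
		moreover have cl: "W (min (max x s) t) w = W (min x t) w - W (min x s) w + W s w" for x
			using assms(3) by (cases "x <= s") (auto simp: min_def max_def)
		ultimately show "(if r i <= t then z i w else 0) *
				 (W (min (max (r (Suc i)) s) t) w - W (min (max (r i) s) t) w) =
				 z i w * (W (min (r (Suc i)) t) w - W (min (r i) t) w) -
				 z i w * (W (min (r (Suc i)) s) w - W (min (r i) s) w)"
			unfolding cl using assms(3) by (auto simp: min_def algebra_simps)
	qed
	finally show ?thesis unfolding simple_ito_def by (simp add: sum_subtractf)
qed

lemma rfam_step:
	assumes "simple_integrand F n u z" "0 <= s" "s <= t"
	shows "fam_step (rfam n u z s t) r w = simple_process n u z r w * indicator {s<..t} r"
proof -
	have "fam_step (rfam n u z s t) r w = (\<Sum>i<n. (if u i <= t then z i w else 0) *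
		 indicator {min (max (u i) s) t<..min (max (u (Suc i)) s) t} r)"
		unfolding fam_step_def rfam_def by (simp add: comp_def elem_step_def interv_sum_list_conv_sum_set_nat atLeast0LessThan)
	also have "... = (\<Sum>i<n. z i w * indicator {u i<..u (Suc i)} r * indicator {s<..t} r)"
	proof (rule sum.cong[OF refl])
		fix i assume "i \<in> {..<n}"
		then have "u i <= u (Suc i)" using assms unfolding simple_integrand_def by auto
		then show "(if u i <= t then z i w else 0) * indicator {min (max (u i) s) t<..min (max (u (Suc i)) s) t} r =
				z i w * indicator {u i<..u (Suc i)} r * indicator {s<..t} r"
			using assms(3) by (auto simp: indicator_def)
	qed
	finally show ?thesis unfolding simple_process_def sum_distrib_right .
qed

definition neg_fam :: "(real \<times> real \<times> ('w => real)) list => (real \<times> real \<times> ('w => real)) list" where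
	"neg_fam = map (%(a, b, z). (a, b, %w. - z w))"

lemma neg_fam: "list_all elem fs ==> list_all elem (neg_fam fs)"
	"fam_ito (neg_fam fs) w = - fam_ito fs w" "fam_step (neg_fam fs) r w = - fam_step fs r w"
proof -
	have *: "elem (a, b, z) ==> elem (a, b, %w. - z w)" for a b z by (simp add: elem_def)
	show "list_all elem fs ==> list_all elem (neg_fam fs)"
		by (induction fs) (auto simp: neg_fam_def *)
	show "fam_ito (neg_fam fs) w = - fam_ito fs w" "fam_step (neg_fam fs) r w = - fam_step fs r w"
		by (induction fs) (auto simp: neg_fam_def fam_ito_def fam_step_def elem_ito_def elem_step_def)
qed

lemma fam_append: "fam_ito (fs @ gs) w = fam_ito fs w + fam_ito gs w"
	"fam_step (fs @ gs) r w = fam_step fs r w + fam_step gs r w"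
	by (auto simp: fam_ito_def fam_step_def)

lemma simple_ito_0: "simple_integrand F n r z ==> simple_ito W n r z 0 w = 0"
	using simple_nonneg[of n r z] by (auto simp: simple_ito_def min_absorb2 Suc_le_eq intro!: sum.neutral)

text \<open>The integrals up to t and up to s come with unrelated approximating sequences. The
  families \<open>fs\<close> are cut from the sequence for t. The sequence for s enters only through
  the discrepancy \<open>gs\<close> on (0, s], which tends to 0 in mean square because both
  sequences approximate the same integrand there.\<close>

lemma ito_approx:
	assumes st: "0 <= s" "s <= t"
		and It: "ito_integral P F W H t It" and Is: "ito_integral P F W H s Is"
		and Hm [measurable]: "(%(r, w). H' r w) \<in> bm (borel \<Otimes>\<^sub>M P)"
		and HH: "\<And>r. 0 <= r ==> H r = H' r"
	obtains fs :: "nat => (real \<times> real \<times> ('w => real)) list" where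
		"\<And>k. list_all elem (fs k)" "\<And>k a b \<xi>. (a, b, \<xi>) \<in> set (fs k) ==> s <= a"
		"\<And>k r w. r \<notin> {s<..t} ==> fam_step (fs k) r w = 0"
		"(%k. \<integral>\<^sup>+w. ennreal ((It w - Is w - fam_ito (fs k) w)^2) \<partial>P) \<longlonglongrightarrow> 0"
		"(%k. \<integral>\<^sup>+w. (NN r|lborel. ennreal ((fam_step (fs k) r w - H' r w)^2) * indicator {s<..t} r) \<partial>P) \<longlonglongrightarrow> 0"
proof -
	from It obtain n \<tau> \<xi> where It_m [measurable]: "It \<in> bm P"
		and S: "\<And>k. simple_integrand F (n k) (\<tau> k) (\<xi> k)"
		and S1: "(%k::nat. \<integral>\<^sup>+w. (\<integral>\<^sup>+r\<in>{0..t}. ennreal ((simple_process (n k) (\<tau> k) (\<xi> k) r w - H r w)^2) \<partial>lborel) \<partial>P) \<longlonglongrightarrow> 0"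
		and S2: "(%k::nat. \<integral>\<^sup>+w. ennreal ((simple_ito W (n k) (\<tau> k) (\<xi> k) t w - It w)^2) \<partial>P) \<longlonglongrightarrow> 0"
		unfolding ito_integral_def by blast
	from Is obtain n' \<tau>' \<xi>' where Is_m [measurable]: "Is \<in> bm P"
		and R: "\<And>k. simple_integrand F (n' k) (\<tau>' k) (\<xi>' k)"
		and R1: "(%k::nat. \<integral>\<^sup>+w. (\<integral>\<^sup>+r\<in>{0..s}. ennreal ((simple_process (n' k) (\<tau>' k) (\<xi>' k) r w - H r w)^2) \<partial>lborel) \<partial>P) \<longlonglongrightarrow> 0"
		and R2: "(%k::nat. \<integral>\<^sup>+w. ennreal ((simple_ito W (n' k) (\<tau>' k) (\<xi>' k) s w - Is w)^2) \<partial>P) \<longlonglongrightarrow> 0"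
		unfolding ito_integral_def by blast
	define fs where "fs k = rfam (n k) (\<tau> k) (\<xi> k) s t" for k
	define gs where "gs k = rfam (n k) (\<tau> k) (\<xi> k) 0 s @ neg_fam (rfam (n' k) (\<tau>' k) (\<xi>' k) 0 s)" for k
	define e1 where "e1 k = (\<integral>\<^sup>+w. (\<integral>\<^sup>+r\<in>{0..t}. ennreal ((simple_process (n k) (\<tau> k) (\<xi> k) r w - H r w)^2) \<partial>lborel) \<partial>P)" for k
	define e2 where "e2 k = (\<integral>\<^sup>+w. (\<integral>\<^sup>+r\<in>{0..s}. ennreal ((simple_process (n' k) (\<tau>' k) (\<xi>' k) r w - H r w)^2) \<partial>lborel) \<partial>P)" for k
	define d1 where "d1 k = (NN w|P. ennreal ((simple_ito W (n k) (\<tau> k) (\<xi> k) t w - It w)^2))" for k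
	define d2 where "d2 k = (NN w|P. ennreal ((simple_ito W (n' k) (\<tau>' k) (\<xi>' k) s w - Is w)^2))" for k
	have fs: "list_all elem (fs k)" for k unfolding fs_def by (rule rfam_elem[OF S st])
	have gs: "list_all elem (gs k)" for k
		unfolding gs_def using rfam_elem[OF S order_refl st(1)] neg_fam(1)[OF rfam_elem[OF R order_refl st(1)]] by simp
	note [measurable] = fam_meas[OF fs] fam_meas[OF gs] fam_meas[OF rfam_elem[OF S order_refl order_trans[OF st]]]
		fam_meas[OF rfam_elem[OF R order_refl st(1)]] fam_meas[OF rfam_elem[OF S order_refl st(1)]]
	have sp: "simple_process (n k) (\<tau> k) (\<xi> k) r w = fam_step (rfam (n k) (\<tau> k) (\<xi> k) 0 t) r w" if "r \<in> {0<..t}" for k r w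
		using rfam_step[OF S order_refl order_trans[OF st], of k r w] that by simp
	have sp': "simple_process (n' k) (\<tau>' k) (\<xi>' k) r w = fam_step (rfam (n' k) (\<tau>' k) (\<xi>' k) 0 s) r w" if "r \<in> {0<..s}" for k r w
		using rfam_step[OF R order_refl st(1), of k r w] that by simp
	have gs_step: "(fam_step (gs k) r w)^2 = (fam_step (rfam (n k) (\<tau> k) (\<xi> k) 0 t) r w - fam_step (rfam (n' k) (\<tau>' k) (\<xi>' k) 0 s) r w)^2 * indicator {0<..s} r" for k r w
		unfolding gs_def fam_append neg_fam(3) rfam_step[OF S order_refl st(1)] rfam_step[OF R order_refl st(1)]
			rfam_step[OF S order_refl order_trans[OF st]] using st by (auto simp: indicator_def)
	let ?E1 = "%k w. \<integral>\<^sup>+r. ennreal ((fam_step (rfam (n k) (\<tau> k) (\<xi> k) 0 t) r w - H' r w)^2) * indicator {0<..t} r \<partial>lborel"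
	let ?E2 = "%k w. \<integral>\<^sup>+r. ennreal ((fam_step (rfam (n' k) (\<tau>' k) (\<xi>' k) 0 s) r w - H' r w)^2) * indicator {0<..s} r \<partial>lborel"
	have E1: "(NN w|P. ?E1 k w) <= e1 k" for k
		unfolding e1_def by (intro nn_integral_mono) (auto simp: HH sp indicator_def)
	have E2: "(NN w|P. ?E2 k w) <= e2 k" for k
		unfolding e2_def by (intro nn_integral_mono) (auto simp: HH sp' indicator_def)
	have gs2: "(NN w|P. ennreal ((fam_ito (gs k) w)^2)) <= 2 * e1 k + 2 * e2 k" for k
	proof -
		have "(NN w|P. ennreal ((fam_ito (gs k) w)^2)) = (NN w|P. (NN r|lborel. ennreal ((fam_step (gs k) r w)^2)))"
			by (rule fam_isometry(1)[OF gs])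
		also have "... <= (NN w|P. (NN r|lborel. 2 * (ennreal ((fam_step (rfam (n k) (\<tau> k) (\<xi> k) 0 t) r w - H' r w)^2) * indicator {0<..t} r)
			 + 2 * (ennreal ((fam_step (rfam (n' k) (\<tau>' k) (\<xi>' k) 0 s) r w - H' r w)^2) * indicator {0<..s} r)))"
			unfolding gs_step using st by (intro nn_integral_mono) (auto simp: indicator_def intro: ennreal_sq_diff2)
		also have "... = (NN w|P. 2 * ?E1 k w + 2 * ?E2 k w)"
			by (intro nn_integral_cong) (subst nn_integral_add, simp, simp, simp add: nn_integral_cmult)
		also have "... = 2 * (NN w|P. ?E1 k w) + 2 * (NN w|P. ?E2 k w)"
			by (subst nn_integral_add, simp, simp, simp add: nn_integral_cmult)
		also have "... <= 2 * e1 k + 2 * e2 k" by (intro add_mono mult_left_mono E1 E2) auto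
		finally show ?thesis .
	qed
	have fin: "(NN w|P. ennreal ((It w - Is w - fam_ito (fs k) w)^2)) <= 4 * (d1 k + d2 k + (2 * e1 k + 2 * e2 k))" for k
	proof -
		have m: "simple_ito W (n k) (\<tau> k) (\<xi> k) t \<in> bm P" "simple_ito W (n' k) (\<tau>' k) (\<xi>' k) s \<in> bm P"
			using rfam_ito[OF S order_refl order_trans[OF st], of k] rfam_ito[OF R order_refl st(1), of k]
				simple_ito_0[OF S] simple_ito_0[OF R]
				fam_meas(1)[OF rfam_elem[OF S order_refl order_trans[OF st]], of k] fam_meas(1)[OF rfam_elem[OF R order_refl st(1)], of k]
			by (simp_all cong: measurable_cong)
		note [measurable] = m
		have eq: "It w - Is w - fam_ito (fs k) w = - (simple_ito W (n k) (\<tau> k) (\<xi> k) t w - It w) +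
			 (simple_ito W (n' k) (\<tau>' k) (\<xi>' k) s w - Is w) + fam_ito (gs k) w + 0" for w
			unfolding fs_def gs_def fam_append neg_fam(2) rfam_ito[OF S st] rfam_ito[OF S order_refl st(1)]
				rfam_ito[OF R order_refl st(1)] simple_ito_0[OF S] simple_ito_0[OF R] by simp
		have "(NN w|P. ennreal ((It w - Is w - fam_ito (fs k) w)^2)) <=
			(NN w|P. 4 * (ennreal ((simple_ito W (n k) (\<tau> k) (\<xi> k) t w - It w)^2) +
			 ennreal ((simple_ito W (n' k) (\<tau>' k) (\<xi>' k) s w - Is w)^2) + ennreal ((fam_ito (gs k) w)^2)))"
		proof (intro nn_integral_mono)
			fix w
			show "ennreal ((It w - Is w - fam_ito (fs k) w)^2) <= 4 * (ennreal ((simple_ito W (n k) (\<tau> k) (\<xi> k) t w - It w)^2) +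
			 ennreal ((simple_ito W (n' k) (\<tau>' k) (\<xi>' k) s w - Is w)^2) + ennreal ((fam_ito (gs k) w)^2))"
				unfolding eq by (rule order_trans[OF ennreal_sq_add4]) (simp del: minus_diff_eq)
		qed
		also have "... = 4 * (d1 k + d2 k + (NN w|P. ennreal ((fam_ito (gs k) w)^2)))"
			unfolding d1_def d2_def by (simp add: nn_integral_cmult nn_integral_add)
		also have "... <= 4 * (d1 k + d2 k + (2 * e1 k + 2 * e2 k))"
			by (intro mult_left_mono add_mono gs2) auto
		finally show ?thesis .
	qed
	have lim: "e1 \<longlonglongrightarrow> 0" "e2 \<longlonglongrightarrow> 0" "d1 \<longlonglongrightarrow> 0" "d2 \<longlonglongrightarrow> 0"
		using S1 R1 S2 R2 unfolding e1_def e2_def d1_def d2_def by auto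
	have "(%k. 4 * (d1 k + d2 k + (2 * e1 k + 2 * e2 k))) \<longlonglongrightarrow> 4 * (0 + 0 + (2 * 0 + 2 * 0))"
		by (intro ennreal_tendsto_cmult tendsto_add lim) auto
	then have lim1: "(%k. 4 * (d1 k + d2 k + (2 * e1 k + 2 * e2 k))) \<longlonglongrightarrow> 0" by simp
	show thesis
	proof (rule that[of fs])
		show "list_all elem (fs k)" for k by (rule fs)
		show "s <= a" if "(a, b, \<zeta>) \<in> set (fs k)" for k a b \<zeta> using rfam_ge that st unfolding fs_def by blast
		show "fam_step (fs k) r w = 0" if "r \<notin> {s<..t}" for k r w
			unfolding fs_def rfam_step[OF S st] using that by simp
		show "(%k. \<integral>\<^sup>+w. ennreal ((It w - Is w - fam_ito (fs k) w)^2) \<partial>P) \<longlonglongrightarrow> 0"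
			by (rule tendsto_sandwich[OF _ _ tendsto_const lim1]) (use fin in \<open>auto intro!: always_eventually\<close>)
		have "(NN w|P. (NN r|lborel. ennreal ((fam_step (fs k) r w - H' r w)^2) * indicator {s<..t} r)) <= e1 k" for k
			unfolding e1_def using st by (intro nn_integral_mono) (auto simp: HH fs_def rfam_step[OF S st] indicator_def)
		then show "(%k. \<integral>\<^sup>+w. (NN r|lborel. ennreal ((fam_step (fs k) r w - H' r w)^2) * indicator {s<..t} r) \<partial>P) \<longlonglongrightarrow> 0"
			by (intro tendsto_sandwich[OF _ _ tendsto_const lim(1)]) (auto intro!: always_eventually)
	qed
qed

text \<open>Appending the piece (s, t] with coefficient \<open>- z\<close> to the approximating
  family reduces the estimate to the isometry. The factor 4 arises from using (a + b)^2 <= 2 a^2 + 2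
  b^2 twice.\<close>

lemma ito_incr_L2:
	assumes st: "0 <= s" "s <= t"
		and It: "ito_integral P F W H t It" and Is: "ito_integral P F W H s Is"
		and Hm [measurable]: "(%(r, w). H' r w) \<in> bm (borel \<Otimes>\<^sub>M P)"
		and HH: "\<And>r. 0 <= r ==> H r = H' r"
		and xi: "z \<in> bm (F s)" "\<And>w. w \<in> space P ==> \<bar>z w\<bar> <= C"
	shows "(NN w|P. ennreal ((It w - Is w - z w * (W t w - W s w))^2))
		<= 4 * (NN w|P. (NN r|lborel. ennreal ((H' r w - z w)^2) * indicator {s<..t} r))"
proof -
	show ?thesis
	proof (rule ito_approx[OF st It Is Hm HH])
	fix fs :: "nat => (real \<times> real \<times> ('w => real)) list"
	assume fs0: "\<And>k. list_all elem (fs k)" "\<And>k a b z. (a, b, z) \<in> set (fs k) ==> s <= a"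
		"\<And>k r w. r \<notin> {s<..t} ==> fam_step (fs k) r w = 0"
		"(%k. \<integral>\<^sup>+w. ennreal ((It w - Is w - fam_ito (fs k) w)^2) \<partial>P) \<longlonglongrightarrow> 0"
		"(%k. \<integral>\<^sup>+w. (NN r|lborel. ennreal ((fam_step (fs k) r w - H' r w)^2) * indicator {s<..t} r) \<partial>P) \<longlonglongrightarrow> 0"
	note fs = fs0(1,3,4,5)
	have [measurable]: "It \<in> bm P" "Is \<in> bm P" using It Is unfolding ito_integral_def by auto
	note [measurable] = fam_meas[OF fs(1)] W_meas[OF st(1)] W_meas[OF order_trans[OF st]] measurable_F_P[OF xi(1)]
	define d where "d k = (NN w|P. ennreal ((It w - Is w - fam_ito (fs k) w)^2))" for k
	let ?E = "%k w. (NN r|lborel. ennreal ((fam_step (fs k) r w - H' r w)^2) * indicator {s<..t} r)"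
	define e where "e k = (NN w|P. ?E k w)" for k
	let ?Q = "%w. (NN r|lborel. ennreal ((H' r w - z w)^2) * indicator {s<..t} r)"
	define Q where "Q = (NN w|P. ?Q w)"
	define gs where "gs k = fs k @ [(s, t, %w. - z w)]" for k
	have gs: "list_all elem (gs k)" for k
		using fs(1) xi st by (auto simp: gs_def elem_def)
	note [measurable] = fam_meas[OF gs]
	have gi: "fam_ito (gs k) w = fam_ito (fs k) w - z w * (W t w - W s w)" for k w
		unfolding gs_def fam_append by (simp add: fam_ito_def elem_ito_def)
	have gst: "(fam_step (gs k) r w)^2 = (fam_step (fs k) r w - z w)^2 * indicator {s<..t} r" for k w r
		unfolding gs_def fam_append using fs(2)[of r k w] by (auto simp: fam_step_def elem_step_def indicator_def)
	have "(NN w|P. ennreal ((It w - Is w - z w * (W t w - W s w))^2)) <= 2 * d k + 2 * (2 * e k + 2 * Q)" for k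
	proof -
		have "(NN w|P. ennreal ((It w - Is w - z w * (W t w - W s w))^2))
			 <= (NN w|P. 2 * ennreal ((It w - Is w - fam_ito (fs k) w)^2) + 2 * ennreal ((fam_ito (gs k) w)^2))"
		proof (intro nn_integral_mono)
			fix w
			have "It w - Is w - z w * (W t w - W s w) = (It w - Is w - fam_ito (fs k) w) + fam_ito (gs k) w"
				unfolding gi by simp
			then show "ennreal ((It w - Is w - z w * (W t w - W s w))^2) <=
					2 * ennreal ((It w - Is w - fam_ito (fs k) w)^2) + 2 * ennreal ((fam_ito (gs k) w)^2)"
				by (simp only: ennreal_sq_add2)
		qed
		also have "... = 2 * d k + 2 * (NN w|P. ennreal ((fam_ito (gs k) w)^2))"
			unfolding d_def by (simp add: nn_integral_cmult nn_integral_add)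
		also have "(NN w|P. ennreal ((fam_ito (gs k) w)^2)) = (NN w|P. (NN r|lborel. ennreal ((fam_step (gs k) r w)^2)))"
			by (rule fam_isometry(1)[OF gs])
		also have "... <= (NN w|P. (NN r|lborel. 2 * (ennreal ((fam_step (fs k) r w - H' r w)^2) * indicator {s<..t} r)
			 + 2 * (ennreal ((H' r w - z w)^2) * indicator {s<..t} r)))"
		proof (intro nn_integral_mono)
			fix w r
			show "ennreal ((fam_step (gs k) r w)^2) <= 2 * (ennreal ((fam_step (fs k) r w - H' r w)^2) * indicator {s<..t} r)
			 + 2 * (ennreal ((H' r w - z w)^2) * indicator {s<..t} r)"
				unfolding gst using ennreal_sq_add2[of "fam_step (fs k) r w - H' r w" "H' r w - z w"] by (auto simp: indicator_def)
		qed
		also have "... = (NN w|P. 2 * ?E k w + 2 * ?Q w)"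
			by (intro nn_integral_cong) (subst nn_integral_add, simp, simp, simp add: nn_integral_cmult)
		also have "... = 2 * e k + 2 * Q"
			unfolding e_def Q_def by (subst nn_integral_add, simp, simp, simp add: nn_integral_cmult)
		finally show ?thesis by (simp add: mult_left_mono)
	qed
	moreover have "(%k. 2 * d k + 2 * (2 * e k + 2 * Q)) \<longlonglongrightarrow> 2 * 0 + 2 * (2 * 0 + 2 * Q)"
		using fs(3,4) unfolding d_def[symmetric] e_def[symmetric]
		by (intro ennreal_tendsto_cmult tendsto_add tendsto_const) auto
	ultimately have "(NN w|P. ennreal ((It w - Is w - z w * (W t w - W s w))^2)) <= 2 * 0 + 2 * (2 * 0 + 2 * Q)"
		by (intro LIMSEQ_le_const) auto
	also have "... = 4 * Q" by (simp add: mult.assoc[symmetric])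
	finally show ?thesis unfolding Q_def .
	qed
qed

text \<open>Converts a bound in mean square into one in the first mean: integrate, then choose
  e.\<close>

lemma abs_le_sq_bound: "0 < (e::real) ==> \<bar>x\<bar> <= e + x^2 / e"
proof -
	assume e: "0 < e"
	have "2 * (e * \<bar>x\<bar>) <= e^2 + x^2" using sum_squares_bound[of e "\<bar>x\<bar>"] by simp
	then have "\<bar>x\<bar> * e <= e^2 + x^2" using e by (smt (verit) mult.commute mult_nonneg_nonneg abs_ge_zero)
	then show ?thesis using e by (simp add: field_simps power2_eq_square)
qed

text \<open>The approximating families have mean 0 against \<open>Z\<close> by
  \<open>fam_orth\<close>. The error is at most \<open>C * e\<close> plus \<open>C / e\<close> times
  a mean square that vanishes in the limit; afterwards e tends to 0.\<close>

lemma ito_incr_orth: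
	assumes st: "0 <= s" "s <= t"
		and It: "ito_integral P F W H t It" and Is: "ito_integral P F W H s Is"
		and Hm: "(%(r, w). H' r w) \<in> bm (borel \<Otimes>\<^sub>M P)"
		and HH: "\<And>r. 0 <= r ==> H r = H' r"
		and Z: "Z \<in> bm (F s)" "\<And>w. w \<in> space P ==> \<bar>Z w\<bar> <= C"
		and int: "integrable P (%w. Z w * (It w - Is w))"
	shows "(LINT w|P. Z w * (It w - Is w)) = 0"
proof -
	show ?thesis
	proof (rule ito_approx[OF st It Is Hm HH])
	fix fs :: "nat => (real \<times> real \<times> ('w => real)) list"
	assume fs0: "\<And>k. list_all elem (fs k)" "\<And>k a b z. (a, b, z) \<in> set (fs k) ==> s <= a"
		"\<And>k r w. r \<notin> {s<..t} ==> fam_step (fs k) r w = 0"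
		"(%k. \<integral>\<^sup>+w. ennreal ((It w - Is w - fam_ito (fs k) w)^2) \<partial>P) \<longlonglongrightarrow> 0"
		"(%k. \<integral>\<^sup>+w. (NN r|lborel. ennreal ((fam_step (fs k) r w - H' r w)^2) * indicator {s<..t} r) \<partial>P) \<longlonglongrightarrow> 0"
	note fs = fs0(1,2,4)
	have [measurable]: "It \<in> bm P" "Is \<in> bm P" using It Is unfolding ito_integral_def by auto
	note [measurable] = fam_meas[OF fs(1)] measurable_F_P[OF Z(1)]
	define D where "D k w = It w - Is w - fam_ito (fs k) w" for k w
	have Dm [measurable]: "D k \<in> bm P" for k unfolding D_def[abs_def] by simp
	have C0: "0 <= C" using Z(2) not_empty order_trans[OF abs_ge_zero] by blast
	have bd: "ennreal \<bar>\<integral>w. Z w * (It w - Is w) \<partial>P\<bar> <= ennreal (C * e) + ennreal (C / e) * (NN w|P. ennreal ((D k w)^2))" if "e > 0" for e k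
	proof -
		note o = fam_orth[OF fs(1)[of k] fs(2) Z]
		have i: "integrable P (%w. Z w * D k w)"
			using int o unfolding D_def by (simp add: right_diff_distrib)
		have "(LINT w|P. Z w * D k w) = (LINT w|P. Z w * (It w - Is w) - Z w * fam_ito (fs k) w)"
			unfolding D_def by (simp add: right_diff_distrib)
		also have "... = (LINT w|P. Z w * (It w - Is w))" using int o by (subst Bochner_Integration.integral_diff) auto
		finally have "ennreal \<bar>\<integral>w. Z w * (It w - Is w) \<partial>P\<bar> <= (NN w|P. ennreal \<bar>Z w * D k w\<bar>)"
			using integral_norm_bound_ennreal[OF i] by simp
		also have "... <= (NN w|P. ennreal (C * e) + ennreal (C / e) * ennreal ((D k w)^2))"
		proof (intro nn_integral_mono)
			fix w assume "w \<in> space P"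
			then have "\<bar>Z w * D k w\<bar> <= C * (e + (D k w)^2 / e)"
				unfolding abs_mult using Z(2) abs_le_sq_bound[OF \<open>e > 0\<close>, of "D k w"] C0 by (intro mult_mono) auto
			then have "ennreal \<bar>Z w * D k w\<bar> <= ennreal (C * e + C / e * (D k w)^2)"
				by (intro ennreal_leI) (simp add: algebra_simps)
			also have "... = ennreal (C * e) + ennreal (C / e) * ennreal ((D k w)^2)"
				using C0 \<open>e > 0\<close> by (simp add: ennreal_mult[symmetric] del: ennreal_plus flip: ennreal_plus)
			finally show "ennreal \<bar>Z w * D k w\<bar> <= ennreal (C * e) + ennreal (C / e) * ennreal ((D k w)^2)" .
		qed
		also have "... = ennreal (C * e) + ennreal (C / e) * (NN w|P. ennreal ((D k w)^2))"
			by (simp add: nn_integral_add nn_integral_cmult emeasure_space_1)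
		finally show ?thesis .
	qed
	have lim: "(%k. ennreal (C * e) + ennreal (C / e) * (NN w|P. ennreal ((D k w)^2))) \<longlonglongrightarrow> ennreal (C * e) + ennreal (C / e) * 0" for e
		using fs(3) unfolding D_def[symmetric] by (intro tendsto_add tendsto_const ennreal_tendsto_cmult) auto
	have **: "ennreal \<bar>\<integral>w. Z w * (It w - Is w) \<partial>P\<bar> <= ennreal (C * e) + ennreal (C / e) * 0" if "e > 0" for e
		by (rule LIMSEQ_le_const[OF lim]) (use bd that in blast)
	have *: "\<bar>\<integral>w. Z w * (It w - Is w) \<partial>P\<bar> <= C * e" if "e > 0" for e
	proof -
		have "ennreal \<bar>\<integral>w. Z w * (It w - Is w) \<partial>P\<bar> <= ennreal (C * e)" using **[OF that] by simp
		moreover have "0 <= C * e" using C0 that by simp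
		ultimately show ?thesis by (simp only: ennreal_le_iff)
	qed
	have "\<bar>\<integral>w. Z w * (It w - Is w) \<partial>P\<bar> <= 0 + d" if "d > 0" for d
	proof -
		have "C * (d / (C + 1)) <= d" using C0 that by (simp add: field_simps)
		then show ?thesis using *[of "d / (C + 1)"] C0 that by simp
	qed
	then have "\<bar>\<integral>w. Z w * (It w - Is w) \<partial>P\<bar> <= 0" by (rule field_le_epsilon)
	then show ?thesis by simp
	qed
qed

end

section \<open>Expansion over a short time step\<close>

lemma taylor2:
	fixes f f' f'' :: "real => real"
	assumes "\<And>x. (f has_real_derivative f' x) (at x)" "\<And>x. (f' has_real_derivative f'' x) (at x)"
	obtains z where "\<bar>z - x\<bar> <= \<bar>y - x\<bar>" "f y - f x = f' x * (y - x) + 1/2 * f'' z * (y - x)^2"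
proof (cases "y = x")
	case True then show ?thesis using that[of x] by simp
next
	case False
	define diff where "diff = (%n::nat. if n = 0 then f else if n = 1 then f' else f'')"
	have "\<exists>t. (if y < x then y < t \<and> t < x else x < t \<and> t < y) \<and>
			f y = (\<Sum>m<2. (diff m x / fact m) * (y - x) ^ m) + (diff 2 t / fact 2) * (y - x) ^ 2"
		by (rule Taylor[of 2 diff f "min x y" "max x y" x y]) (use False assms in \<open>auto simp: diff_def less_2_cases_iff\<close>)
	then obtain t where "if y < x then y < t \<and> t < x else x < t \<and> t < y"
		"f y = f x + f' x * (y - x) + f'' t / 2 * (y - x)^2"
		by (auto simp: diff_def numeral_2_eq_2)
	then show ?thesis by (intro that[of t]) (auto split: if_splits)
qed

lemma integrable_nonneg_bound:
	assumes "g \<in> bm M" "\<And>x. 0 <= g x" "(NN x|M. ennreal (g x)) <= ennreal c" "0 <= c"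
	shows "integrable M g" "integral\<^sup>L M g <= c"
proof -
	show i: "integrable M g"
		using assms by (intro integrableI_bounded) (auto simp: le_less_trans[OF _ ennreal_less_top])
	have "ennreal (integral\<^sup>L M g) <= ennreal c"
		using nn_integral_eq_integral[OF i] assms by simp
	then show "integral\<^sup>L M g <= c" using assms(4) by simp
qed

lemma ennreal_comb:
	assumes "0 <= a" "0 <= b"
	shows "2 * ennreal a + 2 * ennreal b = ennreal (2 * a + 2 * b)"
		and "4 * ennreal b = ennreal (4 * b)"
	using assms by (simp_all add: ennreal_mult)

section \<open>Second moments of the increments of the solution\<close>

locale sde = brownian P F W for P :: "'w measure" and F W +
	fixes A B :: "real => real" and X :: "real => 'w => real" and K L :: real
	assumes sol: "sde_solution P F W B A X"
		and K1: "1 <= K" and L0: "0 <= L"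
		and A_bd: "\<And>x. \<bar>A x\<bar> <= K" and B_bd: "\<And>x. \<bar>B x\<bar> <= K"
		and A_lip: "\<And>x y. \<bar>A x - A y\<bar> <= L * \<bar>x - y\<bar>" and B_lip: "\<And>x y. \<bar>B x - B y\<bar> <= L * \<bar>x - y\<bar>"
begin

lemma lip_cont: "(\<And>x y. \<bar>g x - g y\<bar> <= L * \<bar>x - y\<bar>) ==> continuous_on UNIV (g :: real => real)"
	using L0 by (intro lipschitz_on_continuous_on[of L] lipschitz_onI) (auto simp: dist_real_def)

lemma A_cont: "continuous_on UNIV A" and B_cont: "continuous_on UNIV B"
	using lip_cont[of A] lip_cont[of B] A_lip B_lip by auto

lemma AB_meas [measurable]: "A \<in> bm borel" "B \<in> bm borel"
	using A_cont B_cont by (auto intro: borel_measurable_continuous_onI)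

text \<open>The process held at its initial value for negative times. Its paths are continuous on
  the whole line, so joint measurability and integrals over \<open>lborel\<close> can be treated
  without restricting the time.\<close>

definition Xc :: "real => 'w => real" where "Xc s = X (max 0 s)"

lemma Xc_eq: "0 <= s ==> Xc s = X s" by (simp add: Xc_def max_def)

lemma X_meas_F: "0 <= t ==> t <= u ==> X t \<in> bm (F u)"
	using sol measurable_F_mono[of "X t" t u] unfolding sde_solution_def by auto

lemma X_meas: "0 <= t ==> X t \<in> bm P"
	using X_meas_F[of t t] measurable_F_P by auto

lemma X_cont: "w \<in> space P ==> continuous_on {0..} (%t. X t w)"
	using sol unfolding sde_solution_def by auto

lemma Xc_cont: "w \<in> space P ==> continuous_on UNIV (%t. Xc t w)"
	unfolding Xc_def by (rule continuous_on_compose2[OF X_cont]) (auto intro!: continuous_intros)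

lemma Xc_pair [measurable]: "(%(s, w). Xc s w) \<in> bm (borel \<Otimes>\<^sub>M P)"
	by (rule borel_measurable_pair_continuous) (auto simp: Xc_def intro: X_meas Xc_cont[unfolded Xc_def])

definition bint :: "real => real => 'w => real" where
	"bint s t w = (LBINT r:{s<..t}. B (Xc r w))"

lemma B_int: "w \<in> space P ==> set_integrable lborel {s..t} (%r. B (Xc r w))"
	by (rule borel_integrable_atLeastAtMost') (intro continuous_on_compose2[OF B_cont] continuous_on_subset[OF Xc_cont]; auto)

lemma bint_meas [measurable]: "bint s t \<in> bm P"
proof -
	have [measurable]: "(%(w, r). Xc r w) \<in> bm (P \<Otimes>\<^sub>M lborel)"
		using measurable_compose[OF measurable_pair_swap' Xc_pair] by (simp add: split_beta')
	show ?thesis unfolding bint_def[abs_def] set_lebesgue_integral_def by measurable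
qed

lemma bint_bound:
	assumes "w \<in> space P" "s <= t"
	shows "\<bar>bint s t w\<bar> <= K * (t - s)"
proof -
	have i: "set_integrable lborel {s<..t} (%r. B (Xc r w))"
		by (rule set_integrable_subset[OF B_int[OF assms(1), of s t]]) auto
	have "\<bar>bint s t w\<bar> <= (LBINT r:{s<..t}. \<bar>B (Xc r w)\<bar>)"
		unfolding bint_def using set_integral_norm_bound[OF i] by simp
	also have "... <= (LBINT r:{s<..t}. K)"
		by (rule set_integral_mono) (use set_integrable_abs[OF i] B_bd assms in \<open>auto simp: set_integrable_def\<close>)
	also have "... = K * (t - s)" using assms by (simp add: set_lebesgue_integral_def)
	finally show ?thesis .
qed

lemma X_incr:
	assumes st: "0 <= s" "s <= t"
	obtains It Is where "ito_integral P F W (%s w. A (X s w)) t It" "ito_integral P F W (%s w. A (X s w)) s Is"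
		"AE w in P. X t w - X s w = bint s t w + (It w - Is w)"
proof -
	have "0 <= t" using st by simp
	from sol obtain It where It: "ito_integral P F W (%s w. A (X s w)) t It"
			"AE w in P. X t w = X 0 w + (LBINT s:{0..t}. B (X s w)) + It w"
		unfolding sde_solution_def using \<open>0 <= t\<close> by blast
	from sol obtain Is where Is: "ito_integral P F W (%s w. A (X s w)) s Is"
			"AE w in P. X s w = X 0 w + (LBINT s:{0..s}. B (X s w)) + Is w"
		unfolding sde_solution_def using \<open>0 <= s\<close> by blast
	have "AE w in P. X t w - X s w = bint s t w + (It w - Is w)"
		using It(2) Is(2) AE_space
	proof eventually_elim
		case (elim w)
		have eq: "(LBINT r:{0..u}. B (X r w)) = (LBINT r:{0..u}. B (Xc r w))" for u
			by (rule set_lebesgue_integral_cong) (auto simp: Xc_eq)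
		have "(LBINT r:{0..s} \<union> {s<..t}. B (Xc r w)) = (LBINT r:{0..s}. B (Xc r w)) + bint s t w"
			unfolding bint_def
		proof (rule set_integral_Un)
			show "set_integrable lborel {s<..t} (%x. B (Xc x w))"
				by (rule set_integrable_subset[OF B_int[OF elim(3), of s t]]) auto
		qed (use B_int[OF elim(3), of 0 s] in auto)
		moreover have "{0..s} \<union> {s<..t} = {0..t}" using st by auto
		ultimately show ?case using elim(1,2) unfolding eq by simp
	qed
	then show thesis using that It(1) Is(1) by blast
qed

lemma A_pair: "(%(r, w). A (Xc r w)) \<in> bm (borel \<Otimes>\<^sub>M P)" by measurable

text \<open>Over a step h <= 1 the drift contributes at most 2 K^2 h^2 <= 2 K^2 h, and the Ito part
  contributes twice 4 K^2 h by \<open>ito_incr_L2\<close> with coefficient 0; hence 10.\<close>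

lemma X_incr_L2:
	assumes st: "0 <= s" "s <= t" "t - s <= 1"
	shows "(NN w|P. ennreal ((X t w - X s w)^2)) <= ennreal (10 * K^2 * (t - s))"
proof (rule X_incr[OF st(1,2)])
	fix It Is assume I: "ito_integral P F W (%s w. A (X s w)) t It" "ito_integral P F W (%s w. A (X s w)) s Is"
		and ae: "AE w in P. X t w - X s w = bint s t w + (It w - Is w)"
	have [measurable]: "It \<in> bm P" "Is \<in> bm P" using I unfolding ito_integral_def by auto
	have "(NN w|P. ennreal ((It w - Is w - 0 * (W t w - W s w))^2))
		<= 4 * (NN w|P. (NN r|lborel. ennreal ((A (Xc r w) - 0)^2) * indicator {s<..t} r))"
		by (rule ito_incr_L2[OF st(1,2) I A_pair, of "%_. 0" 0]) (auto simp: Xc_eq)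
	also have "... <= 4 * (NN w|P. (NN r|lborel. ennreal (K^2) * indicator {s<..t} r))"
		using A_bd K1 by (intro mult_left_mono nn_integral_mono mult_right_mono ennreal_leI) (auto simp: abs_le_square_iff[symmetric] intro!: power2_le_iff_abs_le[THEN iffD2])
	also have "... = ennreal (4 * K^2 * (t - s))"
		using st by (simp add: nn_integral_cmult_indicator emeasure_space_1 ennreal_mult mult.assoc)
	finally have I2: "(NN w|P. ennreal ((It w - Is w)^2)) <= ennreal (4 * K^2 * (t - s))" by simp
	have "(NN w|P. ennreal ((X t w - X s w)^2)) <= (NN w|P. 2 * ennreal (K^2 * (t - s)) + 2 * ennreal ((It w - Is w)^2))"
	proof (rule nn_integral_mono_AE, use ae AE_space in eventually_elim)
		case (elim w)
		have "(bint s t w)^2 <= (K * (t - s))^2"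
			using bint_bound[OF elim(2) st(2)] by (rule power2_le_iff_abs_le[THEN iffD2, rotated]) (use K1 st in auto)
		also have "... = K^2 * (t - s) * (t - s)" by (simp add: power2_eq_square)
		also have "... <= K^2 * (t - s)" using st K1 by (intro mult_left_le) auto
		finally have "ennreal ((bint s t w)^2) <= ennreal (K^2 * (t - s))" by (rule ennreal_leI)
		then show ?case
			unfolding elim(1) by (intro order_trans[OF ennreal_sq_add2] add_mono mult_left_mono) auto
	qed
	also have "... = 2 * ennreal (K^2 * (t - s)) + 2 * (NN w|P. ennreal ((It w - Is w)^2))"
		by (simp add: nn_integral_add nn_integral_cmult emeasure_space_1)
	also have "... <= 2 * ennreal (K^2 * (t - s)) + 2 * ennreal (4 * K^2 * (t - s))"
		by (intro add_mono mult_left_mono I2) auto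
	also have "... = ennreal (2 * (K^2 * (t - s)) + 2 * (4 * K^2 * (t - s)))"
		using st K1 by (intro ennreal_comb) auto
	also have "2 * (K^2 * (t - s)) + 2 * (4 * K^2 * (t - s)) = 10 * K^2 * (t - s)" by simp
	finally show ?thesis .
qed

text \<open>The bound of \<open>X_incr_L2\<close> is integrated over the step after an exchange of
  integrals, which raises the order from h to h^2.\<close>

lemma lip_int_L2:
	assumes st: "0 <= s" "s <= t" "t - s <= 1"
		and g: "\<And>x y. \<bar>g x - g y\<bar> <= L * \<bar>x - y\<bar>"
	shows "(NN w|P. (NN r|lborel. ennreal ((g (Xc r w) - g (X s w))^2) * indicator {s<..t} r))
		<= ennreal (10 * L^2 * K^2 * (t - s)^2)"
proof -
	have [measurable]: "X s \<in> bm P" by (rule X_meas[OF st(1)])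
	have [measurable]: "g \<in> bm borel" using lip_cont[OF g] by (rule borel_measurable_continuous_onI)
	have sp: "(%(w, r). Xc r w) \<in> bm (P \<Otimes>\<^sub>M lborel)"
		using measurable_compose[OF measurable_pair_swap' Xc_pair] by (simp add: split_beta')
	note [measurable] = sp
	interpret pr: pair_sigma_finite P lborel ..
	have sw: "(NN w|P. (NN r|lborel. ennreal ((g (Xc r w) - g (X s w))^2) * indicator {s<..t} r))
		 = (NN r|lborel. (NN w|P. ennreal ((g (Xc r w) - g (X s w))^2) * indicator {s<..t} r))"
		by (rule pr.Fubini'[symmetric]) measurable
	have "(NN w|P. ennreal ((g (Xc r w) - g (X s w))^2) * indicator {s<..t} r)
			<= ennreal (10 * L^2 * K^2 * (t - s)) * indicator {s<..t} r" for r
	proof (cases "r \<in> {s<..t}")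
		case True
		then have r: "0 <= r" "s <= r" "r - s <= 1" using st by auto
		note [measurable] = X_meas[OF r(1)]
		have "(NN w|P. ennreal ((g (Xc r w) - g (X s w))^2) * indicator {s<..t} r) <=
			(NN w|P. ennreal (L^2) * ennreal ((X r w - X s w)^2))"
		proof (rule nn_integral_mono)
			fix w
			have "\<bar>g (X r w) - g (X s w)\<bar>^2 <= (L * \<bar>X r w - X s w\<bar>)^2" by (rule power_mono[OF g]) simp
			then have "(g (X r w) - g (X s w))^2 <= L^2 * (X r w - X s w)^2" by (simp add: power_mult_distrib)
			then show "ennreal ((g (Xc r w) - g (X s w))^2) * indicator {s<..t} r <= ennreal (L^2) * ennreal ((X r w - X s w)^2)"
				using True r by (simp add: Xc_eq ennreal_mult[symmetric] ennreal_leI)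
		qed
		also have "... = ennreal (L^2) * (NN w|P. ennreal ((X r w - X s w)^2))" by (rule nn_integral_cmult) simp
		also have "... <= ennreal (L^2) * ennreal (10 * K^2 * (r - s))"
			by (rule mult_left_mono[OF X_incr_L2]) (use r st in auto)
		also have "... = ennreal (L^2 * (10 * K^2 * (r - s)))" using r by (simp add: ennreal_mult)
		also have "... <= ennreal (10 * L^2 * K^2 * (t - s))"
		proof (rule ennreal_leI)
			have "L^2 * (10 * K^2 * (r - s)) = 10 * L^2 * K^2 * (r - s)" by simp
			also have "... <= 10 * L^2 * K^2 * (t - s)" using True by (intro mult_left_mono) auto
			finally show "L^2 * (10 * K^2 * (r - s)) <= 10 * L^2 * K^2 * (t - s)" .
		qed
		finally show ?thesis using True by simp
	qed simp
	then have "(NN w|P. (NN r|lborel. ennreal ((g (Xc r w) - g (X s w))^2) * indicator {s<..t} r))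
		<= (NN r|lborel. ennreal (10 * L^2 * K^2 * (t - s)) * indicator {s<..t} r)"
		unfolding sw by (intro nn_integral_mono)
	also have "... = ennreal (10 * L^2 * K^2 * (t - s)^2)"
	proof -
		have "10 * L^2 * K^2 * (t - s)^2 = (10 * L^2 * K^2 * (t - s)) * (t - s)" by (simp add: power2_eq_square)
		then show ?thesis using st by (simp only:) (subst ennreal_mult; simp add: nn_integral_cmult_indicator)
	qed
	finally show ?thesis .
qed

lemma X_rho_L2:
	assumes st: "0 <= s" "s <= t" "t - s <= 1"
	shows "(NN w|P. ennreal ((X t w - X s w - A (X s w) * (W t w - W s w))^2)) <= ennreal ((2 * K^2 + 80 * L^2 * K^2) * (t - s)^2)"
proof (rule X_incr[OF st(1,2)])
	fix It Is assume I: "ito_integral P F W (%s w. A (X s w)) t It" "ito_integral P F W (%s w. A (X s w)) s Is"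
		and ae: "AE w in P. X t w - X s w = bint s t w + (It w - Is w)"
	have [measurable]: "It \<in> bm P" "Is \<in> bm P" using I unfolding ito_integral_def by auto
	note [measurable] = X_meas[OF st(1)] W_meas[OF st(1)] W_meas[OF order_trans[OF st(1,2)]]
	define R where "R w = It w - Is w - A (X s w) * (W t w - W s w)" for w
	have [measurable]: "R \<in> bm P" unfolding R_def[abs_def] by simp
	have "(%w. A (X s w)) \<in> bm (F s)"
		by (rule measurable_compose[OF X_meas_F[OF st(1) order_refl]]) simp
	then have "(NN w|P. ennreal ((R w)^2))
		<= 4 * (NN w|P. (NN r|lborel. ennreal ((A (Xc r w) - A (X s w))^2) * indicator {s<..t} r))"
		unfolding R_def by (intro ito_incr_L2[OF st(1,2) I A_pair, where C=K]) (auto simp: Xc_eq A_bd)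
	also have "... <= 4 * ennreal (10 * L^2 * K^2 * (t - s)^2)"
		by (intro mult_left_mono lip_int_L2[OF st A_lip]) auto
	also have "... = ennreal (4 * (10 * L^2 * K^2 * (t - s)^2))"
		by (rule ennreal_comb(2)) auto
	finally have I2: "(NN w|P. ennreal ((R w)^2)) <= ennreal (4 * (10 * L^2 * K^2 * (t - s)^2))" .
	have "(NN w|P. ennreal ((X t w - X s w - A (X s w) * (W t w - W s w))^2)) <= (NN w|P. 2 * ennreal (K^2 * (t - s)^2) + 2 * ennreal ((R w)^2))"
	proof (rule nn_integral_mono_AE, use ae AE_space in eventually_elim)
		case (elim w)
		have "(bint s t w)^2 <= (K * (t - s))^2"
			using bint_bound[OF elim(2) st(2)] by (rule power2_le_iff_abs_le[THEN iffD2, rotated]) (use K1 st in auto)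
		then have b: "ennreal ((bint s t w)^2) <= ennreal (K^2 * (t - s)^2)" by (intro ennreal_leI) (simp add: power_mult_distrib)
		have "X t w - X s w - A (X s w) * (W t w - W s w) = bint s t w + R w"
			using elim(1) by (simp add: R_def)
		then show ?case
			using b by (simp only:) (intro order_trans[OF ennreal_sq_add2] add_mono mult_left_mono; simp)
	qed
	also have "... = 2 * ennreal (K^2 * (t - s)^2) + 2 * (NN w|P. ennreal ((R w)^2))"
		by (simp add: nn_integral_add nn_integral_cmult emeasure_space_1)
	also have "... <= 2 * ennreal (K^2 * (t - s)^2) + 2 * ennreal (4 * (10 * L^2 * K^2 * (t - s)^2))"
		by (intro add_mono mult_left_mono I2) auto
	also have "... = ennreal (2 * (K^2 * (t - s)^2) + 2 * (4 * (10 * L^2 * K^2 * (t - s)^2)))"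
		by (intro ennreal_comb) auto
	also have "2 * (K^2 * (t - s)^2) + 2 * (4 * (10 * L^2 * K^2 * (t - s)^2)) = (2 * K^2 + 80 * L^2 * K^2) * (t - s)^2"
		by (simp add: algebra_simps)
	finally show ?thesis .
qed

text \<open>In \<open>one_step\<close> the free parameter e is the prescribed accuracy: the first
  term is then small relative to the step, and the second is of second order in it.\<close>

lemma beta_L1:
	assumes st: "0 <= s" "s <= t" "t - s <= 1" and e: "0 < e"
	shows "(NN v|P. ennreal \<bar>bint s t v - (t - s) * B (X s v)\<bar>) <= ennreal ((t - s) * e + 10 * L^2 * K^2 * (t - s)^2 / e)"
proof -
	have [measurable]: "X s \<in> bm P" by (rule X_meas[OF st(1)])
	have sp: "(%(v, r). Xc r v) \<in> bm (P \<Otimes>\<^sub>M lborel)"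
		using measurable_compose[OF measurable_pair_swap' Xc_pair] by (simp add: split_beta')
	note [measurable] = sp
	have "(NN v|P. ennreal \<bar>bint s t v - (t - s) * B (X s v)\<bar>)
		<= (NN v|P. ennreal ((t - s) * e) + ennreal (1 / e) * (NN r|lborel. ennreal ((B (Xc r v) - B (X s v))^2) * indicator {s<..t} r))"
	proof (rule nn_integral_mono)
		fix v assume w: "v \<in> space P"
		have i: "set_integrable lborel {s<..t} (%r. B (Xc r v))"
			by (rule set_integrable_subset[OF B_int[OF w, of s t]]) auto
		have i2: "set_integrable lborel {s<..t} (%r. B (X s v))"
			using st by (auto simp: set_integrable_def)
		have [measurable]: "(%r. Xc r v) \<in> bm borel"
			by (rule borel_measurable_continuous_onI[OF Xc_cont[OF w]])
		have "bint s t v - (t - s) * B (X s v) = (LBINT r:{s<..t}. B (Xc r v) - B (X s v))"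
			unfolding bint_def set_integral_diff(2)[OF i i2] using st by (simp add: set_lebesgue_integral_def)
		then have "ennreal \<bar>bint s t v - (t - s) * B (X s v)\<bar> <= (NN r|lborel. ennreal \<bar>indicator {s<..t} r *\<^sub>R (B (Xc r v) - B (X s v))\<bar>)"
			using integral_norm_bound_ennreal[OF set_integral_diff(1)[OF i i2, unfolded set_integrable_def]]
			by (simp add: set_lebesgue_integral_def)
		also have "... <= (NN r|lborel. ennreal e * indicator {s<..t} r + ennreal (1 / e) * (ennreal ((B (Xc r v) - B (X s v))^2) * indicator {s<..t} r))"
			using abs_le_sq_bound[OF e] e
			by (intro nn_integral_mono) (auto simp: indicator_def ennreal_mult[symmetric] simp flip: ennreal_plus intro!: ennreal_leI)
		also have "... = ennreal e * ennreal (t - s) + ennreal (1 / e) * (NN r|lborel. ennreal ((B (Xc r v) - B (X s v))^2) * indicator {s<..t} r)"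
			using st by (simp add: nn_integral_add nn_integral_cmult nn_integral_cmult_indicator)
		finally show "ennreal \<bar>bint s t v - (t - s) * B (X s v)\<bar> <=
			 ennreal ((t - s) * e) + ennreal (1 / e) * (NN r|lborel. ennreal ((B (Xc r v) - B (X s v))^2) * indicator {s<..t} r)"
			using e st by (simp add: ennreal_mult[symmetric] mult.commute)
	qed
	also have "... = ennreal ((t - s) * e) + ennreal (1 / e) * (NN v|P. (NN r|lborel. ennreal ((B (Xc r v) - B (X s v))^2) * indicator {s<..t} r))"
		by (simp add: nn_integral_add nn_integral_cmult emeasure_space_1)
	also have "... <= ennreal ((t - s) * e) + ennreal (1 / e) * ennreal (10 * L^2 * K^2 * (t - s)^2)"
		by (intro add_mono mult_left_mono lip_int_L2[OF st B_lip]) auto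
	also have "... = ennreal ((t - s) * e + 10 * L^2 * K^2 * (t - s)^2 / e)"
		using e st by (simp add: ennreal_mult[symmetric] ennreal_plus[symmetric] del: ennreal_plus)
	finally show ?thesis .
qed

end

text \<open>\<open>p\<close> is a parameter, later the running maximum.\<close>

locale testfn =
	fixes T Kf :: real and f fx fxx ft :: "real => real => real => real"
	assumes T0: "0 < T" and Kf0: "0 <= Kf"
		and f_x: "\<And>s p x. s \<in> {0..T} ==> (f s p has_real_derivative fx s p x) (at x)"
		and f_xx: "\<And>s p x. s \<in> {0..T} ==> (fx s p has_real_derivative fxx s p x) (at x)"
		and f_t: "\<And>s p x. s \<in> {0..T} ==> ((%s. f s p x) has_real_derivative ft s p x) (at s within {0..T})"
		and f_bd: "\<And>s p x. s \<in> {0..T} ==> \<bar>f s p x\<bar> <= Kf"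
		and fx_bd: "\<And>s p x. s \<in> {0..T} ==> \<bar>fx s p x\<bar> <= Kf"
		and fxx_bd: "\<And>s p x. s \<in> {0..T} ==> \<bar>fxx s p x\<bar> <= Kf"
		and ft_bd: "\<And>s p x. s \<in> {0..T} ==> \<bar>ft s p x\<bar> <= Kf"
		and f_cont: "continuous_on ({0..T} \<times> UNIV) (%(s, p, x). f s p x)"
		and fx_cont: "continuous_on ({0..T} \<times> UNIV) (%(s, p, x). fx s p x)"
		and fxx_cont: "continuous_on ({0..T} \<times> UNIV) (%(s, p, x). fxx s p x)"
		and ft_cont: "continuous_on ({0..T} \<times> UNIV) (%(s, p, x). ft s p x)"
begin

text \<open>Uniform continuity is available on a compact box only; outside of it later estimates use
  the bound \<open>Kf\<close> and the small probability of being there. The box is enlarged by 1 in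
  x to contain \<open>x'\<close>.\<close>

lemma modulus:
	fixes g :: "real => real => real => real"
	assumes g: "continuous_on ({0..T} \<times> UNIV) (%(s, p, x). g s p x :: real)" and "0 < e"
	obtains d where "0 < d" "\<And>s s' p x x'. s \<in> {0..T} ==> s' \<in> {0..T} ==> \<bar>p\<bar> <= R ==> \<bar>x\<bar> <= R ==>
			\<bar>s' - s\<bar> <= d ==> \<bar>x' - x\<bar> <= d ==> \<bar>g s' p x' - g s p x\<bar> <= e"
proof -
	let ?S = "{0..T} \<times> {-R..R} \<times> {-R-1..R+1}"
	have "uniformly_continuous_on ?S (%(s, p, x). g s p x)"
		by (intro compact_uniformly_continuous continuous_on_subset[OF g] compact_Times) auto
	from uniformly_continuous_onE[OF this \<open>0 < e\<close>] obtain d where d: "0 < d"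
		"\<And>z z'. z \<in> ?S ==> z' \<in> ?S ==> dist z' z < d ==> dist (case z' of (s, p, x) => g s p x) (case z of (s, p, x) => g s p x) < e"
		by metis
	show thesis
	proof (rule that[of "min 1 (d / 3)"])
		fix s s' p x x' assume *: "s \<in> {0..T}" "s' \<in> {0..T}" "\<bar>p\<bar> <= R" "\<bar>x\<bar> <= R" "\<bar>s' - s\<bar> <= min 1 (d / 3)" "\<bar>x' - x\<bar> <= min 1 (d / 3)"
		have "dist (s', p, x') (s, p, x) <= \<bar>s' - s\<bar> + \<bar>x' - x\<bar>"
			unfolding dist_prod_def by (rule order_trans[OF sqrt_sum_squares_le_sum]) (auto simp: dist_real_def)
		also have "... < d" using * d(1) by simp
		finally have "dist (g s' p x') (g s p x) < e" using d(2)[of "(s, p, x)" "(s', p, x')"] * by (auto simp: abs_le_iff)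
		then show "\<bar>g s' p x' - g s p x\<bar> <= e" by (simp add: dist_real_def)
	qed (use d in auto)
qed

lemma slice_meas:
	fixes g :: "real => real => real => real"
	assumes g: "continuous_on ({0..T} \<times> UNIV) (%(s, p, x). g s p x :: real)" and "s \<in> {0..T}"
		and "p \<in> bm M" "q \<in> bm M"
	shows "(%w. g s (p w) (q w)) \<in> bm M"
proof (rule borel_measurable_continuous_Pair[OF assms(3,4)])
	have "continuous_on UNIV ((%(s, p, x). g s p x) \<circ> (%z. (s, z)))"
		by (rule continuous_on_compose) (use assms in \<open>auto intro!: continuous_intros continuous_on_subset[OF g]\<close>)
	then show "continuous_on UNIV (%x. g s (fst x) (snd x))" by (simp add: comp_def split_beta')
qed

text \<open>Three regimes. Outside the box (c = 1) the derivatives are merely bounded. Inside it, an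
  increment larger than d is paid for by the factor (y - x)^2 / d^2 >= 1; for smaller increments
  both moduli of continuity apply.\<close>

lemma taylor_step:
	assumes st: "s \<in> {0..T}" "t \<in> {0..T}" "s < t" and d: "0 < d" "t - s <= d" and e: "0 <= e"
		and m1: "\<bar>p\<bar> <= R \<and> \<bar>x\<bar> <= R ==> \<forall>x'. \<bar>x' - x\<bar> <= d \<longrightarrow> \<bar>fxx s p x' - fxx s p x\<bar> <= e"
		and m2: "\<bar>p\<bar> <= R \<and> \<bar>x\<bar> <= R ==> \<forall>s'\<in>{s..t}. \<forall>x'. \<bar>x' - x\<bar> <= d \<longrightarrow> \<bar>ft s' p x' - ft s p x\<bar> <= e"
		and c: "c = (if \<bar>p\<bar> <= R \<and> \<bar>x\<bar> <= R then 0 else 1)"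
	shows "\<bar>f t p y - f s p x - (t - s) * ft s p x - fx s p x * (y - x) - 1/2 * fxx s p x * (y - x)^2\<bar> <=
		 (t - s) * (e + 2 * Kf * c + 2 * Kf * ((y - x)^2 / d^2)) + 1/2 * e * (y - x)^2 + Kf * c * (y - x)^2
			 + Kf * (if \<bar>y - x\<bar> > d then (y - x)^2 else 0)"
proof -
	have "((%s. f s p y) has_derivative (*) (ft u p y)) (at u within {s..t})" if "u \<in> {s..t}" for u
		using DERIV_subset[OF f_t[of u p y], of "{s..t}"] that st unfolding has_field_derivative_def by auto
	from mvt_simple[OF st(3) this] obtain u where u: "u \<in> {s<..<t}" "f t p y - f s p y = ft u p y * (t - s)" by auto
	obtain z where z: "\<bar>z - x\<bar> <= \<bar>y - x\<bar>" "f s p y - f s p x = fx s p x * (y - x) + 1/2 * fxx s p z * (y - x)^2"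
		by (rule taylor2[OF f_x[OF st(1)] f_xx[OF st(1)]])
	have eq: "f t p y - f s p x - (t - s) * ft s p x - fx s p x * (y - x) - 1/2 * fxx s p x * (y - x)^2
		= (t - s) * (ft u p y - ft s p x) + 1/2 * (fxx s p z - fxx s p x) * (y - x)^2"
		using u(2) z(2) by (simp add: algebra_simps)
	let ?a = "\<bar>ft u p y - ft s p x\<bar>" and ?b = "\<bar>fxx s p z - fxx s p x\<bar>" and ?D = "(y - x)^2"
	have le: "\<bar>f t p y - f s p x - (t - s) * ft s p x - fx s p x * (y - x) - 1/2 * fxx s p x * (y - x)^2\<bar>
		 <= (t - s) * ?a + 1/2 * ?b * ?D"
		unfolding eq using st by (intro order_trans[OF abs_triangle_ineq]) (simp add: abs_mult)
	have ust: "u \<in> {0..T}" using u st by auto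
	have a2: "?a <= 2 * Kf" using ft_bd[OF ust, of p y] ft_bd[OF st(1), of p x] by linarith
	have b2: "?b <= 2 * Kf" using fxx_bd[OF st(1), of p z] fxx_bd[OF st(1), of p x] by linarith
	have ts: "0 <= t - s" using st by simp
	show ?thesis
	proof (cases "\<bar>p\<bar> <= R \<and> \<bar>x\<bar> <= R")
		case bad: False
		then have c1: "c = 1" using c by auto
		have "(t - s) * ?a + 1/2 * ?b * ?D <= (t - s) * (2 * Kf) + 1/2 * (2 * Kf) * ?D"
			by (intro add_mono mult_left_mono mult_right_mono a2 b2 ts) auto
		moreover have "0 <= (t - s) * (e + 2 * Kf * (?D / d^2)) + 1/2 * e * ?D + Kf * (if \<bar>y - x\<bar> > d then ?D else 0)"
			using ts e Kf0 by (intro add_nonneg_nonneg mult_nonneg_nonneg) auto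
		ultimately show ?thesis using le c1 by (simp add: algebra_simps)
	next
		case good: True
		then have c0: "c = 0" using c by auto
		show ?thesis
		proof (cases "\<bar>y - x\<bar> > d")
			case True
			have "d^2 <= ?D" using True d by (simp add: abs_le_square_iff[symmetric])
			then have "1 <= ?D / d^2" using d by (simp add: field_simps)
			then have "2 * Kf <= 2 * Kf * (?D / d^2)" using Kf0 mult_left_mono[of 1 "?D / d^2" "2 * Kf"] by simp
			then have "(t - s) * ?a + 1/2 * ?b * ?D <= (t - s) * (2 * Kf * (?D / d^2)) + 1/2 * (2 * Kf) * ?D"
				using a2 by (intro add_mono mult_left_mono mult_right_mono b2 ts) auto
			moreover have "0 <= (t - s) * e + 1/2 * e * ?D" using ts e by (intro add_nonneg_nonneg mult_nonneg_nonneg) auto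
			ultimately show ?thesis using le c0 True by (simp add: algebra_simps)
		next
			case False
			then have "?a <= e" "?b <= e" using m1[OF good] m2[OF good] u z(1) by auto
			then have "(t - s) * ?a + 1/2 * ?b * ?D <= (t - s) * e + 1/2 * e * ?D"
				by (intro add_mono mult_left_mono mult_right_mono ts) auto
			moreover have "0 <= (t - s) * (2 * Kf * (?D / d^2))" using ts Kf0 by (intro mult_nonneg_nonneg) auto
			ultimately show ?thesis using le c0 False by (simp add: algebra_simps)
		qed
	qed
qed

end

section \<open>Expected error of one time step\<close>

locale sde_test = sde P F W A B X K L + testfn T Kf f fx fxx ft
	for P :: "'w measure" and F W A B X K L T Kf f fx fxx ft
begin

text \<open>The drift in the Ito formula for f along X with p held fixed.\<close>

definition G :: "real => real => real => real" where
	"G s p x = ft s p x + B x * fx s p x + 1/2 * (A x)^2 * fxx s p x"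

lemma A2_bd: "(A x)^2 <= K^2"
	using A_bd[of x] K1 by (intro power2_le_iff_abs_le[THEN iffD2]) auto

lemma G_bd: "s \<in> {0..T} ==> \<bar>G s p x\<bar> <= Kf + K * Kf + K^2 * Kf"
proof -
	assume s: "s \<in> {0..T}"
	have "\<bar>B x * fx s p x\<bar> <= K * Kf" unfolding abs_mult by (intro mult_mono B_bd fx_bd[OF s]) (use K1 in auto)
	moreover have "\<bar>1/2 * (A x)^2 * fxx s p x\<bar> <= K^2 * Kf"
	proof -
		have "\<bar>(A x)^2 * fxx s p x\<bar> <= K^2 * Kf" unfolding abs_mult by (intro mult_mono fxx_bd[OF s]) (use A2_bd in auto)
		moreover have "0 <= \<bar>(A x)^2 * fxx s p x\<bar>" by simp
		ultimately show ?thesis unfolding mult.assoc abs_mult[of "1/2"] by linarith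
	qed
	ultimately show ?thesis using ft_bd[OF s, of p x] unfolding G_def by linarith
qed

lemma G_cont: "continuous_on ({0..T} \<times> UNIV) (%(s, p, x). G s p x)"
proof -
	have a: "continuous_on ({0..T} \<times> UNIV) (%z. A (snd (snd z)))" for z :: "real \<times> real \<times> real"
		by (rule continuous_on_compose2[OF A_cont]) (auto intro!: continuous_intros)
	have b: "continuous_on ({0..T} \<times> UNIV) (%z. B (snd (snd z)))" for z :: "real \<times> real \<times> real"
		by (rule continuous_on_compose2[OF B_cont]) (auto intro!: continuous_intros)
	show ?thesis unfolding G_def split_beta'
		using fx_cont fxx_cont ft_cont a b unfolding split_beta' by (intro continuous_intros) auto
qed

text \<open>The increment of f is the drift, plus two terms of mean zero, plus a small remainder.
  The constant C depends neither on e nor on R. Summed over a fine grid of [0, T], the error is at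
  most T * C times e plus the largest probability of leaving the box, so e is chosen first, then R,
  then the mesh.\<close>

lemma one_step:
	obtains C where "0 <= C" "\<And>e R. 0 < e ==> e <= 1 ==> \<exists>d>0. \<forall>s t p Z. 0 <= s \<and> s < t \<and> t <= T \<and> t - s <= d \<and>
		 p \<in> bm (F s) \<and> Z \<in> bm (F s) \<and> (\<forall>v\<in>space P. \<bar>Z v\<bar> <= 1) \<longrightarrow>
		 \<bar>\<integral>v. Z v * (f t (p v) (X t v) - f s (p v) (X s v) - (t - s) * G s (p v) (X s v)) \<partial>P\<bar>
			 <= (t - s) * (C * e + C * prob {v\<in>space P. \<not> (\<bar>p v\<bar> <= R \<and> \<bar>X s v\<bar> <= R)})"
proof -
	define C1 where "C1 = 10 * K^2"
	define C2 where "C2 = 2 * K^2 + 80 * L^2 * K^2"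
	define C3 where "C3 = 10 * L^2 * K^2"
	have C0: "0 <= C1" "0 <= C2" "0 <= C3" unfolding C1_def C2_def C3_def by auto
	define C where "C = (3/2 * Kf + 1 + C1 / 2) + 1 + 2 * Kf + 2 * Kf * K^2"
	have "0 <= C" unfolding C_def using C0 Kf0 by (intro add_nonneg_nonneg mult_nonneg_nonneg) auto
	have "\<exists>d>0. \<forall>s t p Z. 0 <= s \<and> s < t \<and> t <= T \<and> t - s <= d \<and>
		 p \<in> bm (F s) \<and> Z \<in> bm (F s) \<and> (\<forall>v\<in>space P. \<bar>Z v\<bar> <= 1) \<longrightarrow>
		 \<bar>\<integral>v. Z v * (f t (p v) (X t v) - f s (p v) (X s v) - (t - s) * G s (p v) (X s v)) \<partial>P\<bar>
			 <= (t - s) * (C * e + C * prob {v\<in>space P. \<not> (\<bar>p v\<bar> <= R \<and> \<bar>X s v\<bar> <= R)})"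
		if e: "0 < e" "e <= 1" for e R
	proof -
		obtain d1 where d1: "0 < d1" "\<And>s s' p x x'. s \<in> {0..T} ==> s' \<in> {0..T} ==> \<bar>p\<bar> <= R ==> \<bar>x\<bar> <= R ==>
			\<bar>s' - s\<bar> <= d1 ==> \<bar>x' - x\<bar> <= d1 ==> \<bar>fxx s' p x' - fxx s p x\<bar> <= e"
			using modulus[OF fxx_cont e(1), of R] by blast
		obtain d2 where d2: "0 < d2" "\<And>s s' p x x'. s \<in> {0..T} ==> s' \<in> {0..T} ==> \<bar>p\<bar> <= R ==> \<bar>x\<bar> <= R ==>
			\<bar>s' - s\<bar> <= d2 ==> \<bar>x' - x\<bar> <= d2 ==> \<bar>ft s' p x' - ft s p x\<bar> <= e"
			using modulus[OF ft_cont e(1), of R] by blast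
		define d0 where "d0 = min d1 d2"
		have d0: "0 < d0" "d0 <= d1" "d0 <= d2" using d1(1) d2(1) by (auto simp: d0_def)
		\<comment> \<open>\<open>Cd\<close> collects the coefficients of h^2 in the expectation of
		  \<open>Bd\<close> below; d is chosen so that h * Cd <= e.\<close>
		define Cd where "Cd = Kf * C3 / e + 1/2 * Kf * (K^2 / e + 1) * C2 + 2 * Kf * C1 / d0^2 + 2 * Kf * C2 + 48 * Kf * K ^ 4 / d0^2 + 4 * Kf * C2"
		have Cd0: "0 <= Cd" unfolding Cd_def using C0 Kf0 e by (intro add_nonneg_nonneg mult_nonneg_nonneg divide_nonneg_nonneg) auto
		define d where "d = min 1 (min d0 (e / (Cd + 1)))"
		have d: "0 < d" "d <= 1" "d <= d0" "d * Cd <= e"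
		proof -
			show "0 < d" "d <= 1" "d <= d0" using d0 e Cd0 by (auto simp: d_def)
			have "d * Cd <= e / (Cd + 1) * Cd" using Cd0 by (intro mult_right_mono) (auto simp: d_def)
			also have "... <= e" using Cd0 e by (simp add: field_simps)
			finally show "d * Cd <= e" .
		qed
		show ?thesis
		proof (intro exI[of _ d] conjI allI impI, fact d(1), elim conjE)
			fix s t :: real and p Z :: "'w => real"
			assume st: "0 <= s" "s < t" "t <= T" "t - s <= d"
				and p: "p \<in> bm (F s)" and Z: "Z \<in> bm (F s)" and Zb: "\<forall>v\<in>space P. \<bar>Z v\<bar> <= 1"
			define h where "h = t - s"
			have h: "0 < h" "h <= 1" "h <= d0" "h * Cd <= e" "0 <= h" "t - s <= 1"
				using st d mult_right_mono[OF st(4) Cd0] by (auto simp: h_def)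
			have sT: "s \<in> {0..T}" "t \<in> {0..T}" using st by auto
			note XsF = X_meas_F[OF st(1) order_refl]
			have t0: "0 <= t" using st by simp
			note [measurable] = X_meas[OF st(1)] X_meas[OF t0] W_meas[OF st(1)] W_meas[OF t0] measurable_F_P[OF p] measurable_F_P[OF Z]
			have AF: "(%v. A (X s v)) \<in> bm (F s)" by (rule measurable_compose[OF XsF]) simp
			note fF = slice_meas[OF fx_cont sT(1) p XsF] slice_meas[OF fxx_cont sT(1) p XsF] slice_meas[OF ft_cont sT(1) p XsF]
			note [measurable] = measurable_F_P[OF fF(1)] measurable_F_P[OF fF(2)] measurable_F_P[OF fF(3)] measurable_F_P[OF AF]
			have [measurable]: "(%v. f s (p v) (X s v)) \<in> bm P" "(%v. f t (p v) (X t v)) \<in> bm P"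
				by (rule slice_meas[OF f_cont sT(1)], simp, simp) (rule slice_meas[OF f_cont sT(2)], simp, simp)
			define D where "D v = W t v - W s v" for v
			define \<Delta> where "\<Delta> v = X t v - X s v" for v
			define \<rho> where "\<rho> v = \<Delta> v - A (X s v) * D v" for v
			define \<beta> where "\<beta> v = bint s t v - h * B (X s v)" for v
			define bad where "bad = {v\<in>space P. \<not> (\<bar>p v\<bar> <= R \<and> \<bar>X s v\<bar> <= R)}"
			define c where "c v = (indicator bad v :: real)" for v
			have [measurable]: "D \<in> bm P" "\<Delta> \<in> bm P" unfolding D_def[abs_def] \<Delta>_def[abs_def] by measurable
			have [measurable]: "\<rho> \<in> bm P" "\<beta> \<in> bm P" unfolding \<rho>_def[abs_def] \<beta>_def[abs_def] by measurable
			have badF: "bad \<in> sets (F s)"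
			proof -
				have "{v\<in>space (F s). \<not> (\<bar>p v\<bar> <= R \<and> \<bar>X s v\<bar> <= R)} \<in> sets (F s)"
					using p XsF by measurable
				then show ?thesis by (simp add: bad_def)
			qed
			have badP: "bad \<in> sets P" using badF sets_F_P by blast
			note [measurable] = badP
			have cF: "c \<in> bm (F s)" unfolding c_def[abs_def] using badF by simp
			have [measurable]: "c \<in> bm P" by (rule measurable_F_P[OF cF])
			have ci: "integrable P c" "integral\<^sup>L P c = prob bad" unfolding c_def[abs_def] using badP by (auto intro!: integrable_real_indicator simp: emeasure_eq_measure)
			have d2i: "integrable P (%v. (D v)^2)" "(LINT v|P. (D v)^2) = h"
				using incr_mult_2[OF st(1) less_imp_le[OF st(2)] borel_measurable_const[of 1] integrable_const[of 1]]
				unfolding D_def h_def by (simp_all add: prob_space)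
			have cd2i: "integrable P (%v. c v * (D v)^2)" "(LINT v|P. c v * (D v)^2) = h * prob bad"
				using incr_mult_2[OF st(1) less_imp_le[OF st(2)] cF ci(1)] ci(2) unfolding D_def h_def by simp_all
			have d4i: "integrable P (%v. (D v) ^ 4)" "(LINT v|P. (D v) ^ 4) = 3 * h^2"
				using incr_4[OF st(1) less_imp_le[OF st(2)]] unfolding D_def h_def by simp_all
			have Di: "integrable P (%v. (\<Delta> v)^2)" "(LINT v|P. (\<Delta> v)^2) <= C1 * h"
				using X_incr_L2[OF st(1) less_imp_le[OF st(2)] h(6)] C0 h(5)
				by (auto intro!: integrable_nonneg_bound simp: \<Delta>_def C1_def h_def)
			have ri: "integrable P (%v. (\<rho> v)^2)" "(LINT v|P. (\<rho> v)^2) <= C2 * h^2"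
				using X_rho_L2[OF st(1) less_imp_le[OF st(2)] h(6)]
				by (auto intro!: integrable_nonneg_bound simp: \<rho>_def \<Delta>_def D_def C2_def h_def)
			have bi: "integrable P (%v. \<bar>\<beta> v\<bar>)" "(LINT v|P. \<bar>\<beta> v\<bar>) <= h * e + C3 * h^2 / e"
			proof -
				have b: "(NN v|P. ennreal \<bar>\<beta> v\<bar>) <= ennreal (h * e + C3 * h^2 / e)"
					using beta_L1[OF st(1) less_imp_le[OF st(2)] h(6) e(1)] unfolding \<beta>_def C3_def h_def .
				have n: "0 <= h * e + C3 * h^2 / e" using h(5) e C0 by (intro add_nonneg_nonneg mult_nonneg_nonneg divide_nonneg_nonneg) auto
				show "integrable P (%v. \<bar>\<beta> v\<bar>)" "(LINT v|P. \<bar>\<beta> v\<bar>) <= h * e + C3 * h^2 / e"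
					by (rule integrable_nonneg_bound[OF _ _ b n], simp, simp)+
			qed
			\<comment> \<open>In order: the drift error, the replacement of \<Delta> by
			  \<open>A (X s) * D\<close> in the quadratic term, the Taylor remainder for small increments,
			  the part outside the box, and the large increments.\<close>
			define Bd where "Bd v = Kf * \<bar>\<beta> v\<bar> + 1/2 * Kf * (e * (D v)^2 + (K^2 / e + 1) * (\<rho> v)^2)
					+ h * (e + 2 * Kf * c v + 2 * Kf / d0^2 * (\<Delta> v)^2) + 1/2 * e * (\<Delta> v)^2
					+ Kf * (2 * K^2 * (c v * (D v)^2) + 2 * (\<rho> v)^2)
					+ Kf * (16 * K ^ 4 / d0^2 * (D v) ^ 4 + 4 * (\<rho> v)^2)" for v
			note ints = bi(1) d2i(1) ri(1) ci(1) Di(1) cd2i(1) d4i(1)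
			have Bdi: "integrable P Bd"
				unfolding Bd_def[abs_def]
				by (intro Bochner_Integration.integrable_add integrable_mult_right ints integrable_const)
			have "integral\<^sup>L P Bd = Kf * (LINT v|P. \<bar>\<beta> v\<bar>) + 1/2 * Kf * (e * h + (K^2 / e + 1) * (LINT v|P. (\<rho> v)^2))
					+ h * (e + 2 * Kf * prob bad + 2 * Kf / d0^2 * (LINT v|P. (\<Delta> v)^2)) + 1/2 * e * (LINT v|P. (\<Delta> v)^2)
					+ Kf * (2 * K^2 * (h * prob bad) + 2 * (LINT v|P. (\<rho> v)^2))
					+ Kf * (16 * K ^ 4 / d0^2 * (3 * h^2) + 4 * (LINT v|P. (\<rho> v)^2))"
				unfolding Bd_def using ints ci(2) d2i(2) cd2i(2) d4i(2) by (simp add: prob_space)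
			also have "... <= Kf * (h * e + C3 * h^2 / e) + 1/2 * Kf * (e * h + (K^2 / e + 1) * (C2 * h^2))
					+ h * (e + 2 * Kf * prob bad + 2 * Kf / d0^2 * (C1 * h)) + 1/2 * e * (C1 * h)
					+ Kf * (2 * K^2 * (h * prob bad) + 2 * (C2 * h^2))
					+ Kf * (16 * K ^ 4 / d0^2 * (3 * h^2) + 4 * (C2 * h^2))"
				by (intro add_mono mult_left_mono order_refl bi(2) ri(2) Di(2)) (use Kf0 h e in \<open>auto intro!: add_nonneg_nonneg mult_nonneg_nonneg\<close>)
			also have "... = h * (e * (3/2 * Kf + 1 + C1 / 2) + prob bad * (2 * Kf + 2 * Kf * K^2) + h * Cd)"
				unfolding Cd_def by (simp add: algebra_simps power2_eq_square add_divide_distrib)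
			also have "... <= h * (C * e + C * prob bad)"
			proof (rule mult_left_mono[OF _ h(5)])
				have 1: "e * (3/2 * Kf + 1 + C1 / 2) + e <= C * e"
				proof -
					have "C * e = (e * (3/2 * Kf + 1 + C1 / 2) + e) + e * (2 * Kf + 2 * Kf * K^2)" unfolding C_def by (simp add: algebra_simps)
					moreover have "0 <= e * (2 * Kf + 2 * Kf * K^2)" using e Kf0 by (intro mult_nonneg_nonneg add_nonneg_nonneg) auto
					ultimately show ?thesis by linarith
				qed
				have "2 * Kf + 2 * Kf * K^2 <= C" unfolding C_def using Kf0 C0 by simp
				then have "prob bad * (2 * Kf + 2 * Kf * K^2) <= prob bad * C" by (intro mult_left_mono) auto
				with 1 h(4) show "e * (3/2 * Kf + 1 + C1 / 2) + prob bad * (2 * Kf + 2 * Kf * K^2) + h * Cd <= C * e + C * prob bad"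
					by (simp add: mult.commute)
			qed
			finally have EBd: "integral\<^sup>L P Bd <= h * (C * e + C * prob bad)" .
			define Q where "Q v = Z v * (f t (p v) (X t v) - f s (p v) (X s v) - h * G s (p v) (X s v))" for v
			have Qm [measurable]: "Q \<in> bm P" unfolding Q_def[abs_def] G_def by measurable
			have Qi: "integrable P Q"
			proof (rule integrable_const_bound[where B="Kf + Kf + h * (Kf + K * Kf + K^2 * Kf)"])
				show "AE v in P. norm (Q v) <= Kf + Kf + h * (Kf + K * Kf + K^2 * Kf)"
				proof (rule AE_I2)
					fix v assume w: "v \<in> space P"
					have "\<bar>h * G s (p v) (X s v)\<bar> <= h * (Kf + K * Kf + K^2 * Kf)"
						using G_bd[OF sT(1)] h by (simp add: abs_mult mult_left_mono)
					then have "\<bar>f t (p v) (X t v) - f s (p v) (X s v) - h * G s (p v) (X s v)\<bar> <= Kf + Kf + h * (Kf + K * Kf + K^2 * Kf)"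
						using f_bd[OF sT(1), of "p v" "X s v"] f_bd[OF sT(2), of "p v" "X t v"] by linarith
					then have "\<bar>Z v\<bar> * \<bar>f t (p v) (X t v) - f s (p v) (X s v) - h * G s (p v) (X s v)\<bar> <= 1 * (Kf + Kf + h * (Kf + K * Kf + K^2 * Kf))"
						using Zb w by (intro mult_mono) auto
					then show "norm (Q v) <= Kf + Kf + h * (Kf + K * Kf + K^2 * Kf)" unfolding Q_def real_norm_def abs_mult by simp
				qed
			qed simp
			show "\<bar>\<integral>v. Z v * (f t (p v) (X t v) - f s (p v) (X s v) - (t - s) * G s (p v) (X s v)) \<partial>P\<bar>
			 <= (t - s) * (C * e + C * prob {v\<in>space P. \<not> (\<bar>p v\<bar> <= R \<and> \<bar>X s v\<bar> <= R)})"
			proof (rule X_incr[OF st(1) less_imp_le[OF st(2)]])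
				fix It Is assume I: "ito_integral P F W (%s v. A (X s v)) t It" "ito_integral P F W (%s v. A (X s v)) s Is"
					and ae: "AE v in P. X t v - X s v = bint s t v + (It v - Is v)"
				have [measurable]: "It \<in> bm P" "Is \<in> bm P" using I unfolding ito_integral_def by auto
				\<comment> \<open>\<open>Z1\<close> multiplies the increment of the Ito integral and
				  \<open>Z2\<close> multiplies \<open>(D v)^2 - h\<close>; both coefficients are known at time
				  s, so both products have mean zero.\<close>
				define Z1 where "Z1 v = Z v * fx s (p v) (X s v)" for v
				define Z2 where "Z2 v = 1/2 * (Z v * fxx s (p v) (X s v)) * (A (X s v))^2" for v
				have Z1F: "Z1 \<in> bm (F s)" unfolding Z1_def[abs_def] using Z fF by simp
				have Z2F: "Z2 \<in> bm (F s)" unfolding Z2_def[abs_def] using Z fF AF by measurable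
				have Zf: "\<bar>Z v * fx s (p v) (X s v)\<bar> <= Kf" "\<bar>Z v * fxx s (p v) (X s v)\<bar> <= Kf" if "v \<in> space P" for v
					using Zb that mult_mono[of "\<bar>Z v\<bar>" 1 "\<bar>fx s (p v) (X s v)\<bar>" Kf] mult_mono[of "\<bar>Z v\<bar>" 1 "\<bar>fxx s (p v) (X s v)\<bar>" Kf]
						fx_bd[OF sT(1)] fxx_bd[OF sT(1)] by (auto simp: abs_mult)
				have Z1b: "\<bar>Z1 v\<bar> <= Kf" if "v \<in> space P" for v using Zf that unfolding Z1_def by auto
				have Z2b: "\<bar>Z2 v\<bar> <= 1/2 * Kf * K^2" if "v \<in> space P" for v
				proof -
					have "\<bar>Z v * fxx s (p v) (X s v)\<bar> * (A (X s v))^2 <= Kf * K^2"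
						using Zf(2)[OF that] A2_bd by (intro mult_mono) (auto simp: Kf0)
					then show ?thesis unfolding Z2_def by (simp add: abs_mult)
				qed
				have Z2i: "integrable P Z2"
					by (rule integrable_const_bound[where B="1/2 * Kf * K^2"]) (use Z2b measurable_F_P[OF Z2F] in auto)
				note [measurable] = measurable_F_P[OF Z1F] measurable_F_P[OF Z2F]
				have mart2: "integrable P (%v. Z2 v * ((D v)^2 - h))" "(LINT v|P. Z2 v * ((D v)^2 - h)) = 0"
					using incr_mult_2[OF st(1) less_imp_le[OF st(2)] Z2F Z2i] Z2i unfolding D_def[symmetric] h_def[symmetric]
					by (simp_all add: right_diff_distrib mult.commute)
				have Di1: "integrable P \<Delta>"
					by (rule Bochner_Integration.integrable_bound[OF Bochner_Integration.integrable_add[OF integrable_const[of 1] Di(1)]])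
						 (use abs_le_sq_bound[of 1] in auto)
				have ii: "integrable P (%v. It v - Is v)"
				proof -
					have "integrable P (%v. \<Delta> v - bint s t v)"
					proof (rule Bochner_Integration.integrable_diff[OF Di1])
						show "integrable P (bint s t)"
							by (rule integrable_const_bound[where B="K * h"]) (use bint_bound[of _ s t] st in \<open>auto simp: h_def\<close>)
					qed
					then show ?thesis
						by (rule integrable_cong_AE_imp) (use ae in \<open>auto simp: \<Delta>_def\<close>)
				qed
				have Z1i: "integrable P (%v. Z1 v * (It v - Is v))"
				proof (rule Bochner_Integration.integrable_bound[OF integrable_mult_right[OF ii, of Kf]])
					show "AE v in P. norm (Z1 v * (It v - Is v)) <= norm (Kf * (It v - Is v))"
						using Z1b Kf0 by (intro AE_I2) (auto simp: abs_mult intro!: mult_right_mono)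
				qed simp
				have mart1: "(LINT v|P. Z1 v * (It v - Is v)) = 0"
					by (rule ito_incr_orth[OF st(1) less_imp_le[OF st(2)] I A_pair _ Z1F Z1b Z1i]) (auto simp: Xc_eq)
				have "AE v in P. \<bar>Q v - Z1 v * (It v - Is v) - Z2 v * ((D v)^2 - h)\<bar> <= Bd v"
					using ae AE_space
				proof eventually_elim
					case (elim v)
					have w: "v \<in> space P" by fact
					have It: "It v - Is v = \<Delta> v - bint s t v" using elim(1) by (simp add: \<Delta>_def)
					define Rm where "Rm = f t (p v) (X t v) - f s (p v) (X s v) - h * ft s (p v) (X s v)
						 - fx s (p v) (X s v) * \<Delta> v - 1/2 * fxx s (p v) (X s v) * (\<Delta> v)^2"
					have cw: "c v = (if \<bar>p v\<bar> <= R \<and> \<bar>X s v\<bar> <= R then 0 else 1)"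
						unfolding c_def bad_def using w by (auto simp: indicator_def)
					have Rm: "\<bar>Rm\<bar> <= h * (e + 2 * Kf * c v + 2 * Kf * ((\<Delta> v)^2 / d0^2)) + 1/2 * e * (\<Delta> v)^2 + Kf * c v * (\<Delta> v)^2
							+ Kf * (if \<bar>\<Delta> v\<bar> > d0 then (\<Delta> v)^2 else 0)"
						unfolding Rm_def h_def \<Delta>_def
					proof (rule taylor_step[OF sT st(2) d0(1), where R=R])
						show "t - s <= d0" using h unfolding h_def by simp
						show "\<forall>x'. \<bar>x' - X s v\<bar> <= d0 \<longrightarrow> \<bar>fxx s (p v) x' - fxx s (p v) (X s v)\<bar> <= e" if "\<bar>p v\<bar> <= R \<and> \<bar>X s v\<bar> <= R"
							using d1(2)[OF sT(1) sT(1)] that d0 d1(1) by auto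
						show "\<forall>s'\<in>{s..t}. \<forall>x'. \<bar>x' - X s v\<bar> <= d0 \<longrightarrow> \<bar>ft s' (p v) x' - ft s (p v) (X s v)\<bar> <= e" if "\<bar>p v\<bar> <= R \<and> \<bar>X s v\<bar> <= R"
							using d2(2)[OF sT(1)] that d0 d2(1) h st unfolding h_def by auto
					qed (use e cw in auto)
					have Dl: "\<Delta> v = A (X s v) * D v + \<rho> v" by (simp add: \<rho>_def)
					have AD: "(A (X s v) * D v)^2 <= K^2 * (D v)^2" unfolding power_mult_distrib by (intro mult_right_mono A2_bd) simp
					have D2: "(\<Delta> v)^2 <= 2 * (K^2 * (D v)^2) + 2 * (\<rho> v)^2"
					proof -
						have "(\<Delta> v)^2 <= 2 * (A (X s v) * D v)^2 + 2 * (\<rho> v)^2"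
							unfolding Dl using sum_squares_bound[of "A (X s v) * D v" "\<rho> v"] by (simp add: power2_sum)
						then show ?thesis using AD by linarith
					qed
					\<comment> \<open>Fourth moments are at hand for W, not for X. If \<rho>^2 dominates, the
					  square of \<Delta> is at most 4 \<rho>^2. Otherwise it is at most 4 q with q = K^2 D^2, and
					  being larger than d0^2 it allows a further factor 4 q / d0^2.\<close>
					have D3: "(if \<bar>\<Delta> v\<bar> > d0 then (\<Delta> v)^2 else 0) <= 16 * K ^ 4 / d0^2 * (D v) ^ 4 + 4 * (\<rho> v)^2"
					proof (cases "\<bar>\<Delta> v\<bar> > d0")
						case True
						show ?thesis
						proof (cases "K^2 * (D v)^2 <= (\<rho> v)^2")
							case True
							have "0 <= 16 * K ^ 4 / d0^2 * (D v) ^ 4" by (intro mult_nonneg_nonneg divide_nonneg_nonneg) auto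
							then show ?thesis using True D2 by (smt (verit) zero_le_power2)
						next
							case False
							have dd: "d0^2 <= (\<Delta> v)^2" using True d0(1) by (simp add: abs_le_square_iff[symmetric])
							define q where "q = K^2 * (D v)^2"
							have D4: "(\<Delta> v)^2 <= 4 * q" using False D2 unfolding q_def by linarith
							have "4 * q * d0^2 <= 4 * q * (4 * q)" using dd D4 by (intro mult_left_mono) (auto simp: q_def)
							then have "4 * q <= 16 * q^2 / d0^2" using d0(1) by (simp add: field_simps power2_eq_square)
							also have "16 * q^2 / d0^2 = 16 * K ^ 4 / d0^2 * (D v) ^ 4"
								unfolding q_def by (simp add: power_mult_distrib power_mult[symmetric] flip: power_mult)
							finally show ?thesis using D4 True by (smt (verit) zero_le_power2)
						qed
					next
						case False
						have "0 <= 16 * K ^ 4 / d0^2 * (D v) ^ 4" by (intro mult_nonneg_nonneg divide_nonneg_nonneg) auto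
						then show ?thesis using False by simp
					qed
					have cD: "c v * (\<Delta> v)^2 <= 2 * K^2 * (c v * (D v)^2) + 2 * (\<rho> v)^2"
						using D2 unfolding cw by auto
					have eq: "Q v - Z1 v * (It v - Is v) - Z2 v * ((D v)^2 - h) =
						Z1 v * \<beta> v + 1/2 * (Z v * fxx s (p v) (X s v)) * (2 * (A (X s v) * D v) * \<rho> v + (\<rho> v)^2) + Z v * Rm"
						unfolding Q_def Z1_def Z2_def It \<beta>_def Rm_def G_def unfolding Dl
						by (simp add: field_simps power2_eq_square)
					have t1: "\<bar>Z1 v * \<beta> v\<bar> <= Kf * \<bar>\<beta> v\<bar>" unfolding abs_mult by (intro mult_right_mono Z1b[OF w]) simp
					have cross: "\<bar>2 * (A (X s v) * D v) * \<rho> v\<bar> <= e * (D v)^2 + K^2 / e * (\<rho> v)^2"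
					proof -
						have "\<bar>A (X s v)\<bar> * (\<bar>D v\<bar> * \<bar>\<rho> v\<bar>) <= K * (\<bar>D v\<bar> * \<bar>\<rho> v\<bar>)" by (intro mult_right_mono A_bd) simp
						then have 1: "\<bar>2 * (A (X s v) * D v) * \<rho> v\<bar> <= 2 * (K * (\<bar>D v\<bar> * \<bar>\<rho> v\<bar>))" by (simp add: abs_mult mult.assoc)
						have "2 * (e * \<bar>D v\<bar>) * (K * \<bar>\<rho> v\<bar>) <= (e * \<bar>D v\<bar>)^2 + (K * \<bar>\<rho> v\<bar>)^2" by (rule sum_squares_bound)
						then have "2 * (K * (\<bar>D v\<bar> * \<bar>\<rho> v\<bar>)) <= ((e * \<bar>D v\<bar>)^2 + (K * \<bar>\<rho> v\<bar>)^2) / e"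
							using e by (simp add: pos_le_divide_eq mult.commute mult.left_commute)
						also have "... = e * (D v)^2 + K^2 / e * (\<rho> v)^2"
							using e unfolding power_mult_distrib power2_abs by (simp add: field_simps power2_eq_square)
						finally show ?thesis using 1 by linarith
					qed
					have "\<bar>2 * (A (X s v) * D v) * \<rho> v + (\<rho> v)^2\<bar> <= e * (D v)^2 + (K^2 / e + 1) * (\<rho> v)^2"
						using cross abs_triangle_ineq[of "2 * (A (X s v) * D v) * \<rho> v" "(\<rho> v)^2"] by (simp add: distrib_right)
					then have "\<bar>Z v * fxx s (p v) (X s v)\<bar> * \<bar>2 * (A (X s v) * D v) * \<rho> v + (\<rho> v)^2\<bar> <= Kf * (e * (D v)^2 + (K^2 / e + 1) * (\<rho> v)^2)"
						by (intro mult_mono Zf(2)[OF w]) (auto simp: Kf0)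
					then have t2: "\<bar>1/2 * (Z v * fxx s (p v) (X s v)) * (2 * (A (X s v) * D v) * \<rho> v + (\<rho> v)^2)\<bar>
						 <= 1/2 * Kf * (e * (D v)^2 + (K^2 / e + 1) * (\<rho> v)^2)" by (simp add: abs_mult)
					have "\<bar>Z v\<bar> * \<bar>Rm\<bar> <= 1 * \<bar>Rm\<bar>" using Zb w by (intro mult_right_mono) auto
					then have t3: "\<bar>Z v * Rm\<bar> <= h * (e + 2 * Kf * c v + 2 * Kf / d0^2 * (\<Delta> v)^2) + 1/2 * e * (\<Delta> v)^2
						 + Kf * (2 * K^2 * (c v * (D v)^2) + 2 * (\<rho> v)^2) + Kf * (16 * K ^ 4 / d0^2 * (D v) ^ 4 + 4 * (\<rho> v)^2)"
					proof -
						have eqs: "2 * Kf * ((\<Delta> v)^2 / d0^2) = 2 * Kf / d0^2 * (\<Delta> v)^2" "Kf * c v * (\<Delta> v)^2 = Kf * (c v * (\<Delta> v)^2)"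
							by simp_all
						have "\<bar>Z v * Rm\<bar> <= \<bar>Rm\<bar>" using \<open>\<bar>Z v\<bar> * \<bar>Rm\<bar> <= 1 * \<bar>Rm\<bar>\<close> by (simp add: abs_mult)
						also note Rm[unfolded eqs]
						finally show ?thesis
							by (rule order_trans) (intro add_mono order_refl mult_left_mono[OF D3 Kf0] mult_left_mono[OF cD Kf0])
					qed
					show ?case unfolding eq Bd_def using t1 t2 t3 by linarith
				qed
				then have ae2: "AE v in P. \<bar>Q v - Z1 v * (It v - Is v) - Z2 v * ((D v)^2 - h)\<bar> <= Bd v" .
				have "\<bar>\<integral>v. Q v - Z1 v * (It v - Is v) - Z2 v * ((D v)^2 - h) \<partial>P\<bar> <= integral\<^sup>L P Bd"
					by (rule order_trans[OF integral_abs_bound]) (rule integral_mono_AE, use Qi Z1i mart2 Bdi ae2 in auto)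
				moreover have "(LINT v|P. Q v - Z1 v * (It v - Is v) - Z2 v * ((D v)^2 - h)) = integral\<^sup>L P Q"
					by (subst Bochner_Integration.integral_diff, use Qi Z1i mart2 in simp, rule mart2)
						(subst Bochner_Integration.integral_diff, rule Qi, rule Z1i, simp add: mart1 mart2)
				ultimately show ?thesis using EBd unfolding Q_def bad_def h_def by simp
			qed
		qed
	qed
	then show thesis using that[OF \<open>0 <= C\<close>] by blast
qed

end

section \<open>The running maximum\<close>

lemma rs_bdd:
	fixes x :: "real => real"
	assumes "continuous_on {0..} x"
	shows "bdd_above (x ` {0..s})"
	by (intro bounded_imp_bdd_above compact_imp_bounded compact_continuous_image continuous_on_subset[OF assms]) auto

lemma rs_ge:
	fixes x :: "real => real"
	assumes "continuous_on {0..} x" "0 <= r" "r <= s"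
	shows "x r <= (SUP r\<in>{0..s}. x r)"
	by (rule cSUP_upper) (use assms rs_bdd in auto)

lemma rs_attained:
	fixes x :: "real => real"
	assumes "continuous_on {0..} x" "0 <= s"
	obtains r where "0 <= r" "r <= s" "(SUP r\<in>{0..s}. x r) = x r"
proof -
	obtain r where r: "r \<in> {0..s}" "\<forall>q\<in>{0..s}. x q <= x r"
		using continuous_attains_sup[of "{0..s}" x] continuous_on_subset[OF assms(1), of "{0..s}"] assms(2) by auto
	have "(SUP r\<in>{0..s}. x r) <= x r" by (rule cSUP_least) (use r assms in auto)
	moreover have "x r <= (SUP r\<in>{0..s}. x r)" by (rule rs_ge) (use assms r in auto)
	ultimately show thesis using that[of r] r by auto
qed

lemma rs_mono:
	fixes x :: "real => real"
	assumes "continuous_on {0..} x" "0 <= s" "s <= t"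
	shows "(SUP r\<in>{0..s}. x r) <= (SUP r\<in>{0..t}. x r)"
	by (rule cSUP_subset_mono) (use assms rs_bdd in auto)

text \<open>The new maximum is attained after s, and at time s the path is not above z, so the
  intermediate value theorem yields a visit to z. This is how the maximum is tied to the current
  position whenever it increases.\<close>

lemma rs_hit:
	fixes x :: "real => real"
	assumes x: "continuous_on {0..} x" and st: "0 <= s" "s <= t"
		and z: "(SUP r\<in>{0..s}. x r) <= z" "z <= (SUP r\<in>{0..t}. x r)" "(SUP r\<in>{0..s}. x r) < (SUP r\<in>{0..t}. x r)"
	obtains r where "s <= r" "r <= t" "x r = z"
proof -
	obtain q where q: "0 <= q" "q <= t" "(SUP r\<in>{0..t}. x r) = x q" using rs_attained[OF x order_trans[OF st]] by blast
	have "s < q"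
	proof (rule ccontr)
		assume "\<not> s < q"
		then have "x q <= (SUP r\<in>{0..s}. x r)" using rs_ge[OF x q(1), of s] by simp
		then show False using z q by simp
	qed
	moreover have "x s <= z" using rs_ge[OF x st(1) order_refl] z by simp
	ultimately obtain r where "s <= r" "r <= q" "x r = z"
		using IVT'[of x s z q] z q continuous_on_subset[OF x, of "{s..q}"] st by auto
	then show thesis using that q by auto
qed

lemma rs_cont:
	fixes x :: "real => real"
	assumes x: "continuous_on {0..} x"
	shows "continuous_on {0..} (%s. SUP r\<in>{0..s}. x r)"
	unfolding continuous_on_iff
proof (intro ballI allI impI)
	fix s0 e :: real assume "s0 \<in> {0..}" "0 < e"
	have "uniformly_continuous_on {0..s0+1} x"
		by (intro compact_uniformly_continuous continuous_on_subset[OF x]) auto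
	from uniformly_continuous_onE[OF this, of "e/2"] \<open>0 < e\<close> obtain d where d: "0 < d"
		"\<And>r q. r \<in> {0..s0+1} ==> q \<in> {0..s0+1} ==> dist q r < d ==> dist (x q) (x r) < e/2"
		by (metis half_gt_zero)
	have *: "(SUP r\<in>{0..t}. x r) <= (SUP r\<in>{0..s}. x r) + e/2" if sts: "0 <= s" "s <= t" "t <= s0 + 1" "t - s < d" for s t
	proof -
		obtain q where q: "0 <= q" "q <= t" "(SUP r\<in>{0..t}. x r) = x q" using rs_attained[OF x order_trans[OF sts(1,2)]] by blast
		show ?thesis
		proof (cases "q <= s")
			case True then show ?thesis using rs_ge[OF x q(1) True] q \<open>0 < e\<close> by simp
		next
			case False
			then have "dist (x q) (x s) < e/2" using d(2)[of s q] that q by (auto simp: dist_real_def)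
			then have "x q <= x s + e/2" unfolding dist_real_def by linarith
			then show ?thesis using rs_ge[OF x that(1) order_refl] q by simp
		qed
	qed
	show "\<exists>d>0. \<forall>s\<in>{0..}. dist s s0 < d \<longrightarrow> dist (SUP r\<in>{0..s}. x r) (SUP r\<in>{0..s0}. x r) < e"
	proof (intro exI[of _ "min d 1"] conjI ballI impI)
		fix s assume s: "s \<in> {0..}" "dist s s0 < min d 1"
		have s00: "0 <= s0" using \<open>s0 \<in> {0..}\<close> by simp
		have "\<bar>(SUP r\<in>{0..s}. x r) - (SUP r\<in>{0..s0}. x r)\<bar> <= e/2"
		proof (cases "s <= s0")
			case True
			have "(SUP r\<in>{0..s0}. x r) <= (SUP r\<in>{0..s}. x r) + e/2" by (rule *) (use s s00 True in \<open>auto simp: dist_real_def\<close>)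
			then show ?thesis using rs_mono[OF x _ True] s by auto
		next
			case False
			have "(SUP r\<in>{0..s}. x r) <= (SUP r\<in>{0..s0}. x r) + e/2" by (rule *) (use s s00 False in \<open>auto simp: dist_real_def\<close>)
			then show ?thesis using rs_mono[OF x s00, of s] False by auto
		qed
		then show "dist (SUP r\<in>{0..s}. x r) (SUP r\<in>{0..s0}. x r) < e" using \<open>0 < e\<close> by (simp add: dist_real_def)
	qed (use d in auto)
qed

text \<open>By continuity the supremum is at most a as soon as the path is so at the times q * s
  with q rational in (0, 1), a countable set with closure [0, 1]. Scaling by s includes the case s =
  0.\<close>

lemma running_sup_measurable:
	assumes m: "\<And>r. 0 <= r ==> r <= s ==> Y r \<in> bm N" and s: "0 <= s"
		and c: "\<And>v. v \<in> space N ==> continuous_on {0..} (%t. Y t v)"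
	shows "running_sup Y s \<in> bm N"
	unfolding borel_measurable_iff_le
proof
	fix a :: real
	let ?Q = "{0<..<1::real} \<inter> \<rat>"
	have cl: "closure ?Q = {0..1}"
		using closure_open_Int_superset[of "{0<..<1::real}" \<rat>] by (simp add: Rats_closure_real)
	have "{v \<in> space N. running_sup Y s v <= a} = {v \<in> space N. \<forall>q\<in>?Q. Y (q * s) v <= a}"
	proof (intro Collect_cong conj_cong refl iffI)
		fix v assume w: "v \<in> space N" and le: "running_sup Y s v <= a"
		show "\<forall>q\<in>?Q. Y (q * s) v <= a"
		proof
			fix q :: real assume "q \<in> ?Q"
			then have "0 <= q * s" "q * s <= s" using s by (auto intro: mult_left_le_one_le)
			from rs_ge[OF c[OF w] this] le show "Y (q * s) v <= a" unfolding running_sup_def by simp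
		qed
	next
		fix v assume w: "v \<in> space N" and le: "\<forall>q\<in>?Q. Y (q * s) v <= a"
		have "Y (q * s) v <= a" if "q \<in> {0..1}" for q
		proof (rule continuous_le_on_closure[of ?Q "%q. Y (q * s) v"])
			show "continuous_on (closure ?Q) (%q. Y (q * s) v)"
				unfolding cl by (rule continuous_on_compose2[OF c[OF w]]) (use s in \<open>auto intro!: continuous_intros\<close>)
		qed (use that cl le in auto)
		then have "Y r v <= a" if "r \<in> {0..s}" for r
		proof (cases "s = 0")
			case True
			then show ?thesis using \<open>\<And>q. q \<in> {0..1} ==> Y (q * s) v <= a\<close>[of 0] that by auto
		next
			case False
			then have "r / s \<in> {0..1}" "r / s * s = r" using that s by auto
			then show ?thesis using \<open>\<And>q. q \<in> {0..1} ==> Y (q * s) v <= a\<close>[of "r / s"] by simp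
		qed
		then show "running_sup Y s v <= a" unfolding running_sup_def using s by (intro cSUP_least) auto
	qed
	also have "... \<in> sets N"
	proof -
		have ct: "countable ?Q" by (rule countable_Int2[OF countable_rat])
		have "Y (q * s) \<in> bm N" if "q \<in> ?Q" for q
			using that s by (intro m) (auto intro: mult_left_le_one_le)
		then show ?thesis by (intro sets.sets_Collect_countable_All'[OF _ ct]) measurable
	qed
	finally show "{v \<in> space N. running_sup Y s v <= a} \<in> sets N" .
qed

text \<open>Dominated convergence for the step functions \<phi>. Continuity is asked for almost
  everywhere because the weights along a path may jump at countably many times.\<close>

lemma riemann_limit:
	fixes g :: "real => real"
	assumes T: "0 < T" and g [measurable]: "g \<in> bm borel" and b: "\<And>s. s \<in> {0..T} ==> \<bar>g s\<bar> <= C"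
		and c: "AE s in lborel. s \<in> {0<..<T} \<longrightarrow> continuous (at s within {0..T}) g"
	shows "(%N. \<Sum>i<Suc N. g (real i * T / real (Suc N)) * (T / real (Suc N))) \<longlonglongrightarrow> (LBINT s:{0..T}. g s)"
proof -
	define t where "t N i = real i * T / real (Suc N)" for N i
	define \<phi> where "\<phi> N s = (\<Sum>i<Suc N. g (t N i) * indicator {t N i..<t N (Suc i)} s)" for N s
	have h: "t N (Suc i) - t N i = T / real (Suc N)" for N i
		unfolding t_def of_nat_Suc distrib_right add_divide_distrib by simp
	have int: "integrable lborel (%s. g (t N i) * indicator {t N i..<t N (Suc i)} s)"
		"(LINT s|lborel. g (t N i) * indicator {t N i..<t N (Suc i)} s) = g (t N i) * (T / real (Suc N))" for N i
	proof -
		have "t N i <= t N (Suc i)" using h[of N i] T by (smt (verit) divide_nonneg_nonneg of_nat_0_le_iff)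
		then show "integrable lborel (%s. g (t N i) * indicator {t N i..<t N (Suc i)} s)"
			"(LINT s|lborel. g (t N i) * indicator {t N i..<t N (Suc i)} s) = g (t N i) * (T / real (Suc N))"
			using h[of N i] by (auto simp: measure_def intro!: integrable_mult_right integrable_real_indicator)
	qed
	have I: "(LINT s|lborel. \<phi> N s) = (\<Sum>i<Suc N. g (t N i) * (T / real (Suc N)))" for N
		unfolding \<phi>_def using int by (subst Bochner_Integration.integral_sum) (auto simp del: sum.lessThan_Suc)
	have k: "\<phi> N s = g (t N (nat \<lfloor>s * real (Suc N) / T\<rfloor>))" "0 <= t N (nat \<lfloor>s * real (Suc N) / T\<rfloor>)" "\<bar>t N (nat \<lfloor>s * real (Suc N) / T\<rfloor>) - s\<bar> <= T / real (Suc N)"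
		 "t N (nat \<lfloor>s * real (Suc N) / T\<rfloor>) <= T" if "s \<in> {0..<T}" for N s
	proof -
		define k where "k = nat \<lfloor>s * real (Suc N) / T\<rfloor>"
		have nn: "0 <= s * real (Suc N) / T" using that T by simp
		have kr: "real k <= s * real (Suc N) / T" "s * real (Suc N) / T < real k + 1"
			unfolding k_def using nn by (auto simp: of_nat_nat)
		have ks: "t N k <= s" "s < t N (Suc k)" using kr T unfolding t_def by (auto simp: field_simps)
		have kN: "k < Suc N"
		proof -
			have "s * real (Suc N) < T * real (Suc N)" using that by (intro mult_strict_right_mono) auto
			then have "s * real (Suc N) / T < real (Suc N)" using T by (simp only: pos_divide_less_eq mult.commute)
			then have "real k < real (Suc N)" using kr(1) by linarith
			then show ?thesis by simp
		qed
		have ind: "indicator {t N i..<t N (Suc i)} s = (if i = k then 1 else (0::real))" for i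
		proof (cases "i = k")
			case True then show ?thesis using ks by simp
		next
			case False
			have mono: "t N a <= t N b" if "a <= b" for a b using that T unfolding t_def by (intro divide_right_mono mult_right_mono) auto
			consider "Suc i <= k" | "Suc k <= i" using False by linarith
			then have "s \<notin> {t N i..<t N (Suc i)}" using mono ks by cases force+
			then show ?thesis using False by simp
		qed
		have "\<phi> N s = (\<Sum>i<Suc N. if i = k then g (t N i) else 0)"
			unfolding \<phi>_def ind by (rule sum.cong) auto
		then show "\<phi> N s = g (t N k)" using kN by (simp only: sum.delta finite_lessThan lessThan_iff if_True)
		show "0 <= t N k" using T by (simp add: t_def)
		show "\<bar>t N k - s\<bar> <= T / real (Suc N)" using ks h[of N k] by simp
		show "t N k <= T" using ks that by simp
	qed
	have z: "\<phi> N s = 0" if "s \<notin> {0..<T}" for N s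
	proof -
		have "indicator {t N i..<t N (Suc i)} s = (0::real)" if "i < Suc N" for i
		proof -
			have "0 <= t N i" using T by (simp add: t_def)
			moreover have "t N (Suc i) <= t N (Suc N)" using that T unfolding t_def by (intro divide_right_mono mult_right_mono) auto
			moreover have "t N (Suc N) = T" by (simp add: t_def)
			ultimately show ?thesis using \<open>s \<notin> {0..<T}\<close> by (auto simp: indicator_def)
		qed
		then show ?thesis unfolding \<phi>_def by (intro sum.neutral) auto
	qed
	have "(%N. \<integral>s. \<phi> N s \<partial>lborel) \<longlonglongrightarrow> (LINT s|lborel. indicator {0..T} s *\<^sub>R g s)"
	proof (rule integral_dominated_convergence[where w="%s. C * indicator {0..T} s"])
		show "\<phi> N \<in> bm lborel" for N unfolding \<phi>_def[abs_def] by measurable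
		show "integrable lborel (%s. C * indicator {0..T} s)" using T by auto
		have "AE s in lborel. s \<noteq> 0 \<and> s \<noteq> T" by (intro AE_conjI AE_lborel_singleton)
		then show "AE s in lborel. (%N. \<phi> N s) \<longlonglongrightarrow> indicator {0..T} s *\<^sub>R g s"
			using c
		proof eventually_elim
			case (elim s)
			show ?case
			proof (cases "s \<in> {0<..<T}")
				case True
				then have s: "s \<in> {0..<T}" by auto
				let ?u = "%N. t N (nat \<lfloor>s * real (Suc N) / T\<rfloor>)"
				have "(%N. ?u N - s) \<longlonglongrightarrow> 0"
				proof (rule Lim_null_comparison[OF always_eventually])
					show "\<forall>N. norm (?u N - s) <= T / real (Suc N)" using k(3)[OF s] by simp
					have "(%N. T * (1 / real (Suc N))) \<longlonglongrightarrow> T * 0"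
						by (intro tendsto_mult tendsto_const LIMSEQ_inverse_real_of_nat[unfolded inverse_eq_divide])
					then show "(%N. T / real (Suc N)) \<longlonglongrightarrow> 0" by simp
				qed
				then have u: "?u \<longlonglongrightarrow> s" by (simp add: LIM_zero_iff)
				have "(%N. g (?u N)) \<longlonglongrightarrow> g s"
					using elim(2) True k(2,4)[OF s] by (intro continuous_within_tendsto_compose[of s "{0..T}" g] u) auto
				then show ?thesis using True s by (simp add: k(1)[OF s])
			next
				case False
				then have "s \<notin> {0..<T}" "s \<notin> {0..T}" using elim(1) by auto
				then show ?thesis using z by simp
			qed
		qed
		show "AE s in lborel. norm (\<phi> N s) <= C * indicator {0..T} s" for N
		proof (rule AE_I2)
			fix s show "norm (\<phi> N s) <= C * indicator {0..T} s"
			proof (cases "s \<in> {0..<T}")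
				case True then show ?thesis using k[OF True, of N] b by auto
			next
				case False then show ?thesis using z[OF False, of N] b[of 0] T by (auto simp: indicator_def)
			qed
		qed
	qed simp
	then show ?thesis unfolding I set_lebesgue_integral_def t_def .
qed

lemma abel_sum:
	fixes z f :: "nat => real"
	shows "(\<Sum>i<n. z i * (f (Suc i) - f i)) = z n * f n - z 0 * f 0 + (\<Sum>i<n. (z i - z (Suc i)) * f (Suc i))"
	by (induction n) (auto simp: algebra_simps)

lemma (in prob_space) tail_small:
	assumes [measurable]: "S \<in> bm M" and "0 < e"
	obtains R :: real where "prob {w\<in>space M. R < S w} <= e"
proof -
	have "(%n. prob {w\<in>space M. real n < S w}) \<longlonglongrightarrow> prob (\<Inter>n. {w\<in>space M. real n < S w})"
		by (rule finite_Lim_measure_decseq) (auto simp: decseq_def intro: less_le_trans)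
	moreover have "(\<Inter>n. {w\<in>space M. real n < S w}) = {}"
	proof -
		have "\<exists>n. \<not> real n < S w" for w using reals_Archimedean2[of "S w"] by (auto intro: less_imp_le simp: not_less)
		then show ?thesis by blast
	qed
	ultimately have "(%n. prob {w\<in>space M. real n < S w}) \<longlonglongrightarrow> 0" by simp
	from LIMSEQ_D[OF this \<open>0 < e\<close>] obtain n where "norm (prob {w\<in>space M. real n < S w} - 0) < e" by blast
	then show thesis using that[of "real n"] by simp
qed

context sde
begin

abbreviation M :: "real => 'w => real" where "M \<equiv> running_sup X"

lemma M_ge: "w \<in> space P ==> 0 <= r ==> r <= s ==> X r w <= M s w"
	unfolding running_sup_def by (rule rs_ge[OF X_cont])

lemma M_mono: "w \<in> space P ==> 0 <= s ==> s <= t ==> M s w <= M t w"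
	unfolding running_sup_def by (rule rs_mono[OF X_cont])

lemma M_0: "M 0 w = X 0 w"
	unfolding running_sup_def by simp

lemma M_meas_F: "0 <= s ==> s <= u ==> M s \<in> bm (F u)"
	by (rule running_sup_measurable) (auto intro: X_meas_F X_cont)

lemma M_meas: "0 <= s ==> M s \<in> bm P"
	using M_meas_F[of s s] measurable_F_P by auto

lemma M_cont: "w \<in> space P ==> continuous_on {0..} (%t. M t w)"
	unfolding running_sup_def by (rule rs_cont[OF X_cont])

definition Mc :: "real => 'w => real" where "Mc s = M (max 0 s)"

lemma Mc_eq: "0 <= s ==> Mc s = M s" by (simp add: Mc_def max_def)

lemma Mc_cont: "w \<in> space P ==> continuous_on UNIV (%t. Mc t w)"
	unfolding Mc_def by (rule continuous_on_compose2[OF M_cont]) (auto intro!: continuous_intros)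

lemma Mc_pair [measurable]: "(%(s, w). Mc s w) \<in> bm (borel \<Otimes>\<^sub>M P)"
	by (rule borel_measurable_pair_continuous) (auto simp: Mc_def intro: M_meas Mc_cont[unfolded Mc_def])

text \<open>On a step during which the maximum moves, X visits every level that the maximum crosses
  (\<open>rs_hit\<close>). Uniform continuity of the path on [0, T] then bounds the distance to the
  position at the end of the step.\<close>

lemma osc:
	assumes w: "v \<in> space P" and "0 < \<eta>"
	obtains e where "0 < e" "\<And>s t z. 0 <= s ==> s <= t ==> t <= T ==> t - s < e ==> M s v < M t v ==>
		M s v <= z ==> z <= M t v ==> \<bar>z - X t v\<bar> < \<eta>"
proof -
	have "uniformly_continuous_on {0..T} (%s. X s v)"
		by (intro compact_uniformly_continuous continuous_on_subset[OF X_cont[OF w]]) auto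
	from uniformly_continuous_onE[OF this \<open>0 < \<eta>\<close>] obtain d where d: "0 < d"
		"\<And>r q. r \<in> {0..T} ==> q \<in> {0..T} ==> dist q r < d ==> dist (X q v) (X r v) < \<eta>"
		by metis
	show thesis
	proof (rule that[OF d(1)])
		fix s t z assume *: "0 <= s" "s <= t" "t <= T" "t - s < d" "M s v < M t v" "M s v <= z" "z <= M t v"
		obtain r where "s <= r" "r <= t" "X r v = z"
			using rs_hit[OF X_cont[OF w] *(1,2), of z] * unfolding running_sup_def by blast
		then show "\<bar>z - X t v\<bar> < \<eta>" using d(2)[of t r] * by (auto simp: dist_real_def)
	qed
qed

text \<open>The suprema of X and of - X over all of [0, T] are finite random variables, so one
  radius serves every s at once.\<close>

lemma sup_tail:
	assumes "0 <= T" "0 < e"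
	obtains R where "\<And>s. s \<in> {0..T} ==> prob {v\<in>space P. \<not> (\<bar>M s v\<bar> <= R \<and> \<bar>X s v\<bar> <= R)} <= e"
proof -
	define S where "S v = max (M T v) (running_sup (%s v. - X s v) T v)" for v
	have m: "running_sup (%s v. - X s v) T \<in> bm P"
		using X_meas X_cont assms by (intro running_sup_measurable) (auto intro!: continuous_intros)
	have "S \<in> bm P" unfolding S_def[abs_def] using m M_meas[OF assms(1)] by simp
	from tail_small[OF this assms(2)] obtain R where R: "prob {v\<in>space P. R < S v} <= e" by blast
	show thesis
	proof (rule that[of R])
		fix s assume s: "s \<in> {0..T}"
		have "{v\<in>space P. \<not> (\<bar>M s v\<bar> <= R \<and> \<bar>X s v\<bar> <= R)} \<subseteq> {v\<in>space P. R < S v}"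
		proof (rule ccontr)
			assume "\<not> ?thesis"
			then obtain v where w: "v \<in> space P" and n: "\<not> R < S v" and no: "\<not> (\<bar>M s v\<bar> <= R \<and> \<bar>X s v\<bar> <= R)" by auto
			have c: "continuous_on {0..} (%s. - X s v)" using X_cont[OF w] by (intro continuous_intros)
			have "- X s v <= R" using rs_ge[OF c, of s T] s n unfolding S_def running_sup_def by auto
			moreover have "M s v <= R" using M_mono[OF w, of s T] s n unfolding S_def by auto
			moreover have "X s v <= M s v" using M_ge[OF w, of s s] s by auto
			ultimately show False using no by auto
		qed
		then have "prob {v\<in>space P. \<not> (\<bar>M s v\<bar> <= R \<and> \<bar>X s v\<bar> <= R)} <= prob {v\<in>space P. R < S v}"
			using \<open>S \<in> bm P\<close> by (intro finite_measure_mono) auto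
		with R show "prob {v\<in>space P. \<not> (\<bar>M s v\<bar> <= R \<and> \<bar>X s v\<bar> <= R)} <= e" by simp
	qed
qed

end

section \<open>Sums over a grid and their limits\<close>

context sde_test
begin

definition tt :: "nat => nat => real" where "tt N i = real i * T / real (Suc N)"

lemma tt: "tt N 0 = 0" "tt N (Suc N) = T" "0 <= tt N i" "i <= Suc N ==> tt N i <= T" "tt N (Suc i) - tt N i = T / real (Suc N)"
	 "tt N i < tt N (Suc i)" "i <= Suc N ==> tt N i \<in> {0..T}" "tt N i <= tt N (Suc i)"
proof -
	show "tt N 0 = 0" "tt N (Suc N) = T" and 1: "0 <= tt N i" for i
		using T0 by (auto simp: tt_def)
	show 2: "tt N (Suc i) - tt N i = T / real (Suc N)" for i
		unfolding tt_def of_nat_Suc distrib_right add_divide_distrib by simp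
	show 3: "tt N i <= T" if "i <= Suc N"
	proof -
		have "real i * T <= real (Suc N) * T" using that T0 by (intro mult_right_mono) auto
		then show ?thesis unfolding tt_def by (simp add: field_simps)
	qed
	show "tt N i < tt N (Suc i)" using 2[of i] T0 by (smt (verit) divide_pos_pos of_nat_0_less_iff zero_less_Suc)
	then show "tt N i <= tt N (Suc i)" by simp
	show "i <= Suc N ==> tt N i \<in> {0..T}" using 1 3 by auto
qed

lemma mesh_small: "0 < d ==> eventually (%N. T / real (Suc N) < d) sequentially"
proof -
	assume "0 < d"
	have "(%N. T * (1 / real (Suc N))) \<longlonglongrightarrow> T * 0"
		by (intro tendsto_mult tendsto_const LIMSEQ_inverse_real_of_nat[unfolded inverse_eq_divide])
	then have "(%N. T / real (Suc N)) \<longlonglongrightarrow> 0" by simp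
	then show ?thesis using \<open>0 < d\<close> by (auto dest: order_tendstoD)
qed

text \<open>Extends functions of a time in [0, T] to all times by constants, so that joint
  continuity, and with it measurability, holds on the whole space.\<close>

definition clip :: "real => real" where "clip s = max 0 (min s T)"

lemma clip: "clip s \<in> {0..T}" "s \<in> {0..T} ==> clip s = s" using T0 by (auto simp: clip_def)

lemma Gc_cont: "continuous_on UNIV (%(s, p, x). G (clip s) p x)"
proof -
	have "continuous_on UNIV ((%(s, p, x). G s p x) \<circ> (%(s, p, x). (clip s, p, x)))"
		by (rule continuous_on_compose)
			 (auto simp: split_beta' clip_def intro!: continuous_intros continuous_on_subset[OF G_cont[unfolded split_beta']] dest: subsetD, use T0 in auto)
	then show ?thesis by (simp add: comp_def split_beta')
qed

lemma Gc_meas [measurable]: "(%(s, p, x). G (clip s) p x) \<in> bm borel"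
	by (rule borel_measurable_continuous_onI[OF Gc_cont])

lemma Gc_meas2:
	assumes "a \<in> bm N" "b \<in> bm N" "c \<in> bm N"
	shows "(%z. G (clip (a z)) (b z) (c z)) \<in> bm N"
proof -
	have "(%z. (a z, b z, c z)) \<in> N \<rightarrow>\<^sub>M borel" using assms by measurable
	from measurable_compose[OF this Gc_meas] show ?thesis by simp
qed

text \<open>The weight is taken at the left end of each step, hence is admissible in
  \<open>one_step\<close>. Since z and M are both monotone, z (M s) is monotone along each path and
  has at most countably many discontinuities, so \<open>riemann_limit\<close> applies. Later z is
  the indicator of {..<a} or the constant 1.\<close>

lemma sum_limit:
	assumes z: "antimono z" "\<And>x. \<bar>z x\<bar> <= (1::real)"
	shows "(%N. \<integral>v. (\<Sum>i<Suc N. z (M (tt N i) v) *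
			 (f (tt N (Suc i)) (M (tt N i) v) (X (tt N (Suc i)) v) - f (tt N i) (M (tt N i) v) (X (tt N i) v))) \<partial>P)
		 \<longlonglongrightarrow> (LINT v|P. (LBINT s:{0..T}. z (M s v) * G s (M s v) (X s v)))"
proof -
	have zm [measurable]: "z \<in> bm borel"
	proof -
		have "mono (%x. - z x)" using z(1) by (auto simp: mono_def antimono_def)
		from borel_measurable_uminus[OF borel_measurable_mono[OF this]] show ?thesis by simp
	qed
	define CG where "CG = Kf + K * Kf + K^2 * Kf"
	have CG: "\<bar>z p * G s p' x\<bar> <= CG" if "s \<in> {0..T}" for p p' s x
		using mult_mono[OF z(2)[of p] G_bd[OF that, of p' x]] unfolding abs_mult CG_def by simp
	define S where "S N v = (\<Sum>i<Suc N. z (M (tt N i) v) *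
			 (f (tt N (Suc i)) (M (tt N i) v) (X (tt N (Suc i)) v) - f (tt N i) (M (tt N i) v) (X (tt N i) v)))" for N v
	define R where "R N v = (\<Sum>i<Suc N. (z (M (tt N i) v) * G (tt N i) (M (tt N i) v) (X (tt N i) v)) * (T / real (Suc N)))" for N v
	have meas: "X (tt N i) \<in> bm P" "M (tt N i) \<in> bm P"
		 "(%v. z (M (tt N i) v)) \<in> bm P" for N i
		using X_meas[OF tt(3), of N i] M_meas[OF tt(3), of N i] by (auto intro: measurable_compose)
	have fm: "(%v. f (tt N j) (M (tt N i) v) (X (tt N j) v)) \<in> bm P" if "j <= Suc N" for N i j
		by (rule slice_meas[OF f_cont tt(7)[OF that] meas(2) meas(1)])
	have Gm: "(%v. G (tt N i) (M (tt N i) v) (X (tt N i) v)) \<in> bm P" if "i <= Suc N" for N i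
		by (rule slice_meas[OF G_cont tt(7)[OF that] meas(2) meas(1)])
	have R_lim: "(%N. \<integral>v. R N v \<partial>P) \<longlonglongrightarrow> (LINT v|P. (LBINT s:{0..T}. z (M s v) * G s (M s v) (X s v)))"
	proof (rule integral_dominated_convergence[where w="%_. T * CG"])
		show "R N \<in> bm P" for N
			unfolding R_def[abs_def] using meas Gm by (intro borel_measurable_sum borel_measurable_times) auto
		show "(%v. LBINT s:{0..T}. z (M s v) * G s (M s v) (X s v)) \<in> bm P"
		proof -
			have sp: "(%(v, r). Xc r v) \<in> bm (P \<Otimes>\<^sub>M lborel)" "(%(v, r). Mc r v) \<in> bm (P \<Otimes>\<^sub>M lborel)"
				using measurable_compose[OF measurable_pair_swap' Xc_pair] measurable_compose[OF measurable_pair_swap' Mc_pair]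
				by (simp_all add: split_beta')
			note [measurable] = sp
			have "(%(v, s). z (Mc s v) * G (clip s) (Mc s v) (Xc s v)) \<in> bm (P \<Otimes>\<^sub>M lborel)"
				unfolding split_beta' using sp by (intro borel_measurable_times Gc_meas2 measurable_compose[OF _ zm]) (auto simp: split_beta')
			note [measurable] = this
			have "(%v. LBINT s:{0..T}. z (Mc s v) * G (clip s) (Mc s v) (Xc s v)) \<in> bm P"
				unfolding set_lebesgue_integral_def by measurable
			then show ?thesis
				by (rule measurable_cong[THEN iffD1, rotated]) (auto intro!: set_lebesgue_integral_cong simp: Xc_eq Mc_eq clip)
		qed
		show "AE v in P. norm (R N v) <= T * CG" for N
		proof (rule AE_I2)
			fix v
			have "\<bar>R N v\<bar> <= (\<Sum>i<Suc N. CG * (T / real (Suc N)))"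
				unfolding R_def
			proof (rule order_trans[OF sum_abs], rule sum_mono)
				fix i assume "i \<in> {..<Suc N}"
				then have "tt N i \<in> {0..T}" by (intro tt) auto
				from CG[OF this] show "\<bar>z (M (tt N i) v) * G (tt N i) (M (tt N i) v) (X (tt N i) v) * (T / real (Suc N))\<bar> <= CG * (T / real (Suc N))"
					unfolding abs_mult[of _ "T / real (Suc N)"] using T0 by (simp add: mult_right_mono divide_right_mono)
			qed
			also have "... = T * CG" by simp
			finally show "norm (R N v) <= T * CG" by simp
		qed
		show "AE v in P. (%N. R N v) \<longlonglongrightarrow> (LBINT s:{0..T}. z (M s v) * G s (M s v) (X s v))"
		proof (rule AE_I2)
			fix v assume w: "v \<in> space P"
			define g where "g s = z (Mc s v) * G (clip s) (Mc s v) (Xc s v)" for s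
			have [measurable]: "(%s. Xc s v) \<in> bm borel" "(%s. Mc s v) \<in> bm borel"
				using Xc_cont[OF w] Mc_cont[OF w] by (auto intro: borel_measurable_continuous_onI)
			have gm: "g \<in> bm borel"
				unfolding g_def[abs_def] by (intro borel_measurable_times Gc_meas2) auto
			have "mono (%s. - z (Mc s v))"
			proof (rule monoI)
				fix s t :: real assume "s <= t"
				then have "Mc s v <= Mc t v" unfolding Mc_def by (intro M_mono[OF w]) auto
				then show "- z (Mc s v) <= - z (Mc t v)" using z(1) by (auto dest: antimonoD)
			qed
			from mono_ctble_discont[OF this] have "countable {s. \<not> isCont (%s. - z (Mc s v)) s}" .
			then have "AE s in lborel. isCont (%s. - z (Mc s v)) s"
				by (rule AE_mp[OF AE_not_in[OF countable_imp_null_set_lborel]]) auto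
			then have "AE s in lborel. s \<in> {0<..<T} \<longrightarrow> continuous (at s within {0..T}) g"
			proof eventually_elim
				case (elim s)
				have c1: "isCont (%s. z (Mc s v)) s" using continuous_minus[OF elim] by simp
				have "continuous_on UNIV ((%(s, p, x). G (clip s) p x) \<circ> (%s. (s, Mc s v, Xc s v)))"
					by (rule continuous_on_compose) (auto intro!: continuous_intros Xc_cont[OF w] Mc_cont[OF w] continuous_on_subset[OF Gc_cont])
				then have "isCont (%s. G (clip s) (Mc s v) (Xc s v)) s" by (simp add: comp_def continuous_on_eq_continuous_at)
				then have "isCont g s" unfolding g_def[abs_def] using c1 by (intro continuous_intros) auto
				then show ?case by (auto intro: continuous_at_imp_continuous_within)
			qed
			from riemann_limit[OF T0 gm _ this, of CG]
			have "(%N. \<Sum>i<Suc N. g (real i * T / real (Suc N)) * (T / real (Suc N))) \<longlonglongrightarrow> (LBINT s:{0..T}. g s)"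
				using CG[OF clip(1)] unfolding g_def by auto
			moreover have "(\<Sum>i<Suc N. g (real i * T / real (Suc N)) * (T / real (Suc N))) = R N v" for N
				unfolding R_def
			proof (rule sum.cong[OF refl])
				fix i assume "i \<in> {..<Suc N}"
				then have "tt N i \<in> {0..T}" by (intro tt) auto
				then show "g (real i * T / real (Suc N)) * (T / real (Suc N)) = z (M (tt N i) v) * G (tt N i) (M (tt N i) v) (X (tt N i) v) * (T / real (Suc N))"
					unfolding g_def tt_def[symmetric] by (simp add: Mc_eq Xc_eq clip)
			qed
			moreover have "(LBINT s:{0..T}. g s) = (LBINT s:{0..T}. z (M s v) * G s (M s v) (X s v))"
				by (rule set_lebesgue_integral_cong) (auto simp: g_def Mc_eq Xc_eq clip)
			ultimately show "(%N. R N v) \<longlonglongrightarrow> (LBINT s:{0..T}. z (M s v) * G s (M s v) (X s v))" by simp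
		qed
	qed simp
	have "(%N. (LINT v|P. S N v) - (LINT v|P. R N v)) \<longlonglongrightarrow> 0"
	proof (rule LIMSEQ_I)
		fix r :: real assume "0 < r"
		show "\<exists>n0. \<forall>N\<ge>n0. norm ((LINT v|P. S N v) - (LINT v|P. R N v) - 0) < r"
		proof (rule one_step)
			fix C assume C0: "0 <= C" and C: "\<And>e R. 0 < e ==> e <= 1 ==> \<exists>d>0. \<forall>s t p Z. 0 <= s \<and> s < t \<and> t <= T \<and> t - s <= d \<and>
				 p \<in> bm (F s) \<and> Z \<in> bm (F s) \<and> (\<forall>v\<in>space P. \<bar>Z v\<bar> <= 1) \<longrightarrow>
				 \<bar>\<integral>v. Z v * (f t (p v) (X t v) - f s (p v) (X s v) - (t - s) * G s (p v) (X s v)) \<partial>P\<bar>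
					 <= (t - s) * (C * e + C * prob {v\<in>space P. \<not> (\<bar>p v\<bar> <= R \<and> \<bar>X s v\<bar> <= R)})"
			define e where "e = min 1 (r / (4 * (C + 1) * T))"
			have e: "0 < e" "e <= 1" using C0 T0 \<open>0 < r\<close> by (auto simp: e_def)
			have er: "T * (C * e + C * e) < r"
			proof -
				have "e <= r / (4 * (C + 1) * T)" by (simp add: e_def)
				moreover have "0 < 4 * (C + 1) * T" using C0 T0 by simp
				ultimately have "e * (4 * (C + 1) * T) <= r" by (simp only: pos_le_divide_eq)
				moreover have "0 < e * T" "0 <= e * T * C" using e T0 C0 by auto
				ultimately show ?thesis by (simp add: algebra_simps)
			qed
			obtain RR where RR: "\<And>s. s \<in> {0..T} ==> prob {v\<in>space P. \<not> (\<bar>M s v\<bar> <= RR \<and> \<bar>X s v\<bar> <= RR)} <= e"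
				using sup_tail[of T e] T0 e by auto
			obtain d where d: "0 < d" "\<And>s t p Z. 0 <= s ==> s < t ==> t <= T ==> t - s <= d ==>
				 p \<in> bm (F s) ==> Z \<in> bm (F s) ==> (\<forall>v\<in>space P. \<bar>Z v\<bar> <= 1) ==>
				 \<bar>\<integral>v. Z v * (f t (p v) (X t v) - f s (p v) (X s v) - (t - s) * G s (p v) (X s v)) \<partial>P\<bar>
					 <= (t - s) * (C * e + C * prob {v\<in>space P. \<not> (\<bar>p v\<bar> <= RR \<and> \<bar>X s v\<bar> <= RR)})"
				using C[OF e, of RR] by blast
			have "norm ((LINT v|P. S N v) - (LINT v|P. R N v) - 0) < r" if N: "T / real (Suc N) < d" for N
			proof -
				define q where "q i v = z (M (tt N i) v) * (f (tt N (Suc i)) (M (tt N i) v) (X (tt N (Suc i)) v) - f (tt N i) (M (tt N i) v) (X (tt N i) v)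
						- (tt N (Suc i) - tt N i) * G (tt N i) (M (tt N i) v) (X (tt N i) v))" for i v
				have Si: "integrable P (%v. z (M (tt N i) v) *
					 (f (tt N (Suc i)) (M (tt N i) v) (X (tt N (Suc i)) v) - f (tt N i) (M (tt N i) v) (X (tt N i) v)))" if "i < Suc N" for i
				proof (rule integrable_const_bound[where B="1 * (Kf + Kf)"])
					have j: "tt N i \<in> {0..T}" "tt N (Suc i) \<in> {0..T}" using that by (auto intro!: tt(7) simp del: atLeastAtMost_iff)
					show "AE v in P. norm (z (M (tt N i) v) *
					 (f (tt N (Suc i)) (M (tt N i) v) (X (tt N (Suc i)) v) - f (tt N i) (M (tt N i) v) (X (tt N i) v))) <= 1 * (Kf + Kf)"
						unfolding real_norm_def abs_mult
						by (intro AE_I2 mult_mono z(2) order_trans[OF abs_triangle_ineq4] add_mono f_bd j) auto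
					show "(%v. z (M (tt N i) v) *
					 (f (tt N (Suc i)) (M (tt N i) v) (X (tt N (Suc i)) v) - f (tt N i) (M (tt N i) v) (X (tt N i) v))) \<in> bm P"
						using that by (intro borel_measurable_times borel_measurable_diff meas fm) auto
				qed
				have Ri: "integrable P (%v. (z (M (tt N i) v) * G (tt N i) (M (tt N i) v) (X (tt N i) v)) * (T / real (Suc N)))" if "i < Suc N" for i
				proof (intro integrable_mult_left integrable_const_bound[where B=CG])
					have j: "tt N i \<in> {0..T}" using that by (auto intro!: tt(7) simp del: atLeastAtMost_iff)
					show "AE v in P. norm (z (M (tt N i) v) * G (tt N i) (M (tt N i) v) (X (tt N i) v)) <= CG" using CG[OF j] by auto
					show "(%v. z (M (tt N i) v) * G (tt N i) (M (tt N i) v) (X (tt N i) v)) \<in> bm P"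
						using that by (intro borel_measurable_times meas Gm) auto
				qed
				have qi: "integrable P (q i)" "(LINT v|P. q i v) = (LINT v|P. z (M (tt N i) v) *
					 (f (tt N (Suc i)) (M (tt N i) v) (X (tt N (Suc i)) v) - f (tt N i) (M (tt N i) v) (X (tt N i) v)))
					 - (LINT v|P. (z (M (tt N i) v) * G (tt N i) (M (tt N i) v) (X (tt N i) v)) * (T / real (Suc N)))" if "i < Suc N" for i
				proof -
					have eq: "q i = (%v. z (M (tt N i) v) *
					 (f (tt N (Suc i)) (M (tt N i) v) (X (tt N (Suc i)) v) - f (tt N i) (M (tt N i) v) (X (tt N i) v))
					 - (z (M (tt N i) v) * G (tt N i) (M (tt N i) v) (X (tt N i) v)) * (T / real (Suc N)))"
						unfolding q_def tt(5) by (simp add: fun_eq_iff algebra_simps)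
					show "integrable P (q i)" unfolding eq by (rule Bochner_Integration.integrable_diff[OF Si[OF that] Ri[OF that]])
					show "(LINT v|P. q i v) = (LINT v|P. z (M (tt N i) v) *
					 (f (tt N (Suc i)) (M (tt N i) v) (X (tt N (Suc i)) v) - f (tt N i) (M (tt N i) v) (X (tt N i) v)))
					 - (LINT v|P. (z (M (tt N i) v) * G (tt N i) (M (tt N i) v) (X (tt N i) v)) * (T / real (Suc N)))"
						unfolding eq by (rule Bochner_Integration.integral_diff[OF Si[OF that] Ri[OF that]])
				qed
				have "(LINT v|P. S N v) - (LINT v|P. R N v) = (\<Sum>i<Suc N. \<integral>v. q i v \<partial>P)"
					unfolding S_def R_def using Si Ri qi(2)
					by (simp add: Bochner_Integration.integral_sum sum_subtractf del: sum.lessThan_Suc)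
				also have "\<bar>...\<bar> <= (\<Sum>i<Suc N. (T / real (Suc N)) * (C * e + C * e))"
				proof (rule order_trans[OF sum_abs], rule sum_mono)
					fix i assume i: "i \<in> {..<Suc N}"
					then have j: "tt N i \<in> {0..T}" "tt N (Suc i) <= T" using tt(4,7)[of i N] tt(4)[of "Suc i" N] by auto
					have "\<bar>\<integral>v. q i v \<partial>P\<bar> <= (tt N (Suc i) - tt N i) * (C * e + C * prob {v\<in>space P. \<not> (\<bar>M (tt N i) v\<bar> <= RR \<and> \<bar>X (tt N i) v\<bar> <= RR)})"
						unfolding q_def
					proof (rule d(2))
						show "M (tt N i) \<in> bm (F (tt N i))" by (rule M_meas_F[OF tt(3) order_refl])
						then show "(%v. z (M (tt N i) v)) \<in> bm (F (tt N i))" by simp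
					qed (use tt(3,5,6) j N z(2) in \<open>auto simp: less_imp_le\<close>)
					also have "... <= (T / real (Suc N)) * (C * e + C * e)"
						unfolding tt(5) using T0 C0 RR[OF j(1)] by (intro mult_left_mono add_left_mono) auto
					finally show "\<bar>\<integral>v. q i v \<partial>P\<bar> <= (T / real (Suc N)) * (C * e + C * e)" .
				qed
				also have "... = T * (C * e + C * e)" by simp
				finally show ?thesis using er by simp
			qed
			with mesh_small[OF d(1)] show ?thesis by (auto simp: eventually_sequentially)
		qed
	qed
	from tendsto_add[OF this R_lim] show ?thesis unfolding S_def by simp
qed

lemma sum_int:
	assumes z: "antimono z" "\<And>x. \<bar>z x\<bar> <= (1::real)"
	shows "integrable P (%w. \<Sum>i<Suc N. z (M (tt N i) w) *
			 (f (tt N (Suc i)) (M (tt N i) w) (X (tt N (Suc i)) w) - f (tt N i) (M (tt N i) w) (X (tt N i) w)))"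
proof (rule Bochner_Integration.integrable_sum)
	have "mono (%x. - z x)" using z(1) by (auto simp: mono_def antimono_def)
	from borel_measurable_uminus[OF borel_measurable_mono[OF this]] have [measurable]: "z \<in> bm borel" by simp
	fix i assume "i \<in> {..<Suc N}"
	then have j: "tt N i \<in> {0..T}" "tt N (Suc i) \<in> {0..T}" by (auto intro!: tt(7) simp del: atLeastAtMost_iff)
	then have [measurable]: "X (tt N i) \<in> bm P" "M (tt N i) \<in> bm P" "X (tt N (Suc i)) \<in> bm P"
		using X_meas M_meas by auto
	show "integrable P (%w. z (M (tt N i) w) *
					 (f (tt N (Suc i)) (M (tt N i) w) (X (tt N (Suc i)) w) - f (tt N i) (M (tt N i) w) (X (tt N i) w)))"
	proof (rule integrable_const_bound[where B="1 * (Kf + Kf)"])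
		show "AE w in P. norm (z (M (tt N i) w) *
					 (f (tt N (Suc i)) (M (tt N i) w) (X (tt N (Suc i)) w) - f (tt N i) (M (tt N i) w) (X (tt N i) w))) <= 1 * (Kf + Kf)"
			unfolding real_norm_def abs_mult
			by (intro AE_I2 mult_mono z(2) order_trans[OF abs_triangle_ineq4] add_mono f_bd j) auto
		show "(%w. z (M (tt N i) w) *
					 (f (tt N (Suc i)) (M (tt N i) w) (X (tt N (Suc i)) w) - f (tt N i) (M (tt N i) w) (X (tt N i) w))) \<in> bm P"
			by (intro borel_measurable_times borel_measurable_diff slice_meas[OF f_cont] j) measurable
	qed
qed

lemma f_lip: "s \<in> {0..T} ==> \<bar>f s p x - f s p y\<bar> <= Kf * \<bar>x - y\<bar>"
	using field_differentiable_bound[of UNIV "f s p" "fx s p" Kf x y] f_x fx_bd by auto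

text \<open>Stopping at level \<open>a\<close>: a function vanishing at \<open>a\<close> contributes nothing at the exit time.\<close>

lemma killed:
	assumes fa: "\<And>s p. s \<in> {0..T} ==> f s p a = 0" and fp: "\<And>s p x. s \<in> {0..T} ==> f s p x = f s 0 x"
	shows "(LINT v|P. indicator {..<a} (M T v) * f T 0 (X T v)) - (LINT v|P. indicator {..<a} (X 0 v) * f 0 0 (X 0 v))
		= (LINT v|P. (LBINT s:{0..T}. indicator {..<a} (M s v) * G s (M s v) (X s v)))"
proof -
	define z :: "real => real" where "z = indicator {..<a}"
	have z: "antimono z" "\<And>x. \<bar>z x\<bar> <= 1" "\<And>x. 0 <= z x" "z \<in> bm borel"
		by (auto simp: z_def antimono_def indicator_def)
	define S where "S N v = (\<Sum>i<Suc N. z (M (tt N i) v) *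
			 (f (tt N (Suc i)) (M (tt N i) v) (X (tt N (Suc i)) v) - f (tt N i) (M (tt N i) v) (X (tt N i) v)))" for N v
	define J where "J N v = (\<Sum>i<Suc N. (z (M (tt N i) v) - z (M (tt N (Suc i)) v)) * f (tt N (Suc i)) 0 (X (tt N (Suc i)) v))" for N v
	define E where "E v = z (M T v) * f T 0 (X T v) - z (X 0 v) * f 0 0 (X 0 v)" for v
	\<comment> \<open>Summation by parts moves the differences onto the weights. A summand of
	  \<open>J\<close> can differ from 0 only on the step in which M crosses a; there X ends close to
	  a, where f vanishes.\<close>
	have S_eq: "S N v = E v + J N v" for N v
	proof -
		have "S N v = (\<Sum>i<Suc N. z (M (tt N i) v) * (f (tt N (Suc i)) 0 (X (tt N (Suc i)) v) - f (tt N i) 0 (X (tt N i) v)))"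
			unfolding S_def
		proof (rule sum.cong[OF refl])
			fix i assume "i \<in> {..<Suc N}"
			then have j: "tt N i \<in> {0..T}" "tt N (Suc i) \<in> {0..T}" by (auto intro!: tt(7) simp del: atLeastAtMost_iff)
			show "z (M (tt N i) v) * (f (tt N (Suc i)) (M (tt N i) v) (X (tt N (Suc i)) v) - f (tt N i) (M (tt N i) v) (X (tt N i) v)) =
				z (M (tt N i) v) * (f (tt N (Suc i)) 0 (X (tt N (Suc i)) v) - f (tt N i) 0 (X (tt N i) v))"
				unfolding fp[OF j(1), of "M (tt N i) v"] fp[OF j(2), of "M (tt N i) v"] ..
		qed
		also have "... = E v + J N v"
			unfolding abel_sum[of "%i. z (M (tt N i) v)" "%i. f (tt N i) 0 (X (tt N i) v)"] E_def J_def tt(1,2) M_0 ..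
		finally show ?thesis .
	qed
	have T: "0 \<in> {0..T}" "T \<in> {0..T}" using T0 by auto
	have [measurable]: "X 0 \<in> bm P" "X T \<in> bm P" "M T \<in> bm P" "z \<in> bm borel"
		using X_meas M_meas T0 z by auto
	have zf: "integrable P (%v. z (M T v) * f T 0 (X T v))" "integrable P (%v. z (X 0 v) * f 0 0 (X 0 v))"
	proof -
		show "integrable P (%v. z (M T v) * f T 0 (X T v))"
		proof (rule integrable_const_bound[where B="1 * Kf"])
			show "(%v. z (M T v) * f T 0 (X T v)) \<in> bm P" by (intro borel_measurable_times slice_meas[OF f_cont T(2)]) auto
			show "AE v in P. norm (z (M T v) * f T 0 (X T v)) <= 1 * Kf"
				unfolding real_norm_def abs_mult by (intro AE_I2 mult_mono z f_bd T) auto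
		qed
		show "integrable P (%v. z (X 0 v) * f 0 0 (X 0 v))"
		proof (rule integrable_const_bound[where B="1 * Kf"])
			show "(%v. z (X 0 v) * f 0 0 (X 0 v)) \<in> bm P" by (intro borel_measurable_times slice_meas[OF f_cont T(1)]) auto
			show "AE v in P. norm (z (X 0 v) * f 0 0 (X 0 v)) <= 1 * Kf"
				unfolding real_norm_def abs_mult by (intro AE_I2 mult_mono z f_bd T) auto
		qed
	qed
	then have Ei: "integrable P E" unfolding E_def[abs_def] by (rule Bochner_Integration.integrable_diff)
	have Si: "integrable P (S N)" for N unfolding S_def[abs_def] by (rule sum_int[OF z(1,2)])
	have Ji: "integrable P (J N)" for N
	proof -
		have "J N = (%v. S N v - E v)" by (auto simp: S_eq)
		then show ?thesis using Bochner_Integration.integrable_diff[OF Si Ei] by simp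
	qed
	have zdec: "0 <= z (M (tt N i) v) - z (M (tt N (Suc i)) v)" if "v \<in> space P" for N i v
		using antimonoD[OF z(1) M_mono[OF that tt(3) tt(8), of N i]] by simp
	have ztel: "(\<Sum>i<Suc N. z (M (tt N i) v) - z (M (tt N (Suc i)) v)) <= 1" for N v
		using sum_lessThan_telescope'[of "%i. z (M (tt N i) v)" "Suc N"] z(2)[of "M (tt N 0) v"] z(3)[of "M (tt N (Suc N)) v"]
		by linarith
	have Jb: "\<bar>J N v\<bar> <= c" if w: "v \<in> space P" and "0 <= c" and
			c: "\<And>i. i < Suc N ==> z (M (tt N i) v) \<noteq> z (M (tt N (Suc i)) v) ==> \<bar>f (tt N (Suc i)) 0 (X (tt N (Suc i)) v)\<bar> <= c" for N v c
	proof -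
		have "\<bar>J N v\<bar> <= (\<Sum>i<Suc N. (z (M (tt N i) v) - z (M (tt N (Suc i)) v)) * c)"
			unfolding J_def
		proof (rule order_trans[OF sum_abs], rule sum_mono)
			fix i assume "i \<in> {..<Suc N}"
			then show "\<bar>(z (M (tt N i) v) - z (M (tt N (Suc i)) v)) * f (tt N (Suc i)) 0 (X (tt N (Suc i)) v)\<bar> <= (z (M (tt N i) v) - z (M (tt N (Suc i)) v)) * c"
				using zdec[OF w, of N i] c[of i] by (cases "z (M (tt N i) v) = z (M (tt N (Suc i)) v)") (auto simp: abs_mult intro: mult_left_mono)
		qed
		also have "... = (\<Sum>i<Suc N. z (M (tt N i) v) - z (M (tt N (Suc i)) v)) * c" by (rule sum_distrib_right[symmetric])
		also have "... <= 1 * c" by (intro mult_right_mono ztel \<open>0 <= c\<close>)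
		finally show ?thesis by simp
	qed
	have "(%N. \<integral>v. J N v \<partial>P) \<longlonglongrightarrow> (LINT v|P. 0)"
	proof (rule integral_dominated_convergence[where w="%_. Kf"])
		show "J N \<in> bm P" for N using Ji by auto
		show "AE v in P. norm (J N v) <= Kf" for N
			unfolding real_norm_def by (intro AE_I2 Jb Kf0 f_bd tt(7)) auto
		show "AE v in P. (%N. J N v) \<longlonglongrightarrow> 0"
		proof (rule AE_I2, rule LIMSEQ_I)
			fix v and r :: real assume w: "v \<in> space P" and r: "0 < r"
			then have "0 < r / (2 * (Kf + 1))" using Kf0 by simp
			from osc[OF w this, of T] obtain d where d: "0 < d" "\<And>s t u. 0 <= s ==> s <= t ==> t <= T ==> t - s < d ==> M s v < M t v ==>
				 M s v <= u ==> u <= M t v ==> \<bar>u - X t v\<bar> < r / (2 * (Kf + 1))" by blast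
			have "norm (J N v - 0) < r" if N: "T / real (Suc N) < d" for N
			proof -
				have "\<bar>J N v\<bar> <= Kf * (r / (2 * (Kf + 1)))"
				proof (rule Jb[OF w])
					show "0 <= Kf * (r / (2 * (Kf + 1)))" using Kf0 r by simp
					fix i assume i: "i < Suc N" and ne: "z (M (tt N i) v) \<noteq> z (M (tt N (Suc i)) v)"
					have j: "tt N (Suc i) \<in> {0..T}" "tt N (Suc i) <= T" using i tt(4,7)[of "Suc i" N] by auto
					have "M (tt N i) v <= M (tt N (Suc i)) v" by (rule M_mono[OF w tt(3) tt(8)])
					then have a: "M (tt N i) v < a" "a <= M (tt N (Suc i)) v" using ne unfolding z_def
						by (cases "M (tt N i) v < a"; cases "M (tt N (Suc i)) v < a"; simp add: indicator_def)+
					have "\<bar>a - X (tt N (Suc i)) v\<bar> < r / (2 * (Kf + 1))"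
						by (rule d(2)[OF tt(3) tt(8) j(2)]) (use a N tt(5)[of N i] in auto)
					then have "Kf * \<bar>X (tt N (Suc i)) v - a\<bar> <= Kf * (r / (2 * (Kf + 1)))" using Kf0 by (intro mult_left_mono) auto
					with f_lip[OF j(1), of 0 "X (tt N (Suc i)) v" a]
					show "\<bar>f (tt N (Suc i)) 0 (X (tt N (Suc i)) v)\<bar> <= Kf * (r / (2 * (Kf + 1)))" by (simp add: fa[OF j(1)])
				qed
				also have "... < r"
				proof -
					have "Kf * r < r * (2 * (Kf + 1))" using mult_nonneg_nonneg[OF Kf0 less_imp_le[OF r]] r by (simp add: algebra_simps)
					then show ?thesis using Kf0 by (simp add: pos_divide_less_eq)
				qed
				finally show ?thesis by simp
			qed
			with mesh_small[OF d(1)] show "\<exists>n0. \<forall>N\<ge>n0. norm (J N v - 0) < r" by (auto simp: eventually_sequentially)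
		qed
	qed auto
	then have "(%N. (LINT v|P. E v) + (LINT v|P. J N v)) \<longlonglongrightarrow> (LINT v|P. E v) + 0" by (intro tendsto_add tendsto_const) simp
	moreover have "(LINT v|P. S N v) = (LINT v|P. E v) + (LINT v|P. J N v)" for N
		unfolding S_eq by (rule Bochner_Integration.integral_add[OF Ei Ji])
	ultimately have "(%N. \<integral>v. S N v \<partial>P) \<longlonglongrightarrow> (LINT v|P. E v)" by simp
	moreover have "(%N. \<integral>v. S N v \<partial>P) \<longlonglongrightarrow> (LINT v|P. (LBINT s:{0..T}. z (M s v) * G s (M s v) (X s v)))"
		unfolding S_def by (rule sum_limit[OF z(1,2)])
	ultimately have "(LINT v|P. E v) = (LINT v|P. (LBINT s:{0..T}. z (M s v) * G s (M s v) (X s v)))" by (rule LIMSEQ_unique)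
	then show ?thesis unfolding E_def z_def[symmetric] using zf by simp
qed

text \<open>The part of the telescoping sum in which only the parameter p moves, with X already at
  the end of the step.\<close>

definition JM :: "nat => 'w => real" where
	"JM N w = (\<Sum>i<Suc N. f 0 (M (tt N (Suc i)) w) (X (tt N (Suc i)) w) - f 0 (M (tt N i) w) (X (tt N (Suc i)) w))"

text \<open>The total increment of f telescopes into steps of X with M frozen, covered by
  \<open>sum_limit\<close> with weight 1, and steps of M with X frozen, which are
  \<open>JM\<close>.\<close>

lemma JM_limit:
	assumes ff: "\<And>s p x. s \<in> {0..T} ==> f s p x = f 0 p x"
	shows "integrable P (JM N)" (is ?I)
		and "(%N. \<integral>w. JM N w \<partial>P) \<longlonglongrightarrow> (LINT w|P. f 0 (M T w) (X T w)) - (LINT w|P. f 0 (X 0 w) (X 0 w))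
		- (LINT w|P. (LBINT s:{0..T}. G s (M s w) (X s w)))" (is ?L)
proof -
	have one: "antimono (%_::real. 1::real)" "\<And>x::real. \<bar>1::real\<bar> <= 1" by (auto simp: antimono_def)
	define S where "S N w = (\<Sum>i<Suc N. 1 *
			 (f (tt N (Suc i)) (M (tt N i) w) (X (tt N (Suc i)) w) - f (tt N i) (M (tt N i) w) (X (tt N i) w)))" for N w
	have Si: "integrable P (S N)" for N unfolding S_def[abs_def] by (rule sum_int[OF one])
	have T: "0 \<in> {0..T}" "T \<in> {0..T}" using T0 by auto
	have Fi: "integrable P (%w. f 0 (M s w) (X s w))" if "s \<in> {0..T}" for s
		using that T f_bd[OF T(1)] by (intro integrable_const_bound[where B=Kf] slice_meas[OF f_cont] M_meas X_meas) auto
	have JM: "JM N w = f 0 (M T w) (X T w) - f 0 (M 0 w) (X 0 w) - S N w" for N w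
	proof -
		have "S N w = (\<Sum>i<Suc N. f 0 (M (tt N i) w) (X (tt N (Suc i)) w) - f 0 (M (tt N i) w) (X (tt N i) w))"
			unfolding S_def
		proof (rule sum.cong[OF refl])
			fix i assume "i \<in> {..<Suc N}"
			then have j: "tt N i \<in> {0..T}" "tt N (Suc i) \<in> {0..T}" by (auto intro!: tt(7) simp del: atLeastAtMost_iff)
			show "1 * (f (tt N (Suc i)) (M (tt N i) w) (X (tt N (Suc i)) w) - f (tt N i) (M (tt N i) w) (X (tt N i) w)) =
				f 0 (M (tt N i) w) (X (tt N (Suc i)) w) - f 0 (M (tt N i) w) (X (tt N i) w)"
				unfolding ff[OF j(1)] ff[OF j(2)] by simp
		qed
		then have "JM N w + S N w = (\<Sum>i<Suc N. f 0 (M (tt N (Suc i)) w) (X (tt N (Suc i)) w) - f 0 (M (tt N i) w) (X (tt N i) w))"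
			unfolding JM_def by (simp add: sum.distrib[symmetric] del: sum.lessThan_Suc)
		also have "... = f 0 (M T w) (X T w) - f 0 (M 0 w) (X 0 w)"
			using sum_lessThan_telescope[of "%i. f 0 (M (tt N i) w) (X (tt N i) w)" "Suc N"] by (simp add: tt(1,2) del: sum.lessThan_Suc)
		finally show ?thesis by simp
	qed
	show ?I unfolding JM[abs_def] by (intro Bochner_Integration.integrable_diff Fi T Si)
	have "(LINT w|P. JM N w) = (LINT w|P. f 0 (M T w) (X T w)) - (LINT w|P. f 0 (M 0 w) (X 0 w)) - (LINT w|P. S N w)" for N
		unfolding JM using Fi[OF T(1)] Fi[OF T(2)] Si by (simp add: Bochner_Integration.integral_diff)
	moreover have "(%N. \<integral>w. S N w \<partial>P) \<longlonglongrightarrow> (LINT w|P. (LBINT s:{0..T}. 1 * G s (M s w) (X s w)))"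
		unfolding S_def by (rule sum_limit[OF one])
	ultimately show ?L using tendsto_diff[OF tendsto_const] unfolding M_0 by auto
qed

end

section \<open>Gaussian kernels\<close>

definition gam :: "real => real => real" where
	"gam r v = exp (- v\<^sup>2 / (2 * r)) / sqrt (2 * pi * r)"

lemma gam_meas [measurable (raw)]:
	assumes [measurable]: "a \<in> bm N" "b \<in> bm N"
	shows "(%z. gam (a z) (b z)) \<in> bm N"
	unfolding gam_def by measurable

lemma gam_normal: "0 < r ==> gam r v = normal_density 0 (sqrt r) v"
	by (simp add: gam_def normal_density_def)

lemma gam_pos: "0 < r ==> 0 < gam r v" and gam_nonneg: "0 < r ==> 0 <= gam r v"
	by (auto simp: gam_def)

lemma gam_commute: "gam r (x - y) = gam r (y - x)"
	by (auto simp: gam_def power2_commute)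

lemma gam_antimono: "0 < r ==> \<bar>v\<bar> <= \<bar>w\<bar> ==> gam r w <= gam r v"
	by (auto simp: gam_def abs_le_square_iff intro!: divide_right_mono)

lemma gam_le: "0 < r ==> gam r v <= 1 / sqrt r"
proof -
	assume t: "0 < r"
	have "gam r v <= 1 / sqrt (2 * pi * r)" using t by (auto simp: gam_def intro!: divide_right_mono)
	also have "... <= 1 / sqrt r"
	proof (intro divide_left_mono)
		have "1 * r <= 2 * pi * r" using t pi_ge_two by (intro mult_right_mono) auto
		then show "sqrt r <= sqrt (2 * pi * r)" by simp
	qed (use t in auto)
	finally show ?thesis .
qed

lemma gam_cont:
	assumes "continuous_on S a" "continuous_on S b" "\<And>z. z \<in> S ==> 0 < a z"
	shows "continuous_on S (%z. gam (a z) (b z))"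
	unfolding gam_def using assms(3) by (intro continuous_intros assms) (auto dest: assms(3))

lemma gam_deriv:
	assumes "0 < r"
	shows "(gam r has_real_derivative - v / r * gam r v) (at v)"
proof -
	have "((%v. exp (- v\<^sup>2 / (2 * r)) / c) has_real_derivative - v / r * (exp (- v\<^sup>2 / (2 * r)) / c)) (at v)" if "c \<noteq> 0" for c
		using assms that by (auto intro!: derivative_eq_intros)
	then show ?thesis unfolding gam_def[abs_def] using assms by auto
qed

lemma gam_tendsto:
	assumes "(a \<longlongrightarrow> r) G" "(b \<longlongrightarrow> v) G" "0 < r"
	shows "((%z. gam (a z) (b z)) \<longlongrightarrow> gam r v) G"
	unfolding gam_def using assms(3) by (intro tendsto_intros assms) auto

lemma nn_integral_gam: "0 < r ==> (NN v|lborel. ennreal (gam r (v - a))) = 1"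
proof -
	assume t: "0 < r"
	have "(NN v|lborel. ennreal (gam r (v - a))) = (NN v|lborel. ennreal (normal_density a (sqrt r) v))"
		using t by (simp add: gam_normal normal_density_def)
	also have "... = ennreal (LINT v|lborel. normal_density a (sqrt r) v)"
		using t by (intro nn_integral_eq_integral) auto
	finally show ?thesis using t by simp
qed

lemma nn_integral_gam_sq: "0 < r ==> (NN v|lborel. ennreal ((v - a)^2 * gam r (v - a))) = ennreal r"
proof -
	assume t: "0 < r"
	have i: "has_bochner_integral lborel (%x. normal_density a (sqrt r) x * (x - a)^2) r"
		using normal_moment_even[of "sqrt r" a 1] t by simp
	have "(NN v|lborel. ennreal ((v - a)^2 * gam r (v - a))) = (NN v|lborel. ennreal (normal_density a (sqrt r) v * (v - a)^2))"
		using t by (simp add: gam_normal normal_density_def mult.commute)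
	also have "... = ennreal (LINT v|lborel. normal_density a (sqrt r) v * (v - a)^2)"
		using i by (intro nn_integral_eq_integral) (auto simp: has_bochner_integral_iff)
	finally show ?thesis using i by (simp add: has_bochner_integral_iff)
qed

text \<open>Half of the exponent is split off. It absorbs an exponential weight or a power of v, and
  what remains is a Gaussian of twice the variance; each absorption below doubles the variance
  once.\<close>

lemma gam_double: "0 < r ==> gam r v = sqrt 2 * exp (- v\<^sup>2 / (4 * r)) * gam (2 * r) v"
proof -
	assume t: "0 < r"
	have e: "exp (- v\<^sup>2 / (2 * r)) = exp (- v\<^sup>2 / (4 * r)) * exp (- v\<^sup>2 / (4 * r))"
		using t by (simp add: exp_add[symmetric] field_simps)
	have s: "sqrt (2 * pi * (2 * r)) = sqrt 2 * sqrt (2 * pi * r)"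
		by (simp add: real_sqrt_mult)
	have s0: "sqrt (2 * pi * r) \<noteq> 0" "sqrt (2::real) \<noteq> 0" using t by auto
	have "sqrt 2 * exp (- v\<^sup>2 / (4 * r)) * gam (2 * r) v = (exp (- v\<^sup>2 / (4 * r)) * exp (- v\<^sup>2 / (4 * r))) / sqrt (2 * pi * r)"
		unfolding gam_def s using s0 by simp
	then show ?thesis unfolding gam_def e by simp
qed

lemma gam_exp: "0 < r ==> 0 <= L ==> exp (L * \<bar>v\<bar>) * gam r v <= sqrt 2 * exp (L^2 * r) * gam (2 * r) v"
proof -
	assume t: "0 < r" and L: "0 <= L"
	have "L * \<bar>v\<bar> - v\<^sup>2 / (4 * r) <= L^2 * r"
	proof -
		\<comment> \<open>Completing the square: L |v| - v^2 / (4 r) is largest at |v| = 2 L r, with value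
		  L^2 r.\<close>
		have "0 <= (\<bar>v\<bar> - 2 * L * r)^2" by simp
		then have "4 * r * (L * \<bar>v\<bar>) <= v^2 + 4 * r * (L^2 * r)" by (simp add: power2_eq_square algebra_simps)
		then have "L * \<bar>v\<bar> <= (v^2 + 4 * r * (L^2 * r)) / (4 * r)" using t by (simp add: field_simps)
		also have "... = v^2 / (4 * r) + L^2 * r" using t by (simp add: add_divide_distrib)
		finally show ?thesis by simp
	qed
	then have "exp (L * \<bar>v\<bar>) * exp (- v\<^sup>2 / (4 * r)) <= exp (L^2 * r)" by (simp add: exp_add[symmetric])
	then have "(exp (L * \<bar>v\<bar>) * exp (- v\<^sup>2 / (4 * r))) * (sqrt 2 * gam (2 * r) v) <= exp (L^2 * r) * (sqrt 2 * gam (2 * r) v)"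
		using gam_nonneg[of "2 * r" v] t by (intro mult_right_mono) auto
	then show ?thesis unfolding gam_double[OF t] by (simp add: mult.assoc mult.left_commute)
qed

lemma v_gam: "0 < r ==> \<bar>v\<bar> / r * gam r v <= sqrt 2 / sqrt r * gam (2 * r) v"
proof -
	assume t: "0 < r"
	define x where "x = \<bar>v\<bar> / sqrt r"
	have x2: "x^2 / 4 = v^2 / (4 * r)" using t by (simp add: x_def power_divide)
	have "x <= 1 + x^2 / 4" using zero_le_power2[of "x / 2 - 1"] by (simp add: power2_eq_square algebra_simps)
	also have "... <= exp (v^2 / (4 * r))" unfolding x2[symmetric] by (rule exp_ge_add_one_self)
	finally have "x * exp (- v\<^sup>2 / (4 * r)) <= exp (v^2 / (4 * r)) * exp (- v\<^sup>2 / (4 * r))" by (intro mult_right_mono) auto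
	then have "x * exp (- v\<^sup>2 / (4 * r)) <= 1" by (simp add: exp_add[symmetric])
	then have "(x * exp (- v\<^sup>2 / (4 * r))) * (sqrt 2 / sqrt r * gam (2 * r) v) <= 1 * (sqrt 2 / sqrt r * gam (2 * r) v)"
		using gam_nonneg[of "2 * r" v] t by (intro mult_right_mono) auto
	moreover have "\<bar>v\<bar> / r = x / sqrt r" using t by (simp add: x_def)
	ultimately show ?thesis unfolding gam_double[OF t] by (simp add: mult.assoc mult.left_commute)
qed

lemma v_gam_exp:
	assumes t: "0 < r" and L: "0 <= L"
	shows "exp (L * \<bar>v\<bar>) * (\<bar>v\<bar> / r * gam r v) <= 2 * exp (2 * L^2 * r) / sqrt r * gam (4 * r) v"
proof -
	have "exp (L * \<bar>v\<bar>) * (\<bar>v\<bar> / r * gam r v) <= exp (L * \<bar>v\<bar>) * (sqrt 2 / sqrt r * gam (2 * r) v)"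
		by (intro mult_left_mono v_gam t) auto
	also have "... = sqrt 2 / sqrt r * (exp (L * \<bar>v\<bar>) * gam (2 * r) v)" by simp
	also have "... <= sqrt 2 / sqrt r * (sqrt 2 * exp (L^2 * (2 * r)) * gam (2 * (2 * r)) v)"
		using t L by (intro mult_left_mono gam_exp) auto
	also have "... = (sqrt 2 * sqrt 2) * exp (2 * L^2 * r) / sqrt r * gam (4 * r) v"
	proof -
		have e: "L^2 * (2 * r) = 2 * L^2 * r" "2 * (2 * r) = 4 * r" by simp_all
		show ?thesis unfolding e by (simp only: divide_inverse mult_ac)
	qed
	finally show ?thesis by simp
qed

text \<open>Killed Gaussian kernel on \<open>(-\<infinity>, l)\<close> and the joint density of Brownian motion and its maximum,
	extended continuously to the boundary \<open>y = l\<close>, \<open>y = m\<close>.\<close>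

definition gk :: "real => real => real => real => real" where
	"gk l r x y = (if x < l \<and> y <= l then gam r (x - y) - gam r (2 * l - x - y) else 0)"

definition rk :: "real => real => real => real => real" where
	"rk r x m y = (if x < m \<and> y <= m then 2 * ((2 * m - x - y) / r * gam r (2 * m - x - y)) else 0)"

lemma gk_meas [measurable (raw)]:
	assumes [measurable]: "a \<in> bm N" "b \<in> bm N" "c \<in> bm N" "d \<in> bm N"
	shows "(%z. gk (a z) (b z) (c z) (d z)) \<in> bm N"
	unfolding gk_def by measurable

lemma rk_meas [measurable (raw)]:
	assumes [measurable]: "a \<in> bm N" "b \<in> bm N" "c \<in> bm N" "d \<in> bm N"
	shows "(%z. rk (a z) (b z) (c z) (d z)) \<in> bm N"
	unfolding rk_def by measurable

lemma gk_nonneg: "0 < r ==> 0 <= gk l r x y"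
	using gam_antimono[of r "x - y" "2 * l - x - y"] by (auto simp: gk_def abs_if)

lemma gk_le: "0 < r ==> gk l r x y <= gam r (x - y)"
	using gam_nonneg by (auto simp: gk_def)

lemma rk_nonneg: "0 < r ==> 0 <= rk r x m y"
	using gam_nonneg[of r] by (auto simp: rk_def)

lemma rk_le: "0 < r ==> rk r x m y <= 2 * (sqrt 2 / sqrt r * gam (2 * r) (m - x))"
proof (cases "x < m \<and> y <= m")
	assume t: "0 < r"
	case True
	have "(2 * m - x - y) / r * gam r (2 * m - x - y) <= sqrt 2 / sqrt r * gam (2 * r) (2 * m - x - y)"
		using v_gam[OF t, of "2 * m - x - y"] True by simp
	also have "... <= sqrt 2 / sqrt r * gam (2 * r) (m - x)"
		using t True by (intro mult_left_mono gam_antimono) auto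
	finally show ?thesis using True by (simp add: rk_def)
qed (use gam_nonneg in \<open>auto simp: rk_def\<close>)

text \<open>As a function of m, \<open>rk\<close> is the derivative of - gam r (2 m - x - y). Thus
  the density of the maximum, integrated over levels below l, gives the kernel killed at l.\<close>

lemma rk_int:
	assumes t: "0 < r"
	shows "(NN m|lborel. ennreal (rk r x m y) * indicator {..<l} m) = ennreal (gk l r x y)"
proof (cases "max x y < l")
	case True
	let ?F = "%m. - gam r (2 * m - x - y)" and ?f = "%m. 2 * ((2 * m - x - y) / r * gam r (2 * m - x - y))"
	have "(NN m|lborel. ennreal (rk r x m y) * indicator {..<l} m) = (NN m|lborel. ennreal (?f m) * indicator {max x y..l} m)"
	proof (rule nn_integral_cong_AE)
		have "AE m in lborel. m \<noteq> x \<and> m \<noteq> l" by (intro AE_conjI AE_lborel_singleton)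
		then show "AE m in lborel. ennreal (rk r x m y) * indicator {..<l} m = ennreal (?f m) * indicator {max x y..l} m"
			by eventually_elim (auto simp: rk_def indicator_def)
	qed
	also have "... = ennreal (?F l - ?F (max x y))"
	proof (rule nn_integral_FTC_Icc[where F="?F"])
		show "?f \<in> bm borel" by measurable
		have d: "(?F has_real_derivative ?f m) (at m)" for m
		proof -
			have "((%m. 2 * m - x - y) has_real_derivative 2) (at m)" by (auto intro!: derivative_eq_intros)
			from DERIV_minus[OF DERIV_chain2[OF gam_deriv[OF t] this]] show ?thesis
				by (rule DERIV_cong) (simp add: algebra_simps diff_divide_distrib add_divide_distrib)
		qed
		fix m assume m: "m \<in> {max x y..l}"
		show "(?F has_real_derivative ?f m) (at m)" by (rule d)
		show "0 <= ?f m" using m t gam_nonneg[OF t] by auto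
	qed (use True in auto)
	also have "?F l - ?F (max x y) = gk l r x y"
		using True gam_commute[of r x y] by (auto simp: gk_def max_def)
	finally show ?thesis .
next
	case False
	then have "ennreal (rk r x m y) * indicator {..<l} m = 0" for m by (auto simp: rk_def indicator_def)
	moreover have "gk l r x y = 0"
		using False gam_commute[of r x y] by (cases "y = l") (auto simp: gk_def max_def split: if_splits)
	ultimately show ?thesis by (simp only: nn_integral_0_iff_AE nn_integral_const mult_zero_left ennreal_0)
qed

text \<open>Here m' is a maximum reached in the past. Either the path from z stays below m', with
  kernel \<open>gk m'\<close>, or it sets a new maximum between m' and l.\<close>

lemma rk_int_from:
	assumes t: "0 < r" and "m' <= l" and z: "z <= m'"
	shows "ennreal (gk m' r z y) + (NN m|lborel. ennreal (rk r z m y) * indicator {m'<..} m * indicator {..<l} m) = ennreal (gk l r z y)"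
proof -
	have "(NN m|lborel. ennreal (rk r z m y) * indicator {..<l} m) =
		(NN m|lborel. ennreal (rk r z m y) * indicator {..<m'} m + ennreal (rk r z m y) * indicator {m'<..} m * indicator {..<l} m)"
	proof (rule nn_integral_cong_AE)
		have "AE m in lborel. m \<noteq> m'" by (rule AE_lborel_singleton)
		then show "AE m in lborel. ennreal (rk r z m y) * indicator {..<l} m =
			ennreal (rk r z m y) * indicator {..<m'} m + ennreal (rk r z m y) * indicator {m'<..} m * indicator {..<l} m"
			by eventually_elim (use assms(2) in \<open>auto simp: indicator_def\<close>)
	qed
	also have "... = (NN m|lborel. ennreal (rk r z m y) * indicator {..<m'} m) + (NN m|lborel. ennreal (rk r z m y) * indicator {m'<..} m * indicator {..<l} m)"
		by (rule nn_integral_add) measurable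
	finally show ?thesis unfolding rk_int[OF t] by simp
qed

lemma gam_tendsto_0:
	assumes "0 < \<rho>"
	shows "((%e. gam e \<rho>) \<longlongrightarrow> 0) (at_right 0)"
proof (rule tendsto_sandwich[of "%_. 0" _ _ "%e. 4 * sqrt e / \<rho>^2"])
	have b: "gam e \<rho> <= 4 * sqrt e / \<rho>^2" if "0 < e" for e
	proof -
		define q where "q = \<rho>^2 / (2 * e)"
		have q: "0 < q" using assms that by (simp add: q_def)
		have "exp (- q) <= 1 / q"
		proof -
			have "q <= exp q" using exp_ge_add_one_self[of q] by linarith
			then have "1 / exp q <= 1 / q" using q by (intro divide_left_mono) auto
			then show ?thesis by (simp add: exp_minus inverse_eq_divide)
		qed
		moreover have "1 / sqrt (2 * pi * e) <= 1 / sqrt e"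
		proof (intro divide_left_mono)
			have "1 * e <= 2 * pi * e" using that pi_ge_two by (intro mult_right_mono) auto
			then show "sqrt e <= sqrt (2 * pi * e)" by simp
		qed (use that in auto)
		ultimately have "exp (- q) * (1 / sqrt (2 * pi * e)) <= 1 / q * (1 / sqrt e)"
			using q that by (intro mult_mono) auto
		also have "... = 2 * (e / sqrt e) / \<rho>^2" by (simp add: q_def)
		also have "e / sqrt e = sqrt e" using that by (simp add: real_div_sqrt)
		also have "2 * sqrt e / \<rho>^2 <= 4 * sqrt e / \<rho>^2" using that by (intro divide_right_mono) auto
		finally show ?thesis by (simp add: gam_def q_def)
	qed
	show "\<forall>\<^sub>F e in at_right 0. gam e \<rho> <= 4 * sqrt e / \<rho>^2"
		using b by (auto simp: eventually_at_right_less eventually_at_filter)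
	show "\<forall>\<^sub>F e in at_right 0. 0 <= gam e \<rho>"
		using gam_nonneg by (auto simp: eventually_at_filter)
	have "((%e. 4 * sqrt e / \<rho>^2) \<longlongrightarrow> 4 * sqrt 0 / \<rho>^2) (at_right 0)"
		using assms by (intro tendsto_intros) auto
	then show "((%e. 4 * sqrt e / \<rho>^2) \<longlongrightarrow> 0) (at_right 0)" by simp
qed simp

text \<open>For r > 0, the probability that Brownian motion from x stays below l up to time r and
  ends in (c, d).\<close>

definition gJ :: "real => real => real => real => real => ennreal" where
	"gJ c d l r x = (NN y|lborel. ennreal (gk l r x y) * indicator {c<..<d} y)"

lemma gJ_meas [measurable (raw)]:
	assumes [measurable]: "a \<in> bm N" "b \<in> bm N" "e \<in> bm N"
	shows "(%z. gJ c d (a z) (b z) (e z)) \<in> bm N"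
	unfolding gJ_def by (rule sigma_finite_measure.borel_measurable_nn_integral[OF sigma_finite_lborel]) measurable

lemma gJ_tendsto:
	assumes "\<tau> \<longlonglongrightarrow> \<tau>0" "0 < \<tau>0" and dec: "\<And>n. \<tau>0 <= \<tau> n"
	shows "(%n::nat. gJ c d l (\<tau> n) x) \<longlonglongrightarrow> gJ c d l \<tau>0 x"
	unfolding gJ_def
proof (rule nn_integral_dominated_convergence[where w="%y. ennreal (1 / sqrt \<tau>0) * indicator {c<..<d} y"])
	have t: "0 < \<tau> n" for n using dec[of n] assms(2) by simp
	have "gk l (\<tau> n) x y <= 1 / sqrt \<tau>0" for n y
	proof -
		have "gk l (\<tau> n) x y <= 1 / sqrt (\<tau> n)" using gk_le[OF t] gam_le[OF t] order_trans by blast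
		also have "... <= 1 / sqrt \<tau>0" using dec[of n] assms(2) t[of n] by (intro divide_left_mono) auto
		finally show ?thesis .
	qed
	then show "AE y in lborel. ennreal (gk l (\<tau> n) x y) * indicator {c<..<d} y <= ennreal (1 / sqrt \<tau>0) * indicator {c<..<d} y" for n
		by (intro AE_I2 mult_right_mono ennreal_leI) auto
	show "(NN y|lborel. ennreal (1 / sqrt \<tau>0) * indicator {c<..<d} y) < \<infinity>"
		by (cases "c <= d") (auto simp: nn_integral_cmult_indicator ennreal_mult_less_top)
	show "AE y in lborel. (%n. ennreal (gk l (\<tau> n) x y) * indicator {c<..<d} y) \<longlonglongrightarrow> ennreal (gk l \<tau>0 x y) * indicator {c<..<d} y"
		unfolding gk_def using assms
		by (intro AE_I2) (auto simp: indicator_def intro!: tendsto_ennrealI tendsto_diff gam_tendsto)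
qed auto

text \<open>Lower bound inside the interval: of the total Gaussian mass 1, Chebyshev's inequality
  removes at most e / \<rho>^2 outside (c, d), and the reflected kernel removes at most the length
  of (c, d) times the Gaussian at distance u - x. End points are excluded because half of the mass
  falls outside there.\<close>

lemma gJ_delta:
	assumes d: "d <= u" and x: "x < u" "x \<noteq> c" "x \<noteq> d"
		and e: "e \<longlonglongrightarrow> 0" "\<And>n. 0 < e n"
	shows "(%n::nat. gJ c d u (e n) x) \<longlonglongrightarrow> indicator {c<..<d} x"
proof -
	have fl: "filterlim e (at_right 0) sequentially"
		using e(1) e(2)[THEN less_imp_neq, symmetric] e(2) by (auto simp: filterlim_at intro!: always_eventually)
	have fin: "emeasure lborel {c<..<d} < \<infinity>" by (cases "c <= d") auto
	show ?thesis
	proof (cases "x \<in> {c<..<d}")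
		case False
		define \<rho> where "\<rho> = (if x < c then c - x else if d < x then x - d else 1)"
		have \<rho>: "0 < \<rho>" using False x by (auto simp: \<rho>_def)
		have ne: "\<rho> <= \<bar>x - y\<bar>" if "y \<in> {c<..<d}" for y using that False x by (auto simp: \<rho>_def)
		have "gJ c d u (e n) x <= (NN y|lborel. ennreal (gam (e n) \<rho>) * indicator {c<..<d} y)" for n
			unfolding gJ_def using ne \<rho> e(2)
			by (intro nn_integral_mono) (auto simp: indicator_def intro!: ennreal_leI order_trans[OF gk_le] gam_antimono)
		then have le: "gJ c d u (e n) x <= emeasure lborel {c<..<d} * ennreal (gam (e n) \<rho>)" for n
			by (simp add: nn_integral_cmult_indicator mult.commute)
		have "(%n. emeasure lborel {c<..<d} * ennreal (gam (e n) \<rho>)) \<longlonglongrightarrow> emeasure lborel {c<..<d} * ennreal 0"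
			using fin by (intro ennreal_tendsto_cmult tendsto_ennrealI filterlim_compose[OF gam_tendsto_0[OF \<rho>] fl]) auto
		then have l0: "(%n. emeasure lborel {c<..<d} * ennreal (gam (e n) \<rho>)) \<longlonglongrightarrow> 0" by simp
		have "(%n. gJ c d u (e n) x) \<longlonglongrightarrow> 0"
			by (rule tendsto_sandwich[OF _ _ tendsto_const l0]) (simp_all add: le)
		then show ?thesis using False by simp
	next
		case True
		define \<rho> where "\<rho> = min (x - c) (d - x)"
		have \<rho>: "0 < \<rho>" using True by (auto simp: \<rho>_def)
		define g1 where "g1 n = (NN y|lborel. ennreal (gam (e n) (y - x)) * indicator {c<..<d} y)" for n
		have up: "gJ c d u (e n) x <= 1" for n
		proof -
			have "gJ c d u (e n) x <= (NN y|lborel. ennreal (gam (e n) (y - x)))"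
				unfolding gJ_def
				by (intro nn_integral_mono) (auto simp: indicator_def gam_commute[of _ _ x] intro!: ennreal_leI gk_le[OF e(2)])
			then show ?thesis by (simp add: nn_integral_gam[OF e(2)])
		qed
		have low: "1 <= gJ c d u (e n) x + (ennreal (e n / \<rho>^2) + emeasure lborel {c<..<d} * ennreal (gam (e n) (u - x)))" for n
		proof -
			have "1 = (NN y|lborel. ennreal (gam (e n) (y - x)))" by (simp add: nn_integral_gam[OF e(2)])
			also have "... <= (NN y|lborel. ennreal (gk u (e n) x y) * indicator {c<..<d} y +
				 (ennreal (1 / \<rho>^2) * ennreal ((y - x)^2 * gam (e n) (y - x)) + ennreal (gam (e n) (u - x)) * indicator {c<..<d} y))"
			proof (intro nn_integral_mono)
				fix y
				show "ennreal (gam (e n) (y - x)) <= ennreal (gk u (e n) x y) * indicator {c<..<d} y +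
				 (ennreal (1 / \<rho>^2) * ennreal ((y - x)^2 * gam (e n) (y - x)) + ennreal (gam (e n) (u - x)) * indicator {c<..<d} y)"
				proof (cases "y \<in> {c<..<d}")
					case True
					have "gam (e n) (2 * u - x - y) <= gam (e n) (u - x)"
						using True d x e(2) by (intro gam_antimono) auto
					then have "gam (e n) (y - x) <= gk u (e n) x y + gam (e n) (u - x)"
						using True d x gam_commute[of "e n" x y] by (auto simp: gk_def)
					then have "ennreal (gam (e n) (y - x)) <= ennreal (gk u (e n) x y) + ennreal (gam (e n) (u - x))"
						using gk_nonneg[OF e(2)] gam_nonneg[OF e(2)] by (simp add: ennreal_leI flip: ennreal_plus)
					also have "... <= ennreal (gk u (e n) x y) + (ennreal (1 / \<rho>^2) * ennreal ((y - x)^2 * gam (e n) (y - x)) + ennreal (gam (e n) (u - x)))"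
						by (intro add_left_mono) simp
					finally show ?thesis using True by simp
				next
					case False
					then have "\<rho> <= \<bar>y - x\<bar>" using \<open>x \<in> {c<..<d}\<close> by (auto simp: \<rho>_def)
					then have "\<rho>^2 <= (y - x)^2" using \<rho> by (simp add: abs_le_square_iff[symmetric])
					then have "1 <= (y - x)^2 / \<rho>^2" using \<rho> by simp
					then have "1 * gam (e n) (y - x) <= (y - x)^2 / \<rho>^2 * gam (e n) (y - x)"
						using gam_nonneg[OF e(2)] by (intro mult_right_mono) auto
					then have "ennreal (gam (e n) (y - x)) <= ennreal (1 / \<rho>^2 * ((y - x)^2 * gam (e n) (y - x)))"
						by (intro ennreal_leI) simp
					also have "... = ennreal (1 / \<rho>^2) * ennreal ((y - x)^2 * gam (e n) (y - x))"
						by (rule ennreal_mult) (auto intro!: mult_nonneg_nonneg gam_nonneg e(2))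
					finally show ?thesis using False by simp
				qed
			qed
			also have "... = gJ c d u (e n) x + ((NN y|lborel. ennreal (1 / \<rho>^2) * ennreal ((y - x)^2 * gam (e n) (y - x)))
				 + (NN y|lborel. ennreal (gam (e n) (u - x)) * indicator {c<..<d} y))"
				unfolding gJ_def by (subst nn_integral_add, measurable) (subst nn_integral_add, measurable)
			also have "(NN y|lborel. ennreal (1 / \<rho>^2) * ennreal ((y - x)^2 * gam (e n) (y - x))) = ennreal (1 / \<rho>^2) * ennreal (e n)"
				by (subst nn_integral_cmult) (auto simp: nn_integral_gam_sq[OF e(2)])
			also have "... = ennreal (e n / \<rho>^2)" using e(2)[of n] by (simp add: ennreal_mult[symmetric])
			finally show ?thesis by (simp add: nn_integral_cmult_indicator mult.commute[of "emeasure lborel {c<..<d}"])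
		qed
		let ?r = "%n. ennreal (e n / \<rho>^2) + emeasure lborel {c<..<d} * ennreal (gam (e n) (u - x))"
		have "?r \<longlonglongrightarrow> ennreal (0 / \<rho>^2) + emeasure lborel {c<..<d} * ennreal 0"
			using fin x \<rho> by (intro tendsto_add ennreal_tendsto_cmult tendsto_ennrealI filterlim_compose[OF gam_tendsto_0 fl] tendsto_divide e tendsto_const) auto
		then have r0: "?r \<longlonglongrightarrow> 0" by simp
		have "(%n. 1 - ?r n) \<longlonglongrightarrow> 1 - 0" by (intro tendsto_diff_ennreal tendsto_const r0) auto
		then have l: "(%n. 1 - ?r n) \<longlonglongrightarrow> 1" by simp
		have "(%n. gJ c d u (e n) x) \<longlonglongrightarrow> 1"
		proof (rule tendsto_sandwich[OF _ _ l tendsto_const])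
			show "\<forall>\<^sub>F n in sequentially. 1 - ?r n <= gJ c d u (e n) x"
				using low by (intro always_eventually allI) (metis add.commute ennreal_minus_le_iff ennreal_one_neq_top)
			show "\<forall>\<^sub>F n in sequentially. gJ c d u (e n) x <= 1" using up by simp
		qed
		then show ?thesis using True by simp
	qed
qed

section \<open>The density of the transformed process\<close>

definition add_measure :: "'a measure => 'a measure => 'a measure" where
	"add_measure M N = measure_of (space M) (sets M) (%A. emeasure M A + emeasure N A)"

lemma add_measure:
	assumes "sets N = sets M"
	shows "sets (add_measure M N) = sets M" "space (add_measure M N) = space M"
		and "A \<in> sets M ==> emeasure (add_measure M N) A = emeasure M A + emeasure N A"
proof -
	show "sets (add_measure M N) = sets M" "space (add_measure M N) = space M"
		unfolding add_measure_def by auto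
	assume A: "A \<in> sets M"
	show "emeasure (add_measure M N) A = emeasure M A + emeasure N A"
		unfolding add_measure_def
	proof (rule emeasure_measure_of_sigma)
		show "sigma_algebra (space M) (sets M)" ..
		show "positive (sets M) (%A. emeasure M A + emeasure N A)" by (auto simp: positive_def)
		show "countably_additive (sets M) (%A. emeasure M A + emeasure N A)"
		proof (rule countably_additiveI)
			fix B :: "nat => 'a set" assume B: "range B \<subseteq> sets M" "disjoint_family B" "(\<Union>i. B i) \<in> sets M"
			have "(\<Sum>i. emeasure M (B i)) = emeasure M (\<Union>i. B i)" by (rule suminf_emeasure) (use B in auto)
			moreover have "(\<Sum>i. emeasure N (B i)) = emeasure N (\<Union>i. B i)" by (rule suminf_emeasure) (use B assms in auto)
			ultimately show "(\<Sum>i. emeasure M (B i) + emeasure N (B i)) = emeasure M (\<Union>i. B i) + emeasure N (\<Union>i. B i)"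
				by (subst suminf_add[symmetric]) auto
		qed
	qed (rule A)
qed

text \<open>Killed kernels describe the event that the maximum lies below a level, hence half-lines
  in the first coordinate.\<close>

definition box_gen :: "(real \<times> real) set set" where
	"box_gen = {{..<a} \<times> {c<..<d} | a c d. True}"

lemma Int_stable_box_gen: "Int_stable box_gen"
proof (rule Int_stableI)
	fix S S' assume "S \<in> box_gen" "S' \<in> box_gen"
	then obtain a c d a' c' d' where "S = {..<a} \<times> {c<..<d}" "S' = {..<a'} \<times> {c'<..<d'}"
		unfolding box_gen_def by auto
	then have "S \<inter> S' = {..<min a a'} \<times> {max c c'<..<min d d'}" by auto
	then show "S \<inter> S' \<in> box_gen" unfolding box_gen_def by blast
qed

lemma sets_box_gen: "sets (borel :: (real \<times> real) measure) = sigma_sets UNIV box_gen"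
proof
	have "{..<a} \<times> {c<..<d} \<in> sets (borel :: (real \<times> real) measure)" for a c d :: real
		by (simp add: borel_prod[symmetric])
	then have "box_gen \<subseteq> sets (borel :: (real \<times> real) measure)" unfolding box_gen_def by auto
	from sets.sigma_sets_subset[OF this] show "sigma_sets UNIV box_gen \<subseteq> sets (borel :: (real \<times> real) measure)" by simp
	interpret S: sigma_algebra UNIV "sigma_sets UNIV box_gen" by (rule sigma_algebra_sigma_sets) auto
	have g: "{..<a} \<times> {c<..<d} \<in> sigma_sets UNIV box_gen" for a c d
		by (rule sigma_sets.Basic) (auto simp: box_gen_def)
	have b: "box p q \<in> sigma_sets UNIV box_gen" for p q :: "real \<times> real"
	proof -
		have "box p q = (\<Union>n::nat. {..<fst q} \<times> {snd p<..<snd q} - {..<fst p + 1 / real (Suc n)} \<times> {snd p<..<snd q})"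
		proof (intro set_eqI iffI)
			fix z assume "z \<in> box p q"
			moreover obtain x y where z: "z = (x, y)" by (cases z)
			ultimately have xy: "fst p < x" "x < fst q" "snd p < y" "y < snd q" by (auto simp: box_def Basis_prod_def inner_prod_def)
			obtain n where "1 / real (Suc n) < x - fst p" using nat_approx_posE[of "x - fst p"] xy by auto
			then show "z \<in> (\<Union>n::nat. {..<fst q} \<times> {snd p<..<snd q} - {..<fst p + 1 / real (Suc n)} \<times> {snd p<..<snd q})"
				using xy unfolding z by (intro UN_I[of n]) auto
		next
			fix z assume zz: "z \<in> (\<Union>n::nat. {..<fst q} \<times> {snd p<..<snd q} - {..<fst p + 1 / real (Suc n)} \<times> {snd p<..<snd q})"
			obtain x y where z: "z = (x, y)" by (cases z)
			with zz obtain n where "x \<in> {..<fst q}" "y \<in> {snd p<..<snd q}" "(x, y) \<notin> {..<fst p + 1 / real (Suc n)} \<times> {snd p<..<snd q}"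
				by auto
			then have *: "x < fst q" "snd p < y" "y < snd q" "fst p + 1 / real (Suc n) <= x" by auto
			moreover have "0 < 1 / real (Suc n)" by simp
			ultimately have "fst p < x" by linarith
			with * show "z \<in> box p q" unfolding z by (auto simp: box_def Basis_prod_def inner_prod_def)
		qed
		also have "... \<in> sigma_sets UNIV box_gen"
			by (rule S.countable_nat_UN) (use S.Diff[OF g g] in blast)
		finally show ?thesis .
	qed
	have "sets (borel :: (real \<times> real) measure) = sigma_sets UNIV (range (%(a, b). box a b))"
		by (simp add: borel_eq_box)
	also have "... \<subseteq> sigma_sets UNIV box_gen"
		by (rule S.sigma_sets_subset) (use b in auto)
	finally show "sets (borel :: (real \<times> real) measure) \<subseteq> sigma_sets UNIV box_gen" .
qed

lemma measure_eqI_box_gen: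
	fixes M N :: "(real \<times> real) measure"
	assumes "sets M = sets borel" "sets N = sets borel"
		and eq: "\<And>a c d. emeasure M ({..<a} \<times> {c<..<d}) = emeasure N ({..<a} \<times> {c<..<d})"
		and fin: "\<And>a c d. emeasure M ({..<a} \<times> {c<..<d}) \<noteq> \<infinity>"
	shows "M = N"
proof (rule measure_eqI_generator_eq[OF Int_stable_box_gen, of UNIV M N "%n. {..<real n} \<times> {- real n<..<real n}"])
	show "\<And>X. X \<in> box_gen ==> emeasure M X = emeasure N X" using eq unfolding box_gen_def by auto
	show "sets M = sigma_sets UNIV box_gen" "sets N = sigma_sets UNIV box_gen" using assms sets_box_gen by auto
	show "range (%n. {..<real n} \<times> {- real n<..<real n}) \<subseteq> box_gen" unfolding box_gen_def by auto
	show "(\<Union>n. {..<real n} \<times> {- real n<..<real n}) = UNIV"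
	proof (safe; simp)
		fix a b :: real
		obtain n where "max a \<bar>b\<bar> < real n" using reals_Archimedean2 by blast
		then show "\<exists>n. a < real n \<and> - real n < b \<and> b < real n" by (intro exI[of _ n]) auto
	qed
	show "emeasure M ({..<real n} \<times> {- real n<..<real n}) \<noteq> \<infinity>" for n by (rule fin)
qed auto

text \<open>Radon-Nikodym with a bound at every point. Replacing u by the maximum of f and u leaves
  the measure with density u unchanged, so f exceeds u on a null set only and the minimum of both is
  again a density.\<close>

lemma (in sigma_finite_measure) density_dominated:
	assumes N: "sets N = sets M" and [measurable]: "u \<in> bm M"
		and le: "\<And>S. S \<in> sets M ==> emeasure N S <= (NN x|M. u x * indicator S x)"
	obtains D where "D \<in> bm M" "\<And>x. D x <= u x" "N = density M D"
proof -
	have "absolutely_continuous M N"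
		unfolding absolutely_continuous_def
	proof
		fix S assume S: "S \<in> null_sets M"
		have "emeasure N S <= (NN x|M. u x * indicator S x)" using S by (intro le) auto
		also have "... = 0" using S by (subst nn_integral_0_iff_AE) (auto dest: AE_not_in elim!: eventually_mono)
		finally show "S \<in> null_sets N" using S N by auto
	qed
	from Radon_Nikodym[OF this N] obtain f where f [measurable]: "f \<in> bm M" and Nf: "density M f = N" by blast
	have "density M (%x. max (f x) (u x)) = density M u"
	proof (rule measure_eqI)
		fix A assume "A \<in> sets (density M (%x. max (f x) (u x)))"
		then have [measurable]: "A \<in> sets M" by simp
		let ?B = "{x\<in>space M. u x < f x}"
		have B [measurable]: "?B \<in> sets M" by measurable
		have "(NN x|M. max (f x) (u x) * indicator A x) = (NN x|M. f x * indicator (A \<inter> ?B) x + u x * indicator (A - ?B) x)"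
			by (rule nn_integral_cong) (auto simp: indicator_def max_def)
		also have "... = (NN x|M. f x * indicator (A \<inter> ?B) x) + (NN x|M. u x * indicator (A - ?B) x)"
			by (rule nn_integral_add) auto
		also have "(NN x|M. f x * indicator (A \<inter> ?B) x) = emeasure N (A \<inter> ?B)"
			unfolding Nf[symmetric] by (simp add: emeasure_density)
		also have "... + (NN x|M. u x * indicator (A - ?B) x) <= (NN x|M. u x * indicator (A \<inter> ?B) x) + (NN x|M. u x * indicator (A - ?B) x)"
			by (intro add_right_mono le) auto
		also have "... = (NN x|M. u x * indicator (A \<inter> ?B) x + u x * indicator (A - ?B) x)"
			by (rule nn_integral_add[symmetric]) auto
		also have "... = (NN x|M. u x * indicator A x)"
			by (rule nn_integral_cong) (auto simp: indicator_def)
		finally have "(NN x|M. max (f x) (u x) * indicator A x) <= (NN x|M. u x * indicator A x)" .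
		moreover have "(NN x|M. u x * indicator A x) <= (NN x|M. max (f x) (u x) * indicator A x)"
			by (intro nn_integral_mono mult_right_mono) auto
		ultimately show "emeasure (density M (%x. max (f x) (u x))) A = emeasure (density M u) A"
			by (simp add: emeasure_density)
	qed simp
	then have "AE x in M. max (f x) (u x) = u x" by (intro density_unique) auto
	then have ae: "AE x in M. f x <= u x" by eventually_elim (metis max.cobounded1)
	show thesis
	proof (rule that[of "%x. min (f x) (u x)"])
		show "N = density M (%x. min (f x) (u x))"
			unfolding Nf[symmetric] using ae by (intro density_cong) (auto elim!: eventually_mono simp: min_def)
	qed auto
qed

lemma nn_integral_inv_sqrt:
	assumes "0 < t"
	shows "(NN s|lborel. ennreal (1 / sqrt s) * indicator {0<..<t} s) < \<infinity>"
proof -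
	have hi: "((%x. x powr (- 1/2)) has_integral t powr (- 1/2 + 1) / (- 1/2 + 1)) {0..t}"
		by (rule has_integral_powr_from_0) (use assms in auto)
	have "((%x. x powr (- 1/2) * indicator {0..t} x) has_integral t powr (- 1/2 + 1) / (- 1/2 + 1)) UNIV"
	proof -
		have "(%x::real. x powr (- 1/2) * indicator {0..t} x) = (%x. if x \<in> {0..t} then x powr (- 1/2) else 0)"
			by (auto simp: indicator_def)
		then show ?thesis using hi by (simp only: has_integral_restrict_UNIV)
	qed
	then have "(NN x|lborel. ennreal (x powr (- 1/2) * indicator {0..t} x)) = ennreal (t powr (- 1/2 + 1) / (- 1/2 + 1))"
		by (intro nn_integral_has_integral_lborel) auto
	moreover have "(NN s|lborel. ennreal (1 / sqrt s) * indicator {0<..<t} s) <= (NN x|lborel. ennreal (x powr (- 1/2) * indicator {0..t} x))"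
		by (intro nn_integral_mono) (auto simp: indicator_def powr_half_sqrt[symmetric] powr_minus_divide)
	ultimately show ?thesis by (metis ennreal_less_top infinity_ennreal_def le_less_trans)
qed

text \<open>On each half of (0, t) one of the two factors is at most 1 / sqrt (t / 2).\<close>

lemma nn_integral_inv_sqrt2:
	assumes "0 < t"
	shows "(NN s|lborel. ennreal (1 / sqrt s * (1 / sqrt (t - s))) * indicator {0<..<t} s) < \<infinity>"
proof -
	have r: "(NN s|lborel. ennreal (1 / sqrt (t - s)) * indicator {0<..<t} s) = (NN s|lborel. ennreal (1 / sqrt s) * indicator {0<..<t} s)"
		by (subst nn_integral_real_affine[where c="-1" and t=t]) (auto simp: indicator_def intro!: nn_integral_cong)
	have "(NN s|lborel. ennreal (1 / sqrt s * (1 / sqrt (t - s))) * indicator {0<..<t} s) <=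
		(NN s|lborel. ennreal (1 / sqrt (t / 2)) * (ennreal (1 / sqrt s) * indicator {0<..<t} s + ennreal (1 / sqrt (t - s)) * indicator {0<..<t} s))"
	proof (intro nn_integral_mono)
		fix s
		show "ennreal (1 / sqrt s * (1 / sqrt (t - s))) * indicator {0<..<t} s <=
			 ennreal (1 / sqrt (t / 2)) * (ennreal (1 / sqrt s) * indicator {0<..<t} s + ennreal (1 / sqrt (t - s)) * indicator {0<..<t} s)"
		proof (cases "s \<in> {0<..<t}")
			case True
			have "1 / sqrt s * (1 / sqrt (t - s)) <= 1 / sqrt (t / 2) * (1 / sqrt s + 1 / sqrt (t - s))"
			proof (cases "s <= t / 2")
				case le: True
				have "1 / sqrt (t - s) <= 1 / sqrt (t / 2)" using True le by (intro divide_left_mono) auto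
				then have "1 / sqrt s * (1 / sqrt (t - s)) <= 1 / sqrt s * (1 / sqrt (t / 2))" using True by (intro mult_left_mono) auto
				moreover have "0 <= 1 / sqrt (t / 2) * (1 / sqrt (t - s))" using True by auto
				ultimately show ?thesis unfolding distrib_left mult.commute[of "1 / sqrt (t / 2)" "1 / sqrt s"] by linarith
			next
				case ge: False
				have "1 / sqrt s <= 1 / sqrt (t / 2)" using True ge by (intro divide_left_mono) auto
				then have "1 / sqrt s * (1 / sqrt (t - s)) <= 1 / sqrt (t / 2) * (1 / sqrt (t - s))" using True by (intro mult_right_mono) auto
				moreover have "0 <= 1 / sqrt (t / 2) * (1 / sqrt s)" using True by auto
				ultimately show ?thesis unfolding distrib_left by linarith
			qed
			then have "ennreal (1 / sqrt s * (1 / sqrt (t - s))) <= ennreal (1 / sqrt (t / 2) * (1 / sqrt s + 1 / sqrt (t - s)))" by (rule ennreal_leI)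
			also have "... = ennreal (1 / sqrt (t / 2)) * (ennreal (1 / sqrt s) + ennreal (1 / sqrt (t - s)))"
				using True by (subst ennreal_mult) (auto intro!: add_nonneg_nonneg)
			finally show ?thesis using True by simp
		qed simp
	qed
	also have "... = ennreal (1 / sqrt (t / 2)) * ((NN s|lborel. ennreal (1 / sqrt s) * indicator {0<..<t} s) + (NN s|lborel. ennreal (1 / sqrt (t - s)) * indicator {0<..<t} s))"
		by (subst nn_integral_cmult) (auto simp: nn_integral_add)
	also have "... < \<infinity>" using nn_integral_inv_sqrt[OF assms] unfolding r by (auto simp: ennreal_mult_less_top)
	finally show ?thesis .
qed

text \<open>\<open>Y\<close> and \<open>N\<close> stand for \<phi>(X) and \<phi>(M).
  \<open>H\<close> is Duhamel's formula tested with the killed kernel with pole y. The splitting w1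
  - w2 = V - \<kappa> puts each term on the side where it is nonnegative, so the equation lives in
  \<open>ennreal\<close>; the positive \<epsilon> keeps the kernel regular up to time t.\<close>

locale flat = prob_space P for P :: "'w measure" +
	fixes Y N :: "real => 'w => real" and \<eta> V :: "real => real" and L K :: real
	assumes Ym: "(%(s, w). Y s w) \<in> bm (borel \<Otimes>\<^sub>M P)"
		and Nm: "(%(s, w). N s w) \<in> bm (borel \<Otimes>\<^sub>M P)"
		and YN: "\<And>w s. w \<in> space P ==> Y s w <= N s w"
		and N0: "\<And>w. w \<in> space P ==> N 0 w = Y 0 w"
		and \<eta>_pos: "\<And>x. 0 < \<eta> x" and \<eta>_lip: "\<And>x y. \<eta> x <= \<eta> y * exp (L * \<bar>x - y\<bar>)"
		and \<eta>_m [measurable]: "\<eta> \<in> bm borel" and L0: "0 <= L" and K0: "0 <= K"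
		and V_m [measurable]: "V \<in> bm borel" and V_bd: "\<And>x. \<bar>V x\<bar> <= K"
		and H: "\<And>w1 w2 \<kappa> t \<epsilon> y \<alpha>. w1 \<in> bm borel ==> w2 \<in> bm borel ==>
			(\<And>x. 0 <= w1 x \<and> w1 x <= 2 * K) ==> (\<And>x. 0 <= w2 x \<and> w2 x <= 2 * K) ==> (\<And>x. w1 x - w2 x = V x - \<kappa>) ==>
			0 < t ==> 0 < \<epsilon> ==> y <= \<alpha> ==>
			(NN w|P. ennreal (exp (\<kappa> * t) * \<eta> (Y t w)) * indicator {..<\<alpha>} (N t w) * ennreal (gk \<alpha> \<epsilon> (Y t w) y))
			+ (NN z|(P \<Otimes>\<^sub>M lborel). ennreal (exp (\<kappa> * snd z) * w1 (Y (snd z) (fst z)) * \<eta> (Y (snd z) (fst z))) * indicator {..<\<alpha>} (N (snd z) (fst z))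
					 * indicator {0..<t} (snd z) * ennreal (gk \<alpha> (t + \<epsilon> - snd z) (Y (snd z) (fst z)) y))
			= (NN w|P. ennreal (\<eta> (Y 0 w)) * indicator {..<\<alpha>} (N 0 w) * ennreal (gk \<alpha> (t + \<epsilon>) (Y 0 w) y))
			+ (NN z|(P \<Otimes>\<^sub>M lborel). ennreal (exp (\<kappa> * snd z) * w2 (Y (snd z) (fst z)) * \<eta> (Y (snd z) (fst z))) * indicator {..<\<alpha>} (N (snd z) (fst z))
					 * indicator {0..<t} (snd z) * ennreal (gk \<alpha> (t + \<epsilon> - snd z) (Y (snd z) (fst z)) y))"
begin

sublocale PL: pair_sigma_finite P lborel ..

lemma PL_sf: "sigma_finite_measure (P \<Otimes>\<^sub>M lborel)" ..

lemma Y_raw [measurable (raw)]: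
	assumes "a \<in> bm Q" "b \<in> Q \<rightarrow>\<^sub>M P"
	shows "(%z. Y (a z) (b z)) \<in> bm Q"
	using measurable_compose[OF measurable_Pair[OF assms] Ym] by simp

lemma N_raw [measurable (raw)]:
	assumes "a \<in> bm Q" "b \<in> Q \<rightarrow>\<^sub>M P"
	shows "(%z. N (a z) (b z)) \<in> bm Q"
	using measurable_compose[OF measurable_Pair[OF assms] Nm] by simp

lemma \<eta>_nonneg: "0 <= \<eta> x" using \<eta>_pos[of x] by simp

text \<open>The weight changes at most exponentially with the distance, so it can be moved from x to
  y by \<open>gam_exp\<close>, at the price of a doubled variance.\<close>

lemma eta_gam: "0 < r ==> \<eta> x * gam r (x - y) <= sqrt 2 * exp (L^2 * r) * \<eta> y * gam (2 * r) (x - y)"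
proof -
	assume t: "0 < r"
	have "\<eta> x * gam r (x - y) <= (\<eta> y * exp (L * \<bar>x - y\<bar>)) * gam r (x - y)"
		by (intro mult_right_mono \<eta>_lip gam_nonneg t)
	also have "... = \<eta> y * (exp (L * \<bar>x - y\<bar>) * gam r (x - y))" by simp
	also have "... <= \<eta> y * (sqrt 2 * exp (L^2 * r) * gam (2 * r) (x - y))"
		by (intro mult_left_mono gam_exp t L0 \<eta>_nonneg)
	finally show ?thesis by (simp add: mult_ac)
qed

text \<open>Bound for the weighted killed semigroup, uniform in the starting point although the
  weight may be unbounded: the weight is moved into the bounded interval (c, d).\<close>

definition Bd :: "real => real => real => real" where
	"Bd T c d = sqrt 2 * exp (L^2 * T) * (\<eta> c * exp (L * \<bar>d - c\<bar>))"

lemma Bd_nonneg: "0 <= Bd T c d" unfolding Bd_def using \<eta>_nonneg by auto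

lemma eta_gJ:
	assumes "0 < r" "r <= T"
	shows "ennreal (\<eta> x) * gJ c d l r x <= ennreal (Bd T c d)"
proof -
	have "ennreal (\<eta> x) * gJ c d l r x = (NN y|lborel. ennreal (\<eta> x) * (ennreal (gk l r x y) * indicator {c<..<d} y))"
		unfolding gJ_def by (rule nn_integral_cmult[symmetric]) measurable
	also have "... <= (NN y|lborel. ennreal (Bd T c d) * ennreal (gam (2 * r) (y - x)))"
	proof (rule nn_integral_mono)
		fix y
		show "ennreal (\<eta> x) * (ennreal (gk l r x y) * indicator {c<..<d} y) <= ennreal (Bd T c d) * ennreal (gam (2 * r) (y - x))"
		proof (cases "y \<in> {c<..<d}")
			case True
			have "\<eta> x * gk l r x y <= \<eta> x * gam r (x - y)" by (intro mult_left_mono gk_le \<eta>_nonneg assms)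
			also have "... <= sqrt 2 * exp (L^2 * r) * \<eta> y * gam (2 * r) (x - y)" by (rule eta_gam[OF assms(1)])
			also have "... <= Bd T c d * gam (2 * r) (x - y)"
			proof (rule mult_right_mono)
				have "\<eta> y <= \<eta> c * exp (L * \<bar>y - c\<bar>)" by (rule \<eta>_lip)
				also have "... <= \<eta> c * exp (L * \<bar>d - c\<bar>)" using True L0 \<eta>_nonneg by (intro mult_left_mono) (auto intro!: mult_left_mono)
				finally have "\<eta> y <= \<eta> c * exp (L * \<bar>d - c\<bar>)" .
				moreover have "exp (L^2 * r) <= exp (L^2 * T)" using assms by (simp add: mult_left_mono)
				ultimately show "sqrt 2 * exp (L^2 * r) * \<eta> y <= Bd T c d" unfolding Bd_def using \<eta>_nonneg by (intro mult_mono) auto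
			qed (use gam_nonneg assms in auto)
			finally have "ennreal (\<eta> x * gk l r x y) <= ennreal (Bd T c d * gam (2 * r) (x - y))" by (rule ennreal_leI)
			then show ?thesis
				using True \<eta>_nonneg gk_nonneg[OF assms(1)] Bd_nonneg gam_nonneg[of "2 * r"] assms
				by (simp add: ennreal_mult gam_commute[of _ x])
		qed simp
	qed
	also have "... = ennreal (Bd T c d)"
		using assms nn_integral_gam[of "2 * r" x] by (subst nn_integral_cmult) auto
	finally show ?thesis .
qed

lemma swap_gJ:
	assumes "sigma_finite_measure Q" and [measurable]: "h \<in> bm Q" "r \<in> bm Q" "x \<in> bm Q"
	shows "(NN y|lborel. (NN z|Q. h z * ennreal (gk l (r z) (x z) y)) * indicator {c<..<d} y) = (NN z|Q. h z * gJ c d l (r z) (x z))"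
proof -
	interpret Q: sigma_finite_measure Q by fact
	interpret QL: pair_sigma_finite Q lborel ..
	have "(NN y|lborel. (NN z|Q. h z * ennreal (gk l (r z) (x z) y)) * indicator {c<..<d} y)
		 = (NN y|lborel. (NN z|Q. h z * (ennreal (gk l (r z) (x z) y) * indicator {c<..<d} y)))"
		by (subst nn_integral_multc[symmetric]) (auto simp: mult.assoc)
	also have "... = (NN z|Q. (NN y|lborel. h z * (ennreal (gk l (r z) (x z) y) * indicator {c<..<d} y)))"
		by (rule QL.Fubini') measurable
	also have "... = (NN z|Q. h z * gJ c d l (r z) (x z))"
		unfolding gJ_def by (intro nn_integral_cong nn_integral_cmult) measurable
	finally show ?thesis .
qed

text \<open>\<open>H\<close> integrated over the pole y in (c, d); the condition on d keeps all
  these poles below the barrier.\<close>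

lemma H_J:
	assumes w [measurable]: "w1 \<in> bm borel" "w2 \<in> bm borel"
		and wb: "\<And>x. 0 <= w1 x \<and> w1 x <= 2 * K" "\<And>x. 0 <= w2 x \<and> w2 x <= 2 * K" "\<And>x. w1 x - w2 x = V x - k"
		and t: "0 < t" "0 < e" and d: "d <= l"
	shows "(NN v|P. ennreal (exp (k * t) * \<eta> (Y t v)) * indicator {..<l} (N t v) * gJ c d l e (Y t v))
			+ (NN z|(P \<Otimes>\<^sub>M lborel). ennreal (exp (k * snd z) * w1 (Y (snd z) (fst z)) * \<eta> (Y (snd z) (fst z))) * indicator {..<l} (N (snd z) (fst z))
					 * indicator {0..<t} (snd z) * gJ c d l (t + e - snd z) (Y (snd z) (fst z)))
			= (NN v|P. ennreal (\<eta> (Y 0 v)) * indicator {..<l} (N 0 v) * gJ c d l (t + e) (Y 0 v))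
			+ (NN z|(P \<Otimes>\<^sub>M lborel). ennreal (exp (k * snd z) * w2 (Y (snd z) (fst z)) * \<eta> (Y (snd z) (fst z))) * indicator {..<l} (N (snd z) (fst z))
					 * indicator {0..<t} (snd z) * gJ c d l (t + e - snd z) (Y (snd z) (fst z)))"
		(is "?A + ?B = ?C + ?D")
proof -
	let ?a = "%y. \<integral>\<^sup>+v. ennreal (exp (k * t) * \<eta> (Y t v)) * indicator {..<l} (N t v) * ennreal (gk l e (Y t v) y) \<partial>P"
	let ?b = "%w y. \<integral>\<^sup>+z. ennreal (exp (k * snd z) * w (Y (snd z) (fst z)) * \<eta> (Y (snd z) (fst z))) * indicator {..<l} (N (snd z) (fst z))
					 * indicator {0..<t} (snd z) * ennreal (gk l (t + e - snd z) (Y (snd z) (fst z)) y) \<partial>(P \<Otimes>\<^sub>M lborel)"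
	let ?c = "%y. \<integral>\<^sup>+v. ennreal (\<eta> (Y 0 v)) * indicator {..<l} (N 0 v) * ennreal (gk l (t + e) (Y 0 v) y) \<partial>P"
	have am [measurable]: "?a \<in> bm lborel" by measurable
	have cm [measurable]: "?c \<in> bm lborel" by measurable
	have bm [measurable]: "?b w \<in> bm lborel" if [measurable]: "w \<in> bm borel" for w
		by (rule sigma_finite_measure.borel_measurable_nn_integral[OF PL_sf]) measurable
	have "(NN y|lborel. (?a y + ?b w1 y) * indicator {c<..<d} y) = (NN y|lborel. (?c y + ?b w2 y) * indicator {c<..<d} y)"
		using H[OF w wb t, of _ l] d by (intro nn_integral_cong) (auto simp: indicator_def)
	then have "(NN y|lborel. ?a y * indicator {c<..<d} y) + (NN y|lborel. ?b w1 y * indicator {c<..<d} y)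
		= (NN y|lborel. ?c y * indicator {c<..<d} y) + (NN y|lborel. ?b w2 y * indicator {c<..<d} y)"
		unfolding distrib_right by (subst (asm) nn_integral_add; measurable) (subst (asm) nn_integral_add; measurable)
	moreover have "(NN y|lborel. ?a y * indicator {c<..<d} y) = ?A"
		by (rule swap_gJ) (unfold_locales, measurable)
	moreover have "(NN y|lborel. ?c y * indicator {c<..<d} y) = ?C"
		by (rule swap_gJ) (unfold_locales, measurable)
	moreover have "(NN y|lborel. ?b w1 y * indicator {c<..<d} y) = ?B"
		by (rule swap_gJ[OF PL_sf]) measurable
	moreover have "(NN y|lborel. ?b w2 y * indicator {c<..<d} y) = ?D"
		by (rule swap_gJ[OF PL_sf]) measurable
	ultimately show ?thesis by simp
qed

text \<open>Take \<open>H\<close> with \<kappa> = - K and drop the nonnegative perturbation on the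
  left. An atom at c would contribute a multiple of gam r 0 - gam r (2 (l - c)), which is unbounded
  as r tends to 0, whereas the right side is bounded. This disposes of the end points excluded in
  \<open>gJ_delta\<close>.\<close>

lemma no_atom:
	assumes t: "0 < t" and c: "c < l"
	shows "AE w in P. \<not> (N t w < l \<and> Y t w = c)"
proof -
	let ?E = "{w\<in>space P. N t w < l \<and> Y t w = c}"
	have E: "?E \<in> sets P" by measurable
	have Vb: "0 <= V x + K \<and> V x + K <= 2 * K" for x using V_bd[of x] by (auto simp: abs_le_iff)
	define C where "C = sqrt 2 * exp (L^2 * (t + 1)) * \<eta> c * (1 / sqrt t)"
	have le: "exp (- K * t) * \<eta> c * (gam r 0 - gam r (2 * (l - c))) * prob ?E <= C" if e: "0 < r" "r < 1" for r
	proof -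
		have g0: "0 <= gam r 0 - gam r (2 * (l - c))" using gam_antimono[OF e(1), of 0] by auto
		have "ennreal (exp (- K * t) * \<eta> c * (gam r 0 - gam r (2 * (l - c)))) * emeasure P ?E
			= (NN w|P. ennreal (exp (- K * t) * \<eta> c * (gam r 0 - gam r (2 * (l - c)))) * indicator ?E w)"
			by (rule nn_integral_cmult_indicator[OF E, symmetric])
		also have "... <= (NN w|P. ennreal (exp (- K * t) * \<eta> (Y t w)) * indicator {..<l} (N t w) * ennreal (gk l r (Y t w) c))"
			using c g0 \<eta>_nonneg by (intro nn_integral_mono) (auto simp: indicator_def gk_def ennreal_mult[symmetric] right_diff_distrib)
		also have "... <= (NN w|P. ennreal (\<eta> (Y 0 w)) * indicator {..<l} (N 0 w) * ennreal (gk l (t + r) (Y 0 w) c))"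
		proof -
			have *: "a <= a'" if "a + b = a' + b'" "b' = 0" for a b a' b' :: ennreal
				using that by (metis add.right_neutral le_iff_add)
			show ?thesis
				by (rule *[OF H[of "%x. V x + K" "%_. 0" "- K" t r c l]]) (use Vb K0 t e c in auto)
		qed
		also have "... <= (NN w|P. ennreal C)"
		proof (rule nn_integral_mono)
			fix w
			have "\<eta> (Y 0 w) * gk l (t + r) (Y 0 w) c <= \<eta> (Y 0 w) * gam (t + r) (Y 0 w - c)"
				using t e by (intro mult_left_mono gk_le \<eta>_nonneg) auto
			also have "... <= sqrt 2 * exp (L^2 * (t + r)) * \<eta> c * gam (2 * (t + r)) (Y 0 w - c)"
				using t e by (intro eta_gam) auto
			also have "... <= C" unfolding C_def
			proof (intro mult_mono)
				have "gam (2 * (t + r)) (Y 0 w - c) <= 1 / sqrt (2 * (t + r))" using t e by (intro gam_le) auto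
				also have "... <= 1 / sqrt t" using t e by (intro divide_left_mono) auto
				finally show "gam (2 * (t + r)) (Y 0 w - c) <= 1 / sqrt t" .
			qed (use e t \<eta>_nonneg gam_nonneg in \<open>auto intro!: mult_left_mono\<close>)
			finally have "ennreal (\<eta> (Y 0 w) * gk l (t + r) (Y 0 w) c) <= ennreal C" by (rule ennreal_leI)
			then show "ennreal (\<eta> (Y 0 w)) * indicator {..<l} (N 0 w) * ennreal (gk l (t + r) (Y 0 w) c) <= ennreal C"
				using \<eta>_nonneg gk_nonneg[of "t + r"] t e by (auto simp: indicator_def ennreal_mult)
		qed
		also have "... = ennreal C" by (simp add: emeasure_space_1)
		finally have "ennreal (exp (- K * t) * \<eta> c * (gam r 0 - gam r (2 * (l - c))) * prob ?E) <= ennreal C"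
			using g0 \<eta>_nonneg by (simp add: emeasure_eq_measure ennreal_mult[symmetric])
		moreover have "0 <= C" using \<eta>_nonneg t by (auto simp: C_def)
		ultimately show ?thesis by simp
	qed
	have "prob ?E = 0"
	proof (rule ccontr)
		assume "prob ?E \<noteq> 0"
		then have p: "0 < exp (- K * t) * \<eta> c * prob ?E" using \<eta>_pos by (simp add: measure_nonneg less_le)
		have l: "((%r. gam r (2 * (l - c))) \<longlongrightarrow> 0) (at_right 0)" using c by (intro gam_tendsto_0) auto
		define B where "B = C / (exp (- K * t) * \<eta> c * prob ?E) + 1"
		have "eventually (%r. gam r (2 * (l - c)) < 1) (at_right 0)" using l by (rule order_tendstoD) simp
		\<comment> \<open>Below this threshold gam r 0 = 1 / sqrt (2 pi r) exceeds |B| + 1.\<close>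
		moreover have "eventually (%r. r < 1 / (2 * pi * (\<bar>B\<bar> + 1)^2)) (at_right 0)"
			by (rule order_tendstoD(2)[OF tendsto_ident_at]) (auto intro!: divide_pos_pos mult_pos_pos zero_less_power)
		moreover have "eventually (%r::real. r < 1) (at_right 0)" by (rule order_tendstoD(2)[OF tendsto_ident_at]) auto
		moreover have "eventually (%r::real. 0 < r) (at_right 0)" by (rule eventually_at_right_less)
		ultimately have "eventually (%r. False) (at_right (0::real))"
		proof eventually_elim
			case (elim r)
			have "r * (2 * pi * (\<bar>B\<bar> + 1)^2) < 1" using elim(2) by (simp add: pos_less_divide_eq)
			then have "(\<bar>B\<bar> + 1)^2 < 1 / (2 * pi * r)" using elim(4) by (simp add: field_simps)
			then have "sqrt ((\<bar>B\<bar> + 1)^2) < sqrt (1 / (2 * pi * r))" by (rule real_sqrt_less_mono)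
			then have "\<bar>B\<bar> + 1 < gam r 0" by (simp add: gam_def real_sqrt_divide)
			then have "B < gam r 0 - gam r (2 * (l - c))" using elim(1) by linarith
			then have "B * (exp (- K * t) * \<eta> c * prob ?E) < (gam r 0 - gam r (2 * (l - c))) * (exp (- K * t) * \<eta> c * prob ?E)"
				using p by (rule mult_strict_right_mono)
			also have "... <= C" using le[OF elim(4,3)] by (simp add: mult_ac)
			finally have "B * (exp (- K * t) * \<eta> c * prob ?E) < C" .
			moreover have "(C / q + 1) * q = C + q" if "0 < q" for q using that by (simp add: distrib_right)
			then have "B * (exp (- K * t) * \<eta> c * prob ?E) = C + exp (- K * t) * \<eta> c * prob ?E"
				unfolding B_def using p by blast
			ultimately show False using p by linarith
		qed
		then show False by simp
	qed
	then have "?E \<in> null_sets P" using E by (auto simp: emeasure_eq_measure)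
	then show ?thesis by (rule AE_I') auto
qed

text \<open>Dominated convergence with the uniform bound \<open>Bd\<close>. The terminal kernel
  becomes the indicator of (c, d) away from the end points, which are negligible by
  \<open>no_atom\<close>.\<close>

lemma H_limit:
	assumes w [measurable]: "w1 \<in> bm borel" "w2 \<in> bm borel"
		and wb: "\<And>x. 0 <= w1 x \<and> w1 x <= 2 * K" "\<And>x. 0 <= w2 x \<and> w2 x <= 2 * K" "\<And>x. w1 x - w2 x = V x - k"
		and t: "0 < t" and d: "d <= l"
	shows "(NN v|P. ennreal (exp (k * t) * \<eta> (Y t v)) * indicator {..<l} (N t v) * indicator {c<..<d} (Y t v))
			+ (NN z|(P \<Otimes>\<^sub>M lborel). ennreal (exp (k * snd z) * w1 (Y (snd z) (fst z)) * \<eta> (Y (snd z) (fst z))) * indicator {..<l} (N (snd z) (fst z))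
					 * indicator {0..<t} (snd z) * gJ c d l (t - snd z) (Y (snd z) (fst z)))
			= (NN v|P. ennreal (\<eta> (Y 0 v)) * indicator {..<l} (N 0 v) * gJ c d l t (Y 0 v))
			+ (NN z|(P \<Otimes>\<^sub>M lborel). ennreal (exp (k * snd z) * w2 (Y (snd z) (fst z)) * \<eta> (Y (snd z) (fst z))) * indicator {..<l} (N (snd z) (fst z))
					 * indicator {0..<t} (snd z) * gJ c d l (t - snd z) (Y (snd z) (fst z)))"
proof -
	define \<epsilon> where "\<epsilon> n = 1 / real (Suc n)" for n
	have e0: "0 < \<epsilon> n" "\<epsilon> n <= 1" for n by (auto simp: \<epsilon>_def)
	have el: "\<epsilon> \<longlonglongrightarrow> 0" unfolding \<epsilon>_def using LIMSEQ_inverse_real_of_nat by (simp add: inverse_eq_divide)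
	define C where "C = Bd (t + 1) c d"
	have C0: "0 <= C" unfolding C_def by (rule Bd_nonneg)
	have bd: "ennreal (r * \<eta> x) * gJ c d l u x <= ennreal (R * C)" if "0 <= r" "r <= R" "0 < u" "u <= t + 1" for r R u x
	proof -
		have "ennreal (r * \<eta> x) * gJ c d l u x = ennreal r * (ennreal (\<eta> x) * gJ c d l u x)"
			using that \<eta>_nonneg by (simp add: ennreal_mult mult.assoc)
		also have "... <= ennreal R * ennreal C" unfolding C_def using that by (intro mult_mono eta_gJ ennreal_leI) auto
		finally show ?thesis using that C0 by (simp add: ennreal_mult)
	qed
	have fin: "ennreal r * gJ c d l u x < \<infinity>" "ennreal r < \<infinity>" if "0 < u" for r u x
	proof -
		have "ennreal (1 * \<eta> x) * gJ c d l u x < \<infinity>"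
			using eta_gJ[OF that order_refl, of x c d l] by (auto intro: le_less_trans)
		then have "gJ c d l u x < \<infinity>" using \<eta>_pos[of x] by (auto simp: ennreal_mult_less_top)
		then show "ennreal r * gJ c d l u x < \<infinity>" "ennreal r < \<infinity>" by (auto simp: ennreal_mult_less_top)
	qed
	have A: "(%n. \<integral>\<^sup>+v. ennreal (exp (k * t) * \<eta> (Y t v)) * indicator {..<l} (N t v) * gJ c d l (\<epsilon> n) (Y t v) \<partial>P)
		 \<longlonglongrightarrow> (NN v|P. ennreal (exp (k * t) * \<eta> (Y t v)) * indicator {..<l} (N t v) * indicator {c<..<d} (Y t v))"
	proof (rule nn_integral_dominated_convergence[where w="%_. ennreal (exp (k * t) * C)"])
		show "AE v in P. ennreal (exp (k * t) * \<eta> (Y t v)) * indicator {..<l} (N t v) * gJ c d l (\<epsilon> n) (Y t v) <= ennreal (exp (k * t) * C)" for n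
			using bd[of "exp (k * t)" "exp (k * t)" "\<epsilon> n"] e0[of n] t by (intro AE_I2) (auto simp: indicator_def)
		have at: "AE v in P. N t v < l \<longrightarrow> Y t v \<noteq> e" for e
		proof (cases "e < l")
			case True
			from no_atom[OF t this] show ?thesis by eventually_elim auto
		next
			case False
			then show ?thesis using YN[of _ t] by (intro AE_I2) force
		qed
		note a1 = at[of c] and a2 = at[of d]
		show "AE v in P. (%n. ennreal (exp (k * t) * \<eta> (Y t v)) * indicator {..<l} (N t v) * gJ c d l (\<epsilon> n) (Y t v))
			\<longlonglongrightarrow> ennreal (exp (k * t) * \<eta> (Y t v)) * indicator {..<l} (N t v) * indicator {c<..<d} (Y t v)"
			using a1 a2 AE_space
		proof eventually_elim
			case (elim v)
			show ?case
			proof (cases "N t v < l")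
				case True
				then have "Y t v < l" using YN[OF elim(3), of t] by simp
				with elim True have "(%n. gJ c d l (\<epsilon> n) (Y t v)) \<longlonglongrightarrow> indicator {c<..<d} (Y t v)"
					by (intro gJ_delta d el e0) auto
				then show ?thesis using True by (simp add: ennreal_tendsto_cmult)
			qed simp
		qed
		show "(NN v|P. ennreal (exp (k * t) * C)) < \<infinity>" by (simp add: emeasure_space_1)
	qed auto
	have B: "(%n. \<integral>\<^sup>+z. ennreal (exp (k * snd z) * w (Y (snd z) (fst z)) * \<eta> (Y (snd z) (fst z))) * indicator {..<l} (N (snd z) (fst z))
					 * indicator {0..<t} (snd z) * gJ c d l (t + \<epsilon> n - snd z) (Y (snd z) (fst z)) \<partial>(P \<Otimes>\<^sub>M lborel))
		 \<longlonglongrightarrow> (NN z|(P \<Otimes>\<^sub>M lborel). ennreal (exp (k * snd z) * w (Y (snd z) (fst z)) * \<eta> (Y (snd z) (fst z))) * indicator {..<l} (N (snd z) (fst z))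
					 * indicator {0..<t} (snd z) * gJ c d l (t - snd z) (Y (snd z) (fst z)))"
		if [measurable]: "w \<in> bm borel" and wb: "\<And>x. 0 <= w x \<and> w x <= 2 * K" for w
	proof (rule nn_integral_dominated_convergence[where w="%z. ennreal (exp (\<bar>k\<bar> * t) * (2 * K) * C) * indicator {0..<t} (snd z)"])
		show "AE z in P \<Otimes>\<^sub>M lborel. ennreal (exp (k * snd z) * w (Y (snd z) (fst z)) * \<eta> (Y (snd z) (fst z))) * indicator {..<l} (N (snd z) (fst z))
					 * indicator {0..<t} (snd z) * gJ c d l (t + \<epsilon> n - snd z) (Y (snd z) (fst z)) <= ennreal (exp (\<bar>k\<bar> * t) * (2 * K) * C) * indicator {0..<t} (snd z)" for n
		proof (rule AE_I2)
			fix z :: "'w \<times> real"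
			show "ennreal (exp (k * snd z) * w (Y (snd z) (fst z)) * \<eta> (Y (snd z) (fst z))) * indicator {..<l} (N (snd z) (fst z))
					 * indicator {0..<t} (snd z) * gJ c d l (t + \<epsilon> n - snd z) (Y (snd z) (fst z)) <= ennreal (exp (\<bar>k\<bar> * t) * (2 * K) * C) * indicator {0..<t} (snd z)"
			proof (cases "snd z \<in> {0..<t}")
				case True
				have "k * snd z <= \<bar>k\<bar> * t" using True by (intro mult_mono) auto
				then have "exp (k * snd z) * w (Y (snd z) (fst z)) <= exp (\<bar>k\<bar> * t) * (2 * K)"
					using wb by (intro mult_mono) auto
				then have "ennreal (exp (k * snd z) * w (Y (snd z) (fst z)) * \<eta> (Y (snd z) (fst z))) * gJ c d l (t + \<epsilon> n - snd z) (Y (snd z) (fst z)) <= ennreal (exp (\<bar>k\<bar> * t) * (2 * K) * C)"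
					using True e0[of n] wb by (intro bd) auto
				then show ?thesis using True by (auto simp: indicator_def)
			qed simp
		qed
		show "AE z in P \<Otimes>\<^sub>M lborel. (%n. ennreal (exp (k * snd z) * w (Y (snd z) (fst z)) * \<eta> (Y (snd z) (fst z))) * indicator {..<l} (N (snd z) (fst z))
					 * indicator {0..<t} (snd z) * gJ c d l (t + \<epsilon> n - snd z) (Y (snd z) (fst z)))
			\<longlonglongrightarrow> ennreal (exp (k * snd z) * w (Y (snd z) (fst z)) * \<eta> (Y (snd z) (fst z))) * indicator {..<l} (N (snd z) (fst z))
					 * indicator {0..<t} (snd z) * gJ c d l (t - snd z) (Y (snd z) (fst z))"
		proof (rule AE_I2)
			fix z :: "'w \<times> real"
			show "(%n. ennreal (exp (k * snd z) * w (Y (snd z) (fst z)) * \<eta> (Y (snd z) (fst z))) * indicator {..<l} (N (snd z) (fst z))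
					 * indicator {0..<t} (snd z) * gJ c d l (t + \<epsilon> n - snd z) (Y (snd z) (fst z)))
			\<longlonglongrightarrow> ennreal (exp (k * snd z) * w (Y (snd z) (fst z)) * \<eta> (Y (snd z) (fst z))) * indicator {..<l} (N (snd z) (fst z))
					 * indicator {0..<t} (snd z) * gJ c d l (t - snd z) (Y (snd z) (fst z))"
			proof (cases "snd z \<in> {0..<t} \<and> N (snd z) (fst z) < l")
				case True
				have "(%n. t + \<epsilon> n - snd z) \<longlonglongrightarrow> t + 0 - snd z" by (intro tendsto_intros el)
				then have "(%n. gJ c d l (t + \<epsilon> n - snd z) (Y (snd z) (fst z))) \<longlonglongrightarrow> gJ c d l (t - snd z) (Y (snd z) (fst z))"
					using True e0 by (intro gJ_tendsto) (auto simp: less_imp_le)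
				then show ?thesis using True by (simp add: ennreal_tendsto_cmult)
			qed (auto simp: indicator_def)
		qed
		show "(NN z|(P \<Otimes>\<^sub>M lborel). ennreal (exp (\<bar>k\<bar> * t) * (2 * K) * C) * indicator {0..<t} (snd z)) < \<infinity>"
		proof -
			have "(NN z|(P \<Otimes>\<^sub>M lborel). ennreal (exp (\<bar>k\<bar> * t) * (2 * K) * C) * indicator {0..<t} (snd z)) =
				(\<integral>\<^sup>+v. \<integral>\<^sup>+s. ennreal (exp (\<bar>k\<bar> * t) * (2 * K) * C) * indicator {0..<t} s \<partial>lborel \<partial>P)"
				by (subst lborel.nn_integral_fst[symmetric]) auto
			also have "... < \<infinity>" using t by (simp add: nn_integral_cmult_indicator emeasure_space_1 ennreal_mult_less_top)
			finally show ?thesis .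
		qed
	qed auto
	have Cc: "(%n. \<integral>\<^sup>+v. ennreal (\<eta> (Y 0 v)) * indicator {..<l} (N 0 v) * gJ c d l (t + \<epsilon> n) (Y 0 v) \<partial>P)
		 \<longlonglongrightarrow> (NN v|P. ennreal (\<eta> (Y 0 v)) * indicator {..<l} (N 0 v) * gJ c d l t (Y 0 v))"
	proof (rule nn_integral_dominated_convergence[where w="%_. ennreal (1 * C)"])
		show "AE v in P. ennreal (\<eta> (Y 0 v)) * indicator {..<l} (N 0 v) * gJ c d l (t + \<epsilon> n) (Y 0 v) <= ennreal (1 * C)" for n
			using bd[of 1 1 "t + \<epsilon> n"] e0[of n] t by (intro AE_I2) (auto simp: indicator_def)
		show "AE v in P. (%n. ennreal (\<eta> (Y 0 v)) * indicator {..<l} (N 0 v) * gJ c d l (t + \<epsilon> n) (Y 0 v))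
			\<longlonglongrightarrow> ennreal (\<eta> (Y 0 v)) * indicator {..<l} (N 0 v) * gJ c d l t (Y 0 v)"
		proof (rule AE_I2)
			fix v
			have "(%n. t + \<epsilon> n) \<longlonglongrightarrow> t + 0" by (intro tendsto_intros el)
			then have "(%n. gJ c d l (t + \<epsilon> n) (Y 0 v)) \<longlonglongrightarrow> gJ c d l t (Y 0 v)"
				using t e0 by (intro gJ_tendsto) (auto simp: less_imp_le)
			then show "(%n. ennreal (\<eta> (Y 0 v)) * indicator {..<l} (N 0 v) * gJ c d l (t + \<epsilon> n) (Y 0 v))
				\<longlonglongrightarrow> ennreal (\<eta> (Y 0 v)) * indicator {..<l} (N 0 v) * gJ c d l t (Y 0 v)"
				by (cases "N 0 v < l") (auto intro!: ennreal_tendsto_cmult)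
		qed
		show "(NN v|P. ennreal (1 * C)) < \<infinity>" by (simp add: emeasure_space_1)
	qed auto
	show ?thesis
		by (rule LIMSEQ_unique[OF tendsto_add[OF A B[OF w(1) wb(1)]]])
			 (subst H_J[OF w wb t e0(1) d], rule tendsto_add[OF Cc B[OF w(2) wb(2)]])
qed

end

text \<open>The probability that a Brownian path from x ends in (c, d) after raising its past
  maximum m' to a value below a.\<close>

definition J2 :: "real => real => real => real => real => real => ennreal" where
	"J2 a c d m' r x = (NN y|lborel. (NN m|lborel. ennreal (rk r x m y) * indicator {m'<..} m * indicator {..<a} m) * indicator {c<..<d} y)"

lemma indicator_Ioi_raw [measurable (raw)]:
	fixes f g :: "'a => real"
	assumes [measurable]: "f \<in> bm Q" "g \<in> bm Q"
	shows "(%z. indicator {f z<..} (g z) :: ennreal) \<in> bm Q"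
		and "(%z. indicator {..<f z} (g z) :: ennreal) \<in> bm Q"
proof -
	have "(%z. indicator {f z<..} (g z) :: ennreal) = (%z. if f z < g z then 1 else 0)"
		"(%z. indicator {..<f z} (g z) :: ennreal) = (%z. if g z < f z then 1 else 0)" by (auto simp: indicator_def)
	then show "(%z. indicator {f z<..} (g z) :: ennreal) \<in> bm Q"
		"(%z. indicator {..<f z} (g z) :: ennreal) \<in> bm Q" by simp_all
qed

lemma emeasure_distr_density:
	assumes f [measurable]: "f \<in> bm Q" and g [measurable]: "g \<in> Q \<rightarrow>\<^sub>M R" and S [measurable]: "S \<in> sets R"
	shows "emeasure (distr (density Q f) R g) S = (NN x|Q. f x * indicator S (g x))"
proof -
	have "emeasure (distr (density Q f) R g) S = emeasure (density Q f) (g -` S \<inter> space Q)"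
		using g S by (subst emeasure_distr) auto
	also have "... = (NN x|Q. f x * indicator (g -` S \<inter> space Q) x)"
		by (rule emeasure_density) measurable
	also have "... = (NN x|Q. f x * indicator S (g x))"
		by (rule nn_integral_cong) (auto split: split_indicator)
	finally show ?thesis .
qed

text \<open>This is \<open>rk_int_from\<close> integrated over y. If m' is not below a, both sides
  vanish.\<close>

lemma J2_sum:
	assumes "0 < r" "x <= m'"
	shows "indicator {..<a} m' * gJ c d m' r x + J2 a c d m' r x = indicator {..<a} m' * gJ c d a r x"
proof (cases "m' < a")
	case True
	have "gJ c d m' r x + J2 a c d m' r x = (NN y|lborel. ennreal (gk m' r x y) * indicator {c<..<d} y +
			(NN m|lborel. ennreal (rk r x m y) * indicator {m'<..} m * indicator {..<a} m) * indicator {c<..<d} y)"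
		unfolding gJ_def J2_def by (rule nn_integral_add[symmetric]) measurable
	also have "... = gJ c d a r x"
		unfolding gJ_def distrib_right[symmetric] using rk_int_from[OF assms(1) less_imp_le[OF True] assms(2)] by simp
	finally show ?thesis using True by simp
next
	case False
	then have "indicator {m'<..} m * indicator {..<a} m = (0::ennreal)" for m by (auto simp: indicator_def)
	then have "J2 a c d m' r x = 0" unfolding J2_def mult.assoc by (simp only: mult_zero_right mult_zero_left nn_integral_const)
	then show ?thesis using False by simp
qed

lemma J2_alt:
	shows "J2 a c d m' r x = (NN m|lborel. indicator {m'<..} m * (indicator {..<a} m * (NN y|lborel. ennreal (rk r x m y) * indicator {c<..<d} y)))"
proof -
	have "J2 a c d m' r x = (NN y|lborel. (NN m|lborel. indicator {m'<..} m * (indicator {..<a} m * (ennreal (rk r x m y) * indicator {c<..<d} y))))"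
		unfolding J2_def by (subst nn_integral_multc[symmetric]) (auto simp: mult_ac)
	also have "... = (NN m|lborel. (NN y|lborel. indicator {m'<..} m * (indicator {..<a} m * (ennreal (rk r x m y) * indicator {c<..<d} y))))"
		by (rule lborel_pair.Fubini') measurable
	also have "... = (NN m|lborel. indicator {m'<..} m * (indicator {..<a} m * (NN y|lborel. ennreal (rk r x m y) * indicator {c<..<d} y)))"
		by (intro nn_integral_cong) (auto simp: nn_integral_cmult indicator_def)
	finally show ?thesis .
qed

lemma J2_0:
	assumes "0 < r"
	shows "(NN q|lborel. ennreal (rk r x (fst q) (snd q)) * indicator ({..<a} \<times> {c<..<d}) q) = gJ c d a r x"
proof -
	have "(NN q|lborel. ennreal (rk r x (fst q) (snd q)) * indicator ({..<a} \<times> {c<..<d}) q)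
		= (NN q|(lborel \<Otimes>\<^sub>M lborel). ennreal (rk r x (fst q) (snd q)) * (indicator {..<a} (fst q) * indicator {c<..<d} (snd q)))"
		unfolding lborel_prod by (rule nn_integral_cong) (auto simp: indicator_def)
	also have "... = (NN y|lborel. (NN m|lborel. ennreal (rk r x m y) * (indicator {..<a} m * indicator {c<..<d} y)))"
		by (subst lborel_pair.nn_integral_snd[symmetric]) (auto simp: split_beta')
	also have "... = gJ c d a r x"
		unfolding gJ_def by (intro nn_integral_cong) (simp add: mult.assoc[symmetric] nn_integral_multc rk_int[OF assms])
	finally show ?thesis .
qed

text \<open>The killed kernel vanishes at the barrier and beyond it.\<close>

lemma gJ_min: "gJ c d a r x = gJ c (min d a) a r x"
	unfolding gJ_def
proof (rule nn_integral_cong)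
	fix y show "ennreal (gk a r x y) * indicator {c<..<d} y = ennreal (gk a r x y) * indicator {c<..<min d a} y"
		using gam_commute[of r x a] by (cases "y = a") (auto simp: gk_def indicator_def)
qed

section \<open>Comparison with the law of Brownian motion and its maximum\<close>

context flat
begin

text \<open>Density of the end point y and the maximum m of Brownian motion at time t, started from
  the law of \<open>Y 0\<close> weighted by \<eta>.\<close>

definition U :: "real => real => real => ennreal" where
	"U t m y = (NN w|P. ennreal (\<eta> (Y 0 w)) * ennreal (rk t (Y 0 w) m y))"

lemma U_raw [measurable (raw)]:
	assumes [measurable]: "a \<in> bm Q" "b \<in> bm Q" "c \<in> bm Q"
	shows "(%z. U (a z) (b z) (c z)) \<in> bm Q"
	unfolding U_def by measurable

definition law :: "real => real => (real \<times> real) measure" where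
	"law k t = distr (density P (%w. ennreal (exp (k * t) * \<eta> (Y t w)))) borel (%w. (N t w, Y t w))"

lemma sets_law [simp]: "sets (law k t) = sets borel" by (simp add: law_def)

lemma NY_meas [measurable]: "(%w. (N t w, Y t w)) \<in> bm P"
	unfolding borel_prod[symmetric] by measurable

lemma emeasure_law:
	assumes "S \<in> sets borel"
	shows "emeasure (law k t) S = (NN w|P. ennreal (exp (k * t) * \<eta> (Y t w)) * indicator S (N t w, Y t w))"
unfolding law_def by (rule emeasure_distr_density[OF _ _ assms]) measurable

definition kern :: "real => (real => real) => real => 'w \<times> real => ennreal" where
	"kern k w t z = ennreal (exp (k * snd z) * w (Y (snd z) (fst z)) * \<eta> (Y (snd z) (fst z))) * indicator {0..<t} (snd z)"

lemma kern_meas [measurable]: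
	assumes [measurable]: "w \<in> bm borel"
	shows "kern k w t \<in> bm (P \<Otimes>\<^sub>M lborel)"
	unfolding kern_def[abs_def] by measurable

text \<open>The Duhamel term as a measure: the perturbation acts at time s, then a Brownian path
  runs for the time t - s. \<open>Q1\<close> collects the paths that keep the maximum
  \<open>N s\<close>, and \<open>Q2\<close> those that set a new maximum.\<close>

definition Q1 :: "real => (real => real) => real => (real \<times> real) measure" where
	"Q1 k w t = distr (density ((P \<Otimes>\<^sub>M lborel) \<Otimes>\<^sub>M lborel)
		 (%v. kern k w t (fst v) * ennreal (gk (N (snd (fst v)) (fst (fst v))) (t - snd (fst v)) (Y (snd (fst v)) (fst (fst v))) (snd v))))
		 borel (%v. (N (snd (fst v)) (fst (fst v)), snd v))"

definition Q2 :: "real => (real => real) => real => (real \<times> real) measure" where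
	"Q2 k w t = distr (density ((P \<Otimes>\<^sub>M lborel) \<Otimes>\<^sub>M lborel)
		 (%v. kern k w t (fst v) * (ennreal (rk (t - snd (fst v)) (Y (snd (fst v)) (fst (fst v))) (fst (snd v)) (snd (snd v)))
				* indicator {N (snd (fst v)) (fst (fst v))<..} (fst (snd v)))))
		 borel snd"

lemma G_sets [measurable]: "{..<a} \<times> {c<..<d} \<in> sets (borel :: (real \<times> real) measure)" for a c d :: real
	by (simp add: borel_prod[symmetric])

lemma fst_borel [measurable]: "(fst :: real \<times> real => real) \<in> bm borel" "(snd :: real \<times> real => real) \<in> bm borel"
	by (simp_all add: borel_prod[symmetric])

text \<open>On a box the two contributions recombine by \<open>J2_sum\<close> into the kernel killed
  at a.\<close>

lemma Q12_box:
	assumes [measurable]: "w \<in> bm borel"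
	shows "emeasure (Q1 k w t) ({..<a} \<times> {c<..<d}) + emeasure (Q2 k w t) ({..<a} \<times> {c<..<d})
		= (NN z|(P \<Otimes>\<^sub>M lborel). kern k w t z * (indicator {..<a} (N (snd z) (fst z)) * gJ c d a (t - snd z) (Y (snd z) (fst z))))"
proof -
	let ?G = "{..<a} \<times> {c<..<d}"
	let ?N = "%z. N (snd z) (fst z)" and ?Y = "%z. Y (snd z) (fst z)"
	have [measurable]: "(%v. (N (snd (fst v)) (fst (fst v)), snd v)) \<in> bm ((P \<Otimes>\<^sub>M lborel) \<Otimes>\<^sub>M lborel)"
		unfolding borel_prod[symmetric] by measurable
	have "emeasure (Q1 k w t) ?G = (NN v|((P \<Otimes>\<^sub>M lborel) \<Otimes>\<^sub>M lborel). kern k w t (fst v) * ennreal (gk (?N (fst v)) (t - snd (fst v)) (?Y (fst v)) (snd v))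
			* (indicator {..<a} (?N (fst v)) * indicator {c<..<d} (snd v)))"
		unfolding Q1_def by (subst emeasure_distr_density) (auto intro!: nn_integral_cong split: split_indicator)
	also have "... = (\<integral>\<^sup>+z. \<integral>\<^sup>+y. kern k w t z * ennreal (gk (?N z) (t - snd z) (?Y z) y) * (indicator {..<a} (?N z) * indicator {c<..<d} y) \<partial>lborel \<partial>(P \<Otimes>\<^sub>M lborel))"
		by (subst lborel.nn_integral_fst[symmetric]) (auto simp: split_beta')
	also have "... = (NN z|(P \<Otimes>\<^sub>M lborel). kern k w t z * (indicator {..<a} (?N z) * gJ c d (?N z) (t - snd z) (?Y z)))"
		unfolding gJ_def by (intro nn_integral_cong) (auto simp: nn_integral_cmult[symmetric] mult_ac)
	finally have 1: "emeasure (Q1 k w t) ?G = (NN z|(P \<Otimes>\<^sub>M lborel). kern k w t z * (indicator {..<a} (?N z) * gJ c d (?N z) (t - snd z) (?Y z)))" .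
	have sndm: "snd \<in> (P \<Otimes>\<^sub>M lborel) \<Otimes>\<^sub>M lborel \<rightarrow>\<^sub>M (borel :: (real \<times> real) measure)" by (simp add: measurable_lborel2[symmetric])
	have "emeasure (Q2 k w t) ?G = (NN v|((P \<Otimes>\<^sub>M lborel) \<Otimes>\<^sub>M lborel). kern k w t (fst v) * (ennreal (rk (t - snd (fst v)) (?Y (fst v)) (fst (snd v)) (snd (snd v)))
				* indicator {?N (fst v)<..} (fst (snd v))) * indicator ?G (snd v))"
		unfolding Q2_def by (subst emeasure_distr_density) (auto simp: sndm intro!: nn_integral_cong)
	also have "... = (\<integral>\<^sup>+z. \<integral>\<^sup>+q. kern k w t z * (ennreal (rk (t - snd z) (?Y z) (fst q) (snd q)) * indicator {?N z<..} (fst q)) * indicator ?G q \<partial>lborel \<partial>(P \<Otimes>\<^sub>M lborel))"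
		by (subst lborel.nn_integral_fst[symmetric]) (auto simp: split_beta')
	also have "... = (NN z|(P \<Otimes>\<^sub>M lborel). kern k w t z * J2 a c d (?N z) (t - snd z) (?Y z))"
	proof (rule nn_integral_cong)
		fix z :: "'w \<times> real"
		have "(NN q|lborel. kern k w t z * (ennreal (rk (t - snd z) (?Y z) (fst q) (snd q)) * indicator {?N z<..} (fst q)) * indicator ?G q)
			= (NN q|(lborel \<Otimes>\<^sub>M lborel). kern k w t z * (ennreal (rk (t - snd z) (?Y z) (fst q) (snd q)) * indicator {?N z<..} (fst q) * indicator {..<a} (fst q) * indicator {c<..<d} (snd q)))"
			unfolding lborel_prod by (rule nn_integral_cong) (auto simp: indicator_def)
		also have "... = kern k w t z * (NN q|(lborel \<Otimes>\<^sub>M lborel). ennreal (rk (t - snd z) (?Y z) (fst q) (snd q)) * indicator {?N z<..} (fst q) * indicator {..<a} (fst q) * indicator {c<..<d} (snd q))"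
			by (rule nn_integral_cmult) measurable
		also have "(NN q|(lborel \<Otimes>\<^sub>M lborel). ennreal (rk (t - snd z) (?Y z) (fst q) (snd q)) * indicator {?N z<..} (fst q) * indicator {..<a} (fst q) * indicator {c<..<d} (snd q))
			= J2 a c d (?N z) (t - snd z) (?Y z)"
			unfolding J2_def by (subst lborel_pair.nn_integral_snd[symmetric]) (auto simp: split_beta' nn_integral_multc[symmetric] intro!: nn_integral_cong)
		finally show "(NN q|lborel. kern k w t z * (ennreal (rk (t - snd z) (?Y z) (fst q) (snd q)) * indicator {?N z<..} (fst q)) * indicator ?G q)
			 = kern k w t z * J2 a c d (?N z) (t - snd z) (?Y z)" .
	qed
	finally have 2: "emeasure (Q2 k w t) ?G = (NN z|(P \<Otimes>\<^sub>M lborel). kern k w t z * J2 a c d (?N z) (t - snd z) (?Y z))" .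
	have [measurable]: "(%z. J2 a c d (?N z) (t - snd z) (?Y z)) \<in> bm (P \<Otimes>\<^sub>M lborel)"
		unfolding J2_def by measurable
	have "emeasure (Q1 k w t) ?G + emeasure (Q2 k w t) ?G =
		(NN z|(P \<Otimes>\<^sub>M lborel). kern k w t z * (indicator {..<a} (?N z) * gJ c d (?N z) (t - snd z) (?Y z)) + kern k w t z * J2 a c d (?N z) (t - snd z) (?Y z))"
		unfolding 1 2 by (rule nn_integral_add[symmetric]) measurable
	also have "... = (NN z|(P \<Otimes>\<^sub>M lborel). kern k w t z * (indicator {..<a} (?N z) * gJ c d a (t - snd z) (?Y z)))"
	proof (rule nn_integral_cong)
		fix z :: "'w \<times> real" assume "z \<in> space (P \<Otimes>\<^sub>M lborel)"
		then have "?Y z <= ?N z" by (intro YN) (auto simp: space_pair_measure)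
		then show "kern k w t z * (indicator {..<a} (?N z) * gJ c d (?N z) (t - snd z) (?Y z)) + kern k w t z * J2 a c d (?N z) (t - snd z) (?Y z)
			= kern k w t z * (indicator {..<a} (?N z) * gJ c d a (t - snd z) (?Y z))"
			using J2_sum[of "t - snd z" "?Y z" "?N z" a c d] unfolding distrib_left[symmetric] by (cases "snd z \<in> {0..<t}") (auto simp: kern_def)
	qed
	finally show ?thesis .
qed

definition Um :: "real => (real \<times> real) measure" where
	"Um t = density lborel (%q. U t (fst q) (snd q))"

lemma sets_Q [simp]: "sets (Q1 k w t) = sets borel" "sets (Q2 k w t) = sets borel" "sets (Um t) = sets borel"
	by (auto simp: Q1_def Q2_def Um_def)

lemma U_int:
	assumes [measurable]: "S \<in> sets borel"
	shows "(NN q|lborel. U t (fst q) (snd q) * indicator S q) =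
		 (NN w|P. ennreal (\<eta> (Y 0 w)) * (NN q|lborel. ennreal (rk t (Y 0 w) (fst q) (snd q)) * indicator S q))"
proof -
	have PP: "pair_sigma_finite P (lborel :: (real \<times> real) measure)" ..
	have "(NN q|lborel. U t (fst q) (snd q) * indicator S q) =
		 (NN q|lborel. (NN w|P. ennreal (\<eta> (Y 0 w)) * (ennreal (rk t (Y 0 w) (fst q) (snd q)) * indicator S q)))"
		unfolding U_def by (subst nn_integral_multc[symmetric]) (auto simp: mult_ac)
	also have "... = (NN w|P. (NN q|lborel. ennreal (\<eta> (Y 0 w)) * (ennreal (rk t (Y 0 w) (fst q) (snd q)) * indicator S q)))"
		by (rule pair_sigma_finite.Fubini'[OF PP]) measurable
	also have "... = (NN w|P. ennreal (\<eta> (Y 0 w)) * (NN q|lborel. ennreal (rk t (Y 0 w) (fst q) (snd q)) * indicator S q))"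
		by (intro nn_integral_cong nn_integral_cmult) measurable
	finally show ?thesis .
qed

lemma Um_box:
	assumes t: "0 < t"
	shows "emeasure (Um t) ({..<a} \<times> {c<..<d}) = (NN w|P. ennreal (\<eta> (Y 0 w)) * gJ c d a t (Y 0 w))"
proof -
	have "emeasure (Um t) ({..<a} \<times> {c<..<d}) = (NN q|lborel. U t (fst q) (snd q) * indicator ({..<a} \<times> {c<..<d}) q)"
		unfolding Um_def by (subst emeasure_density) auto
	then show ?thesis unfolding U_int[OF G_sets] J2_0[OF t] .
qed

lemma Um_box_fin: "0 < t ==> emeasure (Um t) ({..<a} \<times> {c<..<d}) \<noteq> \<infinity>"
proof -
	assume t: "0 < t"
	have "emeasure (Um t) ({..<a} \<times> {c<..<d}) <= ennreal (Bd t c d)"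
		unfolding Um_box[OF t] by (rule prob_space_nn_integral_const_le[OF prob_space_axioms eta_gJ[OF t order_refl]])
	then show ?thesis by (metis ennreal_neq_top infinity_ennreal_def neq_top_trans)
qed

text \<open>The interval is cut at a because the equation is available for poles up to the barrier
  only. The values are unchanged, since Y <= N and the killed kernel vanishes beyond a.\<close>

lemma box_eq:
	assumes w [measurable]: "w1 \<in> bm borel" "w2 \<in> bm borel"
		and wb: "\<And>x. 0 <= w1 x \<and> w1 x <= 2 * K" "\<And>x. 0 <= w2 x \<and> w2 x <= 2 * K" "\<And>x. w1 x - w2 x = V x - k"
		and t: "0 < t"
	shows "emeasure (law k t) ({..<a} \<times> {c<..<d}) + (NN z|(P \<Otimes>\<^sub>M lborel). kern k w1 t z * (indicator {..<a} (N (snd z) (fst z)) * gJ c d a (t - snd z) (Y (snd z) (fst z))))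
	 = emeasure (Um t) ({..<a} \<times> {c<..<d}) + (NN z|(P \<Otimes>\<^sub>M lborel). kern k w2 t z * (indicator {..<a} (N (snd z) (fst z)) * gJ c d a (t - snd z) (Y (snd z) (fst z))))"
proof -
	have "emeasure (law k t) ({..<a} \<times> {c<..<d}) = (NN v|P. ennreal (exp (k * t) * \<eta> (Y t v)) * indicator {..<a} (N t v) * indicator {c<..<min d a} (Y t v))"
		unfolding emeasure_law[OF G_sets]
	proof (rule nn_integral_cong)
		fix v assume "v \<in> space P"
		then show "ennreal (exp (k * t) * \<eta> (Y t v)) * indicator ({..<a} \<times> {c<..<d}) (N t v, Y t v) =
			ennreal (exp (k * t) * \<eta> (Y t v)) * indicator {..<a} (N t v) * indicator {c<..<min d a} (Y t v)"
			using YN[of v t] by (auto simp: indicator_def)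
	qed
	moreover have "emeasure (Um t) ({..<a} \<times> {c<..<d}) = (NN v|P. ennreal (\<eta> (Y 0 v)) * indicator {..<a} (N 0 v) * gJ c (min d a) a t (Y 0 v))"
		unfolding Um_box[OF t] gJ_min[of c d]
	proof (rule nn_integral_cong)
		fix v assume w: "v \<in> space P"
		have "gJ c (min d a) a t (Y 0 v) = 0" if "\<not> Y 0 v < a" using that by (simp add: gJ_def gk_def)
		then show "ennreal (\<eta> (Y 0 v)) * gJ c (min d a) a t (Y 0 v) = ennreal (\<eta> (Y 0 v)) * indicator {..<a} (N 0 v) * gJ c (min d a) a t (Y 0 v)"
			using N0[OF w] by (auto simp: indicator_def)
	qed
	ultimately show ?thesis
		using H_limit[OF w wb t, of "min d a" a c] unfolding gJ_min[of c d] kern_def by (simp add: mult_ac)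
qed

lemma VK: "0 <= V x + K \<and> V x + K <= 2 * K" "0 <= K - V x \<and> K - V x <= 2 * K"
	using V_bd[of x] by (auto simp: abs_le_iff)

text \<open>An inequality on boxes would not extend to Borel sets. The perturbation is therefore
  realised as the measure \<open>Q1\<close> plus \<open>Q2\<close>, so that both sides agree on a
  generating class and hence as measures; the inequality is then read off.\<close>

lemma law_le: "0 < t ==> S \<in> sets borel ==> emeasure (law (- K) t) S <= emeasure (Um t) S"
proof -
	assume t: "0 < t" and S: "S \<in> sets borel"
	let ?w = "%x. V x + K"
	have w: "?w \<in> bm borel" by measurable
	let ?R = "add_measure (law (- K) t) (add_measure (Q1 (- K) ?w t) (Q2 (- K) ?w t))"
	have R: "emeasure ?R S = emeasure (law (- K) t) S + (emeasure (Q1 (- K) ?w t) S + emeasure (Q2 (- K) ?w t) S)" if "S \<in> sets borel" for S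
		using that by (subst add_measure(3)) (auto simp: add_measure)
	have "?R = Um t"
	proof (rule measure_eqI_box_gen)
		fix a c d
		have k0: "kern (- K) (%_. 0) t z = 0" for z by (simp add: kern_def)
		show eq: "emeasure ?R ({..<a} \<times> {c<..<d}) = emeasure (Um t) ({..<a} \<times> {c<..<d})"
			using box_eq[of ?w "%_. 0" "- K" t a c d] t VK K0 unfolding R[OF G_sets] Q12_box[OF w] k0 by auto
		then show "emeasure ?R ({..<a} \<times> {c<..<d}) \<noteq> \<infinity>" using Um_box_fin[OF t] by simp
	qed (auto simp: add_measure)
	then show ?thesis using R[OF S] by (metis le_iff_add)
qed

text \<open>As \<open>law_le\<close> with the sides exchanged. The measure that must be finite on
  boxes is now the weighted law, and the growth bound on \<eta> over (c, d) provides this.\<close>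

lemma Um_le: "0 < t ==> S \<in> sets borel ==> emeasure (Um t) S <= emeasure (law K t) S"
proof -
	assume t: "0 < t" and S: "S \<in> sets borel"
	let ?w = "%x. K - V x"
	have w: "?w \<in> bm borel" by measurable
	let ?R = "add_measure (Um t) (add_measure (Q1 K ?w t) (Q2 K ?w t))"
	have R: "emeasure ?R S = emeasure (Um t) S + (emeasure (Q1 K ?w t) S + emeasure (Q2 K ?w t) S)" if "S \<in> sets borel" for S
		using that by (subst add_measure(3)) (auto simp: add_measure)
	have "law K t = ?R"
	proof (rule measure_eqI_box_gen)
		fix a c d
		have k0: "kern K (%_. 0) t z = 0" for z by (simp add: kern_def)
		show eq: "emeasure (law K t) ({..<a} \<times> {c<..<d}) = emeasure ?R ({..<a} \<times> {c<..<d})"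
			using box_eq[of "%_. 0" ?w K t a c d] t VK K0 unfolding R[OF G_sets] Q12_box[OF w] k0 by auto
		have "emeasure (law K t) ({..<a} \<times> {c<..<d}) <= ennreal (exp (K * t) * (\<eta> c * exp (L * \<bar>d - c\<bar>)))"
			unfolding emeasure_law[OF G_sets]
		proof (rule prob_space_nn_integral_const_le[OF prob_space_axioms])
			fix v
			show "ennreal (exp (K * t) * \<eta> (Y t v)) * indicator ({..<a} \<times> {c<..<d}) (N t v, Y t v) <= ennreal (exp (K * t) * (\<eta> c * exp (L * \<bar>d - c\<bar>)))"
			proof (cases "Y t v \<in> {c<..<d}")
				case True
				have "\<eta> (Y t v) <= \<eta> c * exp (L * \<bar>Y t v - c\<bar>)" by (rule \<eta>_lip)
				also have "... <= \<eta> c * exp (L * \<bar>d - c\<bar>)" using True L0 \<eta>_nonneg by (intro mult_left_mono) (auto intro!: mult_left_mono)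
				finally show ?thesis by (auto simp: indicator_def intro!: ennreal_leI)
			qed simp
		qed
		then show "emeasure (law K t) ({..<a} \<times> {c<..<d}) \<noteq> \<infinity>" by (metis ennreal_neq_top infinity_ennreal_def neq_top_trans)
	qed (auto simp: add_measure)
	then show ?thesis using R[OF S] by (metis le_iff_add)
qed

text \<open>The laws at all times s > 0 as one measure in (s, m, y), so that a single density is
  jointly measurable in time and space.\<close>

definition \<Theta> :: "(real \<times> real \<times> real) measure" where
	"\<Theta> = distr (density (P \<Otimes>\<^sub>M lborel) (%z. ennreal (exp (- K * snd z) * \<eta> (Y (snd z) (fst z))) * indicator {0<..} (snd z)))
		 borel (%z. (snd z, N (snd z) (fst z), Y (snd z) (fst z)))"

lemma SNY_meas [measurable]: "(%z. (snd z, N (snd z) (fst z), Y (snd z) (fst z))) \<in> bm (P \<Otimes>\<^sub>M lborel)"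
	unfolding borel_prod[symmetric] by measurable

lemma Theta_int:
	assumes [measurable]: "f \<in> bm borel"
	shows "(\<integral>\<^sup>+x. f x \<partial>\<Theta>) = (NN z|(P \<Otimes>\<^sub>M lborel). ennreal (exp (- K * snd z) * \<eta> (Y (snd z) (fst z))) * indicator {0<..} (snd z) * f (snd z, N (snd z) (fst z), Y (snd z) (fst z)))"
	unfolding \<Theta>_def by (subst nn_integral_distr) (auto simp: nn_integral_density)

lemma Theta_le:
	assumes S [measurable]: "S \<in> sets borel"
	shows "emeasure \<Theta> S <= (NN x|lborel. (U (fst x) (fst (snd x)) (snd (snd x)) * indicator {0<..} (fst x)) * indicator S x)"
proof -
	have "emeasure \<Theta> S = (\<integral>\<^sup>+x. indicator S x \<partial>\<Theta>)" by (simp add: \<Theta>_def)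
	also have "... = (NN z|(P \<Otimes>\<^sub>M lborel). ennreal (exp (- K * snd z) * \<eta> (Y (snd z) (fst z))) * indicator {0<..} (snd z) * indicator S (snd z, N (snd z) (fst z), Y (snd z) (fst z)))"
		by (rule Theta_int) simp
	also have "... = (\<integral>\<^sup>+s. \<integral>\<^sup>+w. ennreal (exp (- K * s) * \<eta> (Y s w)) * indicator {0<..} s * indicator S (s, N s w, Y s w) \<partial>P \<partial>lborel)"
		by (subst PL.nn_integral_snd[symmetric]) (auto simp: split_beta')
	also have "... <= (\<integral>\<^sup>+s. \<integral>\<^sup>+q. (U s (fst q) (snd q) * indicator {0<..} s) * indicator S (s, q) \<partial>lborel \<partial>lborel)"
	proof (rule nn_integral_mono)
		fix s :: real
		show "(NN w|P. ennreal (exp (- K * s) * \<eta> (Y s w)) * indicator {0<..} s * indicator S (s, N s w, Y s w))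
			<= (NN q|lborel. (U s (fst q) (snd q) * indicator {0<..} s) * indicator S (s, q))"
		proof (cases "0 < s")
			case True
			have Ss: "Pair s -` S \<in> sets borel"
				using S by (intro sets_Pair1[of S borel borel, unfolded borel_prod]) auto
			have "(NN w|P. ennreal (exp (- K * s) * \<eta> (Y s w)) * indicator {0<..} s * indicator S (s, N s w, Y s w)) = emeasure (law (- K) s) (Pair s -` S)"
				unfolding emeasure_law[OF Ss] using True by (auto intro!: nn_integral_cong simp: indicator_def)
			also have "... <= emeasure (Um s) (Pair s -` S)" by (rule law_le[OF True Ss])
			also have "... = (NN q|lborel. (U s (fst q) (snd q) * indicator {0<..} s) * indicator S (s, q))"
				unfolding Um_def using Ss True by (subst emeasure_density) (auto intro!: nn_integral_cong simp: indicator_def)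
			finally show ?thesis .
		qed simp
	qed
	also have "... = (NN x|(lborel \<Otimes>\<^sub>M lborel). (U (fst x) (fst (snd x)) (snd (snd x)) * indicator {0<..} (fst x)) * indicator S x)"
	proof (subst lborel.nn_integral_fst[symmetric])
		have "S \<in> sets (lborel \<Otimes>\<^sub>M lborel)" using S unfolding lborel_prod by simp
		note [measurable] = this
		show "(%x. (U (fst x) (fst (snd x)) (snd (snd x)) * indicator {0<..} (fst x)) * indicator S x) \<in> bm (lborel \<Otimes>\<^sub>M lborel)" by measurable
	qed auto
	finally show ?thesis unfolding lborel_prod .
qed

end

section \<open>A version of the density that is continuous up to the diagonal\<close>

lemma measurable_fst_snd_borel [measurable]:
	"(fst :: 'a::topological_space \<times> 'b::topological_space => 'a) \<in> bm borel"
	"(snd :: 'a::topological_space \<times> 'b::topological_space => 'b) \<in> bm borel"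
	by (auto intro!: borel_measurable_continuous_onI continuous_intros)

lemma rk_tendsto:
	assumes "0 < r" "u \<longlonglongrightarrow> y" "\<And>n. u n <= m" "y <= m"
	shows "(%n. rk r x m (u n)) \<longlonglongrightarrow> rk r x m y"
	using assms by (cases "x < m") (auto simp: rk_def intro!: tendsto_intros gam_tendsto)

lemma gk_tendsto:
	assumes "0 < r" "u \<longlonglongrightarrow> y" "\<And>n. u n <= m" "y <= m"
	shows "(%n. gk m r x (u n)) \<longlonglongrightarrow> gk m r x y"
	using assms by (cases "x < m") (auto simp: gk_def intro!: tendsto_intros gam_tendsto)

context flat
begin

text \<open>Twice the constant of \<open>v_gam_exp\<close>; what matters is its order 1 / sqrt t as
  t tends to 0.\<close>

definition ct :: "real => real" where "ct t = 4 * exp (2 * L^2 * t) / sqrt t"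

lemma ct_nonneg: "0 < t ==> 0 <= ct t" by (simp add: ct_def)

text \<open>The kernel depends on 2 m - x - y, which dominates |x - y|, m - x and m - y. So the
  weight is absorbed and either distance may be kept: the first form, with the initial point, is
  integrated over m for (i); the second is uniform in the initial law.\<close>

lemma eta_rk:
	assumes t: "0 < t"
	shows "\<eta> x * rk t x m y <= \<eta> y * (ct t * gam (4 * t) (m - x))" "\<eta> x * rk t x m y <= \<eta> y * (ct t * gam (4 * t) (m - y))"
proof -
	have "\<eta> x * rk t x m y <= \<eta> y * (ct t * gam (4 * t) (m - x)) \<and> \<eta> x * rk t x m y <= \<eta> y * (ct t * gam (4 * t) (m - y))"
	proof (cases "x < m \<and> y <= m")
		case True
		define v where "v = 2 * m - x - y"
		have v: "0 <= v" "\<bar>x - y\<bar> <= \<bar>v\<bar>" "\<bar>m - x\<bar> <= \<bar>v\<bar>" "\<bar>m - y\<bar> <= \<bar>v\<bar>" using True by (auto simp: v_def)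
		have "\<eta> x <= \<eta> y * exp (L * \<bar>x - y\<bar>)" by (rule \<eta>_lip)
		also have "... <= \<eta> y * exp (L * \<bar>v\<bar>)" using v L0 \<eta>_nonneg by (intro mult_left_mono) (auto intro!: mult_left_mono)
		finally have "\<eta> x * rk t x m y <= (\<eta> y * exp (L * \<bar>v\<bar>)) * rk t x m y" by (intro mult_right_mono rk_nonneg t)
		also have "... = \<eta> y * (2 * (exp (L * \<bar>v\<bar>) * (\<bar>v\<bar> / t * gam t v)))" using True v by (simp add: rk_def v_def)
		also have "... <= \<eta> y * (2 * (2 * exp (2 * L^2 * t) / sqrt t * gam (4 * t) v))"
			by (intro mult_left_mono v_gam_exp t L0 \<eta>_nonneg) auto
		also have "... = \<eta> y * (ct t * gam (4 * t) v)" by (simp add: ct_def)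
		finally have "\<eta> x * rk t x m y <= \<eta> y * (ct t * gam (4 * t) v)" .
		moreover have "\<eta> y * (ct t * gam (4 * t) v) <= \<eta> y * (ct t * gam (4 * t) w)" if "\<bar>w\<bar> <= \<bar>v\<bar>" for w
			using that t by (intro mult_left_mono gam_antimono ct_nonneg \<eta>_nonneg) auto
		ultimately show ?thesis using v by (meson order_trans)
	next
		case False
		then have "rk t x m y = 0" by (auto simp: rk_def)
		then show ?thesis using gam_nonneg[of "4 * t"] t \<eta>_nonneg ct_nonneg by simp
	qed
	then show "\<eta> x * rk t x m y <= \<eta> y * (ct t * gam (4 * t) (m - x))" "\<eta> x * rk t x m y <= \<eta> y * (ct t * gam (4 * t) (m - y))" by auto
qed

lemma U_le1:
	assumes t: "0 < t"
	shows "U t m y <= ennreal (\<eta> y) * (NN w|P. ennreal (ct t * gam (4 * t) (m - Y 0 w)))"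
proof -
	have "U t m y <= (NN w|P. ennreal (\<eta> y) * ennreal (ct t * gam (4 * t) (m - Y 0 w)))"
		unfolding U_def
		by (intro nn_integral_mono) (simp add: ennreal_mult'[symmetric] \<eta>_nonneg rk_nonneg[OF t] ennreal_leI eta_rk[OF t])
	also have "... = ennreal (\<eta> y) * (NN w|P. ennreal (ct t * gam (4 * t) (m - Y 0 w)))"
		by (rule nn_integral_cmult) measurable
	finally show ?thesis .
qed

lemma U_le2: "0 < t ==> U t m y <= ennreal (\<eta> y * (ct t * gam (4 * t) (m - y)))"
	unfolding U_def
	by (rule prob_space_nn_integral_const_le[OF prob_space_axioms])
		 (simp add: ennreal_mult'[symmetric] \<eta>_nonneg rk_nonneg ennreal_leI eta_rk)

text \<open>The weight is moved once more, from z to m. The bound becomes Gaussian in z around m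
  with a coefficient free of z, the shape of the dominating function \<open>nw\<close>.\<close>

lemma U_le3: "0 < t ==> U t m z <= ennreal (ct t * (sqrt 2 * exp (4 * L^2 * t)) * \<eta> m * gam (8 * t) (z - m))"
proof -
	assume t: "0 < t"
	have "\<eta> z * (ct t * gam (4 * t) (m - z)) = ct t * (\<eta> z * gam (4 * t) (z - m))" by (simp add: gam_commute)
	also have "... <= ct t * (sqrt 2 * exp (L^2 * (4 * t)) * \<eta> m * gam (2 * (4 * t)) (z - m))"
		using t by (intro mult_left_mono eta_gam ct_nonneg) auto
	finally have "\<eta> z * (ct t * gam (4 * t) (m - z)) <= ct t * (sqrt 2 * exp (4 * L^2 * t)) * \<eta> m * gam (8 * t) (z - m)"
		by (simp add: mult_ac)
	then show ?thesis using U_le2[OF t, of m z] by (meson ennreal_leI order_trans)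
qed

lemma U_fin: "0 < t ==> U t m y < \<infinity>" using U_le2[of t m y] by (auto intro: le_less_trans)

lemma U_zero: "m < y ==> U t m y = 0" by (simp add: U_def rk_def)

text \<open>The density of \<Theta> is bounded by \<open>U\<close> at every point and not only
  almost everywhere, so its sections at fixed m can be used.\<close>

definition DD0 :: "real \<times> real \<times> real => ennreal" where
	"DD0 = (SOME D. D \<in> bm borel \<and> (\<forall>x. D x <= U (fst x) (fst (snd x)) (snd (snd x)) * indicator {0<..} (fst x)) \<and> \<Theta> = density lborel D)"

lemma DD0: "DD0 \<in> bm borel" "DD0 x <= U (fst x) (fst (snd x)) (snd (snd x)) * indicator {0<..} (fst x)" "\<Theta> = density lborel DD0"
proof -
	obtain D where "D \<in> bm lborel" "\<And>x. D x <= U (fst x) (fst (snd x)) (snd (snd x)) * indicator {0<..} (fst x)" "\<Theta> = density lborel D"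
	proof (rule sigma_finite_measure.density_dominated[OF sigma_finite_lborel, of \<Theta> "%x. U (fst x) (fst (snd x)) (snd (snd x)) * indicator {0<..} (fst x)"])
		show "sets \<Theta> = sets lborel" by (simp add: \<Theta>_def)
		show "\<And>S. S \<in> sets lborel ==> emeasure \<Theta> S <= (NN x|lborel. (U (fst x) (fst (snd x)) (snd (snd x)) * indicator {0<..} (fst x)) * indicator S x)"
			using Theta_le by simp
	qed auto
	then have "\<exists>D. D \<in> bm borel \<and> (\<forall>x. D x <= U (fst x) (fst (snd x)) (snd (snd x)) * indicator {0<..} (fst x)) \<and> \<Theta> = density lborel D" by auto
	from someI_ex[OF this, folded DD0_def]
	show "DD0 \<in> bm borel" "DD0 x <= U (fst x) (fst (snd x)) (snd (snd x)) * indicator {0<..} (fst x)" "\<Theta> = density lborel DD0" by blast+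
qed

definition "DD s m z = DD0 (s, m, z)"

lemma DD_le: "DD s m z <= U s m z" "DD s m z = 0 \<or> 0 < s \<and> z <= m"
	using DD0(2)[of "(s, m, z)"] U_zero[of m z s] by (cases "0 < s"; cases "z <= m"; auto simp: DD_def)+

lemma DD_raw [measurable (raw)]:
	assumes [measurable]: "a \<in> bm Q" "b \<in> bm Q" "c \<in> bm Q"
	shows "(%z. DD (a z) (b z) (c z)) \<in> bm Q"
	unfolding DD_def by (rule measurable_compose[OF _ DD0(1)]) measurable

definition Ld :: "real => real => real => ennreal" where
	"Ld s m z = (NN m'|lborel. DD s m' z * indicator {..<m} m')"

lemma Ld_raw [measurable (raw)]:
	assumes [measurable]: "a \<in> bm Q" "b \<in> bm Q" "c \<in> bm Q"
	shows "(%z. Ld (a z) (b z) (c z)) \<in> bm Q"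
	unfolding Ld_def by measurable

lemma Ld_le: "0 < s ==> Ld s m z <= ennreal (\<eta> z * ct s)"
proof -
	assume s: "0 < s"
	have "Ld s m z <= (NN m'|lborel. ennreal (\<eta> z * ct s) * ennreal (gam (4 * s) (m' - z)))"
		unfolding Ld_def
	proof (rule nn_integral_mono)
		fix m'
		have "DD s m' z * indicator {..<m} m' <= U s m' z" using DD_le(1)[of s m' z] by (auto split: split_indicator)
		also have "... <= ennreal (\<eta> z * (ct s * gam (4 * s) (m' - z)))" by (rule U_le2[OF s])
		finally show "DD s m' z * indicator {..<m} m' <= ennreal (\<eta> z * ct s) * ennreal (gam (4 * s) (m' - z))"
			using s gam_nonneg[of "4 * s"] \<eta>_nonneg ct_nonneg[OF s] by (simp add: ennreal_mult'[symmetric] mult.assoc)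
	qed
	also have "... = ennreal (\<eta> z * ct s)" using s by (subst nn_integral_cmult) (auto simp: nn_integral_gam)
	finally show ?thesis .
qed

text \<open>Density of the Duhamel term at (m, y), with q = (s, z). Either the maximum is already m
  at time s and the path stays below it (\<open>DD\<close> with \<open>gk\<close>), or it is still
  less than m and the path then rises to m (\<open>Ld\<close> with \<open>rk\<close>).\<close>

definition nq :: "real => real => real => real \<times> real => ennreal" where
	"nq t m y q = ennreal (V (snd q) + K) * indicator {0<..<t} (fst q) *
		 (DD (fst q) m (snd q) * ennreal (gk m (t - fst q) (snd q) y) + Ld (fst q) m (snd q) * ennreal (rk (t - fst q) (snd q) m y))"

definition nn :: "real => real => real => ennreal" where
	"nn t m y = (NN q|lborel. nq t m y q)"

lemma nq_raw [measurable (raw)]: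
	assumes [measurable]: "a \<in> bm Q" "b \<in> bm Q" "c \<in> bm Q" "d \<in> bm Q"
	shows "(%z. nq (a z) (b z) (c z) (d z)) \<in> bm Q"
proof -
	have [measurable]: "(%z. indicator {0<..<a z} (fst (d z)) :: ennreal) \<in> bm Q"
	proof -
		have "(%z. indicator {0<..<a z} (fst (d z)) :: ennreal) = (%z. if 0 < fst (d z) \<and> fst (d z) < a z then 1 else 0)"
			by (auto simp: indicator_def)
		then show ?thesis by simp
	qed
	show ?thesis unfolding nq_def by measurable
qed

lemma nn_raw [measurable (raw)]:
	assumes [measurable]: "a \<in> bm Q" "b \<in> bm Q" "c \<in> bm Q"
	shows "(%z. nn (a z) (b z) (c z)) \<in> bm Q"
	unfolding nn_def by measurable

text \<open>Dominates \<open>nq\<close> without involving y. The two inverse square roots come from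
  the law at time s and from the kernel over the remaining time; the Gaussians make it integrable in
  z.\<close>

definition nw :: "real => real => real \<times> real => ennreal" where
	"nw t m q = ennreal (2 * K * (16 * exp (8 * L^2 * t) * \<eta> m)) * (ennreal (1 / sqrt (fst q) * (1 / sqrt (t - fst q))) * indicator {0<..<t} (fst q)
		 * (ennreal (gam (8 * fst q) (snd q - m)) + ennreal (gam (4 * (t - fst q)) (snd q - m))))"

lemma nq_le:
	assumes t: "0 < t"
	shows "nq t m y q <= nw t m q"
proof (cases "fst q \<in> {0<..<t}")
	case True
	obtain s z where q: "q = (s, z)" by (cases q)
	have s: "0 < s" "0 < t - s" using True q by auto
	define c where "c = 16 * exp (8 * L^2 * t) * \<eta> m"
	have c0: "0 <= c" using \<eta>_nonneg by (simp add: c_def)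
	have s2: "sqrt 2 <= 2" by (rule real_le_lsqrt) auto
	\<comment> \<open>Each of the two summands produces a product of two exponentials, with total
	  exponent at most 6 t L^2 and 2 t L^2 respectively; 8 t L^2 serves both.\<close>
	have e: "exp (r * L^2 * \<sigma>) * exp (r' * L^2 * \<sigma>') <= exp (8 * L^2 * t)" if "r * \<sigma> + r' * \<sigma>' <= 8 * t" for r r' \<sigma> \<sigma>'
	proof -
		have "L^2 * (r * \<sigma> + r' * \<sigma>') <= L^2 * (8 * t)" using that by (intro mult_left_mono) auto
		then show ?thesis by (simp add: exp_add[symmetric] algebra_simps)
	qed
	have "DD s m z * ennreal (gk m (t - s) z y) <= ennreal (ct s * (sqrt 2 * exp (4 * L^2 * s)) * \<eta> m * gam (8 * s) (z - m)) * ennreal (1 / sqrt (t - s))"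
		using order_trans[OF DD_le(1) U_le3[OF s(1)]] order_trans[OF gk_le[OF s(2)] gam_le[OF s(2)]] by (intro mult_mono ennreal_leI) auto
	also have "... = ennreal (ct s * (sqrt 2 * exp (4 * L^2 * s)) * \<eta> m * gam (8 * s) (z - m) * (1 / sqrt (t - s)))"
		using s ct_nonneg[of s] \<eta>_nonneg gam_nonneg[of "8 * s"] by (intro ennreal_mult[symmetric]) auto
	also have "... <= ennreal (c * (1 / sqrt s * (1 / sqrt (t - s)) * gam (8 * s) (z - m)))"
	proof (rule ennreal_leI)
		have "4 * exp (2 * L^2 * s) * (sqrt 2 * exp (4 * L^2 * s)) * \<eta> m <= c"
		proof -
			have "(4 * sqrt 2) * (exp (2 * L^2 * s) * exp (4 * L^2 * s)) <= 16 * exp (8 * L^2 * t)"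
				using s s2 by (intro mult_mono e) auto
			then have "(4 * sqrt 2) * (exp (2 * L^2 * s) * exp (4 * L^2 * s)) * \<eta> m <= c"
				unfolding c_def by (rule mult_right_mono) (rule \<eta>_nonneg)
			then show ?thesis by (simp add: mult_ac)
		qed
		then have "4 * exp (2 * L^2 * s) * (sqrt 2 * exp (4 * L^2 * s)) * \<eta> m * (1 / sqrt s * (1 / sqrt (t - s)) * gam (8 * s) (z - m)) <= c * (1 / sqrt s * (1 / sqrt (t - s)) * gam (8 * s) (z - m))"
			using s gam_nonneg[of "8 * s"] by (intro mult_right_mono) auto
		then show "ct s * (sqrt 2 * exp (4 * L^2 * s)) * \<eta> m * gam (8 * s) (z - m) * (1 / sqrt (t - s)) <= c * (1 / sqrt s * (1 / sqrt (t - s)) * gam (8 * s) (z - m))"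
			by (simp add: ct_def mult_ac)
	qed
	finally have 1: "DD s m z * ennreal (gk m (t - s) z y) <= ennreal (c * (1 / sqrt s * (1 / sqrt (t - s)) * gam (8 * s) (z - m)))" .
	have "Ld s m z * ennreal (rk (t - s) z m y) <= ennreal (\<eta> z * ct s) * ennreal (2 * (sqrt 2 / sqrt (t - s) * gam (2 * (t - s)) (z - m)))"
		using Ld_le[OF s(1)] rk_le[OF s(2), of z m y] by (intro mult_mono ennreal_leI) (auto simp: gam_commute[of _ z])
	also have "... = ennreal (ct s * (2 * sqrt 2 / sqrt (t - s)) * (\<eta> z * gam (2 * (t - s)) (z - m)))"
		using s ct_nonneg[of s] \<eta>_nonneg gam_nonneg[of "2 * (t - s)"] by (subst ennreal_mult[symmetric]) (auto simp: mult_ac)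
	also have "... <= ennreal (c * (1 / sqrt s * (1 / sqrt (t - s)) * gam (4 * (t - s)) (z - m)))"
	proof (rule ennreal_leI)
		have "\<eta> z * gam (2 * (t - s)) (z - m) <= sqrt 2 * exp (L^2 * (2 * (t - s))) * \<eta> m * gam (2 * (2 * (t - s))) (z - m)"
			using s by (intro eta_gam) auto
		then have "ct s * (2 * sqrt 2 / sqrt (t - s)) * (\<eta> z * gam (2 * (t - s)) (z - m)) <= ct s * (2 * sqrt 2 / sqrt (t - s)) * (sqrt 2 * exp (L^2 * (2 * (t - s))) * \<eta> m * gam (2 * (2 * (t - s))) (z - m))"
			using s ct_nonneg[of s] by (intro mult_left_mono) auto
		also have "... = (16 * (exp (2 * L^2 * s) * exp (2 * L^2 * (t - s)))) * (\<eta> m * (1 / sqrt s * (1 / sqrt (t - s)) * gam (4 * (t - s)) (z - m)))"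
		proof -
			define E g r where "E = exp (2 * L^2 * (t - s))" and "g = gam (4 * (t - s)) (z - m)" and "r = sqrt (t - s)"
			have a: "exp (L^2 * (2 * (t - s))) = E" "gam (2 * (2 * (t - s))) (z - m) = g" by (simp_all add: E_def g_def mult_ac)
			have "sqrt 2 * (sqrt 2 * x) = 2 * x" for x by (simp add: mult.assoc[symmetric])
			then show ?thesis unfolding a E_def[symmetric] g_def[symmetric] r_def[symmetric] ct_def by (simp add: mult_ac)
		qed
		also have "... <= (16 * exp (8 * L^2 * t)) * (\<eta> m * (1 / sqrt s * (1 / sqrt (t - s)) * gam (4 * (t - s)) (z - m)))"
			using s \<eta>_nonneg gam_nonneg[of "4 * (t - s)"] by (intro mult_right_mono mult_left_mono e) auto
		finally show "ct s * (2 * sqrt 2 / sqrt (t - s)) * (\<eta> z * gam (2 * (t - s)) (z - m)) <= c * (1 / sqrt s * (1 / sqrt (t - s)) * gam (4 * (t - s)) (z - m))"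
			by (simp add: c_def mult_ac)
	qed
	finally have 2: "Ld s m z * ennreal (rk (t - s) z m y) <= ennreal (c * (1 / sqrt s * (1 / sqrt (t - s)) * gam (4 * (t - s)) (z - m)))" .
	have "nq t m y q = ennreal (V z + K) * (DD s m z * ennreal (gk m (t - s) z y) + Ld s m z * ennreal (rk (t - s) z m y))"
		using True by (simp add: nq_def q)
	also have "... <= ennreal (2 * K) * (ennreal (c * (1 / sqrt s * (1 / sqrt (t - s)) * gam (8 * s) (z - m))) + ennreal (c * (1 / sqrt s * (1 / sqrt (t - s)) * gam (4 * (t - s)) (z - m))))"
		using VK(1)[of z] by (intro mult_mono add_mono 1 2 ennreal_leI) auto
	also have "... = ennreal (2 * K * (c * (1 / sqrt s * (1 / sqrt (t - s)) * (gam (8 * s) (z - m) + gam (4 * (t - s)) (z - m)))))"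
		using s c0 K0 gam_nonneg[of "4 * (t - s)" "z - m"] gam_nonneg[of "8 * s" "z - m"]
		by (subst ennreal_plus[symmetric]) (auto simp: ennreal_mult'[symmetric] distrib_left)
	also have "... = ennreal (2 * K * c) * (ennreal (1 / sqrt s * (1 / sqrt (t - s))) * ennreal (gam (8 * s) (z - m) + gam (4 * (t - s)) (z - m)))"
		using s c0 K0 gam_nonneg[of "4 * (t - s)" "z - m"] gam_nonneg[of "8 * s" "z - m"]
		by (subst ennreal_mult[symmetric], simp, simp, subst ennreal_mult[symmetric]) (auto simp: mult_ac)
	also have "... = nw t m q"
		using True s gam_nonneg[of "4 * (t - s)" "z - m"] gam_nonneg[of "8 * s" "z - m"] by (simp add: nw_def q c_def)
	finally show ?thesis .
qed (simp add: nq_def)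

lemma nw_meas [measurable]: "nw t m \<in> bm borel"
	unfolding nw_def[abs_def] by measurable

lemma nw_fin:
	assumes t: "0 < t"
	shows "(NN q|lborel. nw t m q) < \<infinity>"
proof -
	let ?c = "ennreal (2 * K * (16 * exp (8 * L^2 * t) * \<eta> m))"
	have "(NN q|lborel. nw t m q) = (\<integral>\<^sup>+s. \<integral>\<^sup>+z. nw t m (s, z) \<partial>lborel \<partial>lborel)"
		using lborel.nn_integral_fst[of "nw t m" lborel] unfolding lborel_prod by simp
	also have "... = (NN s|lborel. ?c * (2 * (ennreal (1 / sqrt s * (1 / sqrt (t - s))) * indicator {0<..<t} s)))"
	proof (rule nn_integral_cong)
		fix s
		show "(NN z|lborel. nw t m (s, z)) = ?c * (2 * (ennreal (1 / sqrt s * (1 / sqrt (t - s))) * indicator {0<..<t} s))"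
		proof (cases "s \<in> {0<..<t}")
			case True
			then show ?thesis unfolding nw_def
				by (simp add: nn_integral_cmult nn_integral_add nn_integral_gam mult_ac)
		qed (simp add: nw_def)
	qed
	also have "... = ?c * (2 * (NN s|lborel. ennreal (1 / sqrt s * (1 / sqrt (t - s))) * indicator {0<..<t} s))"
		by (simp add: nn_integral_cmult)
	also have "... < \<infinity>" using nn_integral_inv_sqrt2[OF t] by (auto simp: ennreal_mult_less_top)
	finally show ?thesis .
qed

lemma nn_fin: "0 < t ==> nn t m y < \<infinity>"
	by (rule le_less_trans[OF _ nw_fin]) (auto simp: nn_def intro!: nn_integral_mono nq_le)

lemma U_tendsto:
	assumes t: "0 < t" and u: "u \<longlonglongrightarrow> y" "\<And>n. u n <= m" "y <= m"
	shows "(%n. U t m (u n)) \<longlonglongrightarrow> U t m y"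
	unfolding U_def
proof (rule nn_integral_dominated_convergence[where w="%v. ennreal (2 * sqrt 2 / sqrt t * (sqrt 2 * exp (2 * L^2 * t) * \<eta> m * (1 / sqrt (4 * t))))"])
	have *: "\<eta> x * rk t x m y <= 2 * sqrt 2 / sqrt t * (sqrt 2 * exp (2 * L^2 * t) * \<eta> m * (1 / sqrt (4 * t)))" for x y
	proof -
		have "\<eta> x * rk t x m y <= \<eta> x * (2 * (sqrt 2 / sqrt t * gam (2 * t) (m - x)))" by (intro mult_left_mono rk_le t \<eta>_nonneg)
		also have "... = 2 * sqrt 2 / sqrt t * (\<eta> x * gam (2 * t) (x - m))" by (simp add: gam_commute)
		also have "... <= 2 * sqrt 2 / sqrt t * (sqrt 2 * exp (L^2 * (2 * t)) * \<eta> m * gam (2 * (2 * t)) (x - m))"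
			using t by (intro mult_left_mono eta_gam) auto
		also have "... <= 2 * sqrt 2 / sqrt t * (sqrt 2 * exp (L^2 * (2 * t)) * \<eta> m * (1 / sqrt (4 * t)))"
			using t gam_le[of "4 * t" "x - m"] \<eta>_nonneg by (intro mult_left_mono) auto
		finally show ?thesis by (simp add: mult_ac)
	qed
	show "AE v in P. ennreal (\<eta> (Y 0 v)) * ennreal (rk t (Y 0 v) m (u n)) <= ennreal (2 * sqrt 2 / sqrt t * (sqrt 2 * exp (2 * L^2 * t) * \<eta> m * (1 / sqrt (4 * t))))" for n
		using * by (intro AE_I2) (simp add: ennreal_mult'[symmetric] \<eta>_nonneg ennreal_leI)
	show "AE v in P. (%n. ennreal (\<eta> (Y 0 v)) * ennreal (rk t (Y 0 v) m (u n))) \<longlonglongrightarrow> ennreal (\<eta> (Y 0 v)) * ennreal (rk t (Y 0 v) m y)"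
		by (intro AE_I2 ennreal_tendsto_cmult tendsto_ennrealI rk_tendsto t u) simp
qed (auto simp: emeasure_space_1)

text \<open>The unknown factors \<open>DD\<close> and \<open>Ld\<close> do not contain y, and the
  bound \<open>nw\<close> does not either. Dominated convergence thus passes the continuity of the
  kernels on the closed half-line y <= m to the integral.\<close>

lemma nn_tendsto:
	assumes t: "0 < t" and u: "u \<longlonglongrightarrow> y" "\<And>n. u n <= m" "y <= m"
	shows "(%n. nn t m (u n)) \<longlonglongrightarrow> nn t m y"
	unfolding nn_def
proof (rule nn_integral_dominated_convergence[where w="nw t m"])
	show "AE q in lborel. (%n. nq t m (u n) q) \<longlonglongrightarrow> nq t m y q"
	proof (rule AE_I2)
		fix q :: "real \<times> real"
		show "(%n. nq t m (u n) q) \<longlonglongrightarrow> nq t m y q"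
		proof (cases "fst q \<in> {0<..<t}")
			case True
			then have s: "0 < fst q" "0 < t - fst q" by auto
			have "DD (fst q) m (snd q) < \<infinity>" using DD_le(1) U_fin[OF s(1)] by (rule le_less_trans)
			moreover have "Ld (fst q) m (snd q) < \<infinity>" using Ld_le[OF s(1)] by (rule le_less_trans) simp
			ultimately show ?thesis
				unfolding nq_def using True
				by (intro ennreal_tendsto_cmult tendsto_add tendsto_ennrealI rk_tendsto gk_tendsto s u) auto
		qed (simp add: nq_def)
	qed
qed (use nq_le[OF t] nw_fin[OF t] in auto)

text \<open>For fixed s and z, \<open>J2_sum\<close> adds the part that keeps the old maximum and
  the part that raises it, which gives the kernel killed at a. The remaining integral against
  \<open>DD\<close> is one against \<Theta>, hence an expectation over paths.\<close>

lemma box_nn: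
	assumes t: "0 < t"
	shows "(NN p|lborel. nn t (fst p) (snd p) * indicator ({..<a} \<times> {c<..<d}) p)
		= (NN z|(P \<Otimes>\<^sub>M lborel). kern (- K) (%x. V x + K) t z * (indicator {..<a} (N (snd z) (fst z)) * gJ c d a (t - snd z) (Y (snd z) (fst z))))"
proof -
	let ?G = "{..<a} \<times> {c<..<d}"
	let ?cc = "%s z. ennreal (V z + K) * indicator {0<..<t} s"
	have "(NN p|lborel. nn t (fst p) (snd p) * indicator ?G p) = (\<integral>\<^sup>+p. \<integral>\<^sup>+q. nq t (fst p) (snd p) q * indicator ?G p \<partial>lborel \<partial>lborel)"
		unfolding nn_def by (subst nn_integral_multc) auto
	also have "... = (\<integral>\<^sup>+q. \<integral>\<^sup>+p. nq t (fst p) (snd p) q * indicator ?G p \<partial>lborel \<partial>lborel)"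
		by (rule lborel_pair.Fubini') measurable
	also have "... = (\<integral>\<^sup>+q. \<integral>\<^sup>+m. DD (fst q) m (snd q) * (?cc (fst q) (snd q) * (indicator {..<a} m * gJ c d a (t - fst q) (snd q))) \<partial>lborel \<partial>lborel)"
	proof (rule nn_integral_cong)
		fix q :: "real \<times> real"
		obtain s z where q: "q = (s, z)" by (cases q)
		show "(NN p|lborel. nq t (fst p) (snd p) q * indicator ?G p) =
			(NN m|lborel. DD (fst q) m (snd q) * (?cc (fst q) (snd q) * (indicator {..<a} m * gJ c d a (t - fst q) (snd q))))"
		proof (cases "s \<in> {0<..<t}")
			case True
			then have s: "0 < t - s" by simp
			let ?J = "%m. \<integral>\<^sup>+y. ennreal (rk (t - s) z m y) * indicator {c<..<d} y \<partial>lborel"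
			have "(NN p|lborel. nq t (fst p) (snd p) q * indicator ?G p) =
				(NN p|(lborel \<Otimes>\<^sub>M lborel). ennreal (V z + K) * ((DD s (fst p) z * (indicator {..<a} (fst p) * (ennreal (gk (fst p) (t - s) z (snd p)) * indicator {c<..<d} (snd p))))
					 + (Ld s (fst p) z * (indicator {..<a} (fst p) * (ennreal (rk (t - s) z (fst p) (snd p)) * indicator {c<..<d} (snd p))))))"
				unfolding lborel_prod using True by (intro nn_integral_cong) (auto simp: nq_def q split: split_indicator)
			also have "... = (\<integral>\<^sup>+m. \<integral>\<^sup>+y. ennreal (V z + K) * ((DD s m z * (indicator {..<a} m * (ennreal (gk m (t - s) z y) * indicator {c<..<d} y)))
					 + (Ld s m z * (indicator {..<a} m * (ennreal (rk (t - s) z m y) * indicator {c<..<d} y)))) \<partial>lborel \<partial>lborel)"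
				by (subst lborel.nn_integral_fst[symmetric]) (auto simp: split_beta')
			also have "... = (NN m|lborel. ennreal (V z + K) * (DD s m z * (indicator {..<a} m * gJ c d m (t - s) z) + Ld s m z * (indicator {..<a} m * ?J m)))"
				unfolding gJ_def by (intro nn_integral_cong) (simp add: nn_integral_cmult nn_integral_add)
			also have "... = ennreal (V z + K) * ((NN m|lborel. DD s m z * (indicator {..<a} m * gJ c d m (t - s) z)) + (NN m|lborel. Ld s m z * (indicator {..<a} m * ?J m)))"
				by (simp add: nn_integral_cmult nn_integral_add)
			also have "(NN m|lborel. Ld s m z * (indicator {..<a} m * ?J m)) = (\<integral>\<^sup>+m. \<integral>\<^sup>+m'. DD s m' z * indicator {..<m} m' * (indicator {..<a} m * ?J m) \<partial>lborel \<partial>lborel)"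
				unfolding Ld_def by (intro nn_integral_cong nn_integral_multc[symmetric]) measurable
			also have "... = (\<integral>\<^sup>+m'. \<integral>\<^sup>+m. DD s m' z * indicator {..<m} m' * (indicator {..<a} m * ?J m) \<partial>lborel \<partial>lborel)"
				by (rule lborel_pair.Fubini') measurable
			also have "... = (NN m'|lborel. DD s m' z * J2 a c d m' (t - s) z)"
				unfolding J2_alt by (intro nn_integral_cong, subst nn_integral_cmult[symmetric]) (auto intro!: nn_integral_cong split: split_indicator)
			also have "(NN m|lborel. DD s m z * (indicator {..<a} m * gJ c d m (t - s) z)) + (NN m'|lborel. DD s m' z * J2 a c d m' (t - s) z)
				= (NN m|lborel. DD s m z * (indicator {..<a} m * gJ c d m (t - s) z) + DD s m z * J2 a c d m (t - s) z)"
			proof (rule nn_integral_add[symmetric])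
				show "(%m. DD s m z * J2 a c d m (t - s) z) \<in> bm lborel" unfolding J2_def by measurable
			qed measurable
			also have "... = (NN m|lborel. DD s m z * (indicator {..<a} m * gJ c d a (t - s) z))"
			proof (rule nn_integral_cong)
				fix m
				show "DD s m z * (indicator {..<a} m * gJ c d m (t - s) z) + DD s m z * J2 a c d m (t - s) z = DD s m z * (indicator {..<a} m * gJ c d a (t - s) z)"
					using DD_le(2)[of s m z] J2_sum[OF s, of z m a c d] by (auto simp: distrib_left[symmetric])
			qed
			also have "ennreal (V z + K) * ... = (NN m|lborel. DD (fst q) m (snd q) * (?cc (fst q) (snd q) * (indicator {..<a} m * gJ c d a (t - fst q) (snd q))))"
				using True by (subst nn_integral_cmult[symmetric]) (auto simp: q mult_ac intro!: nn_integral_cong)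
			finally show ?thesis .
		qed (simp add: q nq_def)
	qed
	also have "... = (\<integral>\<^sup>+s. \<integral>\<^sup>+z. \<integral>\<^sup>+m. DD s m z * (?cc s z * (indicator {..<a} m * gJ c d a (t - s) z)) \<partial>lborel \<partial>lborel \<partial>lborel)"
		unfolding lborel_prod[symmetric] by (subst lborel.nn_integral_fst[symmetric]) auto
	also have "... = (\<integral>\<^sup>+s. \<integral>\<^sup>+m. \<integral>\<^sup>+z. DD s m z * (?cc s z * (indicator {..<a} m * gJ c d a (t - s) z)) \<partial>lborel \<partial>lborel \<partial>lborel)"
		by (intro nn_integral_cong lborel_pair.Fubini') measurable
	also have "... = (\<integral>\<^sup>+s. \<integral>\<^sup>+p. DD s (fst p) (snd p) * (?cc s (snd p) * (indicator {..<a} (fst p) * gJ c d a (t - s) (snd p))) \<partial>lborel \<partial>lborel)"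
		unfolding lborel_prod[symmetric] by (intro nn_integral_cong, subst lborel.nn_integral_fst[symmetric]) auto
	also have "... = (NN x|(lborel \<Otimes>\<^sub>M lborel). DD (fst x) (fst (snd x)) (snd (snd x)) * (?cc (fst x) (snd (snd x)) * (indicator {..<a} (fst (snd x)) * gJ c d a (t - fst x) (snd (snd x)))))"
		by (subst lborel.nn_integral_fst[symmetric]) (auto simp: split_beta')
	also have "... = (\<integral>\<^sup>+x. ?cc (fst x) (snd (snd x)) * (indicator {..<a} (fst (snd x)) * gJ c d a (t - fst x) (snd (snd x))) \<partial>\<Theta>)"
		unfolding DD0(3) lborel_prod by (subst nn_integral_density) (auto simp: DD_def DD0(1))
	also have "... = (NN z|(P \<Otimes>\<^sub>M lborel). ennreal (exp (- K * snd z) * \<eta> (Y (snd z) (fst z))) * indicator {0<..} (snd z) * (?cc (snd z) (Y (snd z) (fst z)) * (indicator {..<a} (N (snd z) (fst z)) * gJ c d a (t - snd z) (Y (snd z) (fst z)))))"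
		by (subst Theta_int) auto
	also have "... = (NN z|(P \<Otimes>\<^sub>M lborel). kern (- K) (%x. V x + K) t z * (indicator {..<a} (N (snd z) (fst z)) * gJ c d a (t - snd z) (Y (snd z) (fst z))))"
	proof (rule nn_integral_cong_AE)
		\<comment> \<open>\<Theta> lives on s > 0, while \<open>kern\<close> includes s = 0; the
		  difference is negligible.\<close>
		have "AE s in lborel. s \<noteq> (0::real)" by (rule AE_lborel_singleton)
		moreover have PL': "pair_sigma_finite P (lborel :: real measure)" ..
		ultimately have "AE z in P \<Otimes>\<^sub>M lborel. snd z \<noteq> (0::real)"
		proof (intro pair_sigma_finite.AE_pair_measure[OF PL'])
			show "{z \<in> space (P \<Otimes>\<^sub>M lborel). snd z \<noteq> (0::real)} \<in> sets (P \<Otimes>\<^sub>M lborel)" by measurable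
		qed simp
		then show "AE z in P \<Otimes>\<^sub>M lborel. ennreal (exp (- K * snd z) * \<eta> (Y (snd z) (fst z))) * indicator {0<..} (snd z) * (?cc (snd z) (Y (snd z) (fst z)) * (indicator {..<a} (N (snd z) (fst z)) * gJ c d a (t - snd z) (Y (snd z) (fst z))))
			= kern (- K) (%x. V x + K) t z * (indicator {..<a} (N (snd z) (fst z)) * gJ c d a (t - snd z) (Y (snd z) (fst z)))"
		proof eventually_elim
			case (elim z)
			show ?case
			proof (cases "snd z \<in> {0<..<t}")
				case True
				then show ?thesis using VK \<eta>_nonneg by (simp add: kern_def ennreal_mult mult_ac)
			next
				case False
				then show ?thesis using elim by (auto simp: kern_def split: split_indicator)
			qed
		qed
	qed
	finally show ?thesis .
qed

text \<open>Subtraction in \<open>ennreal\<close> is truncated at 0, so \<open>qd\<close> is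
  nonnegative everywhere, even where \<open>nn\<close> might exceed \<open>U\<close>.\<close>

definition qd :: "real => real => real => real" where
	"qd t m y = (if 0 < t then enn2real (U t m y - nn t m y) else 0)"

lemma qd_raw [measurable (raw)]:
	assumes [measurable]: "a \<in> bm Q" "b \<in> bm Q" "c \<in> bm Q"
	shows "(%z. qd (a z) (b z) (c z)) \<in> bm Q"
	unfolding qd_def by measurable

lemma qd_nonneg: "0 <= qd t m y" by (simp add: qd_def)

lemma qd_zero: "m < y ==> qd t m y = 0" by (simp add: qd_def U_zero)

lemma ennreal_qd: "0 < t ==> ennreal (qd t m y) = U t m y - nn t m y"
	using le_less_trans[OF diff_le_self_ennreal U_fin[of t m y]] by (simp add: qd_def ennreal_enn2real)

lemma qd_le: "0 < t ==> ennreal (qd t m y) <= U t m y"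
	by (simp add: ennreal_qd diff_le_self_ennreal)

lemma qd_cont:
	assumes t: "0 < t"
	shows "continuous_on {..m} (qd t m)"
proof (rule continuous_on_sequentiallyI)
	fix u :: "nat => real" and y assume u: "\<forall>n. u n \<in> {..m}" "y \<in> {..m}" "u \<longlonglongrightarrow> y"
	have "(%n. U t m (u n) - nn t m (u n)) \<longlonglongrightarrow> U t m y - nn t m y"
		using u t U_fin[OF t, of m y] nn_fin[OF t, of m y] by (intro tendsto_diff_ennreal U_tendsto nn_tendsto) auto
	then have "(%n. ennreal (qd t m (u n))) \<longlonglongrightarrow> ennreal (qd t m y)" unfolding ennreal_qd[OF t] .
	then show "(%n. qd t m (u n)) \<longlonglongrightarrow> qd t m y"
		by (simp add: tendsto_ennreal_iff qd_nonneg)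
qed

text \<open>Some density f exists by \<open>law_le\<close>. On boxes f + \<open>nn\<close> and
  \<open>U\<close> have equal integrals, so f = \<open>U\<close> - \<open>nn\<close> almost
  everywhere.\<close>

lemma law_density:
	assumes t: "0 < t"
	shows "law (- K) t = density lborel (%p. ennreal (qd t (fst p) (snd p)))"
proof -
	obtain f where f [measurable]: "f \<in> bm lborel" and fU: "\<And>p. f p <= U t (fst p) (snd p)" and lf: "law (- K) t = density lborel f"
	proof (rule sigma_finite_measure.density_dominated[OF sigma_finite_lborel, of "law (- K) t" "%p. U t (fst p) (snd p)"])
		show "\<And>S. S \<in> sets lborel ==> emeasure (law (- K) t) S <= (NN p|lborel. U t (fst p) (snd p) * indicator S p)"
			using law_le[OF t] by (auto simp: Um_def emeasure_density)
	qed auto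
	have "density lborel (%p. f p + nn t (fst p) (snd p)) = Um t"
	proof (rule measure_eqI_box_gen)
		fix a c d
		have "emeasure (density lborel (%p. f p + nn t (fst p) (snd p))) ({..<a} \<times> {c<..<d})
			= (NN p|lborel. f p * indicator ({..<a} \<times> {c<..<d}) p + nn t (fst p) (snd p) * indicator ({..<a} \<times> {c<..<d}) p)"
			by (subst emeasure_density) (auto simp: distrib_right)
		also have "... = emeasure (law (- K) t) ({..<a} \<times> {c<..<d}) + (NN p|lborel. nn t (fst p) (snd p) * indicator ({..<a} \<times> {c<..<d}) p)"
			unfolding lf by (subst nn_integral_add) (auto simp: emeasure_density)
		also have "... = emeasure (Um t) ({..<a} \<times> {c<..<d})"
		proof -
			have k0: "kern (- K) (%_. 0) t z = 0" for z by (simp add: kern_def)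
			show ?thesis using box_eq[of "%x. V x + K" "%_. 0" "- K" t a c d] t VK K0 unfolding box_nn[OF t] k0 by auto
		qed
		finally show eq: "emeasure (density lborel (%p. f p + nn t (fst p) (snd p))) ({..<a} \<times> {c<..<d}) = emeasure (Um t) ({..<a} \<times> {c<..<d})" .
		then show "emeasure (density lborel (%p. f p + nn t (fst p) (snd p))) ({..<a} \<times> {c<..<d}) \<noteq> \<infinity>" using Um_box_fin[OF t] by simp
	qed auto
	then have "AE p in lborel. f p + nn t (fst p) (snd p) = U t (fst p) (snd p)"
		unfolding Um_def by (intro sigma_finite_measure.density_unique[OF sigma_finite_lborel]) auto
	then have "AE p in lborel. f p = ennreal (qd t (fst p) (snd p))"
	proof eventually_elim
		case (elim p)
		then show ?case unfolding ennreal_qd[OF t] using nn_fin[OF t, of "fst p" "snd p"]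
			unfolding elim[symmetric] by (simp add: ennreal_add_diff_cancel_right less_top)
	qed
	then show ?thesis unfolding lf by (intro density_cong) auto
qed

lemma NY_distributed:
	assumes t: "0 < t"
	shows "distr P lborel (%w. (N t w, Y t w)) = density lborel (%p. ennreal (exp (K * t) / \<eta> (snd p) * qd t (fst p) (snd p)))"
proof (rule measure_eqI)
	fix S assume "S \<in> sets (distr P lborel (%w. (N t w, Y t w)))"
	then have S [measurable]: "S \<in> sets borel" by simp
	have "emeasure (distr P lborel (%w. (N t w, Y t w))) S = (\<integral>\<^sup>+p. indicator S p \<partial>distr P lborel (%w. (N t w, Y t w)))" by simp
	also have "... = (NN w|P. indicator S (N t w, Y t w))" by (rule nn_integral_distr) auto
	also have "... = (NN w|P. ennreal (exp (- K * t) * \<eta> (Y t w)) * (ennreal (exp (K * t) / \<eta> (Y t w)) * indicator S (N t w, Y t w)))"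
	proof (rule nn_integral_cong)
		fix w
		have "exp (- K * t) * \<eta> (Y t w) * (exp (K * t) / \<eta> (Y t w)) = 1"
			using \<eta>_pos[of "Y t w"] by (simp add: exp_minus field_simps)
		then show "indicator S (N t w, Y t w) = ennreal (exp (- K * t) * \<eta> (Y t w)) * (ennreal (exp (K * t) / \<eta> (Y t w)) * indicator S (N t w, Y t w))"
			using \<eta>_nonneg by (simp add: mult.assoc[symmetric] ennreal_mult[symmetric])
	qed
	also have "... = (\<integral>\<^sup>+p. ennreal (exp (K * t) / \<eta> (snd p)) * indicator S p \<partial>law (- K) t)"
		unfolding law_def by (subst nn_integral_distr, simp, simp, subst nn_integral_density) auto
	also have "... = (NN p|lborel. ennreal (exp (K * t) / \<eta> (snd p) * qd t (fst p) (snd p)) * indicator S p)"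
	proof -
		have "ennreal (exp (K * t) / \<eta> (snd p) * qd t (fst p) (snd p)) = ennreal (qd t (fst p) (snd p)) * ennreal (exp (K * t) / \<eta> (snd p))" for p
			using \<eta>_nonneg qd_nonneg by (subst mult.commute, intro ennreal_mult) auto
		then show ?thesis unfolding law_density[OF t] by (subst nn_integral_density) (simp_all add: mult_ac)
	qed
	also have "... = emeasure (density lborel (%p. ennreal (exp (K * t) / \<eta> (snd p) * qd t (fst p) (snd p)))) S"
		by (subst emeasure_density) auto
	finally show "emeasure (distr P lborel (%w. (N t w, Y t w))) S = emeasure (density lborel (%p. ennreal (exp (K * t) / \<eta> (snd p) * qd t (fst p) (snd p)))) S" .
qed simp

text \<open>If Y avoids S, then by \<open>Um_le\<close> so does the second marginal of
  \<open>Um\<close>. But the kernel is positive whenever m exceeds both x and y, so each y in S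
  would carry an interval of values of m with positive density. Applied to the zero set of the
  density of X, this gives positivity.\<close>

lemma Y_null:
	assumes t: "0 < t" and S [measurable]: "S \<in> sets borel" and 0: "AE w in P. Y t w \<notin> S"
	shows "S \<in> null_sets lborel"
proof -
	have T [measurable]: "UNIV \<times> S \<in> sets (borel :: (real \<times> real) measure)" by (simp add: borel_prod[symmetric])
	have "emeasure (Um t) (UNIV \<times> S) <= emeasure (law K t) (UNIV \<times> S)" by (rule Um_le[OF t T])
	also have "... = 0" unfolding emeasure_law[OF T]
		using 0 by (subst nn_integral_0_iff_AE) (auto elim!: eventually_mono)
	finally have "(NN p|lborel. U t (fst p) (snd p) * indicator (UNIV \<times> S) p) = 0"
		unfolding Um_def by (simp add: emeasure_density)
	then have "(NN w|P. ennreal (\<eta> (Y 0 w)) * (NN q|lborel. ennreal (rk t (Y 0 w) (fst q) (snd q)) * indicator (UNIV \<times> S) q)) = 0"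
		unfolding U_int[OF T] .
	then have "AE w in P. ennreal (\<eta> (Y 0 w)) * (NN q|lborel. ennreal (rk t (Y 0 w) (fst q) (snd q)) * indicator (UNIV \<times> S) q) = 0"
		by (subst (asm) nn_integral_0_iff_AE) auto
	\<comment> \<open>An almost sure property holds at some sample point; the value x of
	  \<open>Y 0\<close> there serves as starting point, the kernel being positive for every x.\<close>
	from eventually_happens'[OF ae_filter_bot this]
	obtain x where "ennreal (\<eta> x) * (NN q|lborel. ennreal (rk t x (fst q) (snd q)) * indicator (UNIV \<times> S) q) = 0" by blast
	then have "(NN q|lborel. ennreal (rk t x (fst q) (snd q)) * indicator (UNIV \<times> S) q) = 0" using \<eta>_pos[of x] by auto
	then have "AE q in lborel. ennreal (rk t x (fst q) (snd q)) * indicator (UNIV \<times> S) q = 0"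
		by (subst (asm) nn_integral_0_iff_AE) auto
	then have "AE q in lborel \<Otimes>\<^sub>M lborel. \<not> (x < fst q \<and> snd q < fst q \<and> snd q \<in> S)"
		unfolding lborel_prod
	proof eventually_elim
		case (elim q)
		show ?case
		proof
			assume *: "x < fst q \<and> snd q < fst q \<and> snd q \<in> S"
			then have "0 < rk t x (fst q) (snd q)"
				using t gam_pos[OF t] by (simp add: rk_def)
			then show False using elim * by (cases q) (auto simp: indicator_def)
		qed
	qed
	then have "AE m in lborel. AE y in lborel. \<not> (x < m \<and> y < m \<and> y \<in> S)"
		using lborel_pair.AE_pair by fastforce
	then have "AE y in lborel. AE m in lborel. \<not> (x < m \<and> y < m \<and> y \<in> S)"
	proof (subst (asm) lborel_pair.AE_commute)
		show "{z \<in> space (lborel \<Otimes>\<^sub>M lborel). \<not> (x < fst z \<and> snd z < fst z \<and> snd z \<in> S)} \<in> sets (lborel \<Otimes>\<^sub>M lborel)" by measurable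
	qed
	then have "AE y in lborel. y \<notin> S"
	proof eventually_elim
		case (elim y)
		show ?case
		proof
			assume "y \<in> S"
			with elim have "AE m in lborel. m \<notin> {max x y<..<max x y + 1}" by (auto elim!: eventually_mono)
			then have "{max x y<..<max x y + 1} \<in> null_sets lborel" by (subst AE_iff_null_sets) simp_all
			then have "emeasure lborel {max x y<..<max x y + 1} = 0" by (rule null_setsD1)
			moreover have "emeasure lborel {max x y<..<max x y + 1} = ennreal 1" by (subst emeasure_lborel_Ioo) auto
			ultimately have "ennreal 1 = 0" by (simp only:)
			then show False by simp
		qed
	qed
	then show ?thesis by (subst AE_iff_null_sets) simp_all
qed

end

section \<open>The Lamperti transform\<close>

definition g1 :: "real => real => real" where "g1 r v = - v / r * gam r v"

definition g2 :: "real => real => real" where "g2 r v = (v^2 / r^2 - 1 / r) * gam r v"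

lemma gam_g1: "0 < r ==> (gam r has_real_derivative g1 r v) (at v)"
	unfolding g1_def by (rule gam_deriv)

lemma g1_g2:
	assumes "0 < r"
	shows "(g1 r has_real_derivative g2 r v) (at v)"
proof -
	have d: "((%v. - v / r) has_real_derivative - 1 / r) (at v)"
		using assms by (auto intro!: derivative_eq_intros)
	show ?thesis unfolding g1_def[abs_def]
		by (rule DERIV_cong[OF DERIV_mult'[OF d gam_deriv[OF assms]]])
			 (use assms in \<open>simp add: g2_def field_simps power2_eq_square\<close>)
qed

lemma gam_heat:
	assumes "0 < r"
	shows "((%r. gam r v) has_real_derivative 1/2 * g2 r v) (at r)"
proof -
	have E: "((%r. exp (- v\<^sup>2 / (2 * r))) has_real_derivative exp (- v\<^sup>2 / (2 * r)) * (v^2 / (2 * r^2))) (at r)"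
		using assms by (auto intro!: derivative_eq_intros simp: power2_eq_square field_simps)
	have D: "((%r. sqrt (2 * pi * r)) has_real_derivative pi / sqrt (2 * pi * r)) (at r)"
		using assms by (auto intro!: derivative_eq_intros simp: field_simps mult_less_0_iff)
	define e d where "e = exp (- v\<^sup>2 / (2 * r))" and "d = sqrt (2 * pi * r)"
	have d: "0 < d" "d * d = 2 * pi * r" using assms by (auto simp: d_def)
	have "((%r. gam r v) has_real_derivative (e * (v^2 / (2 * r^2)) * d - e * (pi / d)) / (d * d)) (at r)"
		unfolding gam_def e_def d_def using assms by (intro DERIV_divide E D) auto
	also have "(e * (v^2 / (2 * r^2)) * d - e * (pi / d)) / (d * d) = e / d * (v^2 / (2 * r^2)) - e / d * (pi / (d * d))"
		using d(1) by (simp add: field_simps)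
	also have "... = 1/2 * g2 r v"
	proof -
		have "pi / (2 * pi * r) = 1 / (2 * r)" by simp
		then show ?thesis unfolding d(2) g2_def gam_def e_def[symmetric] d_def[symmetric] by (simp add: algebra_simps)
	qed
	finally show ?thesis .
qed

text \<open>Uniform bound, for variances between e and T, of the Gaussian and its first two
  derivatives times exp (L |v|). The exponent L + 2 appears because factors up to v^2 are estimated
  by exp (2 |v|).\<close>

definition Cg :: "real => real => real => real" where
	"Cg e T L = (1 + 1 / e + 1 / e^2) * (sqrt 2 * exp ((L + 2)^2 * T) * (1 / sqrt (2 * e)))"

lemma Cg_bounds:
	assumes e: "0 < e" "e <= u" "u <= T" and L: "0 <= L"
	shows "exp (L * \<bar>v\<bar>) * \<bar>gam u v\<bar> <= Cg e T L" "exp (L * \<bar>v\<bar>) * \<bar>g1 u v\<bar> <= Cg e T L" "exp (L * \<bar>v\<bar>) * \<bar>g2 u v\<bar> <= Cg e T L"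
proof -
	have t: "0 < u" using e by simp
	have *: "exp (L * \<bar>v\<bar>) * \<bar>r * gam u v\<bar> <= Cg e T L" if r: "\<bar>r\<bar> <= (1 + 1 / e + 1 / e^2) * exp (2 * \<bar>v\<bar>)" for r
	proof -
		have "exp (L * \<bar>v\<bar>) * \<bar>r * gam u v\<bar> = \<bar>r\<bar> * (exp (L * \<bar>v\<bar>) * gam u v)" using gam_nonneg[OF t] by (simp add: abs_mult)
		also have "... <= (1 + 1 / e + 1 / e^2) * exp (2 * \<bar>v\<bar>) * (exp (L * \<bar>v\<bar>) * gam u v)"
			using gam_nonneg[OF t] by (intro mult_right_mono r) auto
		also have "... = (1 + 1 / e + 1 / e^2) * (exp ((L + 2) * \<bar>v\<bar>) * gam u v)" 
		proof -
			have "exp ((L + 2) * \<bar>v\<bar>) = exp (2 * \<bar>v\<bar>) * exp (L * \<bar>v\<bar>)" by (simp add: distrib_right exp_add)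
			then show ?thesis by simp
		qed
		also have "... <= Cg e T L" unfolding Cg_def
		proof (rule mult_left_mono)
			have "exp ((L + 2) * \<bar>v\<bar>) * gam u v <= sqrt 2 * exp ((L + 2)^2 * u) * gam (2 * u) v" using L by (intro gam_exp t) auto
			also have "... <= sqrt 2 * exp ((L + 2)^2 * T) * (1 / sqrt (2 * e))"
			proof (intro mult_mono)
				have "gam (2 * u) v <= 1 / sqrt (2 * u)" using t by (intro gam_le) auto
				also have "... <= 1 / sqrt (2 * e)" using e by (intro divide_left_mono) auto
				finally show "gam (2 * u) v <= 1 / sqrt (2 * e)" .
				show "exp ((L + 2)^2 * u) <= exp ((L + 2)^2 * T)" using e by (simp add: mult_left_mono)
			qed (use gam_nonneg[of "2 * u"] t in auto)
			finally show "exp ((L + 2) * \<bar>v\<bar>) * gam u v <= sqrt 2 * exp ((L + 2)^2 * T) * (1 / sqrt (2 * e))" .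
		qed (use e in auto)
		finally show ?thesis .
	qed
	have v1: "\<bar>v\<bar> <= exp \<bar>v\<bar>" using exp_ge_add_one_self[of "\<bar>v\<bar>"] by linarith
	have sq: "exp \<bar>v\<bar> * exp \<bar>v\<bar> = exp (2 * \<bar>v\<bar>)" by (simp add: exp_add[symmetric])
	have v2: "v^2 <= exp (2 * \<bar>v\<bar>)"
	proof -
		have "\<bar>v\<bar> * \<bar>v\<bar> <= exp \<bar>v\<bar> * exp \<bar>v\<bar>" using v1 by (intro mult_mono) auto
		then show ?thesis unfolding sq by (simp add: power2_eq_square)
	qed
	have v0: "1 <= exp (2 * \<bar>v\<bar>)" "\<bar>v\<bar> <= exp (2 * \<bar>v\<bar>)" using exp_ge_add_one_self[of "2 * \<bar>v\<bar>"] abs_ge_zero[of v] by (simp, linarith)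
	have ie: "1 / u <= 1 / e" "1 / u^2 <= 1 / e^2" "0 < 1 / e" "0 < 1 / e^2" using e by (auto intro!: divide_left_mono power_mono)
	define E where "E = exp (2 * \<bar>v\<bar>)"
	have E: "(1 + 1 / e + 1 / e^2) * exp (2 * \<bar>v\<bar>) = E + 1 / e * E + 1 / e^2 * E" by (simp add: E_def distrib_right)
	have p: "0 <= 1 / e * E" "0 <= 1 / e^2 * E" "0 <= E" using ie by (auto simp: E_def)
	show "exp (L * \<bar>v\<bar>) * \<bar>gam u v\<bar> <= Cg e T L"
	proof -
		have "\<bar>1 :: real\<bar> <= (1 + 1 / e + 1 / e^2) * exp (2 * \<bar>v\<bar>)"
			unfolding E abs_one using p v0(1) unfolding E_def[symmetric] by linarith
		from *[OF this] show ?thesis by simp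
	qed
	have a: "\<bar>- v / u\<bar> <= 1 / e * E"
	proof -
		have "\<bar>- v / u\<bar> = 1 / u * \<bar>v\<bar>" using t by simp
		also have "... <= 1 / e * E" unfolding E_def using ie v0 e by (intro mult_mono) auto
		finally show ?thesis .
	qed
	show "exp (L * \<bar>v\<bar>) * \<bar>g1 u v\<bar> <= Cg e T L" unfolding g1_def by (rule *) (use a p E in linarith)
	have b: "\<bar>v^2 / u^2 - 1 / u\<bar> <= 1 / e^2 * E + 1 / e * E"
	proof -
		have "\<bar>v^2 / u^2 - 1 / u\<bar> <= 1 / u^2 * v^2 + 1 / u * 1" using t by (simp add: abs_le_iff)
		also have "... <= 1 / e^2 * E + 1 / e * E" unfolding E_def using ie v0 v2 e t by (intro add_mono mult_mono) auto
		finally show ?thesis .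
	qed
	show "exp (L * \<bar>v\<bar>) * \<bar>g2 u v\<bar> <= Cg e T L" unfolding g2_def by (rule *) (use b p E in linarith)
qed

definition bd :: "(real => real) => bool" where "bd f \<longleftrightarrow> (\<exists>C. \<forall>x. \<bar>f x\<bar> <= C)"

lemma bd_intros:
	shows bd_const: "bd (%x. c)" and bd_add: "bd f ==> bd g ==> bd (%x. f x + g x)"
		and bd_diff: "bd f ==> bd g ==> bd (%x. f x - g x)" and bd_mult: "bd f ==> bd g ==> bd (%x. f x * g x)"
		and bd_uminus: "bd f ==> bd (%x. - f x)"
proof -
	show "bd (%x. c)" unfolding bd_def by auto
	show "bd f ==> bd (%x. - f x)" unfolding bd_def by auto
	assume "bd f" "bd g"
	then obtain C D where *: "\<And>x. \<bar>f x\<bar> <= C" "\<And>x. \<bar>g x\<bar> <= D" unfolding bd_def by auto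
	have "\<bar>f x + g x\<bar> <= C + D" "\<bar>f x - g x\<bar> <= C + D" for x using *[of x] by linarith+
	then show "bd (%x. f x + g x)" "bd (%x. f x - g x)" unfolding bd_def by blast+
	have "0 <= C" using *(1)[of 0] by linarith
	then have "\<bar>f x * g x\<bar> <= C * D" for x unfolding abs_mult by (intro mult_mono *) auto
	then show "bd (%x. f x * g x)" unfolding bd_def by blast
qed

lemma bdD: "bd f ==> \<exists>C\<ge>0. \<forall>x. \<bar>f x\<bar> <= C"
	unfolding bd_def by (metis abs_ge_zero order_trans)

lemma antiderivative_ex:
	assumes "continuous_on UNIV (f :: real => real)"
	shows "\<exists>g. \<forall>x. (g has_real_derivative f x) (at x)"
	using einterval_antiderivative[of "-\<infinity>" "\<infinity>" f] assms
	by (auto simp: continuous_on_eq_continuous_at has_real_derivative_iff_has_vector_derivative)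

text \<open>Only the square of A enters the generator, so A is accompanied by a positive
  \<open>a\<close> with the same square, which will be A or - A. The bounds \<rho> and R of
  \<open>a\<close> make the transform a bijection that distorts distances by bounded
  factors.\<close>

locale lamperti = sde P F W A B X K L
	for P :: "'w measure" and F W A B X K L +
	fixes a a1 a2 B1 :: "real => real" and \<rho> R :: real
	assumes \<rho>0: "0 < \<rho>" and a_lo: "\<And>x. \<rho> <= a x" and a_hi: "\<And>x. a x <= R" and a_sq: "\<And>x. (a x)^2 = (A x)^2"
		and a_d: "\<And>x. (a has_real_derivative a1 x) (at x)" and a1_d: "\<And>x. (a1 has_real_derivative a2 x) (at x)"
		and B_d: "\<And>x. (B has_real_derivative B1 x) (at x)"
		and bds: "bd a" "bd a1" "bd a2" "bd B1" and conts: "continuous_on UNIV a2" "continuous_on UNIV B1"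
begin

lemma a_pos: "0 < a x" using a_lo[of x] \<rho>0 by linarith

definition "ia x = 1 / a x"

lemma a_ia: "a x * ia x = 1" "(a x)^2 * (ia x)^2 = 1" using a_pos[of x] by (auto simp: ia_def power_divide)

lemma ia_pos: "0 < ia x" using a_pos[of x] by (simp add: ia_def)

lemma ia_le: "ia x <= 1 / \<rho>" and ia_ge: "1 / R <= ia x"
	using a_lo[of x] a_hi[of x] \<rho>0 by (auto simp: ia_def intro!: divide_left_mono)

lemma R0: "0 < R" using a_lo[of 0] a_hi[of 0] \<rho>0 by linarith

lemma ia_d: "(ia has_real_derivative - (a1 x * (ia x * ia x))) (at x)"
proof -
	have "((%x. 1 / a x) has_real_derivative (0 * a x - 1 * a1 x) / (a x * a x)) (at x)"
		using a_pos[of x] by (intro DERIV_divide DERIV_const a_d) auto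
	then show ?thesis unfolding ia_def[abs_def] by simp
qed

text \<open>The logarithmic derivative of the weight. It is the solution k of B / a + a k - a1 / 2 =
  0, the coefficient of the first-order term when the generator acts on exp (HH) u(\<phi>).\<close>

definition "k1 x = a1 x * ia x * (1/2) - B x * (ia x * ia x)"

definition "k2 x = a2 x * ia x * (1/2) - a1 x * a1 x * (ia x * ia x) * (1/2) - B1 x * (ia x * ia x) + 2 * (B x * a1 x * (ia x * ia x) * ia x)"

lemma k1_d: "(k1 has_real_derivative k2 x) (at x)"
proof -
	note d = DERIV_mult'[OF ia_d[of x] ia_d[of x]]
	note d1 = DERIV_cmult_right[OF DERIV_mult'[OF a1_d[of x] ia_d[of x]], of "1/2"]
	show ?thesis unfolding k1_def[abs_def]
		by (rule DERIV_cong[OF DERIV_diff[OF d1 DERIV_mult'[OF B_d[of x] d]]]) (simp add: k2_def algebra_simps)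
qed

lemma bds': "bd ia" "bd B" "bd k1" "bd k2"
proof -
	have "\<bar>ia x\<bar> <= 1 / \<rho>" for x using ia_le[of x] ia_pos[of x] by simp
	then show 1: "bd ia" unfolding bd_def by blast
	show 2: "bd B" using B_bd unfolding bd_def by blast
	show "bd k1" "bd k2" unfolding k1_def[abs_def] k2_def[abs_def] by (intro bd_intros bds 1 2)+
qed

lemma DERIV_continuous_UNIV: "(\<And>x. (f has_real_derivative f' x) (at x)) ==> continuous_on UNIV f"
	for f f' :: "real => real"
	by (meson DERIV_continuous_on has_field_derivative_at_within)

lemma conts': "continuous_on UNIV a" "continuous_on UNIV a1" "continuous_on UNIV ia" "continuous_on UNIV k1" "continuous_on UNIV k2"
proof -
	show 1: "continuous_on UNIV a" "continuous_on UNIV a1" "continuous_on UNIV ia" "continuous_on UNIV k1"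
		by (rule DERIV_continuous_UNIV, rule a_d a1_d ia_d k1_d)+
	show "continuous_on UNIV k2" unfolding k2_def[abs_def] by (intro continuous_intros 1 conts B_cont)
qed

definition "\<phi> = (SOME g. \<forall>x. (g has_real_derivative ia x) (at x))"

definition "HH = (SOME g. \<forall>x. (g has_real_derivative k1 x) (at x))"

lemma \<phi>_d: "(\<phi> has_real_derivative ia x) (at x)"
	using someI_ex[OF antiderivative_ex[OF conts'(3)]] unfolding \<phi>_def by auto

lemma HH_d: "(HH has_real_derivative k1 x) (at x)"
	using someI_ex[OF antiderivative_ex[OF conts'(4)]] unfolding HH_def by auto

lemma \<phi>_bounds:
	assumes "x <= y"
	shows "(y - x) / R <= \<phi> y - \<phi> x" "\<phi> y - \<phi> x <= (y - x) / \<rho>"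
proof -
	have "(y - x) / R <= \<phi> y - \<phi> x \<and> \<phi> y - \<phi> x <= (y - x) / \<rho>"
	proof (cases "x = y")
		case False
		then have xy: "x < y" using assms by simp
		obtain z where z: "\<phi> y - \<phi> x = (y - x) * ia z" using MVT2[OF xy, of \<phi> ia] \<phi>_d by blast
		have "(y - x) * (1 / R) <= (y - x) * ia z" "(y - x) * ia z <= (y - x) * (1 / \<rho>)"
			using ia_le[of z] ia_ge[of z] xy by (intro mult_left_mono; simp)+
		then show ?thesis unfolding z by simp
	qed simp
	then show "(y - x) / R <= \<phi> y - \<phi> x" "\<phi> y - \<phi> x <= (y - x) / \<rho>" by auto
qed

lemma \<phi>_mono: "x < y ==> \<phi> x < \<phi> y"
	using \<phi>_bounds(1)[of x y] R0 by (smt (verit) divide_pos_pos)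

lemma \<phi>_less: "\<phi> x < \<phi> y \<longleftrightarrow> x < y" and \<phi>_le: "\<phi> x <= \<phi> y \<longleftrightarrow> x <= y" and \<phi>_eq: "\<phi> x = \<phi> y \<longleftrightarrow> x = y"
	using \<phi>_mono[of x y] \<phi>_mono[of y x] by (metis less_irrefl less_linear less_imp_le not_le order.strict_trans)+

lemma \<phi>_cont: "continuous_on UNIV \<phi>" by (rule DERIV_continuous_UNIV, rule \<phi>_d)

lemma HH_cont: "continuous_on UNIV HH" by (rule DERIV_continuous_UNIV, rule HH_d)

lemma \<phi>_surj: "\<exists>x. \<phi> x = y"
proof -
	define d where "d = R * (\<bar>y - \<phi> 0\<bar> + 1)"
	have d: "0 <= d" "d / R = \<bar>y - \<phi> 0\<bar> + 1" using R0 by (auto simp: d_def)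
	have "d / R <= \<phi> d - \<phi> 0" using \<phi>_bounds(1)[of 0 d] d by simp
	then have 1: "y <= \<phi> d" using d by linarith
	have "d / R <= \<phi> 0 - \<phi> (- d)" using \<phi>_bounds(1)[of "- d" 0] d by simp
	then have 2: "\<phi> (- d) <= y" using d by linarith
	have "\<exists>x\<ge>-d. x <= d \<and> \<phi> x = y"
		using d by (intro IVT' 1 2 continuous_on_subset[OF \<phi>_cont]) auto
	then show ?thesis by blast
qed

definition "\<psi> y = (SOME x. \<phi> x = y)"

lemma \<phi>_\<psi>: "\<phi> (\<psi> y) = y" unfolding \<psi>_def by (rule someI_ex[OF \<phi>_surj])

lemma \<psi>_\<phi>: "\<psi> (\<phi> x) = x" using \<phi>_\<psi>[of "\<phi> x"] \<phi>_eq by blast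

lemma \<psi>_meas [measurable]: "\<psi> \<in> bm borel"
proof (rule borel_measurable_mono)
	show "mono \<psi>" by (rule monoI) (metis \<phi>_\<psi> \<phi>_le)
qed

lemma \<phi>_meas [measurable]: "\<phi> \<in> bm borel" using \<phi>_cont by (rule borel_measurable_continuous_onI)

text \<open>The derivative \<open>k1\<close> is bounded, and \<phi> shrinks distances at most by the
  factor 1 / R.\<close>

lemma HH_lip: "\<exists>C\<ge>0. \<forall>x y. \<bar>HH x - HH y\<bar> <= C * \<bar>\<phi> x - \<phi> y\<bar>"
proof -
	obtain C where C: "0 <= C" "\<And>x. \<bar>k1 x\<bar> <= C" using bdD[OF bds'(3)] by auto
	have *: "\<bar>HH x - HH y\<bar> <= (C * R) * \<bar>\<phi> x - \<phi> y\<bar>" if xy: "x < y" for x y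
	proof -
		obtain z where z: "HH y - HH x = (y - x) * k1 z" using MVT2[OF xy, of HH k1] HH_d by blast
		have "\<bar>HH x - HH y\<bar> = (y - x) * \<bar>k1 z\<bar>" unfolding abs_minus_commute[of "HH x"] z abs_mult using xy by simp
		also have "... <= (R * (\<phi> y - \<phi> x)) * C"
			using \<phi>_bounds(1)[of x y] \<phi>_mono[OF xy] xy C R0 by (intro mult_mono) (auto simp: field_simps)
		also have "... <= (C * R) * \<bar>\<phi> x - \<phi> y\<bar>" using \<phi>_mono[OF xy] by (simp add: mult_ac)
		finally show ?thesis .
	qed
	have "\<bar>HH x - HH y\<bar> <= (C * R) * \<bar>\<phi> x - \<phi> y\<bar>" for x y
		using *[of x y] *[of y x] by (cases x y rule: linorder_cases) (auto simp: abs_minus_commute)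
	then show ?thesis using C R0 by (intro exI[of _ "C * R"]) auto
qed

definition "LH = (SOME C. 0 <= C \<and> (\<forall>x y. \<bar>HH x - HH y\<bar> <= C * \<bar>\<phi> x - \<phi> y\<bar>))"

lemma LH: "0 <= LH" "\<bar>HH x - HH y\<bar> <= LH * \<bar>\<phi> x - \<phi> y\<bar>"
proof -
	have "\<exists>C. 0 <= C \<and> (\<forall>x y. \<bar>HH x - HH y\<bar> <= C * \<bar>\<phi> x - \<phi> y\<bar>)" using HH_lip by blast
	from someI_ex[OF this, folded LH_def] show "0 <= LH" "\<bar>HH x - HH y\<bar> <= LH * \<bar>\<phi> x - \<phi> y\<bar>" by blast+
qed

definition "et y = exp (HH (\<psi> y))"

lemma et_\<phi>: "et (\<phi> x) = exp (HH x)" by (simp add: et_def \<psi>_\<phi>)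

lemma et_lip: "et x <= et y * exp (LH * \<bar>x - y\<bar>)"
	using LH(2)[of "\<psi> x" "\<psi> y"] by (simp add: et_def exp_add[symmetric] \<phi>_\<psi> abs_le_iff)

lemma et_pos: "0 < et y" by (simp add: et_def)

lemma HH_meas [measurable]: "HH \<in> bm borel" using HH_cont by (rule borel_measurable_continuous_onI)

lemma et_meas [measurable]: "et \<in> bm borel" unfolding et_def[abs_def] by measurable

text \<open>Minus the zero-order coefficient that the weight leaves behind, so that the drift of the
  test function f is (\<kappa> - VV) f.\<close>

definition "VV x = - (B x * k1 x + 1/2 * (a x * a x) * (k1 x * k1 x + k2 x))"

lemma VV_bd: "bd VV" unfolding VV_def[abs_def] by (intro bd_intros bds bds')

lemma VV_meas [measurable]: "VV \<in> bm borel"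
	by (rule borel_measurable_continuous_onI) (auto simp: VV_def[abs_def] intro!: continuous_intros conts' B_cont)

definition "KV = (SOME C. 0 <= C \<and> (\<forall>x. \<bar>VV x\<bar> <= C))"

lemma KV: "0 <= KV" "\<bar>VV x\<bar> <= KV"
proof -
	have "\<exists>C. 0 <= C \<and> (\<forall>x. \<bar>VV x\<bar> <= C)" using bdD[OF VV_bd] by blast
	from someI_ex[OF this, folded KV_def] show "0 <= KV" "\<bar>VV x\<bar> <= KV" by blast+
qed

text \<open>The killed kernel with barrier l and pole y as a function of the starting point v, and
  its first two derivatives in v. The sign of the reflected term alternates because its argument is
  2 l - v - y.\<close>

definition "u0 l y r v = gam r (v - y) - gam r (2 * l - v - y)"
definition "u1 l y r v = g1 r (v - y) + g1 r (2 * l - v - y)"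
definition "u2 l y r v = g2 r (v - y) - g2 r (2 * l - v - y)"

text \<open>The common shape of the test function and of all its derivatives in x and s, so that
  boundedness and continuity are proved once.\<close>

definition comb where
	"comb c0 c1 c2 k T l y s x = exp (k * s + HH x) * (c0 x * u0 l y (T - s) (\<phi> x) + c1 x * u1 l y (T - s) (\<phi> x) + c2 x * u2 l y (T - s) (\<phi> x))"

text \<open>In the coordinate \<phi> x one Gaussian is centred at y and the other at the mirror
  image 2 l - y; the weight is moved to these centres, whence the sum of two weights.\<close>

lemma u_bounds:
	assumes e: "0 < r" "r <= t" "t <= T"
	shows "exp (HH x) * \<bar>u0 l y t (\<phi> x)\<bar> <= (et y + et (2 * l - y)) * Cg r T LH"
		"exp (HH x) * \<bar>u1 l y t (\<phi> x)\<bar> <= (et y + et (2 * l - y)) * Cg r T LH"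
		"exp (HH x) * \<bar>u2 l y t (\<phi> x)\<bar> <= (et y + et (2 * l - y)) * Cg r T LH"
proof -
	have A: "exp (HH x) * \<bar>h (\<phi> x - y)\<bar> <= et y * Cg r T LH" "exp (HH x) * \<bar>h (2 * l - \<phi> x - y)\<bar> <= et (2 * l - y) * Cg r T LH"
		if h: "\<And>v. exp (LH * \<bar>v\<bar>) * \<bar>h v\<bar> <= Cg r T LH" for h :: "real => real"
	proof -
		have *: "exp (HH x) * \<bar>h v\<bar> <= et z * Cg r T LH" if "\<bar>\<phi> x - z\<bar> = \<bar>v\<bar>" for v z
		proof -
			have "exp (HH x) * \<bar>h v\<bar> <= (et z * exp (LH * \<bar>\<phi> x - z\<bar>)) * \<bar>h v\<bar>"
				using et_lip[of "\<phi> x" z] by (intro mult_right_mono) (auto simp: et_\<phi>)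
			also have "... = et z * (exp (LH * \<bar>v\<bar>) * \<bar>h v\<bar>)" by (simp add: that)
			also have "... <= et z * Cg r T LH" using et_pos[of z] by (intro mult_left_mono h) auto
			finally show ?thesis .
		qed
		show "exp (HH x) * \<bar>h (\<phi> x - y)\<bar> <= et y * Cg r T LH" "exp (HH x) * \<bar>h (2 * l - \<phi> x - y)\<bar> <= et (2 * l - y) * Cg r T LH"
			by (rule *, simp)+
	qed
	note Cb = Cg_bounds[OF e LH(1)]
	have B: "exp (HH x) * \<bar>p + q\<bar> <= c + d" "exp (HH x) * \<bar>p - q\<bar> <= c + d" if "exp (HH x) * \<bar>p\<bar> <= c" "exp (HH x) * \<bar>q\<bar> <= d" for p q c d
	proof -
		have "exp (HH x) * \<bar>p + q\<bar> <= exp (HH x) * (\<bar>p\<bar> + \<bar>q\<bar>)" "exp (HH x) * \<bar>p - q\<bar> <= exp (HH x) * (\<bar>p\<bar> + \<bar>q\<bar>)" by (intro mult_left_mono; simp)+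
		then show "exp (HH x) * \<bar>p + q\<bar> <= c + d" "exp (HH x) * \<bar>p - q\<bar> <= c + d" using that by (simp_all only: distrib_left)
	qed
	show "exp (HH x) * \<bar>u0 l y t (\<phi> x)\<bar> <= (et y + et (2 * l - y)) * Cg r T LH"
		"exp (HH x) * \<bar>u1 l y t (\<phi> x)\<bar> <= (et y + et (2 * l - y)) * Cg r T LH"
		"exp (HH x) * \<bar>u2 l y t (\<phi> x)\<bar> <= (et y + et (2 * l - y)) * Cg r T LH"
		unfolding distrib_right u0_def u1_def u2_def by (intro B A Cb)+
qed

lemma comb_bd:
	assumes c: "bd c0" "bd c1" "bd c2" and e: "0 < r"
	shows "\<exists>C\<ge>0. \<forall>s\<in>{0..t}. \<forall>x. \<bar>comb c0 c1 c2 k (t + r) l y s x\<bar> <= C"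
proof -
	obtain C0 C1 C2 where C: "0 <= C0" "\<And>x. \<bar>c0 x\<bar> <= C0" "0 <= C1" "\<And>x. \<bar>c1 x\<bar> <= C1" "0 <= C2" "\<And>x. \<bar>c2 x\<bar> <= C2"
		using c[THEN bdD] by metis
	define D where "D = (et y + et (2 * l - y)) * Cg r (t + r) LH"
	have "\<bar>comb c0 c1 c2 k (t + r) l y s x\<bar> <= exp (\<bar>k\<bar> * t) * ((C0 + C1 + C2) * \<bar>D\<bar>)" if s: "s \<in> {0..t}" for s x
	proof -
		let ?u = "%u. u l y (t + r - s) (\<phi> x)"
		have ub: "exp (HH x) * \<bar>?u u0\<bar> <= \<bar>D\<bar>" "exp (HH x) * \<bar>?u u1\<bar> <= \<bar>D\<bar>" "exp (HH x) * \<bar>?u u2\<bar> <= \<bar>D\<bar>"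
			using u_bounds[OF e, of "t + r - s" "t + r" x l y] s unfolding D_def[symmetric] by auto
		have 1: "\<bar>comb c0 c1 c2 k (t + r) l y s x\<bar> = exp (k * s) * (exp (HH x) * \<bar>c0 x * ?u u0 + c1 x * ?u u1 + c2 x * ?u u2\<bar>)"
			by (simp add: comb_def abs_mult exp_add)
		have "exp (HH x) * \<bar>c0 x * ?u u0 + c1 x * ?u u1 + c2 x * ?u u2\<bar> <= exp (HH x) * (\<bar>c0 x\<bar> * \<bar>?u u0\<bar> + \<bar>c1 x\<bar> * \<bar>?u u1\<bar> + \<bar>c2 x\<bar> * \<bar>?u u2\<bar>)"
			unfolding abs_mult[symmetric] by (intro mult_left_mono) auto
		also have "... = \<bar>c0 x\<bar> * (exp (HH x) * \<bar>?u u0\<bar>) + \<bar>c1 x\<bar> * (exp (HH x) * \<bar>?u u1\<bar>) + \<bar>c2 x\<bar> * (exp (HH x) * \<bar>?u u2\<bar>)"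
			by (simp add: algebra_simps)
		also have "... <= C0 * \<bar>D\<bar> + C1 * \<bar>D\<bar> + C2 * \<bar>D\<bar>" by (intro add_mono mult_mono C ub) auto
		finally have "exp (HH x) * \<bar>c0 x * ?u u0 + c1 x * ?u u1 + c2 x * ?u u2\<bar> <= (C0 + C1 + C2) * \<bar>D\<bar>" by (simp add: distrib_right)
		moreover have "k * s <= \<bar>k\<bar> * t" using s by (intro mult_mono) auto
		ultimately show ?thesis unfolding 1 by - (rule mult_mono, auto)
	qed
	moreover have "0 <= exp (\<bar>k\<bar> * t) * ((C0 + C1 + C2) * \<bar>D\<bar>)" using C by auto
	ultimately show ?thesis by blast
qed

lemma comb_cont:
	assumes c: "continuous_on UNIV c0" "continuous_on UNIV c1" "continuous_on UNIV c2" and e: "0 < r"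
	shows "continuous_on ({0..t} \<times> UNIV) (%(s, p :: real, x). comb c0 c1 c2 k (t + r) l y s x)"
proof -
	let ?S = "{0..t} \<times> (UNIV :: (real \<times> real) set)"
	have x: "continuous_on ?S (%z. h (snd (snd z)))" if "continuous_on UNIV h" for h :: "real => real"
		by (rule continuous_on_compose2[OF that]) (auto intro!: continuous_intros)
	have p: "0 < t + r - fst z" if "z \<in> ?S" for z using that e by auto
	have s: "continuous_on ?S (%z. t + r - fst z)" by (intro continuous_intros)
	have p': "t + r - fst z \<noteq> 0" if "z \<in> ?S" for z using p[OF that] by simp
	have P: "\<forall>z\<in>?S. t + r - fst z \<noteq> 0" "\<forall>z\<in>?S. (t + r - fst z)^2 \<noteq> 0" using p' by auto
	have g: "continuous_on ?S (%z. gam (t + r - fst z) (v z))" "continuous_on ?S (%z. g1 (t + r - fst z) (v z))"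
		 "continuous_on ?S (%z. g2 (t + r - fst z) (v z))" if v: "continuous_on ?S v" for v
	proof -
		show 1: "continuous_on ?S (%z. gam (t + r - fst z) (v z))" by (rule gam_cont[OF s v p])
		show "continuous_on ?S (%z. g1 (t + r - fst z) (v z))" unfolding g1_def by (intro continuous_intros v 1 s P)
		show "continuous_on ?S (%z. g2 (t + r - fst z) (v z))" unfolding g2_def by (intro continuous_intros v 1 s P)
	qed
	show ?thesis unfolding split_beta' comb_def u0_def u1_def u2_def
		by (intro continuous_intros x[OF HH_cont] c[THEN x] g x[OF \<phi>_cont])
qed

lemma u_d:
	assumes "0 < r"
	shows "((%x. u0 l y r (\<phi> x)) has_real_derivative u1 l y r (\<phi> x) * ia x) (at x)"
		"((%x. u1 l y r (\<phi> x)) has_real_derivative u2 l y r (\<phi> x) * ia x) (at x)"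
		"((%r. u0 l y r v) has_real_derivative 1/2 * u2 l y r v) (at r)"
proof -
	have a: "((%x. \<phi> x - y) has_real_derivative ia x) (at x)" "((%x. 2 * l - \<phi> x - y) has_real_derivative - ia x) (at x)"
		by (auto intro!: derivative_eq_intros \<phi>_d)
	show "((%x. u0 l y r (\<phi> x)) has_real_derivative u1 l y r (\<phi> x) * ia x) (at x)"
		unfolding u0_def
		by (rule DERIV_cong[OF DERIV_diff[OF DERIV_chain2[OF gam_g1[OF assms] a(1)] DERIV_chain2[OF gam_g1[OF assms] a(2)]]]) (simp add: u1_def distrib_right)
	show "((%x. u1 l y r (\<phi> x)) has_real_derivative u2 l y r (\<phi> x) * ia x) (at x)"
		unfolding u1_def
		by (rule DERIV_cong[OF DERIV_add[OF DERIV_chain2[OF g1_g2[OF assms] a(1)] DERIV_chain2[OF g1_g2[OF assms] a(2)]]]) (simp add: u2_def left_diff_distrib)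
	show "((%r. u0 l y r v) has_real_derivative 1/2 * u2 l y r v) (at r)"
		unfolding u0_def by (rule DERIV_cong[OF DERIV_diff[OF gam_heat[OF assms] gam_heat[OF assms]]]) (simp add: u2_def)
qed

lemma exp_HH_d: "((%x. exp (k * s + HH x)) has_real_derivative exp (k * s + HH x) * k1 x) (at x)"
	by (auto intro!: derivative_eq_intros HH_d)

text \<open>The remaining time t + r - s never falls below r > 0, so the kernels are smooth and
  bounded on [0, t]. The derivative in s uses the heat equation.\<close>

lemma test:
	assumes t: "0 < t" and e: "0 < r"
	obtains Kf where "sde_test P F W A B X K L t Kf
		(%s p. comb (%_. 1) (%_. 0) (%_. 0) k (t + r) l y s)
		(%s p. comb k1 ia (%_. 0) k (t + r) l y s)
		(%s p. comb (%x. k1 x * k1 x + k2 x) (%x. 2 * (k1 x * ia x) - a1 x * (ia x * ia x)) (%x. ia x * ia x) k (t + r) l y s)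
		(%s p. comb (%_. k) (%_. 0) (%_. - 1/2) k (t + r) l y s)"
proof -
	let ?f = "comb (%_. 1) (%_. 0) (%_. 0) k (t + r) l y"
	let ?fx = "comb k1 ia (%_. 0) k (t + r) l y"
	let ?fxx = "comb (%x. k1 x * k1 x + k2 x) (%x. 2 * (k1 x * ia x) - a1 x * (ia x * ia x)) (%x. ia x * ia x) k (t + r) l y"
	let ?ft = "comb (%_. k) (%_. 0) (%_. - 1/2) k (t + r) l y"
	have b: "\<exists>C\<ge>0. \<forall>s\<in>{0..t}. \<forall>x. \<bar>?f s x\<bar> <= C" "\<exists>C\<ge>0. \<forall>s\<in>{0..t}. \<forall>x. \<bar>?fx s x\<bar> <= C"
		"\<exists>C\<ge>0. \<forall>s\<in>{0..t}. \<forall>x. \<bar>?fxx s x\<bar> <= C" "\<exists>C\<ge>0. \<forall>s\<in>{0..t}. \<forall>x. \<bar>?ft s x\<bar> <= C"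
		by (rule comb_bd; (intro bd_intros bds bds' e)?)+
	obtain C1 where C1: "0 <= C1" "\<And>s x. s \<in> {0..t} ==> \<bar>?f s x\<bar> <= C1" using b(1) by blast
	obtain C2 where C2: "0 <= C2" "\<And>s x. s \<in> {0..t} ==> \<bar>?fx s x\<bar> <= C2" using b(2) by blast
	obtain C3 where C3: "0 <= C3" "\<And>s x. s \<in> {0..t} ==> \<bar>?fxx s x\<bar> <= C3" using b(3) by blast
	obtain C4 where C4: "0 <= C4" "\<And>s x. s \<in> {0..t} ==> \<bar>?ft s x\<bar> <= C4" using b(4) by blast
	have tau: "0 < t + r - s" if "s \<in> {0..t}" for s using that e by auto
	have dx: "(?f s has_real_derivative ?fx s x) (at x)" if s: "s \<in> {0..t}" for s x
		unfolding comb_def by (simp, rule DERIV_cong[OF DERIV_mult'[OF exp_HH_d[of k s x] u_d(1)[OF tau[OF s], of l y x]]]) (simp add: algebra_simps)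
	have dxx: "(?fx s has_real_derivative ?fxx s x) (at x)" if s: "s \<in> {0..t}" for s x
		unfolding comb_def
		by (simp, rule DERIV_cong[OF DERIV_mult'[OF exp_HH_d[of k s x]
					DERIV_add[OF DERIV_mult'[OF k1_d[of x] u_d(1)[OF tau[OF s], of l y x]] DERIV_mult'[OF ia_d[of x] u_d(2)[OF tau[OF s], of l y x]]]]])
			 (simp add: algebra_simps)
	have dt: "((%s. ?f s x) has_real_derivative ?ft s x) (at s within {0..t})" if s: "s \<in> {0..t}" for s x
	proof -
		have e': "((%s. exp (k * s + HH x)) has_real_derivative exp (k * s + HH x) * k) (at s)" by (auto intro!: derivative_eq_intros)
		have l: "((%s. t + r - s) has_real_derivative - 1) (at s)" by (auto intro!: derivative_eq_intros)
		have "((%s. ?f s x) has_real_derivative ?ft s x) (at s)"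
			unfolding comb_def by (simp, rule DERIV_cong[OF DERIV_mult'[OF e' DERIV_chain2[OF u_d(3)[OF tau[OF s]] l]]]) (simp add: algebra_simps)
		then show ?thesis by (rule has_field_derivative_at_within)
	qed
	show thesis
	proof (rule that[of "C1 + C2 + C3 + C4"], unfold_locales)
		show "0 < t" by fact
		show "0 <= C1 + C2 + C3 + C4" using C1 C2 C3 C4 by simp
		fix s p x :: real assume s: "s \<in> {0..t}"
		show "(?f s has_real_derivative ?fx s x) (at x)" by (rule dx[OF s])
		show "(?fx s has_real_derivative ?fxx s x) (at x)" by (rule dxx[OF s])
		show "((%s. ?f s x) has_real_derivative ?ft s x) (at s within {0..t})" by (rule dt[OF s])
		show "\<bar>?f s x\<bar> <= C1 + C2 + C3 + C4" "\<bar>?fx s x\<bar> <= C1 + C2 + C3 + C4" "\<bar>?fxx s x\<bar> <= C1 + C2 + C3 + C4" "\<bar>?ft s x\<bar> <= C1 + C2 + C3 + C4"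
			using C1(2)[OF s, of x] C2(2)[OF s, of x] C3(2)[OF s, of x] C4(2)[OF s, of x] C1(1) C2(1) C3(1) C4(1) by linarith+
	qed (intro comb_cont continuous_intros conts' e)+
qed

definition "Y s w = \<phi> (Xc s w)"
definition "N s w = \<phi> (Mc s w)"

lemma Y_pair: "(%(s, w). Y s w) \<in> bm (borel \<Otimes>\<^sub>M P)"
	and N_pair: "(%(s, w). N s w) \<in> bm (borel \<Otimes>\<^sub>M P)"
	using measurable_compose[OF Xc_pair \<phi>_meas] measurable_compose[OF Mc_pair \<phi>_meas] by (simp_all add: Y_def N_def split_beta')

lemma YN_raw [measurable (raw)]:
	assumes "f \<in> bm Q" "g \<in> Q \<rightarrow>\<^sub>M P"
	shows "(%z. Y (f z) (g z)) \<in> bm Q" "(%z. N (f z) (g z)) \<in> bm Q"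
	using measurable_compose[OF measurable_Pair[OF assms] Y_pair] measurable_compose[OF measurable_Pair[OF assms] N_pair] by simp_all

lemma YN: "w \<in> space P ==> Y s w <= N s w"
	unfolding Y_def N_def Xc_def Mc_def by (simp add: \<phi>_le M_ge)

lemma N0: "N 0 w = Y 0 w" by (simp add: Y_def N_def Xc_def Mc_def M_0)

text \<open>\<open>killed\<close> at the level \<psi> l, where the test function vanishes. Below
  that level the function is the weighted killed kernel and its drift is k - VV times itself; with
  w1 - w2 = VV - k the negative contributions change sides.\<close>

lemma H_eq:
	assumes w [measurable]: "w1 \<in> bm borel" "w2 \<in> bm borel"
		and w1b: "\<And>x. 0 <= w1 x \<and> w1 x <= 2 * KV" and w2b: "\<And>x. 0 <= w2 x \<and> w2 x <= 2 * KV"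
		and ww: "\<And>x. w1 x - w2 x = VV (\<psi> x) - k"
		and t: "0 < t" and e: "0 < r" and y: "y <= l"
	shows "(NN v|P. ennreal (exp (k * t) * et (Y t v)) * indicator {..<l} (N t v) * ennreal (gk l r (Y t v) y))
			+ (NN z|(P \<Otimes>\<^sub>M lborel). ennreal (exp (k * snd z) * w1 (Y (snd z) (fst z)) * et (Y (snd z) (fst z))) * indicator {..<l} (N (snd z) (fst z))
					 * indicator {0..<t} (snd z) * ennreal (gk l (t + r - snd z) (Y (snd z) (fst z)) y))
			= (NN v|P. ennreal (et (Y 0 v)) * indicator {..<l} (N 0 v) * ennreal (gk l (t + r) (Y 0 v) y))
			+ (NN z|(P \<Otimes>\<^sub>M lborel). ennreal (exp (k * snd z) * w2 (Y (snd z) (fst z)) * et (Y (snd z) (fst z))) * indicator {..<l} (N (snd z) (fst z))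
					 * indicator {0..<t} (snd z) * ennreal (gk l (t + r - snd z) (Y (snd z) (fst z)) y))"
proof -
	let ?f = "%s (p::real). comb (%_. 1) (%_. 0) (%_. 0) k (t + r) l y s"
	obtain Kf where T: "sde_test P F W A B X K L t Kf ?f
		(%s p. comb k1 ia (%_. 0) k (t + r) l y s)
		(%s p. comb (%x. k1 x * k1 x + k2 x) (%x. 2 * (k1 x * ia x) - a1 x * (ia x * ia x)) (%x. ia x * ia x) k (t + r) l y s)
		(%s p. comb (%_. k) (%_. 0) (%_. - 1/2) k (t + r) l y s)" by (rule test[OF t e])
	interpret T: sde_test P F W A B X K L t Kf ?f
		"%s p. comb k1 ia (%_. 0) k (t + r) l y s"
		"%s p. comb (%x. k1 x * k1 x + k2 x) (%x. 2 * (k1 x * ia x) - a1 x * (ia x * ia x)) (%x. ia x * ia x) k (t + r) l y s"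
		"%s p. comb (%_. k) (%_. 0) (%_. - 1/2) k (t + r) l y s" by (rule T)
	have PL: "pair_sigma_finite P (lborel :: real measure)" ..
	define b where "b = \<psi> l"
	have lt: "x < b \<longleftrightarrow> \<phi> x < l" for x unfolding b_def by (metis \<phi>_\<psi> \<phi>_less)
	have f: "?f s p x = exp (k * s) * et (\<phi> x) * gk l (t + r - s) (\<phi> x) y" if "x < b" for s p x
		using that y by (simp add: comb_def lt gk_def u0_def exp_add et_\<phi>)
	\<comment> \<open>The first-order coefficient vanishes by the choice of \<open>k1\<close>, the
	  second-order ones cancel by the heat equation, and the zero-order ones give k - VV.\<close>
	have G: "T.G s p x = (k - VV x) * ?f s p x" for s p x
	proof -
		define E v0 v1 v2 where "E = exp (k * s + HH x)" and "v0 = u0 l y (t + r - s) (\<phi> x)"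
			and "v1 = u1 l y (t + r - s) (\<phi> x)" and "v2 = u2 l y (t + r - s) (\<phi> x)"
		have aa: "(A x)^2 = a x * a x" using a_sq[of x] by (simp add: power2_eq_square)
		have i: "a x * ia x = 1" by (rule a_ia)
		have i1: "a x * a x * (k1 x * ia x) = a x * k1 x" "a x * a x * (a1 x * (ia x * ia x)) = a1 x" "a x * a x * (ia x * ia x) = 1"
			using i by algebra+
		have "a x * k1 x = a1 x * (1/2) - B x * ia x" unfolding k1_def using i by algebra
		then have z: "B x * ia x + a x * k1 x - 1/2 * a1 x = 0" by simp
		have "T.G s p x = E * ((k + B x * k1 x + 1/2 * (a x * a x) * (k1 x * k1 x + k2 x)) * v0
			 + (B x * ia x + (a x * a x * (k1 x * ia x)) - 1/2 * (a x * a x * (a1 x * (ia x * ia x)))) * v1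
			 + (1/2 * (a x * a x * (ia x * ia x)) - 1/2) * v2)"
			unfolding T.G_def comb_def aa E_def[symmetric] v0_def[symmetric] v1_def[symmetric] v2_def[symmetric] by (simp add: algebra_simps)
		also have "... = (k - VV x) * (E * v0)" unfolding i1 z VV_def by (simp add: algebra_simps)
		also have "... = (k - VV x) * ?f s p x" by (simp add: comb_def E_def v0_def)
		finally show ?thesis .
	qed
	define h where "h v s = exp (k * s) * et (Y s v) * indicator {..<l} (N s v) * gk l (t + r - s) (Y s v) y" for v s
	have h_eq: "h v s = indicator {..<b} (Mc s v) * ?f s p (Xc s v)" if "v \<in> space P" for v s and p :: real
	proof (cases "Mc s v < b")
		case True
		have "Xc s v <= Mc s v" using that unfolding Xc_def Mc_def by (simp add: M_ge)
		with True have "Xc s v < b" by simp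
		from f[OF this] True show ?thesis by (simp add: h_def Y_def N_def lt)
	qed (simp add: h_def N_def lt)
	have h0: "0 <= h v s" if "s \<in> {0..t}" for v s
		unfolding h_def using that e et_pos[of "Y s v"] by (intro mult_nonneg_nonneg gk_nonneg) (auto intro: less_imp_le)
	have hb: "h v s <= Kf" if "s \<in> {0..t}" "v \<in> space P" for v s
		using h_eq[OF that(2), of s] T.f_bd[OF that(1), of "Xc s v"] T.Kf0 by (auto simp: indicator_def abs_le_iff)
	have hm [measurable]: "(%z. h (p z) (q z)) \<in> bm Q" if [measurable]: "p \<in> Q \<rightarrow>\<^sub>M P" "q \<in> bm Q" for p q and Q :: "'q measure"
		unfolding h_def by measurable
	have hm1 [measurable]: "(%v. h v s) \<in> bm P" for s by (rule hm) auto
	have hm2 [measurable]: "(%z. h (fst z) (snd z)) \<in> bm (P \<Otimes>\<^sub>M lborel)" by (rule hm) auto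
	have I: "(NN v|P. ennreal (h v s)) = ennreal (LINT v|P. indicator {..<b} (Mc s v) * ?f s 0 (Xc s v))"
		"0 <= (LINT v|P. indicator {..<b} (Mc s v) * ?f s 0 (Xc s v))" if s: "s \<in> {0..t}" for s
	proof -
		have "integrable P (%v. h v s)"
			using h0[OF s] hb[OF s] by (intro integrable_const_bound[where B=Kf] AE_I2) auto
		then have "(NN v|P. ennreal (h v s)) = ennreal (LINT v|P. h v s)"
			using h0[OF s] by (intro nn_integral_eq_integral AE_I2)
		moreover have eq: "(LINT v|P. h v s) = (LINT v|P. indicator {..<b} (Mc s v) * ?f s 0 (Xc s v))"
			using h_eq by (intro Bochner_Integration.integral_cong refl) blast
		moreover have "0 <= (LINT v|P. h v s)" using h0[OF s] by (intro integral_nonneg_AE AE_I2)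
		ultimately show "(NN v|P. ennreal (h v s)) = ennreal (LINT v|P. indicator {..<b} (Mc s v) * ?f s 0 (Xc s v))"
			"0 <= (LINT v|P. indicator {..<b} (Mc s v) * ?f s 0 (Xc s v))" by simp_all
	qed
	define g where "g w z = w (Y (snd z) (fst z)) * (indicator {0..<t} (snd z) * h (fst z) (snd z))" for w :: "real => real" and z :: "'w \<times> real"
	have J: "integrable (P \<Otimes>\<^sub>M lborel) (g w)"
		"(NN z|(P \<Otimes>\<^sub>M lborel). ennreal (exp (k * snd z) * w (Y (snd z) (fst z)) * et (Y (snd z) (fst z))) * indicator {..<l} (N (snd z) (fst z))
					 * indicator {0..<t} (snd z) * ennreal (gk l (t + r - snd z) (Y (snd z) (fst z)) y)) = ennreal (LINT z|(P \<Otimes>\<^sub>M lborel). g w z)"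
		"0 <= (LINT z|(P \<Otimes>\<^sub>M lborel). g w z)"
		if [measurable]: "w \<in> bm borel" and wb: "\<And>x. 0 <= w x \<and> w x <= 2 * KV" for w
	proof -
		have gm: "g w \<in> bm (P \<Otimes>\<^sub>M lborel)" unfolding g_def[abs_def] by measurable
		have g0: "0 <= g w z" for z using wb h0[of "snd z" "fst z"] unfolding g_def by (cases "snd z \<in> {0..<t}") (auto intro!: mult_nonneg_nonneg)
		show gi: "integrable (P \<Otimes>\<^sub>M lborel) (g w)"
		proof (rule integrableI_bounded[OF gm])
			have "(NN z|(P \<Otimes>\<^sub>M lborel). ennreal (norm (g w z))) <= (NN z|(P \<Otimes>\<^sub>M lborel). ennreal (2 * KV * Kf) * indicator {0..<t} (snd z))"
			proof (rule nn_integral_mono)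
				fix z assume z: "z \<in> space (P \<Otimes>\<^sub>M (lborel :: real measure))"
				show "ennreal (norm (g w z)) <= ennreal (2 * KV * Kf) * indicator {0..<t} (snd z)"
				proof (cases "snd z \<in> {0..<t}")
					case True
					have "g w z <= 2 * KV * Kf" unfolding g_def
						using wb hb[of "snd z" "fst z"] h0[of "snd z" "fst z"] True z KV by (intro mult_mono) (auto simp: space_pair_measure)
					then show ?thesis using g0[of z] True by (simp add: ennreal_leI)
				qed (simp add: g_def)
			qed
			also have "... = (\<integral>\<^sup>+v. \<integral>\<^sup>+s. ennreal (2 * KV * Kf) * indicator {0..<t} s \<partial>lborel \<partial>P)"
				by (subst lborel.nn_integral_fst[symmetric]) auto
			also have "... < \<infinity>" using t by (simp add: nn_integral_cmult_indicator emeasure_space_1 ennreal_mult_less_top)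
			finally show "(NN z|(P \<Otimes>\<^sub>M lborel). ennreal (norm (g w z))) < \<infinity>" .
		qed
		have "(NN z|(P \<Otimes>\<^sub>M lborel). ennreal (exp (k * snd z) * w (Y (snd z) (fst z)) * et (Y (snd z) (fst z))) * indicator {..<l} (N (snd z) (fst z))
					 * indicator {0..<t} (snd z) * ennreal (gk l (t + r - snd z) (Y (snd z) (fst z)) y)) = (NN z|(P \<Otimes>\<^sub>M lborel). ennreal (g w z))"
		proof (rule nn_integral_cong)
			fix z :: "'w \<times> real"
			show "ennreal (exp (k * snd z) * w (Y (snd z) (fst z)) * et (Y (snd z) (fst z))) * indicator {..<l} (N (snd z) (fst z))
					 * indicator {0..<t} (snd z) * ennreal (gk l (t + r - snd z) (Y (snd z) (fst z)) y) = ennreal (g w z)"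
			proof (cases "snd z \<in> {0..<t} \<and> N (snd z) (fst z) < l")
				case True
				have p: "0 <= exp (k * snd z) * w (Y (snd z) (fst z)) * et (Y (snd z) (fst z))" using wb et_pos by (auto simp: less_imp_le)
				then show ?thesis using True ennreal_mult'[OF p, of "gk l (t + r - snd z) (Y (snd z) (fst z)) y"] by (simp add: g_def h_def mult_ac)
			qed (auto simp: g_def h_def)
		qed
		then show "(NN z|(P \<Otimes>\<^sub>M lborel). ennreal (exp (k * snd z) * w (Y (snd z) (fst z)) * et (Y (snd z) (fst z))) * indicator {..<l} (N (snd z) (fst z))
					 * indicator {0..<t} (snd z) * ennreal (gk l (t + r - snd z) (Y (snd z) (fst z)) y)) = ennreal (LINT z|(P \<Otimes>\<^sub>M lborel). g w z)"
			using nn_integral_eq_integral[OF gi] g0 by simp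
		show "0 <= (LINT z|(P \<Otimes>\<^sub>M lborel). g w z)" by (intro integral_nonneg_AE AE_I2 g0)
	qed
	note J1 = J[OF w(1) w1b] and J2 = J[OF w(2) w2b]
	have k: "(LINT v|P. indicator {..<b} (M t v) * ?f t 0 (X t v)) - (LINT v|P. indicator {..<b} (X 0 v) * ?f 0 0 (X 0 v))
		= (LINT v|P. (LBINT s:{0..t}. indicator {..<b} (M s v) * T.G s (M s v) (X s v)))"
	proof (rule T.killed)
		have "\<phi> b = l" by (simp add: b_def \<phi>_\<psi>)
		then show "?f s p b = 0" for s p by (simp add: comb_def u0_def)
	qed simp
	also have "... = (LINT v|P. (LINT s|lborel. (g w2 (v, s) - g w1 (v, s))))"
	proof (rule Bochner_Integration.integral_cong[OF refl])
		fix v assume o: "v \<in> space P"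
		have "(LBINT s:{0..t}. indicator {..<b} (M s v) * T.G s (M s v) (X s v)) = (LBINT s:{0..t}. (w2 (Y s v) - w1 (Y s v)) * h v s)"
		proof (rule set_lebesgue_integral_cong)
			show "\<forall>s. s \<in> {0..t} \<longrightarrow> indicator {..<b} (M s v) * T.G s (M s v) (X s v) = (w2 (Y s v) - w1 (Y s v)) * h v s"
			proof (intro allI impI)
				fix s assume "s \<in> {0..t}"
				then have MX: "M s v = Mc s v" "X s v = Xc s v" by (auto simp: Mc_eq Xc_eq)
				have "VV (Xc s v) = VV (\<psi> (Y s v))" by (simp add: Y_def \<psi>_\<phi>)
				then have "k - VV (Xc s v) = w2 (Y s v) - w1 (Y s v)" using ww[of "Y s v"] by simp
				then show "indicator {..<b} (M s v) * T.G s (M s v) (X s v) = (w2 (Y s v) - w1 (Y s v)) * h v s"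
					unfolding MX G h_eq[OF o, of s] by simp
			qed
		qed simp
		also have "... = (LINT s|lborel. (g w2 (v, s) - g w1 (v, s)))"
			unfolding set_lebesgue_integral_def
		proof (rule integral_cong_AE)
			have [measurable]: "(%s. h v s) \<in> bm borel" by (rule hm) (use o in auto)
			have [measurable]: "(%s. Y s v) \<in> bm borel" by (rule YN_raw) (use o in auto)
			show "(%s. indicator {0..t} s *\<^sub>R ((w2 (Y s v) - w1 (Y s v)) * h v s)) \<in> bm lborel" by measurable
			show "(%s. g w2 (v, s) - g w1 (v, s)) \<in> bm lborel" unfolding g_def by simp
			have "AE s in lborel. s \<noteq> t" by (rule AE_lborel_singleton)
			then show "AE s in lborel. indicator {0..t} s *\<^sub>R ((w2 (Y s v) - w1 (Y s v)) * h v s) = g w2 (v, s) - g w1 (v, s)"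
				by eventually_elim (auto simp: g_def indicator_def left_diff_distrib)
		qed
		finally show "(LBINT s:{0..t}. indicator {..<b} (M s v) * T.G s (M s v) (X s v)) = (LINT s|lborel. (g w2 (v, s) - g w1 (v, s)))" .
	qed
	also have "... = (LINT z|(P \<Otimes>\<^sub>M lborel). g w2 z - g w1 z)"
		using pair_sigma_finite.integral_fst'[OF PL Bochner_Integration.integrable_diff[OF J2(1) J1(1)]] by simp
	also have "... = (LINT z|(P \<Otimes>\<^sub>M lborel). g w2 z) - (LINT z|(P \<Otimes>\<^sub>M lborel). g w1 z)"
		by (rule Bochner_Integration.integral_diff[OF J2(1) J1(1)])
	finally have main: "(LINT v|P. indicator {..<b} (Mc t v) * ?f t 0 (Xc t v)) + (LINT z|(P \<Otimes>\<^sub>M lborel). g w1 z)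
		 = (LINT v|P. indicator {..<b} (Mc 0 v) * ?f 0 0 (Xc 0 v)) + (LINT z|(P \<Otimes>\<^sub>M lborel). g w2 z)"
		using t by (simp add: Mc_eq Xc_eq M_0)
	have i1: "(NN v|P. ennreal (exp (k * s) * et (Y s v)) * indicator {..<l} (N s v) * ennreal (gk l (t + r - s) (Y s v) y)) = (NN v|P. ennreal (h v s))" for s
		by (intro nn_integral_cong) (auto simp: h_def ennreal_mult'[symmetric] et_pos less_imp_le indicator_def)
	show ?thesis
		using main I[of t] I[of 0] t J1(3) J2(3) i1[of t] i1[of 0]
		unfolding J1(2) J2(2) by (simp add: ennreal_plus[symmetric] del: ennreal_plus)
qed

lemma flat: "flat P Y N et (%y. VV (\<psi> y)) LH KV"
proof (unfold_locales)
	show "(%y. VV (\<psi> y)) \<in> bm borel" by measurable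
qed (use Y_pair N_pair YN N0 et_pos et_lip et_meas LH(1) KV H_eq in \<open>auto\<close>)

end

section \<open>Functions of the process and its maximum\<close>

text \<open>On a fine grid M moves only through levels within \<eta> of X (\<open>osc\<close>), so
  bounds on increments of f in p near the diagonal add up to bounds by the total increment of
  M.\<close>

lemma (in sde_test) JM_between:
	assumes w: "v \<in> space P" and \<eta>: "0 < \<eta>"
		and b: "\<And>p p' x. p <= p' ==> \<bar>p - x\<bar> < \<eta> ==> \<bar>p' - x\<bar> < \<eta> ==> l * (p' - p) <= f 0 p' x - f 0 p x \<and> f 0 p' x - f 0 p x <= u * (p' - p)"
	shows "eventually (%N. l * (M T v - X 0 v) <= JM N v \<and> JM N v <= u * (M T v - X 0 v)) sequentially"
proof -
	obtain d where d: "0 < d" "\<And>s t z. 0 <= s ==> s <= t ==> t <= T ==> t - s < d ==> M s v < M t v ==>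
		M s v <= z ==> z <= M t v ==> \<bar>z - X t v\<bar> < \<eta>"
		using osc[OF w \<eta>, where T=T] by blast
	show ?thesis using mesh_small[OF d(1)]
	proof eventually_elim
		case (elim N)
		let ?J = "%i. f 0 (M (tt N (Suc i)) v) (X (tt N (Suc i)) v) - f 0 (M (tt N i) v) (X (tt N (Suc i)) v)"
		let ?d = "%i. M (tt N (Suc i)) v - M (tt N i) v"
		have *: "l * ?d i <= ?J i \<and> ?J i <= u * ?d i" if "i \<in> {..<Suc N}" for i
		proof (cases "M (tt N i) v < M (tt N (Suc i)) v")
			case True
			have le: "tt N (Suc i) <= T" using that by (intro tt) auto
			have "\<bar>z - X (tt N (Suc i)) v\<bar> < \<eta>" if "M (tt N i) v <= z" "z <= M (tt N (Suc i)) v" for z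
				using that True elim le by (intro d(2)[of "tt N i"]) (auto simp: tt)
			then show ?thesis using True by (intro b) auto
		next
			case False
			moreover have "M (tt N i) v <= M (tt N (Suc i)) v" by (intro M_mono w tt)
			ultimately have "M (tt N i) v = M (tt N (Suc i)) v" by simp
			then show ?thesis by simp
		qed
		have tel: "(\<Sum>i<Suc N. ?d i) = M T v - X 0 v"
			by (subst sum_lessThan_telescope) (simp add: tt M_0)
		have "l * (\<Sum>i<Suc N. ?d i) <= JM N v" "JM N v <= u * (\<Sum>i<Suc N. ?d i)"
			unfolding JM_def sum_distrib_left using * by (intro sum_mono; blast)+
		then show ?case unfolding tel by blast
	qed
qed

text \<open>For every e the sums are eventually at most e times the increment of M, by
  \<open>JM_between\<close>, and they are dominated by C times this integrable increment. Hence the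
  limit in \<open>JM_limit\<close> is 0.\<close>

lemma (in sde_test) JM_zero:
	assumes ff: "\<And>s p x. s \<in> {0..T} ==> f s p x = f 0 p x"
		and lip: "\<And>p p' x. p <= p' ==> \<bar>f 0 p' x - f 0 p x\<bar> <= C * (p' - p)"
		and small: "\<And>e. 0 < e ==> \<exists>\<eta>>0. \<forall>p p' x. p <= p' \<longrightarrow> \<bar>p - x\<bar> < \<eta> \<longrightarrow> \<bar>p' - x\<bar> < \<eta> \<longrightarrow> \<bar>f 0 p' x - f 0 p x\<bar> <= e * (p' - p)"
		and int: "integrable P (%v. M T v - X 0 v)"
	shows "(LINT v|P. f 0 (M T v) (X T v)) - (LINT v|P. f 0 (X 0 v) (X 0 v)) = (LINT v|P. (LBINT s:{0..T}. G s (M s v) (X s v)))"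
proof -
	have "(%N. \<integral>v. JM N v \<partial>P) \<longlonglongrightarrow> (LINT v|P. 0)"
	proof (rule integral_dominated_convergence[where w="%v. C * (M T v - X 0 v)"])
		show "integrable P (%v. C * (M T v - X 0 v))" using int by simp
		show "JM N \<in> bm P" for N using JM_limit(1)[OF ff] by (rule borel_measurable_integrable)
		show "AE v in P. norm (JM N v) <= C * (M T v - X 0 v)" for N
		proof (rule AE_I2)
			fix v assume w: "v \<in> space P"
			have "norm (JM N v) <= (\<Sum>i<Suc N. C * (M (tt N (Suc i)) v - M (tt N i) v))"
				unfolding JM_def by (rule sum_norm_le) (use lip M_mono[OF w] tt in auto)
			also have "... = C * (M T v - X 0 v)"
				unfolding sum_distrib_left[symmetric] by (subst sum_lessThan_telescope) (simp add: tt M_0)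
			finally show "norm (JM N v) <= C * (M T v - X 0 v)" .
		qed
		show "AE v in P. (%N. JM N v) \<longlonglongrightarrow> 0"
		proof (rule AE_I2)
			fix v assume w: "v \<in> space P"
			define D where "D = M T v - X 0 v"
			have D: "0 <= D" unfolding D_def using M_ge[OF w, of 0 T] T0 by simp
			show "(%N. JM N v) \<longlonglongrightarrow> 0"
			proof (rule tendstoI)
				fix r :: real assume r: "0 < r"
				define e where "e = r / (D + 1) / 2"
				have e: "0 < e" "e * D < r" using r D by (auto simp: e_def field_simps intro!: add_nonneg_pos)
				obtain \<eta> where \<eta>: "\<eta> > 0" "\<And>p p' x. p <= p' ==> \<bar>p - x\<bar> < \<eta> ==> \<bar>p' - x\<bar> < \<eta> ==> \<bar>f 0 p' x - f 0 p x\<bar> <= e * (p' - p)"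
					using small[OF e(1)] by blast
				have "eventually (%N. - e * (M T v - X 0 v) <= JM N v \<and> JM N v <= e * (M T v - X 0 v)) sequentially"
				proof (rule JM_between[OF w \<eta>(1)])
					fix p p' x assume "p <= p'" "\<bar>p - x\<bar> < \<eta>" "\<bar>p' - x\<bar> < \<eta>"
					from \<eta>(2)[OF this] show "- e * (p' - p) <= f 0 p' x - f 0 p x \<and> f 0 p' x - f 0 p x <= e * (p' - p)"
						unfolding mult_minus_left abs_le_iff by linarith
				qed
				then show "\<forall>\<^sub>F N in sequentially. dist (JM N v) 0 < r"
					unfolding D_def[symmetric] by eventually_elim (use e(2) in \<open>auto simp: dist_real_def\<close>)
			qed
		qed
	qed auto
	from LIMSEQ_unique[OF this JM_limit(2)[OF ff]] show ?thesis by simp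
qed

text \<open>Minus the derivative of 1 / (1 + w^2), hence of mass 1 on the half-line. Up to the
  factor - 1 / d it is the second derivative in x of d arctan ((m - x) / d), with w = (m - x) /
  d.\<close>

definition kap :: "real => real" where "kap w = 2 * w / (1 + w^2)^2"

lemma kap_le: "\<bar>kap w\<bar> <= 1 / (1 + w^2)"
proof -
	have p: "0 < 1 + w^2" by (simp add: add_pos_nonneg)
	have "0 <= (1 - \<bar>w\<bar>)^2" by simp
	then have "\<bar>2 * w\<bar> <= 1 + w^2" by (simp add: power2_eq_square algebra_simps)
	then have "\<bar>2 * w\<bar> / ((1 + w^2) * (1 + w^2)) <= (1 + w^2) / ((1 + w^2) * (1 + w^2))" using p by (intro divide_right_mono) auto
	then show ?thesis using p by (simp add: kap_def abs_mult power2_eq_square)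
qed

lemma inv_sq_le1: "0 < 1 / (1 + w^2)" "1 / (1 + w^2) <= (1::real)"
	by (auto simp: add_pos_nonneg)

lemma kap_le1: "\<bar>kap w\<bar> <= 1" using kap_le[of w] inv_sq_le1[of w] by linarith

lemma kap_cont: "continuous_on UNIV kap"
proof -
	have "(1 + x^2)^2 \<noteq> 0" for x :: real by (metis add_nonneg_eq_0_iff power_eq_0_iff zero_le_one zero_le_power2 zero_neq_one)
	then show ?thesis unfolding kap_def[abs_def] by (intro continuous_intros) auto
qed

text \<open>The corrector d arctan (v / d) has slope 1 at 0, slope in (0, 1] everywhere, and size of
  order d: it imitates v near 0 and disappears uniformly with d.\<close>

lemma hA_deriv:
	assumes "0 < d"
	shows "((%v. d * arctan (v / d)) has_real_derivative 1 / (1 + (v / d)^2)) (at v)"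
	using assms by (auto intro!: derivative_eq_intros simp: divide_inverse)

lemma hA_mvt:
	assumes "0 < d" "a < b"
	obtains z where "a < z" "z < b" "d * arctan (b / d) - d * arctan (a / d) = (b - a) * (1 / (1 + (z / d)^2))"
	using MVT2[OF assms(2), of "%v. d * arctan (v / d)" "%v. 1 / (1 + (v / d)^2)"] hA_deriv[OF assms(1)] by blast

lemma hA_lip:
	assumes "0 < d" "a <= b"
	shows "0 <= d * arctan (b / d) - d * arctan (a / d)" "d * arctan (b / d) - d * arctan (a / d) <= b - a"
proof -
	have "0 <= d * arctan (b / d) - d * arctan (a / d) \<and> d * arctan (b / d) - d * arctan (a / d) <= b - a"
	proof (cases "a = b")
		case False
		then have ab: "a < b" using assms by simp
		obtain z where z: "d * arctan (b / d) - d * arctan (a / d) = (b - a) * (1 / (1 + (z / d)^2))" by (rule hA_mvt[OF assms(1) ab])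
		have "0 <= (b - a) * (1 / (1 + (z / d)^2))" using ab inv_sq_le1(1)[of "z / d"] by (intro mult_nonneg_nonneg) auto
		moreover have "(b - a) * (1 / (1 + (z / d)^2)) <= (b - a) * 1" by (rule mult_left_mono[OF inv_sq_le1(2)]) (use ab in simp)
		ultimately have "0 <= (b - a) * (1 / (1 + (z / d)^2))" "(b - a) * (1 / (1 + (z / d)^2)) <= (b - a) * 1" by auto
		then show ?thesis unfolding z by simp
	qed simp
	then show "0 <= d * arctan (b / d) - d * arctan (a / d)" "d * arctan (b / d) - d * arctan (a / d) <= b - a" by auto
qed

lemma hA_abs: "0 < d ==> \<bar>d * arctan (v / d)\<bar> <= \<bar>v\<bar>"
	using hA_lip[of d 0 v] hA_lip[of d v 0] by (cases "0 <= v") auto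

lemma hA_bd: "0 < d ==> \<bar>d * arctan (v / d)\<bar> <= 2 * d"
proof -
	assume d: "0 < d"
	have "\<bar>arctan (v / d)\<bar> <= 2" using arctan_bounded[of "v / d"] pi_less_4 by (simp add: abs_le_iff)
	then show ?thesis using d by (simp add: abs_mult)
qed

text \<open>The coefficient \<psi> is kept general: the derivative of f0 in p on the diagonal serves
  the Ito formula, while f0 = 0 with \<psi> = - 1 and d = 1 is the function arctan (p - x) of
  \<open>M_incr_int\<close>.\<close>

lemma (in sde) arctan_test:
	fixes f0 f0x f0xx :: "real => real => real" and \<psi> :: "real => real"
	assumes T: "0 < T" and d: "0 < d"
		and d1: "\<And>p x. (f0 p has_real_derivative f0x p x) (at x)" and d2: "\<And>p x. (f0x p has_real_derivative f0xx p x) (at x)"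
		and b: "\<And>p x. \<bar>f0 p x\<bar> <= C" "\<And>p x. \<bar>f0x p x\<bar> <= C" "\<And>p x. \<bar>f0xx p x\<bar> <= C" "\<And>p. \<bar>\<psi> p\<bar> <= C"
		and c: "continuous_on UNIV (%(p, x). f0 p x)" "continuous_on UNIV (%(p, x). f0x p x)" "continuous_on UNIV (%(p, x). f0xx p x)" "continuous_on UNIV \<psi>"
	shows "sde_test P F W A B X K L T (2 * C + C * (2 * d) + C * (1 / d))
		(%s p x. f0 p x - \<psi> p * (d * arctan ((p - x) / d)))
		(%s p x. f0x p x + \<psi> p * (1 / (1 + ((p - x) / d)^2)))
		(%s p x. f0xx p x + \<psi> p * (1 / d * kap ((p - x) / d))) (%s p x. 0)"
proof (unfold_locales)
	have C0: "0 <= C" using b(4)[of 0] by linarith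
	then have C1: "0 <= C * (2 * d)" "0 <= C * (1 / d)" using d by auto
	show "0 < T" by fact
	show K: "0 <= 2 * C + C * (2 * d) + C * (1 / d)" using C0 C1 by linarith
	fix s p x :: real
	have dpx: "((%x. p - x) has_real_derivative - 1) (at x)" by (auto intro!: derivative_eq_intros)
	show "((%x. f0 p x - \<psi> p * (d * arctan ((p - x) / d))) has_real_derivative f0x p x + \<psi> p * (1 / (1 + ((p - x) / d)^2))) (at x)"
		by (rule DERIV_cong[OF DERIV_diff[OF d1 DERIV_cmult[OF DERIV_chain2[OF hA_deriv[OF d] dpx]]]]) simp
	have nz: "1 + w^2 \<noteq> 0" for w :: real using inv_sq_le1(1)[of w] by force
	have "((%w::real. 1 / (1 + w^2)) has_real_derivative - kap w) (at w)" for w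
		using nz[of w] by (auto intro!: derivative_eq_intros simp: kap_def power2_eq_square)
	moreover have "((%x. (p - x) / d) has_real_derivative - 1 / d) (at x)" using d by (auto intro!: derivative_eq_intros)
	ultimately have dk: "((%x. 1 / (1 + ((p - x) / d)^2)) has_real_derivative - kap ((p - x) / d) * (- 1 / d)) (at x)"
		by (rule DERIV_chain2)
	show "((%x. f0x p x + \<psi> p * (1 / (1 + ((p - x) / d)^2))) has_real_derivative f0xx p x + \<psi> p * (1 / d * kap ((p - x) / d))) (at x)"
		by (rule DERIV_cong[OF DERIV_add[OF d2 DERIV_cmult[OF dk]]]) simp
	show "((%s. f0 p x - \<psi> p * (d * arctan ((p - x) / d))) has_real_derivative 0) (at s within {0..T})" by simp
	have "\<bar>\<psi> p * (d * arctan ((p - x) / d))\<bar> <= C * (2 * d)" unfolding abs_mult[of "\<psi> p"] using C0 by (intro mult_mono b hA_bd d) auto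
	then show "\<bar>f0 p x - \<psi> p * (d * arctan ((p - x) / d))\<bar> <= 2 * C + C * (2 * d) + C * (1 / d)"
		using b(1)[of p x] C0 C1 by linarith
	have "\<bar>\<psi> p * (1 / (1 + ((p - x) / d)^2))\<bar> <= C * 1"
		unfolding abs_mult using C0 inv_sq_le1[of "(p - x) / d"] by (intro mult_mono b) (auto simp: abs_le_iff simp del: divide_le_eq_1)
	then show "\<bar>f0x p x + \<psi> p * (1 / (1 + ((p - x) / d)^2))\<bar> <= 2 * C + C * (2 * d) + C * (1 / d)"
		using b(2)[of p x] C0 C1 by linarith
	have "\<bar>\<psi> p * (1 / d * kap ((p - x) / d))\<bar> <= C * (1 / d * 1)"
		unfolding abs_mult using C0 d by (intro mult_mono b kap_le1) auto
	then show "\<bar>f0xx p x + \<psi> p * (1 / d * kap ((p - x) / d))\<bar> <= 2 * C + C * (2 * d) + C * (1 / d)"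
		using b(3)[of p x] C0 C1 by linarith
	show "\<bar>0\<bar> <= 2 * C + C * (2 * d) + C * (1 / d)" using K by simp
next
	let ?S = "{0..T} \<times> (UNIV :: (real \<times> real) set)"
	have c': "continuous_on ?S (%z. g (fst (snd z)) (snd (snd z)))" if "continuous_on UNIV (%(p, x). g p x)" for g :: "real => real => real"
	proof -
		have "continuous_on ?S (%z. (%(p, x). g p x) (snd z))" by (rule continuous_on_compose2[OF that]) (auto intro!: continuous_intros)
		then show ?thesis by (simp add: split_beta')
	qed
	have cp: "continuous_on ?S (%z. \<psi> (fst (snd z)))" by (rule continuous_on_compose2[OF c(4)]) (auto intro!: continuous_intros)
	have ck: "continuous_on ?S (%z. kap ((fst (snd z) - snd (snd z)) / d))" by (rule continuous_on_compose2[OF kap_cont]) (use d in \<open>auto intro!: continuous_intros\<close>)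
	have nz: "1 + w^2 \<noteq> 0" for w :: real using inv_sq_le1(1)[of w] by force
	have dz: "d \<noteq> 0" using d by simp
	show "continuous_on ?S (%(s, p, x). f0 p x - \<psi> p * (d * arctan ((p - x) / d)))"
		unfolding split_beta' using dz by (intro continuous_intros c' c cp) auto
	show "continuous_on ?S (%(s, p, x). f0x p x + \<psi> p * (1 / (1 + ((p - x) / d)^2)))"
		unfolding split_beta' using dz nz by (intro continuous_intros c' c cp) auto
	show "continuous_on ?S (%(s, p, x). f0xx p x + \<psi> p * (1 / d * kap ((p - x) / d)))"
		unfolding split_beta' using dz by (intro continuous_intros c' c cp ck) auto
	show "continuous_on ?S (%(s, p, x). 0 :: real)" by (simp add: split_beta')
qed

text \<open>Within distance 1 of the diagonal, arctan has slope between 1/2 and 1, so half the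
  increment of M is eventually below \<open>JM\<close>. The expectations of \<open>JM\<close>
  converge because the test function is bounded, and Fatou's lemma gives the finite mean.\<close>

lemma (in sde) M_incr_int:
	assumes T: "0 < T"
	shows "integrable P (%v. M T v - X 0 v)"
proof -
	have tst: "sde_test P F W A B X K L T (2 * 1 + 1 * (2 * 1) + 1 * (1 / 1))
		(%s p x. 0 - (- 1) * (1 * arctan ((p - x) / 1))) (%s p x. 0 + (- 1) * (1 / (1 + ((p - x) / 1)^2)))
		(%s p x. 0 + (- 1) * (1 / 1 * kap ((p - x) / 1))) (%s p x. 0)"
		by (rule arctan_test[OF T]) (auto simp: split_beta')
	interpret S: sde_test P F W A B X K L T "2 * 1 + 1 * (2 * 1) + 1 * (1 / 1)"
		"%s p x. 0 - (- 1) * (1 * arctan ((p - x) / 1))" "%s p x. 0 + (- 1) * (1 / (1 + ((p - x) / 1)^2))"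
		"%s p x. 0 + (- 1) * (1 / 1 * kap ((p - x) / 1))" "%s p x. 0" by (rule tst)
	have ev: "eventually (%N. 1/2 * (M T v - X 0 v) <= S.JM N v \<and> S.JM N v <= 1 * (M T v - X 0 v)) sequentially" if w: "v \<in> space P" for v
	proof (rule S.JM_between[OF w zero_less_one])
		fix p p' x :: real assume p: "p <= p'" "\<bar>p - x\<bar> < 1" "\<bar>p' - x\<bar> < 1"
		have "1/2 * (p' - p) <= arctan (p' - x) - arctan (p - x) \<and> arctan (p' - x) - arctan (p - x) <= 1 * (p' - p)"
		proof (cases "p = p'")
			case False
			then have "p - x < p' - x" using p by simp
			from hA_mvt[OF zero_less_one this] obtain z where z: "p - x < z" "z < p' - x" "arctan (p' - x) - arctan (p - x) = (p' - p) * (1 / (1 + z^2))"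
				by auto
			have "z^2 <= 1" using z p by (simp add: abs_square_le_1)
			then have "1/2 <= 1 / (1 + z^2)" by (simp add: field_simps add_pos_nonneg)
			then have "(p' - p) * (1/2) <= (p' - p) * (1 / (1 + z^2))" "(p' - p) * (1 / (1 + z^2)) <= (p' - p) * 1"
				using p inv_sq_le1[of z] by (intro mult_left_mono; simp)+
			then show ?thesis unfolding z(3) by simp
		qed simp
		then show "1/2 * (p' - p) <= (0 - (- 1) * (1 * arctan ((p' - x) / 1))) - (0 - (- 1) * (1 * arctan ((p - x) / 1))) \<and>
			(0 - (- 1) * (1 * arctan ((p' - x) / 1))) - (0 - (- 1) * (1 * arctan ((p - x) / 1))) <= 1 * (p' - p)" by simp
	qed
	have J: "integrable P (S.JM N)" for N by (rule S.JM_limit(1)) simp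
	have J0: "0 <= S.JM N v" if w: "v \<in> space P" for N v
		unfolding S.JM_def by (intro sum_nonneg) (use M_mono[OF w] S.tt in \<open>auto simp: arctan_le_iff\<close>)
	have "convergent (%N. \<integral>v. S.JM N v \<partial>P)" using S.JM_limit(2) by (auto simp: convergent_def)
	then obtain b where b: "(%N. \<integral>v. S.JM N v \<partial>P) \<longlonglongrightarrow> b" by (auto simp: convergent_def)
	have [measurable]: "M T \<in> bm P" "X 0 \<in> bm P" using M_meas X_meas T by auto
	have "(NN v|P. ennreal (1/2 * (M T v - X 0 v))) <= (NN v|P. liminf (%N. ennreal (S.JM N v)))"
	proof (rule nn_integral_mono)
		fix v assume "v \<in> space P"
		from ev[OF this] show "ennreal (1/2 * (M T v - X 0 v)) <= liminf (%N. ennreal (S.JM N v))"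
			by (intro Liminf_bounded) (auto elim!: eventually_mono intro: ennreal_leI)
	qed
	also have "... <= liminf (%N. \<integral>\<^sup>+v. ennreal (S.JM N v) \<partial>P)"
		using borel_measurable_integrable[OF J] by (intro nn_integral_liminf) auto
	also have "(%N. \<integral>\<^sup>+v. ennreal (S.JM N v) \<partial>P) = (%N. ennreal (LINT v|P. S.JM N v))"
		by (intro ext nn_integral_eq_integral J AE_I2 J0)
	also have "liminf (%N. ennreal (LINT v|P. S.JM N v)) = ennreal b"
		by (intro lim_imp_Liminf tendsto_ennrealI b) simp
	finally have fin: "(NN v|P. ennreal (1/2 * (M T v - X 0 v))) < \<infinity>" by (auto intro: le_less_trans)
	have "integrable P (%v. 1/2 * (M T v - X 0 v))"
	proof (rule integrableI_nonneg)
		show "AE v in P. 0 <= 1/2 * (M T v - X 0 v)" using M_ge[of _ 0 T] T by (intro AE_I2) auto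
	qed (use fin in auto)
	then have "integrable P (%v. 2 * (1/2 * (M T v - X 0 v)))" by (rule integrable_mult_right)
	moreover have "2 * (1/2 * x) = x" for x :: real by simp
	ultimately show ?thesis by (simp only:)
qed

text \<open>On the diagonal the derivative of the corrector in p cancels that of f0, and the change
  of the coefficient \<open>f0m p p\<close> is multiplied by an arctan that is small there. The
  Lipschitz bound on \<open>f0m\<close> makes this quantitative, as \<open>JM_zero\<close>
  demands.\<close>

lemma (in sde) arctan_ito:
	fixes f0 f0x f0xx f0m :: "real => real => real"
	assumes T: "0 < T" and d: "0 < d"
		and d1: "\<And>p x. (f0 p has_real_derivative f0x p x) (at x)" and d2: "\<And>p x. (f0x p has_real_derivative f0xx p x) (at x)"
		and dm: "\<And>p x. ((%p. f0 p x) has_real_derivative f0m p x) (at p)"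
		and b: "\<And>p x. \<bar>f0 p x\<bar> <= C" "\<And>p x. \<bar>f0x p x\<bar> <= C" "\<And>p x. \<bar>f0xx p x\<bar> <= C" "\<And>p x. \<bar>f0m p x\<bar> <= C"
		and c: "continuous_on UNIV (%(p, x). f0 p x)" "continuous_on UNIV (%(p, x). f0x p x)" "continuous_on UNIV (%(p, x). f0xx p x)"
		and lm: "\<And>p x p' x'. \<bar>f0m p x - f0m p' x'\<bar> <= C * (\<bar>p - p'\<bar> + \<bar>x - x'\<bar>)"
	defines "f \<equiv> %p x. f0 p x - f0m p p * (d * arctan ((p - x) / d))"
	shows "(LINT w|P. f (M T w) (X T w)) - (LINT w|P. f (X 0 w) (X 0 w)) =
		(LINT w|P. (LBINT s:{0..T}. B (X s w) * (f0x (M s w) (X s w) + f0m (M s w) (M s w) * (1 / (1 + ((M s w - X s w) / d)^2)))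
			+ 1/2 * (A (X s w))^2 * (f0xx (M s w) (X s w) + f0m (M s w) (M s w) * (1 / d * kap ((M s w - X s w) / d)))))"
proof -
	have C0: "0 <= C" using b(1)[of 0 0] by linarith
	have lipm: "\<bar>f0m p p - f0m q q\<bar> <= 2 * C * \<bar>p - q\<bar>" for p q using lm[of p p q q] by (simp add: algebra_simps)
	have cm: "continuous_on UNIV (%p. f0m p p)"
		by (rule lipschitz_on_continuous_on[of "2 * C"]) (use lipm C0 in \<open>auto intro!: lipschitz_onI simp: dist_real_def\<close>)
	interpret S: sde_test P F W A B X K L T "2 * C + C * (2 * d) + C * (1 / d)" "%s p x. f0 p x - f0m p p * (d * arctan ((p - x) / d))"
		"%s p x. f0x p x + f0m p p * (1 / (1 + ((p - x) / d)^2))" "%s p x. f0xx p x + f0m p p * (1 / d * kap ((p - x) / d))" "%s p x. 0"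
		by (rule arctan_test[OF T d d1 d2 b(1-3) b(4) c cm])
	let ?h = "%v. d * arctan (v / d)"
	have split: "f p' x - f p x = (f0 p' x - f0 p x) - f0m p' p' * (?h (p' - x) - ?h (p - x)) - (f0m p' p' - f0m p p) * ?h (p - x)" for p p' x
		unfolding f_def by (simp add: algebra_simps)
	have psi: "\<bar>(f0m p' p' - f0m p p) * ?h (p - x)\<bar> <= 2 * C * (p' - p) * r" if "p <= p'" "\<bar>?h (p - x)\<bar> <= r" for p p' x r
	proof -
		have "\<bar>f0m p' p' - f0m p p\<bar> <= 2 * C * (p' - p)" using lipm[of p' p] that by simp
		then show ?thesis unfolding abs_mult[of "f0m p' p' - f0m p p"] using that C0 by (intro mult_mono) auto
	qed
	have mvt: "\<exists>u. p <= u \<and> u <= p' \<and> f0 p' x - f0 p x = (p' - p) * f0m u x" if "p <= p'" for p p' x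
	proof (cases "p = p'")
		case False
		then have "p < p'" using that by simp
		from MVT2[OF this, of "%p. f0 p x" "%p. f0m p x"] dm show ?thesis by (meson less_imp_le)
	qed (use that in auto)
	have "(LINT w|P. f (M T w) (X T w)) - (LINT w|P. f (X 0 w) (X 0 w)) = (LINT w|P. (LBINT s:{0..T}. S.G s (M s w) (X s w)))"
		unfolding f_def
	proof (rule S.JM_zero[where C="2 * C + 4 * C * d"])
		fix p p' x :: real assume p: "p <= p'"
		obtain u where "f0 p' x - f0 p x = (p' - p) * f0m u x" using mvt[OF p] by blast
		then have 1: "\<bar>f0 p' x - f0 p x\<bar> <= (p' - p) * C" using p b(4)[of u x] by (simp add: abs_mult mult_left_mono)
		have "\<bar>?h (p' - x) - ?h (p - x)\<bar> <= p' - p" using hA_lip[OF d, of "p - x" "p' - x"] p by auto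
		then have 2: "\<bar>f0m p' p' * (?h (p' - x) - ?h (p - x))\<bar> <= C * (p' - p)" unfolding abs_mult[of "f0m p' p'"] by (intro mult_mono b C0) auto
		have "\<bar>f p' x - f p x\<bar> <= (p' - p) * C + C * (p' - p) + 2 * C * (p' - p) * (2 * d)"
			unfolding split using 1 2 psi[OF p hA_bd[OF d], of x] by linarith
		then show "\<bar>(f0 p' x - f0m p' p' * (d * arctan ((p' - x) / d))) - (f0 p x - f0m p p * (d * arctan ((p - x) / d)))\<bar> <= (2 * C + 4 * C * d) * (p' - p)"
			unfolding f_def by (simp add: algebra_simps)
	next
		fix e :: real assume e: "0 < e"
		\<comment> \<open>The errors below, each proportional to \<eta>, have coefficients 3 C, C / d^2
		  and 2 C; the added 1 keeps \<Lambda> positive.\<close>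
		define \<Lambda> where "\<Lambda> = 5 * C + C / d^2 + 1"
		have L: "0 < \<Lambda>" using C0 by (simp add: \<Lambda>_def add_nonneg_pos)
		define \<eta> where "\<eta> = min 1 (e / \<Lambda>)"
		have h: "0 < \<eta>" "\<eta> <= 1" "\<eta> * \<Lambda> <= e" using e L by (auto simp: \<eta>_def min_def field_simps)
		have "\<bar>f p' x - f p x\<bar> <= e * (p' - p)" if p: "p <= p'" "\<bar>p - x\<bar> < \<eta>" "\<bar>p' - x\<bar> < \<eta>" for p p' x
		proof -
			obtain u where xi: "p <= u" "u <= p'" "f0 p' x - f0 p x = (p' - p) * f0m u x" using mvt[OF p(1)] by blast
			have "\<exists>z. \<bar>z\<bar> <= \<eta> \<and> ?h (p' - x) - ?h (p - x) = (p' - p) * (1 / (1 + (z / d)^2))"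
			proof (cases "p = p'")
				case False
				then have "p - x < p' - x" using p by simp
				from hA_mvt[OF d this] obtain z where "p - x < z" "z < p' - x" "?h (p' - x) - ?h (p - x) = ((p' - x) - (p - x)) * (1 / (1 + (z / d)^2))" by blast
				then show ?thesis using p by (intro exI[of _ z]) auto
			qed (use h in \<open>auto intro!: exI[of _ 0]\<close>)
			then obtain z where z: "\<bar>z\<bar> <= \<eta>" "?h (p' - x) - ?h (p - x) = (p' - p) * (1 / (1 + (z / d)^2))" by blast
			define k where "k = 1 / (1 + (z / d)^2)"
			have k: "0 <= 1 - k" "1 - k <= \<eta> / d^2"
			proof -
				define r where "r = (z / d)^2"
				have r: "0 <= r" by (simp add: r_def)
				have kr: "k = 1 / (1 + r)" unfolding k_def r_def ..
				have "1 - k = r / (1 + r)" unfolding kr using r by (simp add: field_simps)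
				also have "... <= r" using r divide_left_mono[of 1 "1 + r" r] by simp
				finally have "1 - k <= z^2 / d^2" by (simp add: r_def power_divide)
				also have "z^2 <= \<eta>"
				proof -
					have "\<bar>z\<bar> * \<bar>z\<bar> <= \<eta> * 1" using z(1) h by (intro mult_mono) auto
					then show ?thesis by (simp add: power2_eq_square)
				qed
				finally show "1 - k <= \<eta> / d^2" by (simp add: divide_right_mono)
				show "0 <= 1 - k" using inv_sq_le1(2)[of "z / d"] unfolding k_def by simp
			qed
			have "\<bar>f0m u x - f0m p' p'\<bar> <= C * (\<bar>u - p'\<bar> + \<bar>x - p'\<bar>)" by (rule lm)
			also have "... <= C * (3 * \<eta>)" using xi p C0 by (intro mult_left_mono) auto
			finally have 1: "\<bar>f0m u x - f0m p' p'\<bar> <= C * (3 * \<eta>)" .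
			have 2: "\<bar>f0m p' p' * (1 - k)\<bar> <= C * (\<eta> / d^2)" unfolding abs_mult using k by (intro mult_mono b C0) auto
			have "f p' x - f p x = (p' - p) * ((f0m u x - f0m p' p') + f0m p' p' * (1 - k)) - (f0m p' p' - f0m p p) * ?h (p - x)"
				unfolding split xi(3) z(2) k_def[symmetric] by (simp add: algebra_simps)
			moreover have "\<bar>(p' - p) * ((f0m u x - f0m p' p') + f0m p' p' * (1 - k))\<bar> <= (p' - p) * (C * (3 * \<eta>) + C * (\<eta> / d^2))"
				unfolding abs_mult[of "p' - p"] using p 1 2 by (intro mult_mono) auto
			moreover have "\<bar>(f0m p' p' - f0m p p) * ?h (p - x)\<bar> <= 2 * C * (p' - p) * \<eta>"
				using hA_abs[OF d, of "p - x"] p by (intro psi) auto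
			ultimately have "\<bar>f p' x - f p x\<bar> <= (p' - p) * (C * (3 * \<eta>) + C * (\<eta> / d^2)) + 2 * C * (p' - p) * \<eta>" by linarith
			also have "... = (p' - p) * (\<eta> * (\<Lambda> - 1))" by (simp add: \<Lambda>_def algebra_simps)
			also have "... <= (p' - p) * e"
			proof (rule mult_left_mono)
				have "\<eta> * (\<Lambda> - 1) <= \<eta> * \<Lambda>" using h by (intro mult_left_mono) auto
				then show "\<eta> * (\<Lambda> - 1) <= e" using h by linarith
			qed (use p in simp)
			finally show ?thesis by (simp add: mult.commute)
		qed
		then show "\<exists>\<eta>>0. \<forall>p p' x. p <= p' \<longrightarrow> \<bar>p - x\<bar> < \<eta> \<longrightarrow> \<bar>p' - x\<bar> < \<eta> \<longrightarrow>
			\<bar>(f0 p' x - f0m p' p' * (d * arctan ((p' - x) / d))) - (f0 p x - f0m p p * (d * arctan ((p - x) / d)))\<bar> <= e * (p' - p)"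
			using h(1) unfolding f_def by blast
	qed (use M_incr_int[OF T] in auto)
	then show ?thesis unfolding S.G_def by simp
qed

section \<open>Partial derivatives of bounded smooth functions, and integrals on the
  half-line\<close>

lemma Cb_bounded: "Cb i f ==> \<exists>C\<ge>0. \<forall>x. norm (f x) <= C"
proof -
	assume "Cb i f"
	then have "bounded (range f)" by (cases i) auto
	then obtain C where "\<And>x. norm (f x) <= C" by (auto simp: bounded_iff)
	then show ?thesis by (intro exI[of _ C]) (auto intro: order_trans[OF norm_ge_zero])
qed

lemma Cb_real:
	fixes f :: "real => real"
	assumes "Cb (Suc i) f"
	obtains f' where "\<And>x. (f has_real_derivative f' x) (at x)" "Cb i f'"
proof
	fix x
	have "(f has_derivative frechet_derivative f (at x)) (at x)" using assms by (simp add: frechet_derivative_works[symmetric])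
	moreover from this have "frechet_derivative f (at x) = (*) (frechet_derivative f (at x) 1)"
		by (intro ext) (metis has_derivative_linear linear_scale_self mult.commute mult.right_neutral real_scaleR_def linear_scale)
	ultimately show "(f has_real_derivative frechet_derivative f (at x) 1) (at x)" unfolding has_field_derivative_def by metis
qed (use assms in simp)

lemma Cb_real2:
	fixes f :: "real \<times> real => real"
	assumes "Cb (Suc i) f"
	obtains fm fx where "\<And>m x. ((%r. f (r, x)) has_real_derivative fm (m, x)) (at m)" "\<And>m x. ((%y. f (m, y)) has_real_derivative fx (m, x)) (at x)"
		"Cb i fm" "Cb i fx"
proof
	fix m x :: real
	let ?D = "frechet_derivative f (at (m, x))"
	have D: "(f has_derivative ?D) (at (m, x))" using assms by (simp add: frechet_derivative_works[symmetric])
	have lin: "linear ?D" by (rule has_derivative_linear[OF D])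
	have "((%r. f (r, x)) has_derivative (%h. ?D (h, 0))) (at m)"
		by (rule has_derivative_compose[of "%r. (r, x)" "%h. (h, 0)", OF _ D]) (auto intro!: derivative_eq_intros)
	moreover have "(%h. ?D (h, 0)) = (*) (?D (1, 0))"
	proof
		fix h
		show "?D (h, 0) = ?D (1, 0) * h" using linear_scale[OF lin, of h "(1, 0)"] by (simp add: mult.commute)
	qed
	ultimately show "((%r. f (r, x)) has_real_derivative ?D (1, 0)) (at m)" unfolding has_field_derivative_def by simp
	have "((%y. f (m, y)) has_derivative (%h. ?D (0, h))) (at x)"
		by (rule has_derivative_compose[of "%y. (m, y)" "%h. (0, h)", OF _ D]) (auto intro!: derivative_eq_intros)
	moreover have "(%h. ?D (0, h)) = (*) (?D (0, 1))"
	proof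
		fix h
		show "?D (0, h) = ?D (0, 1) * h" using linear_scale[OF lin, of h "(0, 1)"] by (simp add: mult.commute)
	qed
	ultimately show "((%y. f (m, y)) has_real_derivative ?D (0, 1)) (at x)" unfolding has_field_derivative_def by simp
qed (use assms in \<open>auto simp: Basis_prod_def\<close>)

lemma Cb_cont:
	assumes "Cb i f"
	shows "continuous_on UNIV f"
	using assms by (cases i) (auto intro: differentiable_imp_continuous_on simp: differentiable_on_def)

lemma lip_real:
	fixes f :: "real => real"
	assumes "\<And>x. (f has_real_derivative f' x) (at x)" "\<And>x. \<bar>f' x\<bar> <= C"
	shows "\<bar>f x - f y\<bar> <= C * \<bar>x - y\<bar>"
	using field_differentiable_bound[of UNIV f f' C x y] assms by auto

lemma distr_nn_eqI:
	assumes f [measurable]: "f \<in> bm borel" and g [measurable]: "g \<in> bm P"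
		and eq: "\<And>S. S \<in> sets borel ==> (NN w|P. indicator S (g w)) = (NN x|lborel. f x * indicator S x)"
	shows "distr P lborel g = density lborel f"
proof (rule measure_eqI)
	fix S assume "S \<in> sets (distr P lborel g)"
	then have S [measurable]: "S \<in> sets borel" by simp
	have "emeasure (distr P lborel g) S = (\<integral>\<^sup>+p. indicator S p \<partial>distr P lborel g)" by simp
	also have "... = (NN w|P. indicator S (g w))" by (rule nn_integral_distr) auto
	finally show "emeasure (distr P lborel g) S = emeasure (density lborel f) S" unfolding eq[OF S] by (subst emeasure_density) auto
qed simp

lemma half_line:
	shows "integrable lborel (%w::real. indicator {0..} w * (1 / (1 + w^2)))" "(LINT w|lborel. indicator {0..} w * kap w) = 1"
		"integrable lborel (%w. indicator {0..} w * kap w)"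
proof -
	have nz: "1 + w^2 \<noteq> 0" for w :: real using inv_sq_le1(1)[of w] by force
	have [measurable]: "kap \<in> bm borel" by (rule borel_measurable_continuous_onI[OF kap_cont])
	have "(NN w|lborel. ennreal (1 / (1 + w^2)) * indicator {0..} w) = ennreal (pi / 2 - arctan 0)"
		by (rule nn_integral_FTC_atLeast[OF _ _ _ tendsto_arctan_at_top]) (auto intro!: derivative_eq_intros simp: divide_inverse)
	moreover have "(\<integral>\<^sup>+(w::real). ennreal (norm (indicator {0..} w * (1 / (1 + w^2)))) \<partial>lborel) = (NN w|lborel. ennreal (1 / (1 + w^2)) * indicator {0..} w)"
		by (intro nn_integral_cong) (auto split: split_indicator)
	ultimately show "integrable lborel (%w::real. indicator {0..} w * (1 / (1 + w^2)))" by (intro integrableI_bounded) auto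
	have "((%w::real. - (1 / (1 + w^2))) \<longlongrightarrow> 0) at_top"
	proof (rule Lim_null_comparison[OF _ tendsto_inverse_0_at_top[OF filterlim_ident]])
		show "\<forall>\<^sub>F w in at_top. norm (- (1 / (1 + w^2))) <= inverse (w :: real)"
			using eventually_ge_at_top[of 1]
		proof eventually_elim
			case (elim w)
			have "1 * w <= w * w" using elim by (intro mult_right_mono) auto
			then have "w <= 1 + w^2" unfolding power2_eq_square by linarith
			then have "1 / (1 + w^2) <= 1 / w" using elim by (intro divide_left_mono) auto
			then show ?case using inv_sq_le1(1)[of w] by (simp add: inverse_eq_divide)
		qed
	qed
	then have "(NN w|lborel. ennreal (kap w) * indicator {0..} w) = ennreal (0 - (- (1 / (1 + 0^2))))"
		by (intro nn_integral_FTC_atLeast[where F="%w. - (1 / (1 + w^2))"])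
			 (use nz in \<open>auto intro!: derivative_eq_intros simp: kap_def power2_eq_square\<close>)
	moreover have "(NN w|lborel. ennreal (indicator {0..} w * kap w)) = (NN w|lborel. ennreal (kap w) * indicator {0..} w)"
		by (intro nn_integral_cong) (auto split: split_indicator)
	ultimately have *: "(NN w|lborel. ennreal (indicator {0..} w * kap w)) = ennreal 1" by simp
	have nn: "AE w in lborel. 0 <= indicator {0..} w * kap w" by (rule AE_I2) (auto simp: kap_def indicator_def)
	show "(LINT w|lborel. indicator {0..} w * kap w) = 1" by (rule integral_eq_nn_integral[OF _ nn, unfolded *, simplified])
	show "integrable lborel (%w. indicator {0..} w * kap w)" by (rule integrableI_nonneg[OF _ nn]) (auto simp: *)
qed

section \<open>The density in the original coordinates\<close>

context lamperti
begin

sublocale FL: flat P Y N et "%y. VV (\<psi> y)" LH KV by (rule flat)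

lemma ia_meas [measurable]: "ia \<in> bm borel" by (rule borel_measurable_continuous_onI[OF conts'(3)])

text \<open>Lebesgue measure is determined by its values on intervals, and the image under \<phi> of
  the measure with density \<phi>' has the right ones by the fundamental theorem of
  calculus.\<close>

lemma nn_subst:
	assumes [measurable]: "f \<in> bm borel"
	shows "(NN y|lborel. f y) = (NN x|lborel. f (\<phi> x) * ennreal (ia x))"
proof -
	have "lborel = distr (density lborel (%x. ennreal (ia x))) borel \<phi>"
	proof (rule lborel_eqI)
		fix l u :: real assume "\<And>b. b \<in> Basis ==> l \<bullet> b <= u \<bullet> b"
		then have lu: "l <= u" by simp
		have "emeasure (distr (density lborel (%x. ennreal (ia x))) borel \<phi>) {l<..<u} = (NN x|lborel. ennreal (ia x) * indicator {l<..<u} (\<phi> x))"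
			by (rule emeasure_distr_density) auto
		also have "... = (NN x|lborel. ennreal (ia x) * indicator {\<psi> l..\<psi> u} x)"
		proof (rule nn_integral_cong_AE)
			have "AE x in lborel. x \<noteq> \<psi> l" "AE x in lborel. x \<noteq> \<psi> u" by (rule AE_lborel_singleton)+
			then show "AE x in lborel. ennreal (ia x) * indicator {l<..<u} (\<phi> x) = ennreal (ia x) * indicator {\<psi> l..\<psi> u} x"
			proof eventually_elim
				case (elim x)
				have "l < \<phi> x \<longleftrightarrow> \<psi> l < x" "\<phi> x < u \<longleftrightarrow> x < \<psi> u" using \<phi>_less[of "\<psi> l" x] \<phi>_less[of x "\<psi> u"] by (simp_all add: \<phi>_\<psi>)
				then show ?case using elim by (auto split: split_indicator)
			qed
		qed
		also have "... = ennreal (\<phi> (\<psi> u) - \<phi> (\<psi> l))"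
			by (rule nn_integral_FTC_Icc) (use \<phi>_d ia_pos \<phi>_le[of "\<psi> l" "\<psi> u"] lu in \<open>auto simp: \<phi>_\<psi> less_imp_le intro: has_field_derivative_at_within\<close>)
		finally show "emeasure (distr (density lborel (%x. ennreal (ia x))) borel \<phi>) (box l u) = (\<Prod>b\<in>Basis. (u - l) \<bullet> b)"
			by (simp add: \<phi>_\<psi> box_real)
	qed simp
	from arg_cong[OF this, of "%M. nn_integral M f"] show ?thesis
		by (simp add: nn_integral_distr nn_integral_density mult.commute)
qed

lemma AE_subst:
	assumes [measurable]: "Measurable.pred borel Q" and ae: "AE y in lborel. Q y"
	shows "AE x in lborel. Q (\<phi> x)"
proof -
	have "(NN y|lborel. indicator {y. \<not> Q y} y) = 0"
		using ae by (subst nn_integral_0_iff_AE) (auto elim!: eventually_mono)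
	then have "(NN x|lborel. indicator {y. \<not> Q y} (\<phi> x) * ennreal (ia x)) = 0" by (subst (asm) nn_subst) auto
	then have "AE x in lborel. indicator {y. \<not> Q y} (\<phi> x) * ennreal (ia x) = 0" by (subst (asm) nn_integral_0_iff_AE) auto
	then show ?thesis
	proof eventually_elim
		case (elim x)
		then show ?case using ia_pos[of x] by (auto simp: indicator_def split: if_splits)
	qed
qed

text \<open>The first factor undoes the weight built into \<open>law\<close>; the last is the
  Jacobian of \<phi> in both variables.\<close>

definition pp :: "real => real => real => real" where
	"pp t m x = exp (KV * t) / et (\<phi> x) * FL.qd t (\<phi> m) (\<phi> x) * (ia m * ia x)"

lemma pp_raw [measurable (raw)]:
	assumes [measurable]: "p \<in> bm Q" "q \<in> bm Q" "r \<in> bm Q"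
	shows "(%z. pp (p z) (q z) (r z)) \<in> bm Q"
	unfolding pp_def by measurable

lemma pp_nonneg: "0 <= pp t m x"
	unfolding pp_def using FL.qd_nonneg ia_pos et_pos by (simp add: less_imp_le)

lemma pp_zero: "m < x ==> pp t m x = 0" and pp_neg: "t <= 0 ==> pp t m x = 0"
	by (auto simp: pp_def FL.qd_zero \<phi>_less) (simp add: FL.qd_def)

lemma MX_meas: "0 <= t ==> (%w. (M t w, X t w)) \<in> bm P"
	using M_meas X_meas by (intro borel_measurable_Pair) auto

lemma pp_distr:
	assumes t: "0 < t"
	shows "distr P lborel (%w. (M t w, X t w)) = density lborel (%p. ennreal (pp t (fst p) (snd p)))"
proof (rule distr_nn_eqI)
	show "(%w. (M t w, X t w)) \<in> bm P" using t by (intro MX_meas) simp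
	fix S :: "(real \<times> real) set" assume S [measurable]: "S \<in> sets borel"
	let ?r = "%m x. ennreal (exp (KV * t) / et x * FL.qd t m x)"
	have "(NN w|P. indicator S (M t w, X t w)) = (NN w|P. indicator S (\<psi> (N t w), \<psi> (Y t w)))"
		using t by (intro nn_integral_cong) (simp add: N_def Y_def Mc_eq Xc_eq \<psi>_\<phi>)
	also have "... = (\<integral>\<^sup>+p. indicator S (\<psi> (fst p), \<psi> (snd p)) \<partial>distr P lborel (%w. (N t w, Y t w)))"
		by (subst nn_integral_distr) auto
	also have "... = (NN p|lborel. ?r (fst p) (snd p) * indicator S (\<psi> (fst p), \<psi> (snd p)))"
		unfolding FL.NY_distributed[OF t] by (rule nn_integral_density) auto
	also have "... = (\<integral>\<^sup>+m. \<integral>\<^sup>+x. ?r m x * indicator S (\<psi> m, \<psi> x) \<partial>lborel \<partial>lborel)"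
		unfolding lborel_prod[symmetric] by (subst lborel.nn_integral_fst[symmetric]) (auto simp: split_beta')
	also have "... = (NN m|lborel. (NN x|lborel. ?r (\<phi> m) x * indicator S (m, \<psi> x)) * ennreal (ia m))"
		by (subst nn_subst) (auto simp: \<psi>_\<phi>)
	also have "... = (NN m|lborel. (NN x|lborel. (?r (\<phi> m) (\<phi> x) * indicator S (m, x) * ennreal (ia x)) * ennreal (ia m)))"
		by (intro nn_integral_cong, subst nn_subst, simp, subst nn_integral_multc[symmetric]) (auto simp: \<psi>_\<phi>)
	also have "... = (\<integral>\<^sup>+m. \<integral>\<^sup>+x. ennreal (pp t m x) * indicator S (m, x) \<partial>lborel \<partial>lborel)"
	proof (intro nn_integral_cong)
		fix m x
		have "ennreal (pp t m x) = ?r (\<phi> m) (\<phi> x) * (ennreal (ia m) * ennreal (ia x))"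
		proof -
			have 1: "ennreal (ia m * ia x) = ennreal (ia m) * ennreal (ia x)" using ia_pos by (intro ennreal_mult) (auto simp: less_imp_le)
			show ?thesis unfolding pp_def 1[symmetric] using FL.qd_nonneg ia_pos et_pos by (intro ennreal_mult) (auto simp: less_imp_le)
		qed
		then show "?r (\<phi> m) (\<phi> x) * indicator S (m, x) * ennreal (ia x) * ennreal (ia m) = ennreal (pp t m x) * indicator S (m, x)"
			by (simp add: mult_ac)
	qed
	also have "... = (NN p|lborel. ennreal (pp t (fst p) (snd p)) * indicator S p)"
	proof -
		have [measurable]: "S \<in> sets (lborel \<Otimes>\<^sub>M lborel)" unfolding lborel_prod by simp
		show ?thesis unfolding lborel_prod[symmetric] by (subst lborel.nn_integral_fst[symmetric]) auto
	qed
	finally show "(NN w|P. indicator S (M t w, X t w)) = (NN p|lborel. ennreal (pp t (fst p) (snd p)) * indicator S p)" .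
qed simp

definition gY :: "real => real => real" where "gY s n = (LINT w|P. gam (4 * s) (n - Y 0 w))"
definition cs :: "real => real" where "cs s = exp (KV * s) * FL.ct s / \<rho>"
text \<open>A bound of the density that is free of x. Its integral over m is \<open>cs s\<close>, of
  order 1 / sqrt s and thus integrable in time, which is the source of (i).\<close>

definition sb :: "real => real => real" where "sb s m = cs s * (ia m * gY s (\<phi> m))"

lemma gY_raw [measurable (raw)]:
	assumes [measurable]: "p \<in> bm Q" "q \<in> bm Q"
	shows "(%z. gY (p z) (q z)) \<in> bm Q"
	unfolding gY_def by measurable

lemma cs_meas [measurable]: "cs \<in> bm borel" unfolding cs_def[abs_def] FL.ct_def by measurable

lemma gY:
	assumes "0 < s"
	shows "0 <= gY s n" "(NN w|P. ennreal (gam (4 * s) (n - Y 0 w))) = ennreal (gY s n)"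
proof -
	have b: "0 <= gam (4 * s) v" "gam (4 * s) v <= 1 / sqrt (4 * s)" for v using assms gam_nonneg[of "4 * s"] gam_le[of "4 * s" v] by auto
	show "0 <= gY s n" unfolding gY_def using b by (intro integral_nonneg_AE AE_I2)
	have "integrable P (%w. gam (4 * s) (n - Y 0 w))"
		using b by (intro integrable_const_bound[where B="1 / sqrt (4 * s)"] AE_I2) auto
	then show "(NN w|P. ennreal (gam (4 * s) (n - Y 0 w))) = ennreal (gY s n)"
		unfolding gY_def using b by (intro nn_integral_eq_integral AE_I2)
qed

lemma cs: "0 < s ==> 0 <= cs s" "0 < s ==> s <= T ==> cs s <= exp (KV * T) * (4 * exp (2 * LH^2 * T)) / \<rho> * (1 / sqrt s)"
proof -
	show "0 < s ==> 0 <= cs s" unfolding cs_def using FL.ct_nonneg[of s] \<rho>0 by simp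
	assume s: "0 < s" "s <= T"
	have "exp (KV * s) * (4 * exp (2 * LH^2 * s)) <= exp (KV * T) * (4 * exp (2 * LH^2 * T))"
		using s KV(1) by (intro mult_mono) (auto intro!: mult_left_mono)
	then have "exp (KV * s) * (4 * exp (2 * LH^2 * s)) * (1 / (\<rho> * sqrt s)) <= exp (KV * T) * (4 * exp (2 * LH^2 * T)) * (1 / (\<rho> * sqrt s))"
		using s \<rho>0 by (intro mult_right_mono) auto
	then show "cs s <= exp (KV * T) * (4 * exp (2 * LH^2 * T)) / \<rho> * (1 / sqrt s)"
		unfolding cs_def FL.ct_def by (simp add: mult_ac)
qed

lemma sb_nonneg: "0 < s ==> 0 <= sb s m"
	unfolding sb_def using cs gY ia_pos by (intro mult_nonneg_nonneg) (auto simp: less_imp_le)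

text \<open>The weight \<open>et (\<phi> x)\<close> in the bound \<open>U_le1\<close> cancels
  against the one divided out in \<open>pp\<close>.\<close>

lemma pp_le:
	assumes s: "0 < s"
	shows "pp s m x <= sb s m"
proof -
	have "ennreal (FL.qd s (\<phi> m) (\<phi> x)) <= ennreal (et (\<phi> x)) * (NN w|P. ennreal (FL.ct s * gam (4 * s) (\<phi> m - Y 0 w)))"
		using FL.qd_le[OF s] FL.U_le1[OF s] by (rule order_trans)
	also have "(NN w|P. ennreal (FL.ct s * gam (4 * s) (\<phi> m - Y 0 w))) = ennreal (FL.ct s) * ennreal (gY s (\<phi> m))"
		unfolding gY(2)[OF s, symmetric] using FL.ct_nonneg[OF s] by (subst nn_integral_cmult[symmetric]) (auto simp: ennreal_mult')
	also have "ennreal (et (\<phi> x)) * (ennreal (FL.ct s) * ennreal (gY s (\<phi> m))) = ennreal (et (\<phi> x) * (FL.ct s * gY s (\<phi> m)))"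
		using FL.ct_nonneg[OF s] gY(1)[OF s] et_pos[of "\<phi> x"] by (simp add: ennreal_mult less_imp_le)
	finally have q: "FL.qd s (\<phi> m) (\<phi> x) <= et (\<phi> x) * (FL.ct s * gY s (\<phi> m))"
		using FL.ct_nonneg[OF s] gY(1)[OF s] et_pos[of "\<phi> x"] by (subst (asm) ennreal_le_iff) (auto simp: less_imp_le)
	have "pp s m x <= exp (KV * s) / et (\<phi> x) * (et (\<phi> x) * (FL.ct s * gY s (\<phi> m))) * (ia m * (1 / \<rho>))"
		unfolding pp_def using q ia_le[of x] ia_pos et_pos[of "\<phi> x"] FL.qd_nonneg FL.ct_nonneg[OF s] gY(1)[OF s]
		by (intro mult_mono mult_left_mono) (auto simp: less_imp_le)
	also have "... = sb s m" using et_pos[of "\<phi> x"] by (simp add: sb_def cs_def)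
	finally show ?thesis .
qed

lemma sb_int:
	assumes s: "0 < s"
	shows "(NN m|lborel. ennreal (sb s m)) = ennreal (cs s)" "integrable lborel (sb s)" "(LINT m|lborel. sb s m) = cs s"
proof -
	have "(NN m|lborel. ennreal (sb s m)) = (NN m|lborel. ennreal (cs s) * (ennreal (gY s (\<phi> m)) * ennreal (ia m)))"
		unfolding sb_def using cs(1)[OF s] gY(1)[OF s] ia_pos by (intro nn_integral_cong) (simp add: ennreal_mult less_imp_le mult_ac)
	also have "... = ennreal (cs s) * (NN n|lborel. ennreal (gY s n))"
		by (subst nn_subst[of "%n. ennreal (gY s n)"]) (auto simp: nn_integral_cmult)
	also have "(NN n|lborel. ennreal (gY s n)) = (\<integral>\<^sup>+n. \<integral>\<^sup>+w. ennreal (gam (4 * s) (n - Y 0 w)) \<partial>P \<partial>lborel)" unfolding gY(2)[OF s] ..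
	also have "... = (\<integral>\<^sup>+w. \<integral>\<^sup>+n. ennreal (gam (4 * s) (n - Y 0 w)) \<partial>lborel \<partial>P)"
		by (rule FL.PL.Fubini') measurable
	also have "... = 1" using s by (simp add: nn_integral_gam emeasure_space_1)
	finally show 1: "(NN m|lborel. ennreal (sb s m)) = ennreal (cs s)" by simp
	have nn: "AE m in lborel. 0 <= sb s m" using sb_nonneg[OF s] by simp
	have [measurable]: "sb s \<in> bm borel" unfolding sb_def[abs_def] by measurable
	show "integrable lborel (sb s)" by (rule integrableI_nonneg[OF _ nn]) (auto simp: 1)
	show "(LINT m|lborel. sb s m) = cs s" using integral_eq_nn_integral[OF _ nn] cs(1)[OF s] by (simp add: 1)
qed

lemma pp_cont:
	assumes t: "0 < t"
	shows "continuous_on {..m} (pp t m)"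
proof -
	have q: "continuous_on {..m} (%x. FL.qd t (\<phi> m) (\<phi> x))"
		by (rule continuous_on_compose2[OF FL.qd_cont[OF t]]) (auto simp: \<phi>_le intro: continuous_on_subset[OF \<phi>_cont])
	show ?thesis unfolding pp_def[abs_def] et_\<phi>
		by (intro continuous_intros q continuous_on_subset[OF HH_cont] continuous_on_subset[OF conts'(3)]) auto
qed

lemma pp_diag: "((%u. pp t m (m - u)) \<longlongrightarrow> pp t m m) (at_right 0)"
proof (cases "0 < t")
	case True
	have "((%u. m - u) \<longlongrightarrow> m - 0) (at_right 0)" by (intro tendsto_intros)
	then show ?thesis
		by (intro continuous_on_tendsto_compose[OF pp_cont[OF True]]) (auto simp: eventually_at_filter)
qed (simp add: pp_neg)

lemma diag_pp: "diag_limit (%m x t. pp t m x) m t = pp t m m"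
	unfolding diag_limit_def by (rule tendsto_Lim[OF _ pp_diag]) simp

definition px :: "real => real => ennreal" where "px t x = (NN m|lborel. ennreal (pp t m x))"
text \<open>The marginal density may be 0 or \<infinity> on a null set; the value 1 there makes it
  positive and finite everywhere.\<close>

definition pX :: "real => real => real" where "pX x t = (if px t x = 0 \<or> px t x = \<infinity> then 1 else enn2real (px t x))"

lemma px_raw [measurable (raw)]:
	assumes [measurable]: "p \<in> bm Q" "q \<in> bm Q"
	shows "(%z. px (p z) (q z)) \<in> bm Q"
	unfolding px_def by measurable

lemma pX_meas [measurable]: "(%x. pX x t) \<in> bm borel" unfolding pX_def by measurable

lemma pX_pos: "0 < pX x t"
	unfolding pX_def by (auto simp: enn2real_positive_iff less_top zero_less_iff_neq_zero)

text \<open>Almost surely X avoids the zero set of its own density. In the coordinate \<phi> this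
  set is null by \<open>Y_null\<close>, and \<open>AE_subst\<close> carries this back.\<close>

lemma pX_distr:
	assumes t: "0 < t"
	shows "distr P lborel (X t) = density lborel (%x. ennreal (pX x t))"
proof -
	have [measurable]: "X t \<in> bm P" "M t \<in> bm P" using t X_meas M_meas by auto
	have d: "distr P lborel (X t) = density lborel (px t)"
	proof (rule distr_nn_eqI)
		fix S :: "real set" assume S [measurable]: "S \<in> sets borel"
		have "(NN w|P. indicator S (X t w)) = (\<integral>\<^sup>+p. indicator S (snd p) \<partial>distr P lborel (%w. (M t w, X t w)))"
			using MX_meas[of t] t by (subst nn_integral_distr) auto
		also have "... = (NN p|(lborel \<Otimes>\<^sub>M lborel). ennreal (pp t (fst p) (snd p)) * indicator S (snd p))"
			unfolding pp_distr[OF t] lborel_prod by (rule nn_integral_density) auto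
		also have "... = (\<integral>\<^sup>+x. \<integral>\<^sup>+m. ennreal (pp t m x) * indicator S x \<partial>lborel \<partial>lborel)"
			by (subst lborel_pair.nn_integral_snd[symmetric]) (auto simp: split_beta')
		also have "... = (NN x|lborel. px t x * indicator S x)" unfolding px_def by (simp add: nn_integral_multc)
		finally show "(NN w|P. indicator S (X t w)) = (NN x|lborel. px t x * indicator S x)" .
	qed auto
	have i: "(NN w|P. f (X t w)) = (NN x|lborel. px t x * f x)" if [measurable]: "f \<in> bm borel" for f
	proof -
		have "(NN w|P. f (X t w)) = (\<integral>\<^sup>+x. f x \<partial>distr P lborel (X t))" by (subst nn_integral_distr) auto
		then show ?thesis unfolding d by (simp add: nn_integral_density)
	qed
	have "AE x in lborel. px t x \<noteq> \<infinity>"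
		by (rule nn_integral_PInf_AE) (use i[of "%_. 1"] in \<open>auto simp: emeasure_space_1\<close>)
	moreover have "AE x in lborel. px t x \<noteq> 0"
	proof -
		have "(NN w|P. indicator {x. px t x = 0} (X t w)) = (NN x|lborel. px t x * indicator {x. px t x = 0} x)" by (rule i) measurable
		also have "... = (NN x|(lborel :: real measure). 0)" by (rule nn_integral_cong) (auto split: split_indicator)
		also have "... = 0" by simp
		finally have "AE w in P. indicator {x. px t x = 0} (X t w) = (0 :: ennreal)" by (subst (asm) nn_integral_0_iff_AE) auto
		then have "AE w in P. Y t w \<notin> {y. px t (\<psi> y) = 0}"
			by eventually_elim (use t in \<open>auto simp: Y_def \<psi>_\<phi> Xc_eq indicator_def split: if_splits\<close>)
		then have "{y. px t (\<psi> y) = 0} \<in> null_sets lborel" by (intro FL.Y_null[OF t]) auto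
		then have "AE y in lborel. px t (\<psi> y) \<noteq> 0" by (subst (asm) AE_iff_null_sets) auto
		then have "AE x in lborel. px t (\<psi> (\<phi> x)) \<noteq> 0" by (intro AE_subst) auto
		then show ?thesis by (simp add: \<psi>_\<phi>)
	qed
	ultimately have "AE x in lborel. px t x = ennreal (pX x t)"
		by eventually_elim (simp add: pX_def less_top ennreal_enn2real)
	then show ?thesis unfolding d by (intro density_cong) auto
qed

text \<open>Continuity of \<open>pp t m\<close> below m reduces the supremum to rational u, which
  makes it a measurable function of (t, m).\<close>

lemma SUP_rat: "(SUP u\<in>{0<..}. ennreal (pp t m (m - u))) = (SUP u\<in>{0<..} \<inter> \<rat>. ennreal (pp t m (m - u)))"
proof (cases "0 < t")
	case True
	show ?thesis
	proof (rule antisym)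
		show "(SUP u\<in>{0<..}. ennreal (pp t m (m - u))) <= (SUP u\<in>{0<..} \<inter> \<rat>. ennreal (pp t m (m - u)))"
		proof (rule SUP_least)
			fix u :: real assume u: "u \<in> {0<..}"
			have "\<exists>r\<in>\<rat>. u < r \<and> r < u + 1 / real (Suc n)" for n by (rule Rats_dense_in_real) simp
			then obtain r where r: "\<And>n. r n \<in> \<rat>" "\<And>n. u < r n" "\<And>n. r n < u + 1 / real (Suc n)" by metis
			have "(%n. u + 1 / real (Suc n)) \<longlonglongrightarrow> u + 0" by (intro tendsto_intros LIMSEQ_Suc[OF lim_1_over_n])
			then have L: "(%n. u + 1 / real (Suc n)) \<longlonglongrightarrow> u" by simp
			have "r \<longlonglongrightarrow> u"
				by (rule tendsto_sandwich[OF _ _ tendsto_const L]) (use r in \<open>auto intro!: less_imp_le always_eventually simp del: of_nat_Suc\<close>)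
			then have "(%n. m - r n) \<longlonglongrightarrow> m - u" by (intro tendsto_intros)
			then have "(%n. ennreal (pp t m (m - r n))) \<longlonglongrightarrow> ennreal (pp t m (m - u))"
				using u r(2) by (intro tendsto_ennrealI continuous_on_tendsto_compose[OF pp_cont[OF True]]) (auto intro!: always_eventually less_imp_le elim: order.strict_trans)
			then show "ennreal (pp t m (m - u)) <= (SUP u\<in>{0<..} \<inter> \<rat>. ennreal (pp t m (m - u)))"
			proof (rule LIMSEQ_le_const2, intro exI allI impI)
				fix n
				have "r n \<in> {0<..} \<inter> \<rat>" using u r(1)[of n] r(2)[of n] by auto
				then show "ennreal (pp t m (m - r n)) <= (SUP u\<in>{0<..} \<inter> \<rat>. ennreal (pp t m (m - u)))"
					by (rule SUP_upper[of "r n" _ "%u. ennreal (pp t m (m - u))"])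
			qed
		qed
	qed (rule SUP_subset_mono, auto)
next
	case False
	have "(1 :: real) \<in> {0<..} \<inter> \<rat>" by simp
	then have "{0<..} \<inter> \<rat> \<noteq> ({} :: real set)" by blast
	then show ?thesis using False by (simp add: pp_neg)
qed

lemma SUP_meas: "(%(t, m). SUP u\<in>{0<..}. ennreal (pp t m (m - u))) \<in> bm borel"
	unfolding SUP_rat split_beta' by (rule borel_measurable_SUP) (auto intro: countable_Int2 countable_rat)

lemma SUP_bound:
	assumes T: "0 < T"
	shows "(%(t, m). SUP u\<in>{0<..}. ennreal (pp t m (m - u))) \<in> bm (lebesgue_on ({0..T} \<times> UNIV))"
		and "(\<integral>\<^sup>+(t, m). (SUP u\<in>{0<..}. ennreal (pp t m (m - u))) \<partial>lebesgue_on ({0..T} \<times> UNIV)) < \<infinity>"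
proof -
	let ?S = "%t m. SUP u\<in>{0<..}. ennreal (pp t m (m - u))"
	have m: "(%(t, m). ?S t m) \<in> bm lborel" using SUP_meas by simp
	show "(%(t, m). ?S t m) \<in> bm (lebesgue_on ({0..T} \<times> UNIV))"
		by (rule measurable_restrict_space1[OF measurable_completion[OF m]])
	have [measurable]: "{0..T} \<times> UNIV \<in> sets (borel :: (real \<times> real) measure)" by (simp add: borel_prod[symmetric])
	have "(\<integral>\<^sup>+(t, m). ?S t m \<partial>lebesgue_on ({0..T} \<times> UNIV)) = (NN p|lborel. (%(t, m). ?S t m) p * indicator ({0..T} \<times> UNIV) p)"
		by (subst nn_integral_restrict_space) (auto simp: nn_integral_completion)
	also have "... <= (NN p|(lborel \<Otimes>\<^sub>M lborel). ennreal (sb (fst p) (snd p)) * indicator {0<..T} (fst p))"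
		unfolding lborel_prod
	proof (rule nn_integral_mono)
		fix p :: "real \<times> real"
		obtain t m where p: "p = (t, m)" by (cases p)
		show "(%(t, m). ?S t m) p * indicator ({0..T} \<times> UNIV) p <= ennreal (sb (fst p) (snd p)) * indicator {0<..T} (fst p)"
		proof (cases "0 < t")
			case True
			have "?S t m <= ennreal (sb t m)" by (rule SUP_least) (intro ennreal_leI pp_le True)
			then show ?thesis using True by (auto simp: p split: split_indicator)
		next
			case False
			then have "?S t m = 0" by (simp add: pp_neg)
			then show ?thesis by (simp add: p)
		qed
	qed
	also have "... = (\<integral>\<^sup>+t. \<integral>\<^sup>+m. ennreal (sb t m) * indicator {0<..T} t \<partial>lborel \<partial>lborel)"
		unfolding sb_def by (subst lborel.nn_integral_fst[symmetric]) auto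
	also have "... <= (NN t|lborel. ennreal (exp (KV * (T + 1)) * (4 * exp (2 * LH^2 * (T + 1))) / \<rho>) * (ennreal (1 / sqrt t) * indicator {0<..<T+1} t))"
	proof (rule nn_integral_mono)
		fix t :: real
		show "(NN m|lborel. ennreal (sb t m) * indicator {0<..T} t) <= ennreal (exp (KV * (T + 1)) * (4 * exp (2 * LH^2 * (T + 1))) / \<rho>) * (ennreal (1 / sqrt t) * indicator {0<..<T+1} t)"
		proof (cases "t \<in> {0<..T}")
			case True
			then have t: "0 < t" "t <= T + 1" by auto
			have "(NN m|lborel. ennreal (sb t m) * indicator {0<..T} t) = ennreal (cs t)" using True sb_int(1)[OF t(1)] by simp
			also have "... <= ennreal (exp (KV * (T + 1)) * (4 * exp (2 * LH^2 * (T + 1))) / \<rho> * (1 / sqrt t))" by (intro ennreal_leI cs t)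
			also have "... = ennreal (exp (KV * (T + 1)) * (4 * exp (2 * LH^2 * (T + 1))) / \<rho>) * ennreal (1 / sqrt t)"
				using \<rho>0 t by (intro ennreal_mult) auto
			finally show ?thesis using True by simp
		qed simp
	qed
	also have "... < \<infinity>" using nn_integral_inv_sqrt[of "T + 1"] T by (subst nn_integral_cmult) (auto simp: ennreal_mult_less_top)
	finally show "(\<integral>\<^sup>+(t, m). ?S t m \<partial>lebesgue_on ({0..T} \<times> UNIV)) < \<infinity>" .
qed


section \<open>The boundary term as the corrector vanishes\<close>

lemma kap_meas [measurable]: "kap \<in> bm borel" by (rule borel_measurable_continuous_onI[OF kap_cont])

lemma pp_distributed:
	assumes "0 < t"
	shows "distributed P lborel (%w. (M t w, X t w)) (%p. ennreal (pp t (fst p) (snd p)))"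
	unfolding distributed_def
proof (intro conjI)
	show "(%w. (M t w, X t w)) \<in> P \<rightarrow>\<^sub>M lborel" using MX_meas[OF less_imp_le[OF assms]] by simp
qed (rule pp_distr[OF assms], measurable)

lemma pX_distributed:
	assumes "0 < t"
	shows "distributed P lborel (X t) (%x. ennreal (pX x t))"
	unfolding distributed_def
proof (intro conjI)
	show "X t \<in> P \<rightarrow>\<^sub>M lborel" using X_meas[OF less_imp_le[OF assms]] by simp
qed (rule pX_distr[OF assms], measurable)

lemma MXc_raw [measurable (raw)]:
	assumes "f \<in> bm Q" "g \<in> Q \<rightarrow>\<^sub>M P"
	shows "(%z. Mc (f z) (g z)) \<in> bm Q" "(%z. Xc (f z) (g z)) \<in> bm Q"
	using measurable_compose[OF measurable_Pair[OF assms] Mc_pair] measurable_compose[OF measurable_Pair[OF assms] Xc_pair] by (simp_all only: prod.case)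

lemma path_integral:
	fixes g :: "real => real => real"
	assumes G [measurable]: "(%p. g (fst p) (snd p)) \<in> bm borel" and b: "\<And>m x. \<bar>g m x\<bar> <= C" and T: "0 <= T"
	shows "(LINT w|P. (LBINT s:{0..T}. g (M s w) (X s w))) = (LBINT s:{0..T}. (LINT w|P. g (M s w) (X s w)))"
		and "set_integrable lborel {0..T} (%s. \<integral>w. g (M s w) (X s w) \<partial>P)"
		and "0 <= s ==> integrable P (%w. g (M s w) (X s w))"
proof -
	have LP: "pair_sigma_finite (lborel :: real measure) P" ..
	have gm: "(%z. g (p z) (q z)) \<in> bm Q" if [measurable]: "p \<in> bm Q" "q \<in> bm Q" for p q and Q :: "'q measure"
		using measurable_compose[OF borel_measurable_Pair[OF that] G] by simp
	define h where "h s w = indicator {0..T} s * g (Mc s w) (Xc s w)" for s w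
	have hm: "case_prod h \<in> bm (lborel \<Otimes>\<^sub>M P)"
		unfolding h_def split_beta' by (intro borel_measurable_times gm) measurable
	have hi: "integrable (lborel \<Otimes>\<^sub>M P) (case_prod h)"
	proof (rule integrableI_bounded[OF hm])
		have "(NN z|(lborel \<Otimes>\<^sub>M P). ennreal (norm (case_prod h z))) <= (NN z|(lborel \<Otimes>\<^sub>M P). ennreal C * indicator {0..T} (fst z))"
			by (intro nn_integral_mono) (auto simp: h_def indicator_def intro!: ennreal_leI b)
		also have "... = (\<integral>\<^sup>+s. \<integral>\<^sup>+w. ennreal C * indicator {0..T} s \<partial>P \<partial>lborel)"
			by (subst nn_integral_fst[symmetric]) auto
		also have "... < \<infinity>" using T by (simp add: nn_integral_cmult_indicator emeasure_space_1 ennreal_mult_less_top)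
		finally show "(NN z|(lborel \<Otimes>\<^sub>M P). ennreal (norm (case_prod h z))) < \<infinity>" .
	qed
	have e1: "(LBINT s:{0..T}. g (M s w) (X s w)) = (LINT s|lborel. h s w)" for w
		unfolding set_lebesgue_integral_def h_def by (intro Bochner_Integration.integral_cong) (auto simp: indicator_def Mc_eq Xc_eq)
	have e2: "indicator {0..T} s *\<^sub>R (LINT w|P. g (M s w) (X s w)) = (LINT w|P. h s w)" for s
		unfolding h_def by (auto simp: indicator_def Mc_eq Xc_eq)
	show "(LINT w|P. (LBINT s:{0..T}. g (M s w) (X s w))) = (LBINT s:{0..T}. (LINT w|P. g (M s w) (X s w)))"
		unfolding e1 unfolding set_lebesgue_integral_def e2 by (rule pair_sigma_finite.Fubini_integral[OF LP hi])
	show "set_integrable lborel {0..T} (%s. \<integral>w. g (M s w) (X s w) \<partial>P)"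
		unfolding set_integrable_def e2 using pair_sigma_finite.integrable_fst'[OF LP hi] by simp
	show "0 <= s ==> integrable P (%w. g (M s w) (X s w))"
		using M_meas[of s] X_meas[of s] by (intro integrable_const_bound[where B=C] AE_I2 gm) (auto intro: b)
qed

text \<open>The limiting boundary term at time s as an integral over the diagonal;
  \<open>diag_expectation\<close> shows that it is half the expectation in the theorem.\<close>

definition I0 :: "(real => real) => real => real" where
	"I0 h s = (LINT m|lborel. 1/2 * (A m)^2 * h m * pp s m m)"

text \<open>The contribution of the corrector with coefficient h to the generator. As d tends to 0,
  the expectation of the first term vanishes and the second concentrates at the diagonal.\<close>

definition Qd :: "(real => real) => real => real => real => real" where
	"Qd h d m x = B x * (h m * (1 / (1 + ((m - x) / d)^2))) + 1/2 * (A x)^2 * (h m * (1 / d * kap ((m - x) / d)))"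

lemma A2: "\<bar>(A x)^2\<bar> <= K^2"
proof -
	have "\<bar>A x\<bar>^2 <= K^2" by (rule power_mono[OF A_bd abs_ge_zero])
	then show ?thesis by simp
qed

lemma AB_borel [measurable]: "A \<in> bm borel" "B \<in> bm borel"
	by (auto intro: borel_measurable_continuous_onI A_cont B_cont)

lemma Qd_I0_meas:
	assumes [measurable]: "h \<in> bm borel"
	shows "(%p. Qd h d (fst p) (snd p)) \<in> bm borel" "I0 h \<in> bm borel"
proof -
	show "(%p. Qd h d (fst p) (snd p)) \<in> bm borel" unfolding Qd_def by measurable
	show "I0 h \<in> bm borel" unfolding I0_def[abs_def] by measurable
qed

lemma Qd_bd:
	assumes h: "\<And>m. \<bar>h m\<bar> <= C" and d: "0 < d"
	shows "\<bar>Qd h d m x\<bar> <= K * (C * 1) + 1/2 * K^2 * (C * (1 / d * 1))"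
proof -
	have C: "0 <= C" using h[of 0] by linarith
	have "\<bar>Qd h d m x\<bar> <= \<bar>B x\<bar> * (\<bar>h m\<bar> * \<bar>1 / (1 + ((m - x) / d)^2)\<bar>) + 1/2 * \<bar>(A x)^2\<bar> * (\<bar>h m\<bar> * (1 / d * \<bar>kap ((m - x) / d)\<bar>))"
		unfolding Qd_def using d by (intro order_trans[OF abs_triangle_ineq]) (simp add: abs_mult)
	also have "... <= K * (C * 1) + 1/2 * K^2 * (C * (1 / d * 1))"
		using C K1 d inv_sq_le1[of "(m - x) / d"] by (intro add_mono mult_mono h B_bd A2 kap_le1 order_refl) (auto simp: abs_le_iff simp del: divide_le_eq_1)
	finally show ?thesis .
qed

lemma Qd_scaled:
	assumes d: "0 < d"
	shows "d * Qd h d m (m - d * w) = h m * (d * B (m - d * w) * (1 / (1 + w^2)) + 1/2 * (A (m - d * w))^2 * kap w)"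
proof -
	have w: "(m - (m - d * w)) / d = w" using d by simp
	have "d * (b * (r * e) + 1/2 * a * (r * (1 / d * k))) = r * (d * b * e + 1/2 * a * k)" for a b e k r
		using d by (simp add: field_simps)
	then show ?thesis unfolding Qd_def w .
qed

text \<open>The substitution x = m - d w removes the factor 1 / d, and since \<open>pp\<close>
  vanishes above the diagonal only w >= 0 remains. The integrand is dominated by a multiple of sb s
  m / (1 + w^2), and continuity of \<open>pp s m\<close> at the diagonal with mass 1 of
  \<open>kap\<close> gives the limit. The second claim, of order 1 / sqrt s, permits the limit under
  the time integral.\<close>

lemma Qd_limit:
	assumes s: "0 < s" and h: "\<And>m. \<bar>h m\<bar> <= C" and hm [measurable]: "h \<in> bm borel"
		and d: "\<And>n. 0 < u n" "\<And>n. u n <= 1" "u \<longlonglongrightarrow> 0"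
	shows "(%n::nat. \<integral>v. Qd h (u n) (M s v) (X s v) \<partial>P) \<longlonglongrightarrow> I0 h s"
		and "\<bar>\<integral>v. Qd h (u n) (M s v) (X s v) \<partial>P\<bar> <= C * (K + K^2) * (LINT w|lborel. indicator {0..} w * (1 / (1 + w^2))) * cs s"
proof -
	have C: "0 <= C" using h[of 0] by linarith
	let ?e = "%w::real. indicator {0..} w * (1 / (1 + w^2)) :: real"
	define D where "D = C * (K + K^2)"
	have D: "0 <= D" using C K1 by (simp add: D_def)
	define g where "g n m w = indicator {0..} w * (pp s m (m - u n * w) * (h m * (u n * B (m - u n * w) * (1 / (1 + w^2)) + 1/2 * (A (m - u n * w))^2 * kap w)))" for n m w
	have gb: "\<bar>g n m w\<bar> <= D * sb s m * ?e w" for n m w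
	proof -
		let ?q = "u n * B (m - u n * w) * (1 / (1 + w^2)) + 1/2 * (A (m - u n * w))^2 * kap w"
		have "\<bar>?q\<bar> <= (u n * \<bar>B (m - u n * w)\<bar>) * (1 / (1 + w^2)) + \<bar>(A (m - u n * w))^2\<bar> * \<bar>kap w\<bar>"
			using d(1)[of n] inv_sq_le1[of w] by (intro order_trans[OF abs_triangle_ineq] add_mono) (auto simp: abs_mult less_imp_le)
		also have "... <= (1 * K) * (1 / (1 + w^2)) + K^2 * (1 / (1 + w^2))"
			using d(1,2)[of n] inv_sq_le1[of w] K1 by (intro add_mono mult_mono B_bd A2 kap_le) (auto simp: less_imp_le)
		finally have q: "\<bar>?q\<bar> <= (K + K^2) * (1 / (1 + w^2))" by (simp only: distrib_right mult_1)
		define r e where "r = ?q" and "e = 1 / (1 + w^2)"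
		have p: "\<bar>pp s m (m - u n * w)\<bar> <= sb s m" using pp_le[OF s, of m "m - u n * w"] pp_nonneg[of s m "m - u n * w"] by simp
		have "\<bar>pp s m (m - u n * w)\<bar> * (\<bar>h m\<bar> * \<bar>r\<bar>) <= sb s m * (C * ((K + K^2) * e))"
			by (rule mult_mono[OF p mult_mono[OF h q[folded r_def e_def] C abs_ge_zero] sb_nonneg[OF s]]) simp
		then have "\<bar>pp s m (m - u n * w) * (h m * r)\<bar> <= D * sb s m * e" unfolding D_def by (simp only: abs_mult mult_ac)
		then show ?thesis unfolding g_def unfolding r_def[symmetric] unfolding e_def[symmetric] by (cases "0 <= w") auto
	qed
	define J where "J n m = (LINT w|lborel. g n m w)" for n m
	have sbm [measurable]: "sb s \<in> bm borel" using borel_measurable_integrable[OF sb_int(2)[OF s]] by simp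
	have gi: "integrable lborel (g n m)" for n m
	proof (rule Bochner_Integration.integrable_bound)
		show "integrable lborel (%w. D * sb s m * ?e w)" by (intro integrable_mult_right half_line)
		show "g n m \<in> bm lborel" unfolding g_def[abs_def] by measurable
		show "AE w in lborel. norm (g n m w) <= norm (D * sb s m * ?e w)" by (rule AE_I2, unfold real_norm_def, rule order_trans[OF gb abs_ge_self])
	qed
	have EJ: "(LINT v|P. Qd h (u n) (M s v) (X s v)) = (LINT m|lborel. J n m)" for n
	proof -
		have dn: "u n \<noteq> 0" using d(1)[of n] by simp
		have qm [measurable]: "(%p. Qd h (u n) (fst p) (snd p)) \<in> bm borel" by (rule Qd_I0_meas[OF hm])
		let ?F = "%p. pp s (fst p) (snd p) * Qd h (u n) (fst p) (snd p)"
		have "(LINT v|P. Qd h (u n) (M s v) (X s v)) = (LINT p|lborel. ?F p)"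
		proof -
			have "(LINT p|lborel. ?F p) = (LINT v|P. (%p. Qd h (u n) (fst p) (snd p)) (M s v, X s v))"
				by (rule distributed_integral[OF pp_distributed[OF s]]) (use qm pp_nonneg in simp_all)
			then show ?thesis by simp
		qed
		also have "... = (LINT m|lborel. (LINT x|lborel. ?F (m, x)))"
		proof -
			have "integrable lborel ?F \<longleftrightarrow> integrable P (%v. (%p. Qd h (u n) (fst p) (snd p)) (M s v, X s v))"
				by (rule distributed_integrable[OF pp_distributed[OF s]]) (use qm pp_nonneg in simp_all)
			moreover have "integrable P (%v. Qd h (u n) (M s v) (X s v))"
				by (rule path_integral(3)[OF qm Qd_bd[OF h d(1)] order_refl less_imp_le[OF s]])
			ultimately have "integrable lborel ?F" by simp
			from lborel_pair.integral_fst'[of ?F, unfolded lborel_prod, OF this] show ?thesis by simp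
		qed
		also have "... = (LINT m|lborel. J n m)"
		proof (rule Bochner_Integration.integral_cong[OF refl])
			fix m
			have "(LINT x|lborel. ?F (m, x)) = \<bar>- u n\<bar> *\<^sub>R (LINT w|lborel. ?F (m, m + - u n * w))"
				by (rule lborel_integral_real_affine) (use dn in simp)
			also have "... = (LINT w|lborel. u n * ?F (m, m - u n * w))" using d(1)[of n] by simp
			also have "... = J n m" unfolding J_def
			proof (rule Bochner_Integration.integral_cong[OF refl])
				fix w
				show "u n * ?F (m, m - u n * w) = g n m w"
				proof (cases "0 <= w")
					case True
					have "u n * ?F (m, m - u n * w) = pp s m (m - u n * w) * (u n * Qd h (u n) m (m - u n * w))" by simp
					then show ?thesis unfolding Qd_scaled[OF d(1)] using True by (simp add: g_def)
				next
					case False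
					then have "u n * w < 0" using d(1)[of n] by (simp add: mult_pos_neg)
					then have "m < m - u n * w" by simp
					then show ?thesis using False by (simp add: g_def pp_zero)
				qed
			qed
			finally show "(LINT x|lborel. ?F (m, x)) = J n m" .
		qed
		finally show ?thesis .
	qed
	define E where "E = (LINT w|lborel. ?e w)"
	have Jb: "\<bar>J n m\<bar> <= D * E * sb s m" for n m
	proof -
		have "\<bar>J n m\<bar> <= (LINT w|lborel. \<bar>g n m w\<bar>)" unfolding J_def by (rule integral_abs_bound)
		also have "... <= (LINT w|lborel. D * sb s m * ?e w)"
			by (intro integral_mono integrable_abs gi integrable_mult_right half_line gb)
		also have "... = D * sb s m * E" unfolding E_def by (rule Bochner_Integration.integral_mult_right[OF half_line(1)])
		finally show ?thesis by (simp add: mult_ac)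
	qed
	have Jm [measurable]: "J n \<in> bm lborel" for n unfolding J_def[abs_def] g_def by measurable
	have si: "integrable lborel (%m. D * E * sb s m)" by (intro integrable_mult_right sb_int s)
	have "\<bar>\<integral>m. J n m \<partial>lborel\<bar> <= (LINT m|lborel. \<bar>J n m\<bar>)" by (rule integral_abs_bound)
	also have "... <= (LINT m|lborel. D * E * sb s m)"
	proof (rule integral_mono[OF _ si Jb])
		show "integrable lborel (%m. \<bar>J n m\<bar>)"
			by (rule Bochner_Integration.integrable_bound[OF si]) (use Jb in \<open>auto intro: order_trans[OF _ abs_ge_self]\<close>)
	qed
	also have "... = D * E * cs s" using sb_int[OF s] by simp
	finally show "\<bar>\<integral>v. Qd h (u n) (M s v) (X s v) \<partial>P\<bar> <= C * (K + K^2) * (LINT w|lborel. ?e w) * cs s"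
		unfolding EJ D_def E_def .
	have "(%n. \<integral>m. J n m \<partial>lborel) \<longlonglongrightarrow> (LINT m|lborel. 1/2 * (A m)^2 * h m * pp s m m)"
	proof (rule integral_dominated_convergence[OF _ _ si])
		show "AE m in lborel. norm (J n m) <= D * E * sb s m" for n using Jb by simp
		show "AE m in lborel. (%n. J n m) \<longlonglongrightarrow> 1/2 * (A m)^2 * h m * pp s m m"
		proof (rule AE_I2)
			fix m :: real
			have "(%n. J n m) \<longlonglongrightarrow> (LINT w|lborel. (1/2 * (A m)^2 * h m * pp s m m) * (indicator {0..} w * kap w))"
				unfolding J_def
			proof (rule integral_dominated_convergence[where w="%w. D * sb s m * ?e w"])
				show "integrable lborel (%w. D * sb s m * ?e w)" by (intro integrable_mult_right half_line)
				show "AE w in lborel. norm (g n m w) <= D * sb s m * ?e w" for n using gb by simp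
				show "g n m \<in> bm lborel" for n using gi by (rule borel_measurable_integrable)
				show "AE w in lborel. (%n. g n m w) \<longlonglongrightarrow> (1/2 * (A m)^2 * h m * pp s m m) * (indicator {0..} w * kap w)"
				proof (rule AE_I2)
					fix w :: real
					show "(%n. g n m w) \<longlonglongrightarrow> (1/2 * (A m)^2 * h m * pp s m m) * (indicator {0..} w * kap w)"
					proof (cases "0 <= w")
						case True
						have "(%n. m - u n * w) \<longlonglongrightarrow> m - 0 * w" by (intro tendsto_intros d)
						then have l: "(%n. m - u n * w) \<longlonglongrightarrow> m" by simp
						have 1: "(%n. pp s m (m - u n * w)) \<longlonglongrightarrow> pp s m m"
							using True d(1) by (intro continuous_on_tendsto_compose[OF pp_cont[OF s] l]) (auto simp: less_imp_le)
						have 2: "(%n. A (m - u n * w)) \<longlonglongrightarrow> A m" "(%n. B (m - u n * w)) \<longlonglongrightarrow> B m"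
							by (rule continuous_on_tendsto_compose[OF A_cont l] continuous_on_tendsto_compose[OF B_cont l]; simp)+
						have "(%n. g n m w) \<longlonglongrightarrow> indicator {0..} w * (pp s m m * (h m * (0 * B m * (1 / (1 + w^2)) + 1/2 * (A m)^2 * kap w)))"
							unfolding g_def by (intro tendsto_intros 1 2 d)
						then show ?thesis using True by (simp add: mult_ac)
					qed (simp add: g_def)
				qed
			qed measurable
			also have "(LINT w|lborel. (1/2 * (A m)^2 * h m * pp s m m) * (indicator {0..} w * kap w)) = (1/2 * (A m)^2 * h m * pp s m m) * 1"
				unfolding half_line(2)[symmetric] by (rule Bochner_Integration.integral_mult_right[OF half_line(3)])
			finally show "(%n. J n m) \<longlonglongrightarrow> 1/2 * (A m)^2 * h m * pp s m m" by simp
		qed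
	qed measurable
	then show "(%n::nat. \<integral>v. Qd h (u n) (M s v) (X s v) \<partial>P) \<longlonglongrightarrow> I0 h s" unfolding EJ I0_def .
qed

lemma inv_sqrt_integrable:
	assumes T: "0 < T"
	shows "integrable lborel (%s. indicator {0<..T} s * (c * (1 / sqrt s)))"
proof -
	have "integrable lborel (%s. indicator {0<..T} s * (1 / sqrt s))"
	proof (rule integrableI_bounded)
		have "(NN s|lborel. ennreal (norm (indicator {0<..T} s * (1 / sqrt s)))) <= (NN s|lborel. ennreal (1 / sqrt s) * indicator {0<..<T + 1} s)"
			by (intro nn_integral_mono) (auto simp: indicator_def)
		also have "... < \<infinity>" using T by (intro nn_integral_inv_sqrt) simp
		finally show "(NN s|lborel. ennreal (norm (indicator {0<..T} s * (1 / sqrt s)))) < \<infinity>" .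
	qed measurable
	from integrable_mult_right[OF this, of c] show ?thesis by (simp add: mult_ac)
qed

text \<open>\<open>arctan_ito\<close> with d = \<delta> n. The corrector is 0 at the initial time,
  where M = X, and at most 2 C \<delta> n at time T. Its part of the generator converges by
  \<open>Qd_limit\<close>, dominated in time by a multiple of 1 / sqrt s.\<close>

lemma ito_max:
	fixes f0 f0x f0xx f0m :: "real => real => real"
	assumes T: "0 < T"
		and d1: "\<And>p x. (f0 p has_real_derivative f0x p x) (at x)" and d2: "\<And>p x. (f0x p has_real_derivative f0xx p x) (at x)"
		and dm: "\<And>p x. ((%p. f0 p x) has_real_derivative f0m p x) (at p)"
		and b: "\<And>p x. \<bar>f0 p x\<bar> <= C" "\<And>p x. \<bar>f0x p x\<bar> <= C" "\<And>p x. \<bar>f0xx p x\<bar> <= C" "\<And>p x. \<bar>f0m p x\<bar> <= C"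
		and c: "continuous_on UNIV (%(p, x). f0 p x)" "continuous_on UNIV (%(p, x). f0x p x)" "continuous_on UNIV (%(p, x). f0xx p x)"
		and lm: "\<And>p x p' x'. \<bar>f0m p x - f0m p' x'\<bar> <= C * (\<bar>p - p'\<bar> + \<bar>x - x'\<bar>)"
		and hm [measurable]: "(%p. f0m p p) \<in> bm borel"
	shows "(LINT v|P. f0 (M T v) (X T v)) = (LINT v|P. f0 (X 0 v) (X 0 v))
		 + (LBINT s:{0..T}. (LINT v|P. B (X s v) * f0x (M s v) (X s v) + 1/2 * (A (X s v))^2 * f0xx (M s v) (X s v)))
		 + (LBINT s:{0..T}. I0 (%p. f0m p p) s)"
		and "set_integrable lborel {0..T} (I0 (%p. f0m p p))"
proof -
	define h where "h = (%p. f0m p p)"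
	have hb0: "\<bar>h m\<bar> <= C" for m unfolding h_def by (rule b)
	have hm': "h \<in> bm borel" unfolding h_def by (rule hm)
	have C: "0 <= C" using b(1)[of 0 0] by linarith
	have cm: "(%p. g (fst p) (snd p)) \<in> bm borel" if "continuous_on UNIV (%(p, x). g p x)" for g :: "real => real => real"
		using borel_measurable_continuous_onI[OF that] by (simp add: split_beta')
	note [measurable] = cm[OF c(1)] cm[OF c(2)] cm[OF c(3)]
	define l where "l m x = B x * f0x m x + 1/2 * (A x)^2 * f0xx m x" for m x
	have l: "(%p. l (fst p) (snd p)) \<in> bm borel" unfolding l_def by measurable
	have lb: "\<bar>l m x\<bar> <= K * C + K^2 * C" for m x
	proof -
		have "\<bar>l m x\<bar> <= \<bar>B x\<bar> * \<bar>f0x m x\<bar> + \<bar>(A x)^2\<bar> * \<bar>f0xx m x\<bar>"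
			unfolding l_def by (intro order_trans[OF abs_triangle_ineq] add_mono) (simp_all add: abs_mult)
		also have "... <= K * C + K^2 * C" using K1 C by (intro add_mono mult_mono b B_bd A2) auto
		finally show ?thesis .
	qed
	define \<delta> where "\<delta> n = 1 / real (Suc n)" for n
	have d: "\<And>n. 0 < \<delta> n" "\<And>n. \<delta> n <= 1" "\<delta> \<longlonglongrightarrow> 0" unfolding \<delta>_def using LIMSEQ_Suc[OF lim_1_over_n] by auto
	let ?Q = "%n m x. Qd h (\<delta> n) m x"
	have q: "(%p. ?Q n (fst p) (snd p)) \<in> bm borel" for n by (rule Qd_I0_meas[OF hm'])
	note qb = Qd_bd[where h=h, OF hb0 d(1)]
	note pl = path_integral[OF l lb less_imp_le[OF T]]
	note pq = path_integral[OF q qb less_imp_le[OF T]]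
	let ?LQ = "%n. LBINT s:{0..T}. (LINT v|P. ?Q n (M s v) (X s v))"
	let ?f = "%n p x. f0 p x - f0m p p * (\<delta> n * arctan ((p - x) / \<delta> n))"
	have XM [measurable]: "M T \<in> bm P" "X T \<in> bm P" using M_meas X_meas T by auto
	have eq: "(LINT v|P. ?f n (M T v) (X T v)) - (LINT v|P. f0 (X 0 v) (X 0 v)) = (LBINT s:{0..T}. (LINT v|P. l (M s v) (X s v))) + ?LQ n" for n
	proof -
		have "(LINT v|P. ?f n (M T v) (X T v)) - (LINT v|P. ?f n (X 0 v) (X 0 v)) =
			(LINT v|P. (LBINT s:{0..T}. l (M s v) (X s v) + ?Q n (M s v) (X s v)))"
			unfolding arctan_ito[OF T d(1) d1 d2 dm b c lm] l_def Qd_def h_def by (simp only: distrib_left add_ac)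
		also have "... = (LBINT s:{0..T}. (LINT v|P. l (M s v) (X s v) + ?Q n (M s v) (X s v)))"
		proof (rule path_integral(1)[where g="%m x. l m x + ?Q n m x"])
			show "(%p. l (fst p) (snd p) + ?Q n (fst p) (snd p)) \<in> bm borel" using l q by (rule borel_measurable_add)
			show "\<bar>l m x + ?Q n m x\<bar> <= (K * C + K^2 * C) + (K * (C * 1) + 1/2 * K^2 * (C * (1 / \<delta> n * 1)))" for m x
				by (intro order_trans[OF abs_triangle_ineq] add_mono lb qb)
		qed (use T in simp)
		also have "... = (LBINT s:{0..T}. (LINT v|P. l (M s v) (X s v)) + (LINT v|P. ?Q n (M s v) (X s v)))"
			by (rule set_lebesgue_integral_cong) (auto intro!: Bochner_Integration.integral_add pl(3) pq(3))
		also have "... = (LBINT s:{0..T}. (LINT v|P. l (M s v) (X s v))) + ?LQ n"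
			by (rule set_integral_add(2)[OF pl(2) pq(2)])
		finally show ?thesis by simp
	qed
	have F: "(%n. \<integral>v. ?f n (M T v) (X T v) \<partial>P) \<longlonglongrightarrow> (LINT v|P. f0 (M T v) (X T v))"
	proof (rule integral_dominated_convergence[where w="%_. C + C * 2"])
		have fm: "(%v. f0 (M T v) (X T v)) \<in> bm P"
			using measurable_compose[OF MX_meas[OF less_imp_le[OF T]] cm[OF c(1)]] by simp
		then show "(%v. f0 (M T v) (X T v)) \<in> bm P" .
		have [measurable]: "(%v. f0m (M T v) (M T v)) \<in> bm P" by (rule measurable_compose[OF XM(1) hm])
		show "(%v. ?f n (M T v) (X T v)) \<in> bm P" for n
		proof -
			have [measurable]: "(arctan :: real => real) \<in> bm borel" by (intro borel_measurable_continuous_onI continuous_intros)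
			note [measurable] = fm
			show ?thesis by measurable
		qed
		have hb: "\<bar>f0m p p * (\<delta> n * arctan ((p - x) / \<delta> n))\<bar> <= C * (2 * \<delta> n)" for n p x
			unfolding abs_mult[of "f0m p p"] using C by (intro mult_mono b hA_bd d) auto
		show "AE v in P. norm (?f n (M T v) (X T v)) <= C + C * 2" for n
		proof (rule AE_I2)
			fix v
			have "C * (2 * \<delta> n) <= C * 2" using d(2)[of n] C by (intro mult_left_mono) auto
			then show "norm (?f n (M T v) (X T v)) <= C + C * 2"
				using hb[of "M T v" n "X T v"] b(1)[of "M T v" "X T v"] unfolding real_norm_def by linarith
		qed
		show "AE v in P. (%n. ?f n (M T v) (X T v)) \<longlonglongrightarrow> f0 (M T v) (X T v)"
		proof (rule AE_I2)
			fix v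
			have "(%n. C * (2 * \<delta> n)) \<longlonglongrightarrow> C * (2 * 0)" by (intro tendsto_intros d)
			then have l0: "(%n. C * (2 * \<delta> n)) \<longlonglongrightarrow> 0" by simp
			have "(%n. f0m (M T v) (M T v) * (\<delta> n * arctan ((M T v - X T v) / \<delta> n))) \<longlonglongrightarrow> 0"
				by (rule Lim_null_comparison[OF always_eventually l0], rule allI, unfold real_norm_def, rule hb)
			from tendsto_diff[OF tendsto_const this] show "(%n. ?f n (M T v) (X T v)) \<longlonglongrightarrow> f0 (M T v) (X T v)" by simp
		qed
	qed simp
	define D where "D = C * (K + K^2) * (LINT w|lborel. indicator {0..} w * (1 / (1 + w^2)))"
	define D' where "D' = D * (exp (KV * T) * (4 * exp (2 * LH^2 * T)) / \<rho>)"
	have D0: "0 <= D" unfolding D_def using C K1 by (intro mult_nonneg_nonneg integral_nonneg_AE AE_I2) auto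
	have Im [measurable]: "I0 h \<in> bm borel" by (rule Qd_I0_meas[OF hm'])
	have qD: "\<bar>\<integral>v. ?Q n (M s v) (X s v) \<partial>P\<bar> <= D' * (1 / sqrt s)" if s: "0 < s" "s <= T" for n s
	proof -
		have "\<bar>\<integral>v. ?Q n (M s v) (X s v) \<partial>P\<bar> <= D * cs s" unfolding D_def by (rule Qd_limit(2)[OF s(1) hb0 hm' d])
		also have "... <= D * (exp (KV * T) * (4 * exp (2 * LH^2 * T)) / \<rho> * (1 / sqrt s))" by (intro mult_left_mono cs s D0)
		finally show ?thesis unfolding D'_def by (simp only: mult.assoc)
	qed
	have nz: "AE s in lborel. s \<noteq> (0 :: real)" by (rule AE_lborel_singleton)
	have LQ: "?LQ \<longlonglongrightarrow> (LBINT s:{0..T}. I0 h s)"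
		unfolding set_lebesgue_integral_def
	proof (rule integral_dominated_convergence[OF _ _ inv_sqrt_integrable[OF T, of D']])
		show "(%s. indicator {0..T} s *\<^sub>R I0 h s) \<in> bm lborel" by measurable
		show "(%s. indicator {0..T} s *\<^sub>R (LINT v|P. ?Q n (M s v) (X s v))) \<in> bm lborel" for n
			using pq(2) unfolding set_integrable_def by (rule borel_measurable_integrable)
		show "AE s in lborel. norm (indicator {0..T} s *\<^sub>R (LINT v|P. ?Q n (M s v) (X s v))) <= indicator {0<..T} s * (D' * (1 / sqrt s))" for n
			using nz by eventually_elim (use qD in \<open>auto split: split_indicator\<close>)
		show "AE s in lborel. (%n. indicator {0..T} s *\<^sub>R (LINT v|P. ?Q n (M s v) (X s v))) \<longlonglongrightarrow> indicator {0..T} s *\<^sub>R I0 h s"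
			using nz
		proof eventually_elim
			case (elim s)
			show ?case
			proof (cases "s \<in> {0..T}")
				case True
				then have "0 < s" using elim by auto
				from Qd_limit(1)[OF this hb0 hm' d] show ?thesis by (intro tendsto_intros)
			qed simp
		qed
	qed
	have "(%n. (LBINT s:{0..T}. (LINT v|P. l (M s v) (X s v))) + ?LQ n) \<longlonglongrightarrow> (LBINT s:{0..T}. (LINT v|P. l (M s v) (X s v))) + (LBINT s:{0..T}. I0 h s)"
		by (intro tendsto_intros LQ)
	moreover have "(%n. (LINT v|P. ?f n (M T v) (X T v)) - (LINT v|P. f0 (X 0 v) (X 0 v))) \<longlonglongrightarrow> (LINT v|P. f0 (M T v) (X T v)) - (LINT v|P. f0 (X 0 v) (X 0 v))"
		by (intro tendsto_intros F)
	ultimately have "(LINT v|P. f0 (M T v) (X T v)) - (LINT v|P. f0 (X 0 v) (X 0 v)) = (LBINT s:{0..T}. (LINT v|P. l (M s v) (X s v))) + (LBINT s:{0..T}. I0 h s)"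
		unfolding eq by (intro LIMSEQ_unique)
	then show "(LINT v|P. f0 (M T v) (X T v)) = (LINT v|P. f0 (X 0 v) (X 0 v))
		 + (LBINT s:{0..T}. (LINT v|P. B (X s v) * f0x (M s v) (X s v) + 1/2 * (A (X s v))^2 * f0xx (M s v) (X s v)))
		 + (LBINT s:{0..T}. I0 (%p. f0m p p) s)" unfolding l_def h_def by linarith
	show "set_integrable lborel {0..T} (I0 (%p. f0m p p))"
		unfolding set_integrable_def h_def[symmetric]
	proof (rule Bochner_Integration.integrable_bound[OF inv_sqrt_integrable[OF T, of D']])
		show "AE s in lborel. norm (indicator {0..T} s *\<^sub>R I0 h s) <= norm (indicator {0<..T} s * (D' * (1 / sqrt s)))"
			using nz
		proof eventually_elim
			case (elim s)
			show ?case
			proof (cases "s \<in> {0..T}")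
				case True
				then have s: "0 < s" "s <= T" using elim by auto
				have "\<bar>I0 h s\<bar> <= D' * (1 / sqrt s)"
					by (rule LIMSEQ_le_const2[OF tendsto_rabs[OF Qd_limit(1)[OF s(1) hb0 hm' d]]]) (use qD[OF s] in auto)
				also have "... <= \<bar>D' * (1 / sqrt s)\<bar>" by (rule abs_ge_self)
				finally show ?thesis using s by simp
			qed simp
		qed
	qed measurable
qed

text \<open>Under the law of X the quotient loses its denominator, which leaves an integral over the
  diagonal. For s <= 0 both sides of the second claim are 0 because \<open>pp\<close> is.\<close>

lemma diag_expectation:
	assumes h: "\<And>m. \<bar>h m\<bar> <= C" and hm [measurable]: "h \<in> bm borel"
	defines "D \<equiv> %s w. (A (X s w))^2 * h (X s w) * (pp s (X s w) (X s w) / pX (X s w) s)"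
	shows "0 < s ==> integrable P (D s)" "(LINT w|P. D s w) = 2 * I0 h s"
proof -
	have *: "integrable P (D s) \<and> (LINT w|P. D s w) = 2 * I0 h s" if s: "0 < s"
	proof -
		let ?g = "%x. (A x)^2 * h x * (pp s x x / pX x s)"
		have eq: "(%x. pX x s * ?g x) = (%x. 2 * (1/2 * (A x)^2 * h x * pp s x x))" 
		proof
			fix x
			have "pX x s \<noteq> 0" using pX_pos[of x s] by simp
			then show "pX x s * ?g x = 2 * (1/2 * (A x)^2 * h x * pp s x x)" by simp
		qed
		have i: "integrable lborel (%x. 1/2 * (A x)^2 * h x * pp s x x)"
		proof (rule Bochner_Integration.integrable_bound)
			show "integrable lborel (%x. K^2 * C * sb s x)" by (intro integrable_mult_right sb_int s)
			show "AE x in lborel. norm (1/2 * (A x)^2 * h x * pp s x x) <= norm (K^2 * C * sb s x)"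
			proof (rule AE_I2)
				fix x
				have "1/2 * \<bar>(A x)^2\<bar> * \<bar>h x\<bar> * \<bar>pp s x x\<bar> <= K^2 * C * sb s x"
				proof (intro mult_mono h)
					show "1/2 * \<bar>(A x)^2\<bar> <= K^2" using A2[of x] zero_le_power2[of K] by linarith
				qed (use h[of x] pp_le[OF s, of x x] pp_nonneg[of s x x] in auto)
				then show "norm (1/2 * (A x)^2 * h x * pp s x x) <= norm (K^2 * C * sb s x)"
					unfolding real_norm_def by (intro order_trans[OF _ abs_ge_self]) (simp add: abs_mult)
			qed
		qed measurable
		note dd = pX_distributed[OF s]
		have gm: "?g \<in> bm lborel" by measurable
		have nn: "0 <= pX x s" for x using pX_pos[of x s] by simp
		have i2: "integrable lborel (%x. pX x s * ?g x)" unfolding eq by (rule integrable_mult_right[OF i])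
		have "integrable P (D s)"
			unfolding D_def by (rule iffD1[OF distributed_integrable[OF dd gm nn] i2])
		moreover have "(LINT w|P. D s w) = (LINT x|lborel. pX x s * ?g x)"
			unfolding D_def by (rule distributed_integral[OF dd gm nn, symmetric])
		moreover have "... = 2 * I0 h s" unfolding eq I0_def by (rule Bochner_Integration.integral_mult_right[OF i])
		ultimately show ?thesis by simp
	qed
	show "0 < s ==> integrable P (D s)" using * by simp
	show "(LINT w|P. D s w) = 2 * I0 h s"
		using * by (cases "0 < s") (auto simp: D_def I0_def pp_neg)
qed

end

theorem corollary2p1:
	fixes P :: "'w measure" and \<F> :: "real \<Rightarrow> 'w measure"
		and W X M :: "real \<Rightarrow> 'w \<Rightarrow> real"
		and A B :: "real \<Rightarrow> real" and c :: real and \<mu>\<^sub>0 :: "real measure"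
	assumes "prob_space P" and "filtration_on P \<F>" and "brownian_motion P \<F> W"
		and "Cb 1 B" and "Cb 2 A"
		and "c > 0" and "\<And>x. (A x)\<^sup>2 \<ge> c"
		and "prob_space \<mu>\<^sub>0" and "sets \<mu>\<^sub>0 = sets borel"
		and "sde_solution P \<F> W B A X"
		and "distr P borel (X 0) = \<mu>\<^sub>0"
		and "indep_initial P (X 0) W"
		and M_def: "M = running_sup X"
	shows "\<exists>(pV :: real \<Rightarrow> real \<Rightarrow> real \<Rightarrow> real) (pX :: real \<Rightarrow> real \<Rightarrow> real).
		(\<forall>t>0. distributed P lborel (\<lambda>\<omega>. (M t \<omega>, X t \<omega>)) (\<lambda>(m, x). ennreal (pV m x t))
				 \<and> (\<forall>m x. 0 \<le> pV m x t) \<and> (\<forall>m x. m < x \<longrightarrow> pV m x t = 0)) \<and>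
		(\<forall>t>0. distributed P lborel (X t) (\<lambda>x. ennreal (pX x t)) \<and> (\<forall>x. 0 < pX x t)) \<and>
		(\<forall>T>0. (\<lambda>(t, m). SUP u\<in>{0<..}. ennreal (pV m (m - u) t))
							\<in> borel_measurable (lebesgue_on ({0..T} \<times> UNIV)) \<and>
					 (\<integral>\<^sup>+(t, m). (SUP u\<in>{0<..}. ennreal (pV m (m - u) t))
							\<partial>lebesgue_on ({0..T} \<times> UNIV)) < \<infinity>) \<and>
		(\<forall>t>0. AE m in lborel. \<exists>l. ((\<lambda>u. pV m (m - u) t) \<longlongrightarrow> l) (at_right 0)) \<and>
		(\<forall>F :: real \<times> real \<Rightarrow> real. Cb 2 F \<longrightarrow> (\<forall>t>0.
			 let D = (\<lambda>s \<omega>. (A (X s \<omega>))\<^sup>2 * partial_m F (X s \<omega>) (X s \<omega>)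
											 * (diag_limit pV (X s \<omega>) s / pX (X s \<omega>) s))
			 in (AE s in lborel. s \<in> {0<..t} \<longrightarrow> integrable P (D s)) \<and>
					set_integrable lborel {0..t} (\<lambda>s. \<integral>\<omega>. D s \<omega> \<partial>P) \<and>
					(\<integral>\<omega>. F (M t \<omega>, X t \<omega>) \<partial>P) =
						(\<integral>\<omega>. F (X 0 \<omega>, X 0 \<omega>) \<partial>P)
						+ (LBINT s:{0..t}. (\<integral>\<omega>. generator B A F (M s \<omega>) (X s \<omega>) \<partial>P))
						+ 1 / 2 * (LBINT s:{0..t}. (\<integral>\<omega>. D s \<omega> \<partial>P))))"
proof -
	have cb: "Cb (Suc 0) B" "Cb (Suc (Suc 0)) A" using assms(4,5) by (simp_all add: numeral_2_eq_2)
	obtain B1 where B1: "\<And>x. (B has_real_derivative B1 x) (at x)" "Cb 0 B1" using Cb_real[OF cb(1)] by blast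
	obtain A1 where A1: "\<And>x. (A has_real_derivative A1 x) (at x)" "Cb (Suc 0) A1" using Cb_real[OF cb(2)] by blast
	obtain A2 where A2: "\<And>x. (A1 has_real_derivative A2 x) (at x)" "Cb 0 A2" using Cb_real[OF A1(2)] by blast
	obtain C where C: "0 <= C" "\<And>x. \<bar>A x\<bar> <= C" using Cb_bounded[OF cb(2)] by auto
	obtain C' where C': "0 <= C'" "\<And>x. \<bar>B x\<bar> <= C'" using Cb_bounded[OF cb(1)] by auto
	obtain D where D: "0 <= D" "\<And>x. \<bar>A1 x\<bar> <= D" using Cb_bounded[OF A1(2)] by auto
	obtain D' where D': "0 <= D'" "\<And>x. \<bar>B1 x\<bar> <= D'" using Cb_bounded[OF B1(2)] by auto
	obtain D2 where D2: "0 <= D2" "\<And>x. \<bar>A2 x\<bar> <= D2" using Cb_bounded[OF A2(2)] by auto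
	\<comment> \<open>The summand 1 provides \<open>1 <= K\<close>, as \<open>sde\<close>
	  requires.\<close>
	define K where "K = 1 + C + C'"
	define L where "L = D + D'"
	have "\<bar>A1 x\<bar> <= L" "\<bar>B1 x\<bar> <= L" for x using D(1) D'(1) D(2)[of x] D'(2)[of x] unfolding L_def by linarith+
	then have lip: "\<bar>A x - A y\<bar> <= L * \<bar>x - y\<bar>" "\<bar>B x - B y\<bar> <= L * \<bar>x - y\<bar>" for x y
		by (auto intro!: lip_real[OF A1(1)] lip_real[OF B1(1)])
	have AB: "\<bar>A x\<bar> <= K" "\<bar>B x\<bar> <= K" for x using C(1) C'(1) C(2)[of x] C'(2)[of x] unfolding K_def by linarith+
	have sde: "sde P \<F> W A B X K L"
		unfolding sde_def sde_axioms_def brownian_def brownian_axioms_def using assms C C' D D' AB lip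
		by (auto simp: K_def L_def)
	\<comment> \<open>A is continuous without zeros, so its sign is constant, and \<sigma> A = |A| is
	  as smooth as A.\<close>
	define \<sigma> where "\<sigma> = sgn (A 0)"
	have Anz: "A x \<noteq> 0" for x using assms(6) assms(7)[of x] by auto
	have contA: "continuous_on UNIV A" by (rule Cb_cont[OF cb(2)])
	have sgnA: "sgn (A x) = \<sigma>" for x
	proof (rule ccontr)
		assume ne: "sgn (A x) \<noteq> \<sigma>"
		have conn: "connected (A ` UNIV)" by (intro connected_continuous_image contA connected_UNIV)
		have "0 \<in> A ` UNIV"
		proof (cases "A x < 0")
			case True
			then have "0 < A 0" using ne Anz[of 0] by (auto simp: \<sigma>_def sgn_if split: if_splits)
			then show ?thesis using connectedD_interval[OF conn, of "A x" "A 0" 0] True by auto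
		next
			case False
			then have "0 < A x" "A 0 < 0" using ne Anz[of 0] Anz[of x] by (auto simp: \<sigma>_def sgn_if split: if_splits)
			then show ?thesis using connectedD_interval[OF conn, of "A 0" "A x" 0] by auto
		qed
		then show False using Anz by auto
	qed
	have sig: "\<sigma> * A x = \<bar>A x\<bar>" for x using Anz[of x] unfolding sgnA[of x, symmetric] by (simp add: sgn_if)
	have s1: "\<bar>\<sigma>\<bar> = 1" using Anz[of 0] by (simp add: \<sigma>_def sgn_if)
	have lam: "lamperti P \<F> W A B X K L (%x. \<sigma> * A x) (%x. \<sigma> * A1 x) (%x. \<sigma> * A2 x) B1 (sqrt c) C"
		unfolding lamperti_def lamperti_axioms_def
	proof (intro conjI allI sde)
		show "0 < sqrt c" using assms(6) by simp
		show "sqrt c <= \<sigma> * A x" for x unfolding sig using real_sqrt_le_mono[OF assms(7)[of x]] by simp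
		show "\<sigma> * A x <= C" for x unfolding sig by (rule C)
		show "(\<sigma> * A x)\<^sup>2 = (A x)\<^sup>2" for x unfolding sig by simp
		show "((%x. \<sigma> * A x) has_real_derivative \<sigma> * A1 x) (at x)" "((%x. \<sigma> * A1 x) has_real_derivative \<sigma> * A2 x) (at x)" for x
			by (intro DERIV_cmult A1 A2)+
		show "(B has_real_derivative B1 x) (at x)" for x by (rule B1)
		show "bd (%x. \<sigma> * A x)" "bd (%x. \<sigma> * A1 x)" "bd (%x. \<sigma> * A2 x)" "bd B1"
			unfolding bd_def abs_mult s1 mult_1 using C D D2 D' by blast+
		show "continuous_on UNIV (%x. \<sigma> * A2 x)" "continuous_on UNIV B1" using A2(2) B1(2) by (auto intro!: continuous_intros)
	qed
	interpret Lm: lamperti P \<F> W A B X K L "%x. \<sigma> * A x" "%x. \<sigma> * A1 x" "%x. \<sigma> * A2 x" B1 "sqrt c" C by (rule lam)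
	let ?pV = "%m x t. Lm.pp t m x"
	have ito: "let D = (%s \<omega>. (A (X s \<omega>))\<^sup>2 * partial_m F (X s \<omega>) (X s \<omega>) * (diag_limit ?pV (X s \<omega>) s / Lm.pX (X s \<omega>) s))
			 in (AE s in lborel. s \<in> {0<..t} \<longrightarrow> integrable P (D s)) \<and> set_integrable lborel {0..t} (%s. \<integral>\<omega>. D s \<omega> \<partial>P) \<and>
					(\<integral>\<omega>. F (M t \<omega>, X t \<omega>) \<partial>P) = (\<integral>\<omega>. F (X 0 \<omega>, X 0 \<omega>) \<partial>P)
						+ (LBINT s:{0..t}. (\<integral>\<omega>. generator B A F (M s \<omega>) (X s \<omega>) \<partial>P)) + 1 / 2 * (LBINT s:{0..t}. (\<integral>\<omega>. D s \<omega> \<partial>P))"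
		if F: "Cb 2 F" and t: "0 < t" for F :: "real \<times> real => real" and t :: real
	proof -
		have F2: "Cb (Suc (Suc 0)) F" using F by (simp add: numeral_2_eq_2)
		obtain Fm Fx where F1: "\<And>m x. ((%r. F (r, x)) has_real_derivative Fm (m, x)) (at m)" "\<And>m x. ((%y. F (m, y)) has_real_derivative Fx (m, x)) (at x)"
			"Cb (Suc 0) Fm" "Cb (Suc 0) Fx" using Cb_real2[OF F2] by blast
		obtain Fmm Fmx where Fm1: "\<And>m x. ((%r. Fm (r, x)) has_real_derivative Fmm (m, x)) (at m)" "\<And>m x. ((%y. Fm (m, y)) has_real_derivative Fmx (m, x)) (at x)"
			"Cb 0 Fmm" "Cb 0 Fmx" using Cb_real2[OF F1(3)] by blast
		obtain Fxm Fxx where Fx1: "\<And>m x. ((%r. Fx (r, x)) has_real_derivative Fxm (m, x)) (at m)" "\<And>m x. ((%y. Fx (m, y)) has_real_derivative Fxx (m, x)) (at x)"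
			"Cb 0 Fxm" "Cb 0 Fxx" using Cb_real2[OF F1(4)] by blast
		obtain c1 where c1: "0 <= c1" "\<And>z. \<bar>F z\<bar> <= c1" using Cb_bounded[OF F2] by auto
		obtain c2 where c2: "0 <= c2" "\<And>z. \<bar>Fm z\<bar> <= c2" using Cb_bounded[OF F1(3)] by auto
		obtain c3 where c3: "0 <= c3" "\<And>z. \<bar>Fx z\<bar> <= c3" using Cb_bounded[OF F1(4)] by auto
		obtain c4 where c4: "0 <= c4" "\<And>z. \<bar>Fmm z\<bar> <= c4" using Cb_bounded[OF Fm1(3)] by auto
		obtain c5 where c5: "0 <= c5" "\<And>z. \<bar>Fmx z\<bar> <= c5" using Cb_bounded[OF Fm1(4)] by auto
		obtain c6 where c6: "0 <= c6" "\<And>z. \<bar>Fxx z\<bar> <= c6" using Cb_bounded[OF Fx1(4)] by auto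
		define cc where "cc = c1 + c2 + c3 + c4 + c5 + c6"
		have cb: "\<bar>F z\<bar> <= cc" "\<bar>Fm z\<bar> <= cc" "\<bar>Fx z\<bar> <= cc" "\<bar>Fmm z\<bar> <= cc" "\<bar>Fmx z\<bar> <= cc" "\<bar>Fxx z\<bar> <= cc" for z
			using c1(1) c2(1) c3(1) c4(1) c5(1) c6(1) c1(2)[of z] c2(2)[of z] c3(2)[of z] c4(2)[of z] c5(2)[of z] c6(2)[of z] unfolding cc_def by linarith+
		have lm: "\<bar>Fm (p, x) - Fm (p', x')\<bar> <= cc * (\<bar>p - p'\<bar> + \<bar>x - x'\<bar>)" for p x p' x'
		proof -
			have "\<bar>Fm (p, x) - Fm (p', x)\<bar> <= cc * \<bar>p - p'\<bar>" by (rule lip_real[OF Fm1(1)]) (rule cb)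
			moreover have "\<bar>Fm (p', x) - Fm (p', x')\<bar> <= cc * \<bar>x - x'\<bar>" by (rule lip_real[OF Fm1(2)]) (rule cb)
			ultimately show ?thesis by (simp add: distrib_left)
		qed
		have hm: "(%p. Fm (p, p)) \<in> bm borel"
			by (rule borel_measurable_continuous_onI, rule continuous_on_compose2[OF Cb_cont[OF F1(3)]]) (auto intro!: continuous_intros)
		have pm: "partial_m F m x = Fm (m, x)" for m x unfolding partial_m_def by (rule DERIV_imp_deriv[OF F1(1)])
		have px: "partial_x F m x = Fx (m, x)" for m x unfolding partial_x_def by (rule DERIV_imp_deriv[OF F1(2)])
		have pxx: "partial_xx F m x = Fxx (m, x)" for m x unfolding partial_xx_def px by (rule DERIV_imp_deriv[OF Fx1(2)])
		have co: "continuous_on UNIV (%(p, x). g (p, x))" if "Cb i g" for i and g :: "real \<times> real => real"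
			using Cb_cont[OF that] by simp
		note im = Lm.ito_max[of t "%p x. F (p, x)" "%p x. Fx (p, x)" "%p x. Fxx (p, x)" "%p x. Fm (p, x)" cc,
				OF t F1(2) Fx1(2) F1(1) cb(1,3,6,2) co[OF F2] co[OF F1(4)] co[OF Fx1(4)] lm hm]
		note de = Lm.diag_expectation[of "%p. Fm (p, p)" cc, OF cb(2) hm]
		show ?thesis
			unfolding Let_def Lm.diag_pp pm de(2)
		proof (intro conjI)
			show "AE s in lborel. s \<in> {0<..t} \<longrightarrow> integrable P (%\<omega>. (A (X s \<omega>))\<^sup>2 * Fm (X s \<omega>, X s \<omega>) * (Lm.pp s (X s \<omega>) (X s \<omega>) / Lm.pX (X s \<omega>) s))"
				using de(1) by (intro AE_I2) auto
			show "set_integrable lborel {0..t} (%s. 2 * Lm.I0 (%p. Fm (p, p)) s)"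
				using im(2) by (simp add: set_integrable_def mult.left_commute)
			show "(\<integral>\<omega>. F (M t \<omega>, X t \<omega>) \<partial>P) = (\<integral>\<omega>. F (X 0 \<omega>, X 0 \<omega>) \<partial>P)
						+ (LBINT s:{0..t}. (\<integral>\<omega>. generator B A F (M s \<omega>) (X s \<omega>) \<partial>P)) + 1 / 2 * (LBINT s:{0..t}. 2 * Lm.I0 (%p. Fm (p, p)) s)"
				using im(1) unfolding generator_def px pxx M_def by simp
		qed
	qed
	show ?thesis
	proof (intro exI[of _ ?pV] exI[of _ Lm.pX] conjI allI impI)
		fix t :: real assume t: "0 < t"
		show "distributed P lborel (%\<omega>. (M t \<omega>, X t \<omega>)) (%(m, x). ennreal (Lm.pp t m x))"
			using Lm.pp_distributed[OF t] unfolding M_def by (simp add: split_beta')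
		show "distributed P lborel (X t) (%x. ennreal (Lm.pX x t))" by (rule Lm.pX_distributed[OF t])
		show "(%(t, m). SUP u\<in>{0<..}. ennreal (Lm.pp t m (m - u))) \<in> bm (lebesgue_on ({0..t} \<times> UNIV))"
			"(\<integral>\<^sup>+(t, m). (SUP u\<in>{0<..}. ennreal (Lm.pp t m (m - u))) \<partial>lebesgue_on ({0..t} \<times> UNIV)) < \<infinity>"
			by (rule Lm.SUP_bound[OF t])+
		show "AE m in lborel. \<exists>l. ((%u. Lm.pp t m (m - u)) \<longlongrightarrow> l) (at_right 0)"
			using Lm.pp_diag by (intro AE_I2) blast
	next
		fix F :: "real \<times> real => real" and t :: real assume "Cb 2 F" "0 < t"
		from ito[OF this] show "let D = (%s \<omega>. (A (X s \<omega>))\<^sup>2 * partial_m F (X s \<omega>) (X s \<omega>) * (diag_limit ?pV (X s \<omega>) s / Lm.pX (X s \<omega>) s))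
			 in (AE s in lborel. s \<in> {0<..t} \<longrightarrow> integrable P (D s)) \<and> set_integrable lborel {0..t} (%s. \<integral>\<omega>. D s \<omega> \<partial>P) \<and>
					(\<integral>\<omega>. F (M t \<omega>, X t \<omega>) \<partial>P) = (\<integral>\<omega>. F (X 0 \<omega>, X 0 \<omega>) \<partial>P)
						+ (LBINT s:{0..t}. (\<integral>\<omega>. generator B A F (M s \<omega>) (X s \<omega>) \<partial>P)) + 1 / 2 * (LBINT s:{0..t}. (\<integral>\<omega>. D s \<omega> \<partial>P))" .
	qed (auto simp: Lm.pp_nonneg Lm.pp_zero Lm.pX_pos)
qed

end
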